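(* Assume the Standard setup below, that $\tau$ is in the limit circle case at both $a$ and $b$, and that $T_{min}\ge\varepsilon I$ for some $\varepsilon>0$. Let $b_{11},b_{22}\ge 0$ and $b_{12}\in\mathbb{C}$ satisfy $$b_{11}b_{22}N_u-|b_{12}|^2N_v\ge 0,$$ and let $B$ be the nonnegative self-adjoint operator on $\mathcal N_0=\ker(T_{max})=\mathrm{span}\{u_a,\hat v_a\}$ given by $Bu_a=b_{11}u_a+b_{12}\hat v_a$, $B\hat v_a=b_{21}u_a+b_{22}\hat v_a$ with $b_{21}=\overline{b_{12}}\,N_v/N_u$. Put $$D=1-b_{11}\frac{V_b}{U_b}N_u+b_{12}N_v,\qquad E=N_v b_{22}U_b-N_v\overline{b_{12}}V_b+U_bV'_a .$$ Then: (1) If $b_{12}=N_v^{-1}\big(b_{11}\frac{V_b}{U_b}N_u-1\big)$ (so $b_{12}\in\mathbb R$ and $D=0$), then $T_{B,\mathcal N_0}=T_{\alpha,\beta}$ with $\alpha,\beta\in(0,\pi)$ determined by $$\cot\alpha=b_{11}\Big(\frac{V_b}{U_b}\Big)^2N_u-b_{22}N_v-V'_a-\frac{V_b}{U_b},\qquad \cot\beta=\frac{1}{U_b}\Big(U'_b-b_{11}\frac{N_u}{U_b}\Big).$$ (2) Otherwise ($D\neq0$), $T_{B,\mathcal N_0}$ is the restriction of $T_{max}$ to the set of $g\in\mathrm{dom}(T_{max})$ satisfying $$\tilde g(b)=\tilde g'(a)\frac{U_b}{D}+\tilde g(a)\Big(V_b-\frac{E}{D}\Big),$$ $$\tilde g'(b)=\tilde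 g'(a)\frac{U'_b-b_{11}N_u/U_b}{D}+\tilde g(a)\Big\{V'_b-\frac{\overline{b_{12}}N_v}{U_b}-\frac{1}{U_b}\Big(U'_b-\frac{b_{11}N_u}{U_b}\Big)\frac{E}{D}\Big\}.$$ (3) If $\hat B$ is another such operator with coefficients $\hat b_{11},\hat b_{12},\hat b_{22}$, then $0\le T_{B,\mathcal N_0}\le T_{\hat B,\mathcal N_0}$ if and only if $\hat b_{11}\ge b_{11}$, $\hat b_{22}\ge b_{22}$ and $(\hat b_{11}-b_{11})(\hat b_{22}-b_{22})N_u-|\hat b_{12}-b_{12}|^2N_v\ge0$.
   Context: Standard setup. Let $-\infty\le a<b\le\infty$ and let $p,q,r$ be real-valued measurable functions on $(a,b)$ with $p>0$, $r>0$ a.e., and $1/p,q,r\in L^1_{loc}((a,b))$. Let $\tau=\frac1r\big[-\frac{d}{dx}p\frac{d}{dx}+q\big]$, $y^{[1]}=py'$, $W(f,g)=fg^{[1]}-f^{[1]}g$. The maximal operator $T_{max}$ in $L^2((a,b);r\,dx)$ acts as $\tau$ on $\{g\in L^2((a,b);rdx): g,g^{[1]}\in AC_{loc}((a,b)),\ \tau g\in L^2((a,b);rdx)\}$; the minimal operator $T_{min}$ is the closure of the restriction of $T_{max}$ to compactly supported elements; $T_{min}^*=T_{max}$. $\tau$ is limit circle at an endpoint if for every $z\in\mathbb C$ all solutions of $\tau u=zu$ are in $L^2(rdx)$ near that endpoint, limit point otherwise. If $T_{min}$ is bounded below by $\lambda_0$, a principal solution of $\tau u=\lambda_0u$ at $a$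 is a real solution $u$, nonvanishing near $a$, with $\int_a^c p^{-1}u^{-2}dx=\infty$ (unique up to constant multiples); a nonprincipal solution at $a$ is a real solution linearly independent of it; analogously at $b$. Given principal/nonprincipal solutions $u_a,\hat u_a$ at $a$ and $u_b,\hat u_b$ at $b$ with $W(\hat u_a,u_a)=W(\hat u_b,u_b)=1$, the generalized boundary values of $g\in\mathrm{dom}(T_{max})$ (or of any $g$ lying locally in $\mathrm{dom}(T_{max})$ near the endpoint, e.g. solutions) are $\tilde g(a)=-W(u_a,g)(a)$, $\tilde g'(a)=W(\hat u_a,g)(a)$, $\tilde g(b)=-W(u_b,g)(b)$, $\tilde g'(b)=W(\hat u_b,g)(b)$, where $W(\cdot,\cdot)(a)=\lim_{x\downarrow a}$, $W(\cdot,\cdot)(b)=\lim_{x\uparrow b}$. For $\alpha,\beta\in(0,\pi]$, $T_{\alpha,\beta}$ is the restriction of $T_{max}$ to $\{g:\tilde g(a)\cos\alpha+\tilde g'(a)\sin\alpha=0,\ \tilde g(b)\cos\beta-\tilde g'(b)\sin\beta=0\}$; for $\eta\in[0,\pi)$, $R\in SL(2,\mathbb R)$, $T_{\eta,R}$ is the restriction of $T_{max}$ to $\{g:(\tilde g(b),\tilde g'(b))^T=e^{i\eta}R(\tilde g(a),\tilde g'(a))^T\}$. The Friedrichs extension is $T_F=T_{\pi,\pi}$. For nonnegative self-adjoint $A,B$: $A\le B$ means $\mathrm{dom}(B^{1/2})\subseteq\mathrm{dom}(A^{1/2})$ and $\|A^{1/2}f\|\le\|B^{1/2}f\|$ for $f\in\mathrm{dom}(B^{1/2})$.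 If $T_{min}\ge\varepsilon I$, $\varepsilon>0$, set $\mathcal N_0=\ker(T_{max})$; for a closed subspace $\mathcal W\subseteq\mathcal N_0$ and a nonnegative self-adjoint operator $B$ in $\mathcal W$, $T_{B,\mathcal W}$ denotes the restriction of $T_{max}$ to $\mathrm{dom}(T_{min})\dotplus\{((T_F)^{-1}B+I)\eta:\eta\in\mathrm{dom}(B)\}\dotplus\{(T_F)^{-1}v:v\in\mathcal N_0\cap\mathcal W^\perp\}$ (these are exactly the nonnegative self-adjoint extensions of $T_{min}$). Notation for this statement: $u_a,\hat u_a$ are principal and nonprincipal solutions of $\tau u=0$ at $a$ (solutions on all of $(a,b)$) with $W(\hat u_a,u_a)=1$, used to define boundary values at $a$; boundary values at $b$ use a fixed normalized principal/nonprincipal pair of $\tau u=0$ at $b$. $\hat v_a=\hat u_a-\frac{\langle \hat u_a,u_a\rangle}{\|u_a\|^2}u_a$ (inner products and norms in $L^2((a,b);rdx)$). $N_u=\|u_a\|^2$, $N_v=\|\hat v_a\|^2$, $U_b=\tilde u_a(b)$, $U'_b=\tilde u_a'(b)$, $V_b=\tilde{\hat v}_a(b)$, $V'_b=\tilde{\hat v}_a'(b)$, $V'_a=\tilde{\hat v}_a'(a)$ (one has $U_b\ne0$). *)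

theory Defs
  imports "HOL-Analysis.Analysis"
begin

text \<open>The data (a,b,p,q,r) of the differential expression
  tau = (1/r)(-(d/dx) p (d/dx) + q) on the interval (a,b), -infinity <= a < b <= infinity.\<close>

record slp =
  sa :: ereal
  sb :: ereal
  sp :: "real \<Rightarrow> real"
  sq :: "real \<Rightarrow> real"
  sr :: "real \<Rightarrow> real"

definition sI :: "slp \<Rightarrow> real set" where
  "sI S = einterval (sa S) (sb S)"

definition sl_standard :: "slp \<Rightarrow> bool" where
  "sl_standard S \<longleftrightarrow> sa S < sb S \<and>
     set_borel_measurable lborel (sI S) (sp S) \<and>
     set_borel_measurable lborel (sI S) (sq S) \<and>
     set_borel_measurable lborel (sI S) (sr S) \<and>
     (AE x in lborel. x \<in> sI S \<longrightarrow> sp S x > 0) \<and>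
     (AE x in lborel. x \<in> sI S \<longrightarrow> sr S x > 0) \<and>
     (\<forall>c\<in>sI S. \<forall>d\<in>sI S.
        set_integrable lborel {c..d} (\<lambda>x. 1 / sp S x) \<and>
        set_integrable lborel {c..d} (sq S) \<and>
        set_integrable lborel {c..d} (sr S))"

definition L2 :: "slp \<Rightarrow> (real \<Rightarrow> complex) \<Rightarrow> bool" where
  "L2 S f \<longleftrightarrow> set_borel_measurable lborel (sI S) f \<and>
     set_integrable lborel (sI S) (\<lambda>x. (cmod (f x))\<^sup>2 * sr S x)"

definition aeq :: "slp \<Rightarrow> (real \<Rightarrow> complex) \<Rightarrow> (real \<Rightarrow> complex) \<Rightarrow> bool" where
  "aeq S f g \<longleftrightarrow> (AE x in lborel. x \<in> sI S \<longrightarrow> f x = g x)"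

definition ip :: "slp \<Rightarrow> (real \<Rightarrow> complex) \<Rightarrow> (real \<Rightarrow> complex) \<Rightarrow> complex" where
  "ip S f g = (LINT x:sI S|lborel. f x * cnj (g x) * complex_of_real (sr S x))"

definition nrm :: "slp \<Rightarrow> (real \<Rightarrow> complex) \<Rightarrow> real" where
  "nrm S f = sqrt (LINT x:sI S|lborel. (cmod (f x))\<^sup>2 * sr S x)"

text \<open>Linear operators in L^2 are represented by their graphs (sets of pairs),
  closed under a.e. modification.\<close>
type_synonym lrel = "((real \<Rightarrow> complex) \<times> (real \<Rightarrow> complex)) set"

definition Dom :: "lrel \<Rightarrow> (real \<Rightarrow> complex) set" where
  "Dom A = {f. \<exists>h. (f, h) \<in> A}"

text \<open>F is locally absolutely continuous on (a,b) with (a.e.) derivative k, i.e.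
  F(x) - F(c) = integral of k from c to x, for all c, x in (a,b).\<close>
definition lprim :: "slp \<Rightarrow> (real \<Rightarrow> complex) \<Rightarrow> (real \<Rightarrow> complex) \<Rightarrow> bool" where
  "lprim S F k \<longleftrightarrow> (\<forall>c\<in>sI S. \<forall>x\<in>sI S.
     interval_lebesgue_integrable lborel (ereal c) (ereal x) k \<and>
     F x - F c = interval_lebesgue_integral lborel (ereal c) (ereal x) k)"

text \<open>g, g1 = g^[1] = p g' in AC_loc, and h = tau g (a.e.).\<close>
definition qrel :: "slp \<Rightarrow> (real \<Rightarrow> complex) \<Rightarrow> (real \<Rightarrow> complex) \<Rightarrow> (real \<Rightarrow> complex) \<Rightarrow> bool" where
  "qrel S g g1 h \<longleftrightarrow>
     lprim S g (\<lambda>t. g1 t / complex_of_real (sp S t)) \<and>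
     lprim S g1 (\<lambda>t. complex_of_real (sq S t) * g t - complex_of_real (sr S t) * h t)"

definition qd :: "slp \<Rightarrow> (real \<Rightarrow> complex) \<Rightarrow> (real \<Rightarrow> complex)" where
  "qd S g = (SOME g1. \<exists>k. lprim S g (\<lambda>t. g1 t / complex_of_real (sp S t)) \<and> lprim S g1 k)"

definition Wr :: "slp \<Rightarrow> (real \<Rightarrow> complex) \<Rightarrow> (real \<Rightarrow> complex) \<Rightarrow> real \<Rightarrow> complex" where
  "Wr S f g x = f x * qd S g x - qd S f x * g x"

definition filt_a :: "slp \<Rightarrow> real filter" where
  "filt_a S = (if sa S = -\<infinity> then at_bot else at_right (real_of_ereal (sa S)))"

definition filt_b :: "slp \<Rightarrow> real filter" where
  "filt_b S = (if sb S = \<infinity> then at_top else at_left (real_of_ereal (sb S)))"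

definition WA :: "slp \<Rightarrow> (real \<Rightarrow> complex) \<Rightarrow> (real \<Rightarrow> complex) \<Rightarrow> complex" where
  "WA S f g = Lim (filt_a S) (Wr S f g)"

definition WB :: "slp \<Rightarrow> (real \<Rightarrow> complex) \<Rightarrow> (real \<Rightarrow> complex) \<Rightarrow> complex" where
  "WB S f g = Lim (filt_b S) (Wr S f g)"

text \<open>Restriction of T_max to those elements whose AC representative satisfies P.\<close>
definition Trestr :: "slp \<Rightarrow> ((real \<Rightarrow> complex) \<Rightarrow> bool) \<Rightarrow> lrel" where
  "Trestr S P = {(f, h). L2 S f \<and> L2 S h \<and> (\<exists>g g1. aeq S f g \<and> qrel S g g1 h \<and> P g)}"

definition Tmax :: "slp \<Rightarrow> lrel" where
  "Tmax S = Trestr S (\<lambda>_. True)"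

definition Tmin :: "slp \<Rightarrow> lrel" where
  "Tmin S = {(f, h). L2 S f \<and> L2 S h \<and>
     (\<exists>F H. (\<forall>n. (F n, H n) \<in> Tmax S \<and>
              (\<exists>c\<in>sI S. \<exists>d\<in>sI S. AE x in lborel. x \<in> sI S \<and> (x < c \<or> d < x) \<longrightarrow> F n x = 0)) \<and>
            (\<lambda>n. nrm S (\<lambda>x. F n x - f x)) \<longlonglongrightarrow> 0 \<and>
            (\<lambda>n. nrm S (\<lambda>x. H n x - h x)) \<longlonglongrightarrow> 0)}"

definition is_sol :: "slp \<Rightarrow> complex \<Rightarrow> (real \<Rightarrow> complex) \<Rightarrow> bool" where
  "is_sol S z u \<longleftrightarrow> (\<exists>u1. qrel S u u1 (\<lambda>t. z * u t))"

definition limit_circle_a :: "slp \<Rightarrow> bool" where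
  "limit_circle_a S \<longleftrightarrow> (\<forall>z u. is_sol S z u \<longrightarrow>
     (\<exists>c\<in>sI S. set_integrable lborel {x\<in>sI S. x \<le> c} (\<lambda>x. (cmod (u x))\<^sup>2 * sr S x)))"

definition limit_circle_b :: "slp \<Rightarrow> bool" where
  "limit_circle_b S \<longleftrightarrow> (\<forall>z u. is_sol S z u \<longrightarrow>
     (\<exists>c\<in>sI S. set_integrable lborel {x\<in>sI S. c \<le> x} (\<lambda>x. (cmod (u x))\<^sup>2 * sr S x)))"

definition cu :: "(real \<Rightarrow> real) \<Rightarrow> (real \<Rightarrow> complex)" where
  "cu u = (\<lambda>x. complex_of_real (u x))"

definition principal_a :: "slp \<Rightarrow> (real \<Rightarrow> real) \<Rightarrow> bool" where
  "principal_a S u \<longleftrightarrow> is_sol S 0 (cu u) \<and>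
     (\<exists>c\<in>sI S. (\<forall>x\<in>sI S. x \<le> c \<longrightarrow> u x \<noteq> 0) \<and>
        (\<integral>\<^sup>+ x. indicator {x\<in>sI S. x \<le> c} x * ennreal (1 / (sp S x * (u x)\<^sup>2)) \<partial>lborel) = \<infinity>)"

definition principal_b :: "slp \<Rightarrow> (real \<Rightarrow> real) \<Rightarrow> bool" where
  "principal_b S u \<longleftrightarrow> is_sol S 0 (cu u) \<and>
     (\<exists>c\<in>sI S. (\<forall>x\<in>sI S. c \<le> x \<longrightarrow> u x \<noteq> 0) \<and>
        (\<integral>\<^sup>+ x. indicator {x\<in>sI S. c \<le> x} x * ennreal (1 / (sp S x * (u x)\<^sup>2)) \<partial>lborel) = \<infinity>)"

definition normalized_pair_a :: "slp \<Rightarrow> (real \<Rightarrow> real) \<Rightarrow> (real \<Rightarrow> real) \<Rightarrow> bool" where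
  "normalized_pair_a S u uh \<longleftrightarrow> principal_a S u \<and> is_sol S 0 (cu uh) \<and>
     (\<forall>x\<in>sI S. Wr S (cu uh) (cu u) x = 1)"

definition normalized_pair_b :: "slp \<Rightarrow> (real \<Rightarrow> real) \<Rightarrow> (real \<Rightarrow> real) \<Rightarrow> bool" where
  "normalized_pair_b S u uh \<longleftrightarrow> principal_b S u \<and> is_sol S 0 (cu uh) \<and>
     (\<forall>x\<in>sI S. Wr S (cu uh) (cu u) x = 1)"

text \<open>bv_a returns (g~(a), g~'(a)); bv_b returns (g~(b), g~'(b)).\<close>
definition bv_a :: "slp \<Rightarrow> (real \<Rightarrow> real) \<Rightarrow> (real \<Rightarrow> real) \<Rightarrow> (real \<Rightarrow> complex) \<Rightarrow> complex \<times> complex" where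
  "bv_a S ua uha g = (- WA S (cu ua) g, WA S (cu uha) g)"

definition bv_b :: "slp \<Rightarrow> (real \<Rightarrow> real) \<Rightarrow> (real \<Rightarrow> real) \<Rightarrow> (real \<Rightarrow> complex) \<Rightarrow> complex \<times> complex" where
  "bv_b S ub uhb g = (- WB S (cu ub) g, WB S (cu uhb) g)"

definition T_sep :: "slp \<Rightarrow> (real \<Rightarrow> real) \<Rightarrow> (real \<Rightarrow> real) \<Rightarrow> (real \<Rightarrow> real) \<Rightarrow> (real \<Rightarrow> real)
    \<Rightarrow> real \<Rightarrow> real \<Rightarrow> lrel" where
  "T_sep S ua uha ub uhb \<alpha> \<beta> = Trestr S (\<lambda>g.
     fst (bv_a S ua uha g) * complex_of_real (cos \<alpha>) + snd (bv_a S ua uha g) * complex_of_real (sin \<alpha>) = 0 \<and>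
     fst (bv_b S ub uhb g) * complex_of_real (cos \<beta>) - snd (bv_b S ub uhb g) * complex_of_real (sin \<beta>) = 0)"

definition T_F :: "slp \<Rightarrow> (real \<Rightarrow> real) \<Rightarrow> (real \<Rightarrow> real) \<Rightarrow> (real \<Rightarrow> real) \<Rightarrow> (real \<Rightarrow> real) \<Rightarrow> lrel" where
  "T_F S ua uha ub uhb = T_sep S ua uha ub uhb pi pi"

definition N0 :: "slp \<Rightarrow> (real \<Rightarrow> complex) set" where
  "N0 S = {f. (f, (\<lambda>_. 0)) \<in> Tmax S}"

definition perp :: "slp \<Rightarrow> (real \<Rightarrow> complex) set \<Rightarrow> (real \<Rightarrow> complex) set" where
  "perp S W = {f. L2 S f \<and> (\<forall>w\<in>W. ip S f w = 0)}"

text \<open>T_{B,W}: restriction of T_max to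
  dom(T_min) + {((T_F)^{-1} B + I) eta : eta in dom B} + {(T_F)^{-1} v : v in N0 cap W^perp}.\<close>
definition T_BW :: "slp \<Rightarrow> (real \<Rightarrow> real) \<Rightarrow> (real \<Rightarrow> real) \<Rightarrow> (real \<Rightarrow> real) \<Rightarrow> (real \<Rightarrow> real)
    \<Rightarrow> lrel \<Rightarrow> (real \<Rightarrow> complex) set \<Rightarrow> lrel" where
  "T_BW S ua uha ub uhb B W = {(f, h) \<in> Tmax S.
     \<exists>f0 \<eta> \<beta> x v y. f0 \<in> Dom (Tmin S) \<and> (\<eta>, \<beta>) \<in> B \<and> (x, \<beta>) \<in> T_F S ua uha ub uhb \<and>
        v \<in> N0 S \<inter> perp S W \<and> (y, v) \<in> T_F S ua uha ub uhb \<and>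
        aeq S f (\<lambda>t. f0 t + (x t + \<eta> t) + y t)}"

definition Bmat :: "slp \<Rightarrow> (real \<Rightarrow> complex) \<Rightarrow> (real \<Rightarrow> complex) \<Rightarrow> complex \<Rightarrow> complex \<Rightarrow> complex \<Rightarrow> complex \<Rightarrow> lrel" where
  "Bmat S u v b11 b12 b21 b22 = {(f, h). L2 S f \<and> L2 S h \<and> (\<exists>c1 c2.
     aeq S f (\<lambda>t. c1 * u t + c2 * v t) \<and>
     aeq S h (\<lambda>t. (c1 * b11 + c2 * b21) * u t + (c1 * b12 + c2 * b22) * v t))}"

definition adj :: "slp \<Rightarrow> lrel \<Rightarrow> lrel" where
  "adj S A = {(h, k). L2 S h \<and> L2 S k \<and> (\<forall>(f, g)\<in>A. ip S g h = ip S f k)}"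

definition nonneg_sa :: "slp \<Rightarrow> lrel \<Rightarrow> bool" where
  "nonneg_sa S A \<longleftrightarrow> A = adj S A \<and>
     (\<forall>f g g'. (f, g) \<in> A \<longrightarrow> (f, g') \<in> A \<longrightarrow> aeq S g g') \<and>
     (\<forall>(f, g)\<in>A. 0 \<le> Re (ip S g f))"

definition rcomp :: "lrel \<Rightarrow> lrel \<Rightarrow> lrel" where
  "rcomp A B = {(f, h). \<exists>g. (f, g) \<in> B \<and> (g, h) \<in> A}"

definition opsqrt :: "slp \<Rightarrow> lrel \<Rightarrow> lrel" where
  "opsqrt S A = (THE R. nonneg_sa S R \<and> rcomp R R = A)"

definition op_le :: "slp \<Rightarrow> lrel \<Rightarrow> lrel \<Rightarrow> bool" where
  "op_le S A B \<longleftrightarrow> Dom (opsqrt S B) \<subseteq> Dom (opsqrt S A) \<and>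
     (\<forall>f g g'. (f, g) \<in> opsqrt S B \<longrightarrow> (f, g') \<in> opsqrt S A \<longrightarrow> nrm S g' \<le> nrm S g)"

definition zero_op :: "slp \<Rightarrow> lrel" where
  "zero_op S = {(f, h). L2 S f \<and> L2 S h \<and> aeq S h (\<lambda>_. 0)}"

end

theory Submission
  imports Defs "HOL-Analysis.Analysis"
begin

text \<open>Let G be the inverse of the Friedrichs extension and let v_a be the nonprincipal solution made
  orthogonal to u_a. The elements of the graph of T_B are the pairs (G h + \<eta>, h) with
  \<eta> = c_1 u_a + c_2 v_a for which h has the same moments against u_a and v_a as B \<eta>. By Green's
  formula and the Pluecker identity these moments are boundary values of G h, so that the condition
  linking h to \<eta> becomes a linear system for the boundary values of f = G h + \<eta> and (c_1, c_2);
  eliminating c_1 and c_2 gives (1) and (2).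

  For (3), the form order is expressed without square roots: A_1 \<le> A_2 iff
  2 Re \<langle>f, A_1 g\<rangle> - Re \<langle>A_1 g, g\<rangle> \<le> Re \<langle>A_2 f, f\<rangle> for all f and g in the respective domains.
  Here Re \<langle>T_B f, f\<rangle> is the Friedrichs form of G h plus the quadratic form of B at \<eta>. The
  Friedrichs form drops out, because there are functions of arbitrarily small Friedrichs energy
  with prescribed moments: cut the principal solutions off close to the endpoints, using the
  divergence of the integral of 1/(p u^2) there. What remains is the order of two Hermitian forms
  on the two-dimensional kernel of T_max.\<close>

text \<open>The order is defined through \<open>opsqrt\<close>, a definite description, so the
  criterion by forms rests on existence and uniqueness of the square root of an unbounded operator.
  Both are proved for graphs in a real Hilbert space. Complex linearity is recovered afterwards,
  because the root commutes with multiplication by i. Since one Hilbert space type has to serve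
  every S, each operator is carried to the square integrable functions on the whole line by the
  factor sqrt(r) and continued by zero on the functions living off (a,b).

  The second obstacle is that the lower bound is given for \<open>Tmin\<close> only. An element of
  dom(T_F) differs from one of dom(T_min) by a function with prescribed derivative boundary values;
  as the cutoffs provide such functions with arbitrarily small energy and norm, the bound passes to
  T_F. This yields that U_b is nonzero, hence that T_F is onto, and that the inverse G exists. The
  cutoffs are thus needed twice: for G itself and for the order.\<close>

lemma quadratic_nonneg_imp_zero:
  fixes a c :: real
  assumes "a \<ge> 0" "\<And>t. a * t\<^sup>2 + 2 * t * c \<ge> 0"
  shows "c = 0"
proof -
  \<comment> \<open>Adding 1 keeps the denominator of the test value t = -c/u positive also when a =
    0.\<close>
  define u where "u = a + 1"
  have u: "u > 0" using assms(1) by (simp add: u_def)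
  have "0 \<le> a * (- c / u)\<^sup>2 + 2 * (- c / u) * c" by (rule assms(2))
  also have "\<dots> = (a * c\<^sup>2 - 2 * c\<^sup>2 * u) / u\<^sup>2"
    using u by (simp add: field_simps power2_eq_square)
  finally have "0 \<le> a * c\<^sup>2 - 2 * c\<^sup>2 * u" using u by (simp add: zero_le_divide_iff)
  then have "c\<^sup>2 * (a + 2) \<le> 0" by (simp add: u_def algebra_simps)
  thus ?thesis using assms(1) by (simp add: mult_le_0_iff)
qed

text \<open>For n > 0 the left side of the hypothesis is largest at t = l/n^2, with value (l/n)^2.
  For n = 0 it is linear in t and can stay bounded only if l = 0.\<close>

lemma quadratic_upper_bound:
  fixes l n m :: real
  assumes "n \<ge> 0" "m \<ge> 0" "\<And>t. 2 * t * l - t\<^sup>2 * n\<^sup>2 \<le> m\<^sup>2"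
  shows "\<bar>l\<bar> \<le> m * n"
proof (cases "n = 0")
  case True
  have "2 * ((m\<^sup>2 + 1) / l) * l \<le> m\<^sup>2" using assms(3)[of "(m\<^sup>2 + 1) / l"] True by simp
  moreover have "m\<^sup>2 \<ge> 0" by simp
  ultimately have "l = 0" by (cases "l = 0") auto
  thus ?thesis using True by simp
next
  case False
  have "2 * (l / n\<^sup>2) * l - (l / n\<^sup>2)\<^sup>2 * n\<^sup>2 \<le> m\<^sup>2" by (rule assms(3))
  moreover have "2 * (l / n\<^sup>2) * l - (l / n\<^sup>2)\<^sup>2 * n\<^sup>2 = (l / n)\<^sup>2"
    using False by (simp add: field_simps power2_eq_square)
  ultimately have "\<bar>l / n\<bar> \<le> m" using assms(2) by (simp add: abs_le_square_iff[symmetric])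
  thus ?thesis using False assms(1) by (simp add: field_simps abs_mult)
qed

section \<open>Square roots of nonnegative self-adjoint relations in a Hilbert space\<close>

text \<open>Direct method: along a minimising sequence of |T w|^2 - 2 L w the images under T are
  Cauchy by the parallelogram law, and their limit represents L. D itself carries no topology. With
  T the identity this gives orthogonal projections; with T = P Q it gives the values of the square
  root.\<close>

lemma riesz_representation:
  fixes T :: "'b::real_vector \<Rightarrow> 'h::{real_inner,banach}" and L :: "'b \<Rightarrow> real"
  assumes D: "subspace D" and T: "linear T" and L: "linear L"
    and bd: "\<And>w. w \<in> D \<Longrightarrow> \<bar>L w\<bar> \<le> M * norm (T w)"
  shows "\<exists>y\<in>closure (T ` D). \<forall>w\<in>D. L w = y \<bullet> T w"
proof -
  define J where "J w = (norm (T w))\<^sup>2 - 2 * L w" for w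
  have J_ge: "- M\<^sup>2 \<le> J w" if "w \<in> D" for w
  proof -
    have "0 \<le> (norm (T w) - M)\<^sup>2" by simp
    then have "- M\<^sup>2 \<le> (norm (T w))\<^sup>2 - 2 * (M * norm (T w))"
      by (simp add: power2_diff algebra_simps)
    with bd[OF that] show ?thesis unfolding J_def by linarith
  qed
  define m where "m = Inf (J ` D)"
  have bb: "bdd_below (J ` D)" using J_ge by (auto intro!: bdd_belowI)
  have ne: "J ` D \<noteq> {}" using subspace_0[OF D] by blast
  have m_le: "m \<le> J w" if "w \<in> D" for w
    unfolding m_def using bb that by (auto intro: cInf_lower)
  have "\<exists>w\<in>D. J w < m + 1 / real (Suc n)" for n
  proof -
    have "Inf (J ` D) < m + 1 / real (Suc n)" unfolding m_def by simp
    from cInf_lessD[OF ne this] show ?thesis by blast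
  qed
  then obtain w where w: "\<And>n. w n \<in> D" "\<And>n. J (w n) < m + 1 / real (Suc n)" by metis
  have par: "(norm (T u - T v))\<^sup>2 = 2 * J u + 2 * J v - 4 * J ((1/2) *\<^sub>R (u + v))" for u v
    unfolding J_def linear_cmul[OF T] linear_cmul[OF L] linear_add[OF T] linear_add[OF L]
    by (simp add: power2_norm_eq_inner inner_diff inner_add inner_commute algebra_simps)
  have close: "(norm (T (w n) - T (w k)))\<^sup>2 \<le> 2 / real (Suc n) + 2 / real (Suc k)" for n k
  proof -
    have "(1/2) *\<^sub>R (w n + w k) \<in> D" using D w by (intro subspace_scale subspace_add)
    from m_le[OF this] w(2)[of n] w(2)[of k] show ?thesis unfolding par by simp
  qed
  have "Cauchy (\<lambda>n. T (w n))"
  proof (rule CauchyI)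
    fix e :: real assume e: "e > 0"
    obtain N where N: "4 / e\<^sup>2 < real (Suc N)" using reals_Archimedean2 less_SucI
      by (metis of_nat_less_iff less_trans lessI)
    have N': "4 / real (Suc N) < e\<^sup>2"
      using N e by (simp add: field_simps)
    show "\<exists>N. \<forall>n\<ge>N. \<forall>k\<ge>N. norm (T (w n) - T (w k)) < e"
    proof (intro exI allI impI)
      fix n k assume nk: "n \<ge> N" "k \<ge> N"
      have "2 / real (Suc n) \<le> 2 / real (Suc N)" "2 / real (Suc k) \<le> 2 / real (Suc N)"
        using nk by (auto intro!: divide_left_mono)
      with close[of n k] N' have "(norm (T (w n) - T (w k)))\<^sup>2 < e\<^sup>2" by simp
      thus "norm (T (w n) - T (w k)) < e" using e by (simp add: power_less_imp_less_base)
    qed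
  qed
  then obtain y where y: "(\<lambda>n. T (w n)) \<longlonglongrightarrow> y" using Cauchy_convergent_iff convergent_def by blast
  have "y \<in> closure (T ` D)"
    unfolding closure_sequential using y w(1) by (intro exI[of _ "\<lambda>n. T (w n)"]) auto
  moreover have "L v = y \<bullet> T v" if v: "v \<in> D" for v
  proof -
    \<comment> \<open>The minimum need not be attained in D, so the variation in direction v is
      taken at \<open>w n\<close>, with error 1/(n+1), and only then passed to the limit.\<close>
    have "(norm (T v))\<^sup>2 * t\<^sup>2 + 2 * t * (y \<bullet> T v - L v) \<ge> 0" for t
    proof -
      have ge: "(norm (T v))\<^sup>2 * t\<^sup>2 + 2 * t * (T (w n) \<bullet> T v - L v) \<ge> - (1 / real (Suc n))" for n
      proof -
        have "w n + t *\<^sub>R v \<in> D" using D w v by (intro subspace_add subspace_scale)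
        from m_le[OF this] w(2)[of n] have "- (1 / real (Suc n)) \<le> J (w n + t *\<^sub>R v) - J (w n)" by linarith
        also have "\<dots> = (norm (T v))\<^sup>2 * t\<^sup>2 + 2 * t * (T (w n) \<bullet> T v - L v)"
          unfolding J_def linear_cmul[OF T] linear_cmul[OF L] linear_add[OF T] linear_add[OF L]
          by (simp only: power2_norm_eq_inner)
            (simp add: inner_diff inner_add inner_commute algebra_simps power2_eq_square)
        finally show ?thesis .
      qed
      have l1: "(\<lambda>n. (norm (T v))\<^sup>2 * t\<^sup>2 + 2 * t * (T (w n) \<bullet> T v - L v)) \<longlonglongrightarrow>
            (norm (T v))\<^sup>2 * t\<^sup>2 + 2 * t * (y \<bullet> T v - L v)" by (intro tendsto_intros y)
      have l2: "(\<lambda>n. - (1 / real (Suc n))) \<longlonglongrightarrow> 0"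
        using tendsto_minus[OF LIMSEQ_inverse_real_of_nat] by (simp add: inverse_eq_divide)
      show ?thesis by (rule LIMSEQ_le[OF l2 l1]) (use ge in auto)
    qed
    from quadratic_nonneg_imp_zero[OF _ this] show ?thesis by simp
  qed
  ultimately show ?thesis by blast
qed

lemma orthogonal_projection_closure:
  fixes D :: "'h::{real_inner,banach} set"
  assumes "subspace D"
  shows "\<exists>y\<in>closure D. \<forall>w\<in>D. (z - y) \<bullet> w = 0"
proof -
  have "\<exists>y\<in>closure ((\<lambda>x. x) ` D). \<forall>w\<in>D. z \<bullet> w = y \<bullet> w"
    by (rule riesz_representation[OF assms, where M = "norm z"])
      (auto simp: linear_iff inner_add_right Cauchy_Schwarz_ineq2)
  thus ?thesis by (auto simp: inner_diff_left)
qed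

section \<open>Bounded self-adjoint operators and their square roots\<close>

definition hsa :: "('h::real_inner \<Rightarrow>\<^sub>L 'h) \<Rightarrow> bool" where
  "hsa X \<longleftrightarrow> (\<forall>x y. X x \<bullet> y = x \<bullet> X y)"

text \<open>The iteration Y' = (X + Y^2) / 2 for 1 - sqrt (1 - X): its increments are dominated in
  norm by those of the scalar iteration with X = 1.\<close>

lemma blinfun_sqrt:
  fixes X :: "'h::{real_inner,banach} \<Rightarrow>\<^sub>L 'h"
  assumes X: "norm X \<le> 1" and saX: "hsa X"
  shows "\<exists>P :: 'h \<Rightarrow>\<^sub>L 'h. hsa P \<and> (\<forall>x. P (P x) = x - X x) \<and> norm (id_blinfun - P) \<le> 1 \<and>
    (\<forall>V. bounded_linear V \<longrightarrow> (\<forall>x. V (X x) = X (V x)) \<longrightarrow> (\<forall>x. V (P x) = P (V x))) \<and>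
    (\<forall>x. x \<bullet> P x \<ge> 0)"
proof -
  define Y :: "nat \<Rightarrow> 'h \<Rightarrow>\<^sub>L 'h" where "Y = rec_nat 0 (\<lambda>_ Z. (1/2) *\<^sub>R (X + (Z o\<^sub>L Z)))"
  have Y0: "Y 0 = 0" and YS: "\<And>n. Y (Suc n) = (1/2) *\<^sub>R (X + (Y n o\<^sub>L Y n))"
    unfolding Y_def by simp_all
  define s :: "nat \<Rightarrow> real" where "s = rec_nat 0 (\<lambda>_ z. (1 + z * z) / 2)"
  have s0: "s 0 = 0" and sS: "\<And>n. s (Suc n) = (1 + s n * s n) / 2"
    unfolding s_def by simp_all
  have s01: "0 \<le> s n \<and> s n \<le> 1" for n
  proof (induction n)
    case (Suc n)
    then have "s n * s n \<le> 1" "0 \<le> s n * s n" by (auto simp: mult_le_one)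
    then show ?case unfolding sS by simp
  qed (simp add: s0)
  have s_mono: "s n \<le> s (Suc n)" for n
  proof -
    have "0 \<le> (s n - 1) * (s n - 1)" by simp
    then show ?thesis unfolding sS by (simp add: algebra_simps)
  qed
  have Ys: "norm (Y n) \<le> s n" for n
  proof (induction n)
    case (Suc n)
    have "norm (Y n o\<^sub>L Y n) \<le> norm (Y n) * norm (Y n)" by (rule norm_blinfun_compose)
    also have "\<dots> \<le> s n * s n" using Suc s01[of n] by (intro mult_mono) auto
    finally show ?case unfolding YS sS using norm_triangle_ineq[of X "(Y n o\<^sub>L Y n)"] X by simp
  qed (simp add: Y0 s0)
  have comm: "V (Y n x) = Y n (V x)" if V: "bounded_linear V" and VX: "\<And>x. V (X x) = X (V x)" for V n x
  proof (induction n arbitrary: x)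
    case 0 show ?case by (simp add: Y0 linear_simps(3)[OF V])
  next
    case (Suc n)
    show ?case unfolding YS
      by (simp add: blinfun.scaleR_left blinfun.add_left linear_simps[OF V] VX Suc)
  qed
  have YX: "Y n (X x) = X (Y n x)" for n x
    by (rule comm[OF blinfun.bounded_linear_right, symmetric]) simp
  have YY: "Y n (Y m x) = Y m (Y n x)" for n m x
    by (rule comm[OF blinfun.bounded_linear_right]) (rule YX)
  have step: "norm (Y (Suc n) - Y n) \<le> s (Suc n) - s n" for n
  proof (induction n)
    case 0 show ?case using X by (simp add: Y0 YS s0 sS)
  next
    case (Suc n)
    \<comment> \<open>Difference of two squares; it factors because consecutive iterates commute,
      being polynomials in X.\<close>
    have eq: "Y (Suc (Suc n)) - Y (Suc n) = (1/2) *\<^sub>R ((Y (Suc n) + Y n) o\<^sub>L (Y (Suc n) - Y n))"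
      by (rule blinfun_eqI)
        (simp only: YS[of "Suc n"] YS[of n],
         simp add: blinfun.scaleR_left blinfun.add_left blinfun.diff_left blinfun.add_right blinfun.diff_right
           blinfun.scaleR_right algebra_simps YX)
    have "norm ((Y (Suc n) + Y n) o\<^sub>L (Y (Suc n) - Y n)) \<le> norm (Y (Suc n) + Y n) * norm (Y (Suc n) - Y n)"
      by (rule norm_blinfun_compose)
    also have "\<dots> \<le> (s (Suc n) + s n) * (s (Suc n) - s n)"
      using norm_triangle_ineq[of "Y (Suc n)" "Y n"] Ys[of n] Ys[of "Suc n"] Suc s01[of n] s01[of "Suc n"]
      by (intro mult_mono) auto
    finally have "norm (Y (Suc (Suc n)) - Y (Suc n)) \<le> (1/2) * ((s (Suc n) + s n) * (s (Suc n) - s n))"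
      unfolding eq by simp
    also have "\<dots> = s (Suc (Suc n)) - s (Suc n)"
      unfolding sS[of "Suc n"] by (subst (3) sS) (simp add: algebra_simps)
    finally show ?case .
  qed
  have diff: "norm (Y (m + k) - Y m) \<le> s (m + k) - s m" for m k
  proof (induction k)
    case (Suc k)
    have "norm (Y (m + Suc k) - Y m) \<le> norm (Y (Suc (m + k)) - Y (m + k)) + norm (Y (m + k) - Y m)"
      using norm_triangle_ineq[of "Y (Suc (m + k)) - Y (m + k)" "Y (m + k) - Y m"] by simp
    with Suc step[of "m + k"] show ?case by simp
  qed simp
  have "convergent s"
    by (rule Bseq_mono_convergent) (auto intro!: BseqI'[where K = 1] lift_Suc_mono_le[of s] s_mono simp: s01)
  then have "Cauchy s" by (simp add: Cauchy_convergent_iff)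
  have "Cauchy Y"
  proof (rule CauchyI)
    fix e :: real assume "e > 0"
    with \<open>Cauchy s\<close> obtain N where N: "\<And>m n. m \<ge> N \<Longrightarrow> n \<ge> N \<Longrightarrow> norm (s m - s n) < e"
      unfolding Cauchy_iff by blast
    have le: "norm (Y n - Y m) < e" if "m \<ge> N" "n \<ge> m" for m n
    proof -
      have "norm (Y n - Y m) \<le> s n - s m" using diff[of m "n - m"] that by simp
      also have "\<dots> \<le> norm (s n - s m)" by simp
      also have "\<dots> < e" using N that by (meson order_trans)
      finally show ?thesis .
    qed
    show "\<exists>N. \<forall>m\<ge>N. \<forall>n\<ge>N. norm (Y m - Y n) < e"
      using le by (metis nat_le_linear norm_minus_commute)
  qed
  then obtain Z where Z: "Y \<longlonglongrightarrow> Z" using Cauchy_convergent_iff convergent_def by blast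
  have Zx: "(\<lambda>n. Y n x) \<longlonglongrightarrow> Z x" for x by (intro tendsto_intros Z)
  have nZ: "norm Z \<le> 1"
    by (rule LIMSEQ_le_const2[OF tendsto_norm[OF Z]]) (use Ys s01 order_trans in blast)
  have "(\<lambda>n. Y (Suc n)) \<longlonglongrightarrow> (1/2) *\<^sub>R (X + (Z o\<^sub>L Z))"
    unfolding YS by (intro tendsto_intros Z bounded_bilinear.tendsto[OF bounded_bilinear_blinfun_compose])
  with LIMSEQ_Suc[OF Z] have Zeq: "Z = (1/2) *\<^sub>R (X + (Z o\<^sub>L Z))" by (rule LIMSEQ_unique)
  have Zeq': "2 *\<^sub>R Z x = X x + Z (Z x)" for x
    by (subst Zeq) (simp add: blinfun.scaleR_left blinfun.add_left)
  have saY: "Y n x \<bullet> y = x \<bullet> Y n y" for n x y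
    using saX by (induction n arbitrary: x y)
      (simp_all add: Y0 YS hsa_def blinfun.scaleR_left blinfun.add_left inner_add)
  have saZ: "Z x \<bullet> y = x \<bullet> Z y" for x y
  proof (rule LIMSEQ_unique)
    show "(\<lambda>n. Y n x \<bullet> y) \<longlonglongrightarrow> Z x \<bullet> y" by (intro tendsto_intros Zx)
    show "(\<lambda>n. Y n x \<bullet> y) \<longlonglongrightarrow> x \<bullet> Z y" unfolding saY by (intro tendsto_intros Zx)
  qed
  have Zc: "V (Z x) = Z (V x)" if V: "bounded_linear V" "\<And>x. V (X x) = X (V x)" for V x
  proof (rule LIMSEQ_unique)
    show "(\<lambda>n. V (Y n x)) \<longlonglongrightarrow> V (Z x)" by (rule bounded_linear.tendsto[OF V(1) Zx])
    show "(\<lambda>n. V (Y n x)) \<longlonglongrightarrow> Z (V x)" unfolding comm[OF V] by (rule Zx)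
  qed
  \<comment> \<open>The fixed point equation 2 Z = X + Z^2 says (1 - Z)^2 = 1 - X, and norm Z <= 1
    makes 1 - Z nonnegative. That 1 - P = Z is again a contraction is recorded so that a root of P
    can be taken in turn.\<close>
  let ?P = "id_blinfun - Z"
  show ?thesis
  proof (intro exI[of _ ?P] conjI allI impI)
    show "hsa ?P" by (simp add: hsa_def blinfun.diff_left inner_diff saZ)
    show "?P (?P x) = x - X x" for x
      using Zeq'[of x] by (simp add: blinfun.diff_left blinfun.diff_right algebra_simps scaleR_2)
    show "norm (id_blinfun - ?P) \<le> 1" using nZ by simp
    show "V (?P x) = ?P (V x)" if "bounded_linear V" "\<forall>x. V (X x) = X (V x)" for V x
      using Zc[of V] that by (simp add: blinfun.diff_left linear_simps[OF that(1)])
    show "x \<bullet> ?P x \<ge> 0" for x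
    proof -
      have "x \<bullet> Z x \<le> norm x * norm (Z x)" by (rule norm_cauchy_schwarz)
      also have "\<dots> \<le> norm x * (norm Z * norm x)" by (intro mult_left_mono norm_blinfun) auto
      also have "\<dots> \<le> norm x * (1 * norm x)" using nZ by (intro mult_left_mono mult_right_mono) auto
      finally show ?thesis
        by (simp add: blinfun.diff_left inner_diff_right power2_norm_eq_inner[symmetric] power2_eq_square)
    qed
  qed
qed

section \<open>Nonnegative self-adjoint graphs in a real Hilbert space\<close>

definition hadj :: "('h::real_inner \<times> 'h) set \<Rightarrow> ('h \<times> 'h) set" where
  "hadj A = {(h, k). \<forall>(f, g)\<in>A. g \<bullet> h = f \<bullet> k}"

text \<open>Linearity and closedness of the graph come from its being an adjoint, and
  single-valuedness then amounts to its being so at 0.\<close>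

definition nnsa :: "('h::real_inner \<times> 'h) set \<Rightarrow> bool" where
  "nnsa A \<longleftrightarrow> hadj A = A \<and> (\<forall>g. (0, g) \<in> A \<longrightarrow> g = 0) \<and> (\<forall>(f, g)\<in>A. 0 \<le> g \<bullet> f)"

lemma nnsa_sym: "nnsa A \<Longrightarrow> (f, g) \<in> A \<Longrightarrow> (h, k) \<in> A \<Longrightarrow> g \<bullet> h = f \<bullet> k"
  unfolding nnsa_def hadj_def by fast

lemma nnsa_memI: "nnsa A \<Longrightarrow> (\<And>f g. (f, g) \<in> A \<Longrightarrow> g \<bullet> h = f \<bullet> k) \<Longrightarrow> (h, k) \<in> A"
  unfolding nnsa_def hadj_def by fast

lemma nnsa_nonneg: "nnsa A \<Longrightarrow> (f, g) \<in> A \<Longrightarrow> 0 \<le> g \<bullet> f"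
  unfolding nnsa_def by fast

lemma nnsa_add: "nnsa A \<Longrightarrow> (f, g) \<in> A \<Longrightarrow> (h, k) \<in> A \<Longrightarrow> (f + h, g + k) \<in> A"
  by (rule nnsa_memI) (auto simp: inner_add nnsa_sym)

lemma nnsa_scale: "nnsa A \<Longrightarrow> (f, g) \<in> A \<Longrightarrow> (c *\<^sub>R f, c *\<^sub>R g) \<in> A"
  by (rule nnsa_memI) (auto simp: nnsa_sym)

lemma nnsa_diff: "nnsa A \<Longrightarrow> (f, g) \<in> A \<Longrightarrow> (h, k) \<in> A \<Longrightarrow> (f - h, g - k) \<in> A"
  by (rule nnsa_memI) (auto simp: inner_diff nnsa_sym)

lemma nnsa_unique: "nnsa A \<Longrightarrow> (f, g) \<in> A \<Longrightarrow> (f, g') \<in> A \<Longrightarrow> g = g'"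
  using nnsa_diff[of A f g f g'] unfolding nnsa_def by auto

lemma nnsa_closed: "nnsa A \<Longrightarrow> closed A"
  unfolding closed_sequential_limits
proof (intro allI impI)
  fix x l assume A: "nnsa A" and x: "(\<forall>n. x n \<in> A) \<and> x \<longlonglongrightarrow> l"
  have "(fst l, snd l) \<in> A"
  proof (rule nnsa_memI[OF A])
    fix f g assume fg: "(f, g) \<in> A"
    have "g \<bullet> fst (x n) = f \<bullet> snd (x n)" for n
      using x nnsa_sym[OF A fg, of "fst (x n)" "snd (x n)"] by simp
    moreover have "(\<lambda>n. g \<bullet> fst (x n)) \<longlonglongrightarrow> g \<bullet> fst l" "(\<lambda>n. f \<bullet> snd (x n)) \<longlonglongrightarrow> f \<bullet> snd l"
      using x by (auto intro!: tendsto_intros)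
    ultimately show "g \<bullet> fst l = f \<bullet> snd l" using LIMSEQ_unique by simp
  qed
  thus "l \<in> A" by simp
qed

text \<open>In |f + g|^2 the cross term is nonnegative. Hence 1 + A is injective with closed range
  and both (1 + A)^(-1) and A (1 + A)^(-1) are contractions.\<close>

lemma nnsa_norm_sum:
  assumes "nnsa A" "(f, g) \<in> A"
  shows "norm f \<le> norm (f + g) \<and> norm g \<le> norm (f + g)"
proof -
  have "0 \<le> g \<bullet> f" using assms by (rule nnsa_nonneg)
  moreover have "(norm (f + g))\<^sup>2 = (norm f)\<^sup>2 + 2 * (g \<bullet> f) + (norm g)\<^sup>2"
    unfolding power2_norm_eq_inner by (simp add: inner_add inner_commute[of f g])
  moreover have "0 \<le> (norm f)\<^sup>2" "0 \<le> (norm g)\<^sup>2" by simp_all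
  ultimately have "(norm f)\<^sup>2 \<le> (norm (f + g))\<^sup>2" "(norm g)\<^sup>2 \<le> (norm (f + g))\<^sup>2"
    by linarith+
  thus ?thesis using power2_le_imp_le[OF _ norm_ge_zero] by blast
qed

text \<open>The range of 1 + A is closed by \<open>nnsa_norm_sum\<close>. A vector z orthogonal to
  it puts (z, -z) into the adjoint, hence into A, and nonnegativity gives -|z|^2 >= 0.\<close>

lemma nnsa_resolvent_ex:
  fixes A :: "('h::{real_inner,banach} \<times> 'h) set"
  assumes A: "nnsa A"
  shows "\<exists>c. (c, w - c) \<in> A"
proof -
  have z: "(0, 0) \<in> A" by (rule nnsa_memI[OF A]) simp
  have sub: "subspace A"
    unfolding subspace_def using z nnsa_add[OF A] nnsa_scale[OF A] by (auto simp: zero_prod_def)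
  have lin: "linear (\<lambda>x::'h \<times> 'h. fst x + snd x)" by (auto simp: linear_iff algebra_simps)
  obtain y where y: "y \<in> closure ((\<lambda>x. fst x + snd x) ` A)"
    and orth: "\<And>v. v \<in> (\<lambda>x. fst x + snd x) ` A \<Longrightarrow> (w - y) \<bullet> v = 0"
    using orthogonal_projection_closure[OF linear_subspace_image[OF lin sub], of w] by blast
  obtain x where x: "\<And>n. x n \<in> A" "(\<lambda>n. fst (x n) + snd (x n)) \<longlonglongrightarrow> y"
  proof -
    obtain v where v: "\<And>n. v n \<in> (\<lambda>x. fst x + snd x) ` A" "v \<longlonglongrightarrow> y"
      using y unfolding closure_sequential by blast
    then have "\<forall>n. \<exists>x. x \<in> A \<and> v n = fst x + snd x" by blast
    then obtain x where "\<And>n. x n \<in> A \<and> v n = fst (x n) + snd (x n)" by metis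
    moreover from this have "v = (\<lambda>n. fst (x n) + snd (x n))" by auto
    ultimately show ?thesis using v(2) by (intro that[of x]) auto
  qed
  have Cau: "Cauchy (\<lambda>n. fst (x n) + snd (x n))" using x(2) LIMSEQ_imp_Cauchy by blast
  have le: "norm (fst (x n) - fst (x m)) \<le> norm ((fst (x n) + snd (x n)) - (fst (x m) + snd (x m)))"
       "norm (snd (x n) - snd (x m)) \<le> norm ((fst (x n) + snd (x n)) - (fst (x m) + snd (x m)))" for n m
    using nnsa_norm_sum[OF A nnsa_diff[OF A, of "fst (x n)" "snd (x n)" "fst (x m)" "snd (x m)"]] x(1)
    by (simp_all add: algebra_simps)
  have "Cauchy (\<lambda>n. fst (x n))" "Cauchy (\<lambda>n. snd (x n))"
    using Cau unfolding Cauchy_iff by (meson le order_le_less_trans)+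
  then obtain f g where fg: "(\<lambda>n. fst (x n)) \<longlonglongrightarrow> f" "(\<lambda>n. snd (x n)) \<longlonglongrightarrow> g"
    by (auto simp: Cauchy_convergent_iff convergent_def)
  then have "x \<longlonglongrightarrow> (f, g)" using tendsto_Pair by fastforce
  then have fgA: "(f, g) \<in> A" using nnsa_closed[OF A] x(1) unfolding closed_sequential_limits by blast
  have yfg: "y = f + g" using LIMSEQ_unique[OF x(2) tendsto_add[OF fg]] .
  have "(w - y, - (w - y)) \<in> A"
  proof (rule nnsa_memI[OF A])
    fix f g assume "(f, g) \<in> A"
    then have "(w - y) \<bullet> (f + g) = 0" using orth by force
    thus "g \<bullet> (w - y) = f \<bullet> - (w - y)" by (simp add: inner_add_right inner_commute algebra_simps inner_diff)
  qed
  from nnsa_nonneg[OF A this] have "0 \<le> - ((w - y) \<bullet> (w - y))" by (simp only: inner_minus_left)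
  then have "(w - y) \<bullet> (w - y) \<le> 0" by linarith
  then have "w = y" by (metis inner_ge_zero inner_eq_zero_iff order_antisym right_minus_eq)
  then show ?thesis using fgA yfg by (intro exI[of _ f]) simp
qed

text \<open>P and Q are the square roots of C = (1 + A)^(-1) and 1 - C.\<close>

locale nnsa_rep =
  fixes A :: "('h::{real_inner,banach} \<times> 'h) set" and P Q :: "'h \<Rightarrow>\<^sub>L 'h"
  assumes saP: "hsa P" and saQ: "hsa Q" and PQ: "\<And>x. P (Q x) = Q (P x)"
    and sum1: "\<And>x. P (P x) + Q (Q x) = x" and injP: "\<And>x. P x = 0 \<Longrightarrow> x = 0"
    and pos: "\<And>x. x \<bullet> P (Q x) \<ge> 0"
    and A_eq: "A = {(P (P w), Q (Q w)) | w. True}"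
    and commutant: "\<And>V. bounded_linear V \<longrightarrow> (\<forall>x. V (P (P x)) = P (P (V x))) \<longrightarrow>
       (\<forall>x. V (P x) = P (V x) \<and> V (Q x) = Q (V x))"

text \<open>A is the set of pairs (C w, w - C w) with C = (1 + A)^(-1), and C and 1 - C are
  self-adjoint contractions, so \<open>blinfun_sqrt\<close> applies to both. The roots commute with
  each other because each commutes with all that commutes with C.\<close>

lemma nnsa_rep_ex:
  fixes A :: "('h::{real_inner,banach} \<times> 'h) set"
  assumes A: "nnsa A"
  shows "\<exists>P Q. nnsa_rep A P Q"
proof -
  obtain C0 where C0: "\<And>w. (C0 w, w - C0 w) \<in> A" using nnsa_resolvent_ex[OF A] by metis
  have C0u: "C0 (f + g) = f" if "(f, g) \<in> A" for f g
  proof -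
    have d: "(C0 (f + g) - f, (f + g - C0 (f + g)) - g) \<in> A" by (rule nnsa_diff[OF A C0 that])
    have "norm (C0 (f + g) - f) \<le> norm ((C0 (f + g) - f) + ((f + g - C0 (f + g)) - g))"
      using nnsa_norm_sum[OF A d] by blast
    thus ?thesis by simp
  qed
  have C0n: "norm (C0 w) \<le> norm w" "norm (w - C0 w) \<le> norm w" for w
    using nnsa_norm_sum[OF A C0[of w]] by simp_all
  have bl: "bounded_linear C0"
  proof (rule bounded_linear_intro[where K = 1])
    show "C0 (x + y) = C0 x + C0 y" for x y
      using C0u[OF nnsa_add[OF A C0[of x] C0[of y]]] by (simp add: algebra_simps)
    show "C0 (r *\<^sub>R x) = r *\<^sub>R C0 x" for r x
      using C0u[OF nnsa_scale[OF A C0[of x], of r]] by (simp add: algebra_simps)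
    show "norm (C0 x) \<le> norm x * 1" for x using C0n by simp
  qed
  define C where "C = Blinfun C0"
  have C: "C x = C0 x" for x unfolding C_def by (simp add: bounded_linear_Blinfun_apply bl)
  have nC: "norm C \<le> 1" "norm (id_blinfun - C) \<le> 1"
    by (auto intro!: norm_blinfun_bound simp: C C0n blinfun.diff_left)
  have saC: "hsa C"
  proof -
    have "C0 x \<bullet> y = x \<bullet> C0 y" for x y
      using nnsa_sym[OF A C0[of x] C0[of y]] by (simp add: inner_diff inner_commute algebra_simps)
    thus ?thesis by (simp add: hsa_def C)
  qed
  have saC': "hsa (id_blinfun - C)" using saC by (simp add: hsa_def blinfun.diff_left inner_diff)
  obtain P where P: "hsa P" "\<forall>x. P (P x) = x - (id_blinfun - C) x" "norm (id_blinfun - P) \<le> 1"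
    "\<forall>V. bounded_linear V \<longrightarrow> (\<forall>x. V ((id_blinfun - C) x) = (id_blinfun - C) (V x)) \<longrightarrow> (\<forall>x. V (P x) = P (V x))"
    "\<forall>x. x \<bullet> P x \<ge> 0"
    using blinfun_sqrt[OF nC(2) saC'] by blast
  obtain Q where Q: "hsa Q" "\<forall>x. Q (Q x) = x - C x" "norm (id_blinfun - Q) \<le> 1"
    "\<forall>V. bounded_linear V \<longrightarrow> (\<forall>x. V (C x) = C (V x)) \<longrightarrow> (\<forall>x. V (Q x) = Q (V x))"
    "\<forall>x. x \<bullet> Q x \<ge> 0"
    using blinfun_sqrt[OF nC(1) saC] by blast
  have PP: "P (P x) = C x" for x using P(2)[THEN spec, of x] by (simp add: blinfun.diff_left)
  have Pc: "V (P x) = P (V x)" if "bounded_linear V" "\<And>x. V (C x) = C (V x)" for V x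
    using P(4) that by (auto simp: blinfun.diff_left linear_simps[OF that(1)] that(2))
  have PC: "P (C x) = C (P x)" for x by (simp flip: PP)
  have PQ: "P (Q x) = Q (P x)" for x using Q(4) PC blinfun.bounded_linear_right by blast
  \<comment> \<open>From P x = 0 follows C x = 0, that is (0, x) in A, and A is
    single-valued.\<close>
  have Pinj: "x = 0" if "P x = 0" for x
  proof -
    have "C0 x = 0" using PP[of x] that by (simp add: C blinfun.zero_right)
    with C0[of x] A show ?thesis by (simp add: nnsa_def)
  qed
  have saP': "hsa (id_blinfun - P)" using P(1) by (simp add: hsa_def blinfun.diff_left inner_diff)
  \<comment> \<open>A root S of P that commutes with Q is what makes the product P Q nonnegative:
    its form at x is the form of Q at S x.\<close>
  obtain S where S: "hsa S" "\<forall>x. S (S x) = x - (id_blinfun - P) x"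
    "\<forall>V. bounded_linear V \<longrightarrow> (\<forall>x. V ((id_blinfun - P) x) = (id_blinfun - P) (V x)) \<longrightarrow> (\<forall>x. V (S x) = S (V x))"
    using blinfun_sqrt[OF P(3) saP'] by blast
  have SS: "S (S x) = P x" for x using S(2)[THEN spec, of x] by (simp add: blinfun.diff_left)
  have QS: "Q (S x) = S (Q x)" for x
    using S(3)[THEN spec, of "blinfun_apply Q"]
    by (simp add: blinfun.bounded_linear_right blinfun.diff_left blinfun.diff_right PQ)
  have pos: "x \<bullet> P (Q x) \<ge> 0" for x
  proof -
    have "x \<bullet> P (Q x) = S x \<bullet> S (Q x)" using S(1) unfolding hsa_def by (simp flip: SS)
    also have "\<dots> = S x \<bullet> Q (S x)" by (simp add: QS)
    finally show ?thesis using Q(5) by simp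
  qed
  have A_eq: "A = {(P (P w), Q (Q w)) | w. True}"
  proof (intro equalityI subsetI)
    fix x assume "x \<in> A"
    then have "(fst x, snd x) \<in> A" by simp
    from C0u[OF this] have "x = (P (P (fst x + snd x)), Q (Q (fst x + snd x)))"
      by (simp add: PP Q(2) C prod_eq_iff)
    thus "x \<in> {(P (P w), Q (Q w)) | w. True}" by blast
  qed (use C0 in \<open>auto simp: PP Q(2) C\<close>)
  have "nnsa_rep A P Q"
  proof (rule nnsa_rep.intro)
    show "P (P x) + Q (Q x) = x" for x by (simp add: PP Q(2))
    show "bounded_linear V \<longrightarrow> (\<forall>x. V (P (P x)) = P (P (V x))) \<longrightarrow>
       (\<forall>x. V (P x) = P (V x) \<and> V (Q x) = Q (V x))" for V
      using Pc Q(4) by (simp add: PP)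
  qed (fact P(1) Q(1) PQ Pinj pos A_eq)+
  then show ?thesis by blast
qed

text \<open>Cauchy-Schwarz for the semidefinite form of K: a vector of zero energy is orthogonal to
  everything in that form.\<close>

lemma nonneg_form_zero:
  fixes K :: "'h::real_inner \<Rightarrow> 'h"
  assumes K: "linear K" and sa: "\<And>x y. K x \<bullet> y = x \<bullet> K y" and pos: "\<And>x. x \<bullet> K x \<ge> 0"
    and z: "g \<bullet> K g = 0"
  shows "K g = 0"
proof -
  have "K g \<bullet> y = 0" for y
  proof (rule quadratic_nonneg_imp_zero[of "y \<bullet> K y"])
    fix t
    have "0 \<le> (g + t *\<^sub>R y) \<bullet> K (g + t *\<^sub>R y)" by (rule pos)
    also have "\<dots> = (y \<bullet> K y) * t\<^sup>2 + 2 * t * (K g \<bullet> y)"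
      using z sa[of y g] by (simp add: linear_add[OF K] linear_cmul[OF K] inner_add sa power2_eq_square inner_commute algebra_simps)
    finally show "0 \<le> (y \<bullet> K y) * t\<^sup>2 + 2 * t * (K g \<bullet> y)" .
  qed (rule pos)
  from this[of "K g"] show ?thesis by simp
qed

context nnsa_rep
begin

text \<open>Formally Q P^(-1), whose square is (1 - C) C^(-1) = A. The parameter w avoids the
  unbounded inverse of P.\<close>

definition root :: "('h \<times> 'h) set" where "root = {(P w, Q w) | w. True}"

lemma P_move: "P x \<bullet> y = x \<bullet> P y" using saP by (simp add: hsa_def)
lemma Q_move: "Q x \<bullet> y = x \<bullet> Q y" using saQ by (simp add: hsa_def)

text \<open>The parameter is w = P h + Q k, and P^2 + Q^2 = 1 gives h and k back. So
  \<open>root\<close> is the set of solutions of Q h = P k, from which its self-adjointness is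
  visible.\<close>

lemma root_memI: assumes "Q h = P k" shows "(h, k) \<in> root"
proof -
  let ?w = "P h + Q k"
  have "P ?w = P (P h) + Q (P k)" by (simp add: blinfun.add_right PQ)
  also have "\<dots> = h" using sum1[of h] by (simp flip: assms)
  finally have 1: "P ?w = h" .
  have "Q ?w = P (Q h) + Q (Q k)" by (simp add: blinfun.add_right PQ)
  also have "\<dots> = k" using sum1[of k] by (simp add: assms)
  finally have "Q ?w = k" .
  with 1 have "(h, k) = (P ?w, Q ?w)" by simp
  then show ?thesis unfolding root_def by blast
qed

lemma nnsa_root: "nnsa root"
  unfolding nnsa_def
proof (intro conjI allI impI)
  show "hadj root = root"
  proof (intro equalityI subsetI)
    fix x assume "x \<in> hadj root"
    then have *: "Q w \<bullet> fst x = P w \<bullet> snd x" for w unfolding hadj_def root_def by fastforce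
    have "w \<bullet> (Q (fst x) - P (snd x)) = 0" for w
      using *[of w] by (simp add: inner_diff_right P_move Q_move)
    from this[of "Q (fst x) - P (snd x)"] have "Q (fst x) = P (snd x)" by simp
    from root_memI[OF this] show "x \<in> root" by simp
  next
    fix x assume "x \<in> root"
    then show "x \<in> hadj root" unfolding hadj_def root_def
      by (auto simp: P_move Q_move PQ)
  qed
  show "g = 0" if "(0, g) \<in> root" for g
  proof -
    from that obtain w where "P w = 0" "g = Q w" unfolding root_def by auto
    with injP[of w] show ?thesis by (simp add: blinfun.zero_right)
  qed
  show "\<forall>(f, g)\<in>root. 0 \<le> g \<bullet> f"
    unfolding root_def using pos by (auto simp: Q_move PQ)
qed

lemma root_root: "root O root = A"
proof (intro equalityI subsetI)
  fix x assume "x \<in> root O root"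
  then obtain f g where fg: "x = (P f, Q g)" "Q f = P g" unfolding root_def by auto
  let ?w = "P f + Q g"
  have "P ?w = P (P f) + Q (P g)" by (simp add: blinfun.add_right PQ)
  also have "\<dots> = f" using sum1[of f] by (simp flip: fg(2))
  finally have 1: "P ?w = f" .
  have "Q ?w = P (Q f) + Q (Q g)" by (simp add: blinfun.add_right PQ)
  also have "\<dots> = g" using sum1[of g] by (simp add: fg(2))
  finally have "Q ?w = g" .
  with 1 have "x = (P (P ?w), Q (Q ?w))" using fg(1) by simp
  thus "x \<in> A" unfolding A_eq by blast
next
  fix x assume "x \<in> A"
  then obtain w where w: "x = (P (P w), Q (Q w))" unfolding A_eq by blast
  have "(P (P w), Q (P w)) \<in> root" "(P (Q w), Q (Q w)) \<in> root" unfolding root_def by blast+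
  then show "x \<in> root O root" unfolding w using PQ[of w] by auto
qed

text \<open>For another root R the operator K = R C is everywhere defined, bounded, nonnegative and
  commutes with C, and K^2 = (P Q)^2. As for bounded operators this forces K = P Q, whence
  \<open>root\<close> is contained in R. Of two self-adjoint graphs one inside the other, both are
  equal.\<close>

lemma root_unique:
  assumes R: "nnsa R" and RR: "R O R = A"
  shows "R = root"
proof -
  have "\<exists>g. (P (P w), g) \<in> R \<and> (g, Q (Q w)) \<in> R" for w
  proof -
    have "(P (P w), Q (Q w)) \<in> R O R" unfolding RR A_eq by blast
    thus ?thesis by auto
  qed
  then obtain K where K: "\<And>w. (P (P w), K w) \<in> R" "\<And>w. (K w, Q (Q w)) \<in> R" by metis
  have Ku: "K w = g" if "(P (P w), g) \<in> R" for w g using nnsa_unique[OF R K(1) that] .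
  have Kadd: "K (x + y) = K x + K y" for x y
    by (rule Ku) (use nnsa_add[OF R K(1)[of x] K(1)[of y]] in \<open>simp add: blinfun.add_right\<close>)
  have Ksc: "K (c *\<^sub>R x) = c *\<^sub>R K x" for c x
    by (rule Ku) (use nnsa_scale[OF R K(1)[of x], of c] in \<open>simp add: blinfun.scaleR_right\<close>)
  have Klin: "linear K" by (simp add: linear_iff Kadd Ksc)
  have Ksa: "K x \<bullet> y = x \<bullet> K y" for x y
  proof -
    have "K x \<bullet> y = K x \<bullet> P (P y) + K x \<bullet> Q (Q y)" by (simp flip: inner_add_right add: sum1)
    also have "K x \<bullet> P (P y) = P (P x) \<bullet> K y" by (rule nnsa_sym[OF R K(1) K(1)])
    also have "K x \<bullet> Q (Q y) = Q (Q x) \<bullet> K y" by (rule nnsa_sym[OF R K(2) K(2), symmetric])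
    finally show ?thesis by (simp flip: inner_add_left add: sum1)
  qed
  have Kpos: "x \<bullet> K x \<ge> 0" for x
  proof -
    have "x \<bullet> K x = P (P x) \<bullet> K x + Q (Q x) \<bullet> K x" by (simp flip: inner_add_left add: sum1)
    moreover have "0 \<le> K x \<bullet> P (P x)" "0 \<le> Q (Q x) \<bullet> K x"
      by (rule nnsa_nonneg[OF R K(1)], rule nnsa_nonneg[OF R K(2)])
    ultimately show ?thesis by (simp add: inner_commute)
  qed
  \<comment> \<open>R commutes with C: subtracting (C g, K g) from (g, h) leaves (Q Q g, h - K g) in
    R, and composing with (K g, Q Q g) puts (K g, h - K g) into A, that is K g = C h.\<close>
  have Rcomm: "(P (P g), P (P h)) \<in> R" "P (P h) = K g" if "(g, h) \<in> R" for g h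
  proof -
    have "(g - P (P g), h - K g) \<in> R" by (rule nnsa_diff[OF R that K(1)])
    moreover have "g - P (P g) = Q (Q g)" using sum1[of g] by (simp add: algebra_simps)
    ultimately have "(K g, h - K g) \<in> R O R" using K(2)[of g] by auto
    then obtain w where w: "K g = P (P w)" "h - K g = Q (Q w)" unfolding RR A_eq by auto
    then have "h = P (P w) + Q (Q w)" by (simp add: algebra_simps)
    then show "P (P h) = K g" using sum1[of w] w(1) by simp
    with K(1)[of g] show "(P (P g), P (P h)) \<in> R" by simp
  qed
  have KC: "K (P (P x)) = P (P (K x))" for x using Rcomm(1)[OF K(1)[of x]] by (rule Ku)
  have KK: "K (K x) = P (P (Q (Q x)))" for x using Rcomm(1)[OF K(2)[of x]] by (rule Ku)
  have Kbl: "bounded_linear K"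
  proof (rule bounded_linear_intro[where K = "norm ((Q o\<^sub>L Q) o\<^sub>L (P o\<^sub>L P)) + 1"])
    fix x
    let ?B = "(Q o\<^sub>L Q) o\<^sub>L (P o\<^sub>L P)"
    have "(norm (K x))\<^sup>2 = x \<bullet> K (K x)" by (simp add: power2_norm_eq_inner Ksa)
    also have "\<dots> = x \<bullet> ?B x" by (simp add: KK PQ)
    also have "\<dots> \<le> norm x * norm (?B x)" by (rule norm_cauchy_schwarz)
    also have "\<dots> \<le> norm x * (norm ?B * norm x)" by (intro mult_left_mono norm_blinfun) auto
    also have "\<dots> \<le> (norm x * (norm ?B + 1))\<^sup>2"
    proof -
      have "norm ?B \<le> (norm ?B + 1)\<^sup>2" by (simp add: power2_sum)
      from mult_left_mono[OF this, of "(norm x)\<^sup>2"] show ?thesis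
        by (simp add: power2_eq_square algebra_simps)
    qed
    finally show "norm (K x) \<le> norm x * (norm ?B + 1)" by (rule power2_le_imp_le) simp
  qed (simp_all add: Kadd Ksc)
  have KP: "K (P x) = P (K x)" and KQ: "K (Q x) = Q (K x)" for x
    using commutant[of K] Kbl KC by auto
  have K_eq: "K x = P (Q x)" for x
  proof -
    \<comment> \<open>By K^2 = (P Q)^2 this g is annihilated by K + P Q. Both forms are nonnegative,
      so both vanish at g, and then K g = P Q g = 0 gives g orthogonal to itself.\<close>
    define g where "g = K x - P (Q x)"
    have e: "K g + P (Q g) = 0"
      unfolding g_def
      by (simp add: linear_diff[OF Klin] blinfun.diff_right KK KP KQ) (simp add: PQ)
    have "g \<bullet> K g + g \<bullet> P (Q g) = 0" using e by (simp flip: inner_add_right)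
    with Kpos[of g] pos[of g] have z: "g \<bullet> K g = 0" "g \<bullet> P (Q g) = 0" by linarith+
    have "K g = 0" by (rule nonneg_form_zero[OF Klin Ksa Kpos z(1)])
    with e have "P (Q g) = 0" by simp
    have "g \<bullet> g = K x \<bullet> g - P (Q x) \<bullet> g" unfolding g_def by (simp only: inner_diff_left)
    also have "\<dots> = x \<bullet> K g - x \<bullet> P (Q g)" by (simp add: Ksa P_move Q_move PQ)
    finally have "g = 0" using \<open>K g = 0\<close> \<open>P (Q g) = 0\<close> by simp
    then show ?thesis by (simp add: g_def)
  qed
  have sub: "root \<subseteq> R"
  proof
    fix x assume "x \<in> root"
    then obtain w where x: "x = (P w, Q w)" unfolding root_def by blast
    have "(P w, Q w) \<in> R"
    proof (rule nnsa_memI[OF R])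
      fix f g assume fg: "(f, g) \<in> R"
      have "v \<bullet> P (P g - Q f) = 0" for v
      proof -
        have "g \<bullet> P (P v) = f \<bullet> P (Q v)" using nnsa_sym[OF R fg K(1)[of v]] by (simp add: K_eq)
        moreover have "v \<bullet> P (P g) = P (P v) \<bullet> g" by (simp add: P_move)
        moreover have "v \<bullet> P (Q f) = P (Q v) \<bullet> f" by (simp add: P_move Q_move PQ)
        ultimately show ?thesis by (simp add: blinfun.diff_right inner_diff_right inner_commute)
      qed
      from this[of "P (P g - Q f)"] have "P (P g - Q f) = 0" by simp
      from injP[OF this] have "P g = Q f" by simp
      thus "g \<bullet> P w = f \<bullet> Q w" using P_move[of g w] Q_move[of f w] by simp
    qed
    thus "x \<in> R" using x by simp
  qed
  moreover have "R \<subseteq> root"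
  proof
    fix x assume x: "x \<in> R"
    have "(fst x, snd x) \<in> root"
      by (rule nnsa_memI[OF nnsa_root]) (use sub x nnsa_sym[OF R] in auto)
    thus "x \<in> root" by simp
  qed
  ultimately show ?thesis by blast
qed

lemma root_commute:
  assumes V: "bounded_linear V" and VA: "\<And>f g. (f, g) \<in> A \<Longrightarrow> (V f, V g) \<in> A"
    and fg: "(f, g) \<in> root"
  shows "(V f, V g) \<in> root"
proof -
  have "V (P (P x)) = P (P (V x))" for x
  proof -
    have "(V (P (P x)), V (Q (Q x))) \<in> A" by (rule VA) (auto simp: A_eq)
    then obtain w where w: "V (P (P x)) = P (P w)" "V (Q (Q x)) = Q (Q w)" unfolding A_eq by auto
    have "V x = V (P (P x)) + V (Q (Q x))" by (simp flip: linear_simps(1)[OF V] add: sum1)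
    also have "\<dots> = w" using w sum1[of w] by simp
    finally show ?thesis using w(1) by simp
  qed
  from commutant[of V] V this fg show ?thesis unfolding root_def by auto
qed

lemma P_dense: "x \<in> closure (range P)"
proof -
  have "subspace (range P)"
    by (rule linear_subspace_image) (auto simp: bounded_linear.linear blinfun.bounded_linear_right)
  from orthogonal_projection_closure[OF this, of x] obtain y where
    y: "y \<in> closure (range P)" "\<And>w. (x - y) \<bullet> P w = 0" by blast
  have "P (x - y) = 0" using y(2)[of "P (x - y)"] P_move[of "x - y" "P (x - y)"] by simp
  from injP[OF this] y(1) show ?thesis by simp
qed

text \<open>Membership in the domain of the root, and the size of the value there, are read off from
  A alone: scaling (g, k) in the hypothesis bounds the functional sending w to the inner product of
  f with Q Q w by M |P Q w|, and the vector y representing it is the value of the root at f.\<close>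

lemma root_memI_bounded:
  assumes M: "M \<ge> 0" and bd: "\<And>g k. (g, k) \<in> A \<Longrightarrow> 2 * (f \<bullet> k) - k \<bullet> g \<le> M\<^sup>2"
  shows "\<exists>y. (f, y) \<in> root \<and> norm y \<le> M"
proof -
  have Lb: "\<bar>f \<bullet> Q (Q w)\<bar> \<le> M * norm (P (Q w))" for w
  proof (rule quadratic_upper_bound[OF _ M])
    fix t
    have "(P (P (t *\<^sub>R w)), Q (Q (t *\<^sub>R w))) \<in> A" unfolding A_eq by blast
    from bd[OF this] have "2 * (t * (f \<bullet> Q (Q w))) - t * (t * (Q (Q w) \<bullet> P (P w))) \<le> M\<^sup>2"
      by (simp add: blinfun.scaleR_right)
    moreover have "Q (Q w) \<bullet> P (P w) = (norm (P (Q w)))\<^sup>2"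
      by (simp add: power2_norm_eq_inner P_move Q_move PQ)
    ultimately show "2 * t * (f \<bullet> Q (Q w)) - t\<^sup>2 * (norm (P (Q w)))\<^sup>2 \<le> M\<^sup>2"
      by (simp add: power2_eq_square)
  qed simp
  have "\<exists>y\<in>closure ((\<lambda>w. P (Q w)) ` UNIV). \<forall>w\<in>UNIV. f \<bullet> Q (Q w) = y \<bullet> P (Q w)"
    by (rule riesz_representation[where M = M])
      (auto simp: linear_iff blinfun.add_right blinfun.scaleR_right inner_add_right Lb)
  then obtain y where y: "y \<in> closure (range (\<lambda>w. P (Q w)))" "\<And>w. f \<bullet> Q (Q w) = y \<bullet> P (Q w)" by blast
  \<comment> \<open>The representation yields only Q z = 0, which does not give z = 0 when A has a
    kernel. That y lies in the closure of the range of P Q makes z orthogonal to P y as well, and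
    then z = 0.\<close>
  define z where "z = Q f - P y"
  have "w \<bullet> Q z = 0" for w
  proof -
    have "w \<bullet> Q (Q f) = Q (Q w) \<bullet> f" by (simp add: Q_move)
    moreover have "w \<bullet> Q (P y) = P (Q w) \<bullet> y" by (simp add: P_move Q_move PQ)
    ultimately show ?thesis
      using y(2)[of w] by (simp add: z_def blinfun.diff_right inner_diff_right inner_commute)
  qed
  from this[of "Q z"] have Qz: "Q z = 0" by simp
  have "range (\<lambda>w. P (Q w)) \<subseteq> {x. P z \<bullet> x = 0}"
  proof -
    have "P z \<bullet> P (Q w) = P (P (Q z)) \<bullet> w" for w by (simp add: P_move Q_move PQ)
    then show ?thesis using Qz by (auto simp: blinfun.zero_right)
  qed
  moreover have "closed {x. P z \<bullet> x = 0}" by (intro closed_Collect_eq continuous_intros)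
  ultimately have "P z \<bullet> y = 0" using y(1) closure_minimal by blast
  then have "z \<bullet> P y = 0" by (simp add: P_move)
  moreover have "z \<bullet> Q f = 0" using Qz by (simp flip: Q_move)
  ultimately have "z \<bullet> z = 0" by (simp add: z_def inner_diff_right)
  then have "Q f = P y" by (simp add: z_def)
  then have mem: "(f, y) \<in> root" by (rule root_memI)
  have "range (\<lambda>w. P (Q w)) \<subseteq> {x. y \<bullet> x \<le> M * norm x}" using Lb y(2) by (auto simp: abs_le_iff)
  moreover have "closed {x. y \<bullet> x \<le> M * norm x}" by (intro closed_Collect_le continuous_intros)
  ultimately have "y \<bullet> y \<le> M * norm y" using y(1) closure_minimal by blast
  then have "norm y * norm y \<le> M * norm y" by (simp add: power2_norm_eq_inner[symmetric] power2_eq_square)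
  then have "norm y \<le> M" using M by (cases "y = 0") auto
  with mem show ?thesis by blast
qed

end

text \<open>To be applied to multiplication by i and to the projection onto functions supported in
  (a,b): the root inherits both symmetries of the lifted operator.\<close>

lemma nnsa_sqrt_commute:
  fixes A :: "('h::{real_inner,banach} \<times> 'h) set"
  assumes A: "nnsa A" and R: "nnsa R" "R O R = A"
    and V: "bounded_linear V" "\<And>f g. (f, g) \<in> A \<Longrightarrow> (V f, V g) \<in> A" and fg: "(f, g) \<in> R"
  shows "(V f, V g) \<in> R"
proof -
  obtain P Q where "nnsa_rep A P Q" using nnsa_rep_ex[OF A] by blast
  then interpret nnsa_rep A P Q .
  show ?thesis using root_commute[OF V] fg root_unique[OF R] by simp
qed

lemma nnsa_sqrt_ex1:
  fixes A :: "('h::{real_inner,banach} \<times> 'h) set"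
  assumes A: "nnsa A"
  shows "\<exists>!R. nnsa R \<and> R O R = A"
proof -
  obtain P Q where "nnsa_rep A P Q" using nnsa_rep_ex[OF A] by blast
  then interpret nnsa_rep A P Q .
  show ?thesis using nnsa_root root_root root_unique by blast
qed

text \<open>Completing the square: with y1 and y' the values of the root of A1 at f and g, the
  expression 2 (f, k') - (k', g) equals |y1|^2 - |y1 - y'|^2. In the other direction, boundedness of
  its values over A1 puts f into the domain of the root by \<open>root_memI_bounded\<close>.\<close>

lemma nnsa_sqrt_le_iff:
  fixes A1 A2 :: "('h::{real_inner,banach} \<times> 'h) set"
  assumes A1: "nnsa A1" and A2: "nnsa A2"
    and R1: "nnsa R1" "R1 O R1 = A1" and R2: "nnsa R2" "R2 O R2 = A2"
  shows "(Domain R2 \<subseteq> Domain R1 \<and> (\<forall>f g g'. (f, g) \<in> R2 \<longrightarrow> (f, g') \<in> R1 \<longrightarrow> norm g' \<le> norm g))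
     \<longleftrightarrow> (\<forall>(f, k)\<in>A2. \<forall>(g, k')\<in>A1. 2 * (f \<bullet> k') - k' \<bullet> g \<le> k \<bullet> f)" (is "?L \<longleftrightarrow> ?R")
proof
  assume L: ?L
  show ?R
  proof (clarify)
    fix f k g k' assume "(f, k) \<in> A2" "(g, k') \<in> A1"
    then obtain y2 y' where y2: "(f, y2) \<in> R2" "(y2, k) \<in> R2" and y': "(g, y') \<in> R1" "(y', k') \<in> R1"
      unfolding R1(2)[symmetric] R2(2)[symmetric] by blast
    from L y2(1) obtain y1 where y1: "(f, y1) \<in> R1" by blast
    have "norm y1 \<le> norm y2" using L y1 y2(1) by blast
    then have le: "y1 \<bullet> y1 \<le> y2 \<bullet> y2"
      by (metis norm_ge_zero power2_norm_eq_inner power_mono)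
    have "k \<bullet> f = y2 \<bullet> y2" by (rule nnsa_sym[OF R2(1) y2(2,1)])
    moreover have "k' \<bullet> g = y' \<bullet> y'" by (rule nnsa_sym[OF R1(1) y'(2,1)])
    moreover have "k' \<bullet> f = y' \<bullet> y1" by (rule nnsa_sym[OF R1(1) y'(2) y1])
    moreover have "0 \<le> (y1 - y') \<bullet> (y1 - y')" by simp
    ultimately show "2 * (f \<bullet> k') - k' \<bullet> g \<le> k \<bullet> f"
      using le by (simp add: inner_diff inner_commute algebra_simps)
  qed
next
  assume R: ?R
  obtain P1 Q1 where "nnsa_rep A1 P1 Q1" using nnsa_rep_ex[OF A1] by blast
  then interpret I1: nnsa_rep A1 P1 Q1 .
  obtain P2 Q2 where "nnsa_rep A2 P2 Q2" using nnsa_rep_ex[OF A2] by blast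
  then interpret I2: nnsa_rep A2 P2 Q2 .
  have R1e: "R1 = I1.root" by (rule I1.root_unique[OF R1])
  have R2e: "R2 = I2.root" by (rule I2.root_unique[OF R2])
  have main: "\<exists>y. (f, y) \<in> R1 \<and> norm y \<le> norm y2" if f: "(f, y2) \<in> R2" for f y2
    unfolding R1e
  proof (rule I1.root_memI_bounded)
    fix g k assume gk: "(g, k) \<in> A1"
    from f obtain w where w: "f = P2 w" "y2 = Q2 w" unfolding R2e I2.root_def by blast
    \<comment> \<open>The inequality is given for f = P2 (P2 v), in the domain of A2. Written in the
      parameter w both sides are continuous, and the range of P2 is dense, so it extends to the
      whole form domain.\<close>
    let ?S = "{x. 2 * (P2 x \<bullet> k) - k \<bullet> g \<le> (norm (Q2 x))\<^sup>2}"
    have "range P2 \<subseteq> ?S"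
    proof clarify
      fix v
      have "(P2 (P2 v), Q2 (Q2 v)) \<in> A2" unfolding I2.A_eq by blast
      with R gk have "2 * (P2 (P2 v) \<bullet> k) - k \<bullet> g \<le> Q2 (Q2 v) \<bullet> P2 (P2 v)" by fastforce
      also have "\<dots> = (norm (Q2 (P2 v)))\<^sup>2"
        by (simp add: power2_norm_eq_inner I2.P_move I2.Q_move I2.PQ)
      finally show "2 * (P2 (P2 v) \<bullet> k) - k \<bullet> g \<le> (norm (Q2 (P2 v)))\<^sup>2" .
    qed
    moreover have "closed ?S" by (intro closed_Collect_le continuous_intros)
    ultimately have "w \<in> ?S" using I2.P_dense closure_minimal by blast
    then show "2 * (f \<bullet> k) - k \<bullet> g \<le> (norm y2)\<^sup>2" using w by simp
  qed simp
  show ?L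
  proof (intro conjI allI impI)
    show "Domain R2 \<subseteq> Domain R1" using main by blast
    show "norm g' \<le> norm g" if "(f, g) \<in> R2" "(f, g') \<in> R1" for f g g'
      using main[OF that(1)] nnsa_unique[OF R1(1) that(2)] by metis
  qed
qed

section \<open>The Hilbert space of square integrable functions on the line\<close>

lemma borel_measurable_cnj[measurable]: "cnj \<in> borel_measurable borel"
  by (intro borel_measurable_continuous_onI continuous_intros)

definition sqint :: "(real \<Rightarrow> complex) \<Rightarrow> bool" where
  "sqint f \<longleftrightarrow> f \<in> borel_measurable lborel \<and> integrable lborel (\<lambda>x. (cmod (f x))\<^sup>2)"

lemma sqint_measurable[measurable_dest]: "sqint f \<Longrightarrow> f \<in> borel_measurable lborel"
  by (simp add: sqint_def)

lemma sqint_bound: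
  assumes "sqint f" "g \<in> borel_measurable lborel" "\<And>x. cmod (g x) \<le> c * cmod (f x)"
  shows "sqint g"
  unfolding sqint_def
proof (intro conjI assms)
  have "integrable lborel (\<lambda>x. c\<^sup>2 * (cmod (f x))\<^sup>2)" using assms(1) by (simp add: sqint_def)
  then show "integrable lborel (\<lambda>x. (cmod (g x))\<^sup>2)"
  proof (rule Bochner_Integration.integrable_bound)
    show "AE x in lborel. norm ((cmod (g x))\<^sup>2) \<le> norm (c\<^sup>2 * (cmod (f x))\<^sup>2)"
    proof (rule AE_I2)
      fix x
      have "(cmod (g x))\<^sup>2 \<le> (c * cmod (f x))\<^sup>2" using assms(3)[of x] by (intro power_mono) auto
      thus "norm ((cmod (g x))\<^sup>2) \<le> norm (c\<^sup>2 * (cmod (f x))\<^sup>2)" by (simp add: power_mult_distrib)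
    qed
  qed (use assms(2) in measurable)
qed

lemma sqint_zero: "sqint (\<lambda>_. 0)" by (simp add: sqint_def)

lemma sqint_add:
  assumes "sqint f" "sqint g" shows "sqint (\<lambda>x. f x + g x)"
  unfolding sqint_def
proof
  note [measurable] = assms[THEN sqint_measurable]
  show "(\<lambda>x. f x + g x) \<in> borel_measurable lborel" by measurable
  have "integrable lborel (\<lambda>x. 2 * (cmod (f x))\<^sup>2 + 2 * (cmod (g x))\<^sup>2)"
    using assms by (simp add: sqint_def)
  then show "integrable lborel (\<lambda>x. (cmod (f x + g x))\<^sup>2)"
  proof (rule Bochner_Integration.integrable_bound)
    show "AE x in lborel. norm ((cmod (f x + g x))\<^sup>2) \<le> norm (2 * (cmod (f x))\<^sup>2 + 2 * (cmod (g x))\<^sup>2)"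
    proof (rule AE_I2)
      fix x
      have "(cmod (f x + g x))\<^sup>2 \<le> (cmod (f x) + cmod (g x))\<^sup>2"
        by (intro power_mono norm_triangle_ineq) auto
      also have "\<dots> \<le> 2 * (cmod (f x))\<^sup>2 + 2 * (cmod (g x))\<^sup>2"
        using zero_le_power2[of "cmod (f x) - cmod (g x)"] by (simp add: power2_sum power2_diff)
      finally show "norm ((cmod (f x + g x))\<^sup>2) \<le> norm (2 * (cmod (f x))\<^sup>2 + 2 * (cmod (g x))\<^sup>2)" by simp
    qed
  qed measurable
qed

lemma sqint_mult:
  assumes "sqint f" shows "sqint (\<lambda>x. c * f x)"
proof -
  note [measurable] = assms[THEN sqint_measurable]
  show ?thesis by (rule sqint_bound[OF assms, where c = "cmod c"]) (auto simp: norm_mult)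
qed

lemma sqint_diff:
  assumes "sqint f" "sqint g" shows "sqint (\<lambda>x. f x - g x)"
  using sqint_add[OF assms(1) sqint_mult[OF assms(2), of "-1"]] by simp

lemma sqint_scaleR: "sqint f \<Longrightarrow> sqint (\<lambda>x. c *\<^sub>R f x)"
  using sqint_mult[of f "complex_of_real c"] by (simp add: scaleR_conv_of_real)

lemma sqint_integrable_prod:
  assumes "sqint f" "sqint g" shows "integrable lborel (\<lambda>x. f x * cnj (g x))"
proof -
  note [measurable] = assms[THEN sqint_measurable]
  have "integrable lborel (\<lambda>x. (cmod (f x))\<^sup>2 + (cmod (g x))\<^sup>2)"
    using assms by (simp add: sqint_def)
  then show ?thesis
  proof (rule Bochner_Integration.integrable_bound)
    show "AE x in lborel. norm (f x * cnj (g x)) \<le> norm ((cmod (f x))\<^sup>2 + (cmod (g x))\<^sup>2)"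
    proof (rule AE_I2)
      fix x
      have "0 \<le> (cmod (f x) - cmod (g x))\<^sup>2" "0 \<le> cmod (f x) * cmod (g x)" by simp_all
      then have "cmod (f x) * cmod (g x) \<le> (cmod (f x))\<^sup>2 + (cmod (g x))\<^sup>2"
        unfolding power2_diff by linarith
      thus "norm (f x * cnj (g x)) \<le> norm ((cmod (f x))\<^sup>2 + (cmod (g x))\<^sup>2)"
        by (simp add: norm_mult)
    qed
  qed measurable
qed

definition l2rel :: "(real \<Rightarrow> complex) \<Rightarrow> (real \<Rightarrow> complex) \<Rightarrow> bool" where
  "l2rel f g \<longleftrightarrow> sqint f \<and> sqint g \<and> (AE x in lborel. f x = g x)"

\<comment> \<open>One Hilbert space for all problems S, with Lebesgue measure and no weight. The
  functions are complex but the scalars real, as the theory of square roots above asks for.\<close>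
quotient_type l2 = "real \<Rightarrow> complex" / partial: l2rel
proof (rule part_equivpI)
  show "\<exists>x. l2rel x x" by (rule exI[of _ "\<lambda>_. 0"]) (simp add: l2rel_def sqint_zero)
  show "symp l2rel" by (rule sympI) (auto simp: l2rel_def elim: eventually_mono)
  show "transp l2rel" by (rule transpI) (auto simp: l2rel_def elim: eventually_elim2)
qed

instantiation l2 :: real_inner
begin

lift_definition zero_l2 :: l2 is "\<lambda>_. 0" by (simp add: l2rel_def sqint_zero)
lift_definition plus_l2 :: "l2 \<Rightarrow> l2 \<Rightarrow> l2" is "\<lambda>f g x. f x + g x"
  by (auto simp: l2rel_def intro!: sqint_add elim: eventually_elim2)
lift_definition minus_l2 :: "l2 \<Rightarrow> l2 \<Rightarrow> l2" is "\<lambda>f g x. f x - g x"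
  by (auto simp: l2rel_def intro!: sqint_diff elim: eventually_elim2)
lift_definition uminus_l2 :: "l2 \<Rightarrow> l2" is "\<lambda>f x. - f x"
  using sqint_mult[of _ "-1"] by (auto simp: l2rel_def elim: eventually_mono)
lift_definition scaleR_l2 :: "real \<Rightarrow> l2 \<Rightarrow> l2" is "\<lambda>c f x. c *\<^sub>R f x"
  by (auto simp: l2rel_def intro!: sqint_scaleR elim: eventually_mono)
lift_definition inner_l2 :: "l2 \<Rightarrow> l2 \<Rightarrow> real" is "\<lambda>f g. LINT x|lborel. Re (f x * cnj (g x))"
  unfolding l2rel_def
proof (elim conjE)
  fix f f' g g' assume "sqint f" "sqint f'" "sqint g" "sqint g'"
    and AE: "AE x in lborel. f x = f' x" "AE x in lborel. g x = g' x"
  then have [measurable]: "f \<in> borel_measurable lborel" "f' \<in> borel_measurable lborel"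
    "g \<in> borel_measurable lborel" "g' \<in> borel_measurable lborel" by (simp_all add: sqint_def)
  show "(LINT x|lborel. Re (f x * cnj (g x))) = (LINT x|lborel. Re (f' x * cnj (g' x)))"
    by (rule integral_cong_AE) (measurable, use AE in \<open>auto elim: eventually_elim2\<close>)
qed

definition norm_l2 :: "l2 \<Rightarrow> real" where "norm_l2 x = sqrt (inner x x)"
definition sgn_l2 :: "l2 \<Rightarrow> l2" where "sgn_l2 x = inverse (norm x) *\<^sub>R x"
definition dist_l2 :: "l2 \<Rightarrow> l2 \<Rightarrow> real" where "dist_l2 x y = norm (x - y)"
definition uniformity_l2 :: "(l2 \<times> l2) filter" where
  "uniformity_l2 = (INF e\<in>{0<..}. principal {(x, y). dist x y < e})"
definition open_l2 :: "l2 set \<Rightarrow> bool" where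
  "open_l2 U = (\<forall>x\<in>U. \<forall>\<^sub>F (x', y) in uniformity. x' = x \<longrightarrow> y \<in> U)"

instance
proof
  fix x y z :: l2 and a b :: real
  show "x + y + z = x + (y + z)" by transfer (auto simp: l2rel_def algebra_simps intro!: sqint_add)
  show "x + y = y + x" by transfer (auto simp: l2rel_def algebra_simps intro!: sqint_add)
  show "0 + x = x" by transfer (auto simp: l2rel_def)
  show "- x + x = 0" by transfer (auto simp: l2rel_def sqint_zero)
  show "x - y = x + - y" by transfer (auto simp: l2rel_def intro!: sqint_diff)
  show "a *\<^sub>R (x + y) = a *\<^sub>R x + a *\<^sub>R y"
    by transfer (auto simp: l2rel_def scaleR_add_right intro!: sqint_add sqint_scaleR)
  show "(a + b) *\<^sub>R x = a *\<^sub>R x + b *\<^sub>R x"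
    by transfer (auto simp: l2rel_def scaleR_add_left intro!: sqint_add sqint_scaleR)
  show "a *\<^sub>R b *\<^sub>R x = (a * b) *\<^sub>R x" by transfer (auto simp: l2rel_def intro!: sqint_scaleR)
  show "1 *\<^sub>R x = x" by transfer (auto simp: l2rel_def)
  show "sgn x = inverse (norm x) *\<^sub>R x" by (rule sgn_l2_def)
  show "dist x y = norm (x - y)" by (rule dist_l2_def)
  show "(uniformity :: (l2 \<times> l2) filter) = (INF e\<in>{0<..}. principal {(x, y). dist x y < e})"
    by (rule uniformity_l2_def)
  show "open U = (\<forall>x\<in>U. \<forall>\<^sub>F (x', y) in uniformity. x' = x \<longrightarrow> y \<in> U)" for U :: "l2 set"
    by (rule open_l2_def)
  show "inner x y = inner y x" by transfer (simp add: mult.commute)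
  show "inner (x + y) z = inner x z + inner y z"
  proof transfer
    fix x y z assume "l2rel x x" "l2rel y y" "l2rel z z"
    then have "integrable lborel (\<lambda>t. Re (x t * cnj (z t)))" "integrable lborel (\<lambda>t. Re (y t * cnj (z t)))"
      unfolding l2rel_def using integrable_Re[OF sqint_integrable_prod] by metis+
    then show "(LINT t|lborel. Re ((x t + y t) * cnj (z t))) =
       (LINT t|lborel. Re (x t * cnj (z t))) + (LINT t|lborel. Re (y t * cnj (z t)))"
      by (simp add: distrib_right flip: Bochner_Integration.integral_add)
  qed
  show "inner (a *\<^sub>R x) y = a * inner x y" by transfer (simp add: mult.assoc flip: right_diff_distrib)
  show "0 \<le> inner x x"
    by transfer (auto intro!: integral_nonneg_AE simp: complex_mult_cnj)
  show "(inner x x = 0) = (x = 0)"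
  proof transfer
    fix x assume "l2rel x x"
    then have x: "sqint x" by (simp add: l2rel_def)
    have e: "Re (x t * cnj (x t)) = (cmod (x t))\<^sup>2" for t by (simp add: complex_mult_cnj cmod_power2)
    show "((LINT t|lborel. Re (x t * cnj (x t))) = 0) = l2rel x (\<lambda>_. 0)"
      unfolding e using x
      by (subst integral_nonneg_eq_0_iff_AE) (auto simp: sqint_def l2rel_def)
  qed
  show "norm x = sqrt (inner x x)" by (rule norm_l2_def)
qed

end

lemma l2_cases: "\<exists>f. sqint f \<and> x = abs_l2 f"
proof -
  have "l2rel (rep_l2 x) (rep_l2 x)" using Quotient_rep_reflp[OF Quotient_l2] .
  then show ?thesis using Quotient_abs_rep[OF Quotient_l2, of x] by (metis l2rel_def)
qed

lemma l2rel_refl: "sqint f \<Longrightarrow> l2rel f f" by (simp add: l2rel_def)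

lemma abs_l2_eq_iff: "sqint f \<Longrightarrow> sqint g \<Longrightarrow> abs_l2 f = abs_l2 g \<longleftrightarrow> (AE x in lborel. f x = g x)"
  using Quotient_rel[OF Quotient_l2, of f g] by (auto simp: l2rel_def)

lemma abs_l2_add: "sqint f \<Longrightarrow> sqint g \<Longrightarrow> abs_l2 f + abs_l2 g = abs_l2 (\<lambda>x. f x + g x)"
  by (simp add: plus_l2.abs_eq l2rel_refl)

lemma abs_l2_diff: "sqint f \<Longrightarrow> sqint g \<Longrightarrow> abs_l2 f - abs_l2 g = abs_l2 (\<lambda>x. f x - g x)"
  by (simp add: minus_l2.abs_eq l2rel_refl)

lemma abs_l2_scaleR: "sqint f \<Longrightarrow> c *\<^sub>R abs_l2 f = abs_l2 (\<lambda>x. c *\<^sub>R f x)"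
  by (simp add: scaleR_l2.abs_eq l2rel_refl)

lemma abs_l2_inner: "sqint f \<Longrightarrow> sqint g \<Longrightarrow> inner (abs_l2 f) (abs_l2 g) = (LINT x|lborel. Re (f x * cnj (g x)))"
  by (simp add: inner_l2.abs_eq l2rel_refl)

lemma abs_l2_norm: "sqint f \<Longrightarrow> (norm (abs_l2 f))\<^sup>2 = (LINT x|lborel. (cmod (f x))\<^sup>2)"
proof -
  assume f: "sqint f"
  have "Re (f x * cnj (f x)) = (cmod (f x))\<^sup>2" for x
    by (simp add: complex_mult_cnj cmod_power2)
  then show ?thesis unfolding power2_norm_eq_inner[of "abs_l2 f"] by (simp only: abs_l2_inner[OF f f])
qed

text \<open>Riesz-Fischer: along a subsequence with increments at most 2^(-n) the absolute
  increments have a square integrable sum, so the functions converge almost everywhere and, by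
  domination, in norm.\<close>

instance l2 :: banach
proof
  fix X :: "nat \<Rightarrow> l2" assume X: "Cauchy X"
  have "\<exists>N. \<forall>m\<ge>N. \<forall>k\<ge>N. norm (X m - X k) < (1/2)^n" for n
    using X unfolding Cauchy_iff by simp
  then obtain M where M: "\<And>n m k. m \<ge> M n \<Longrightarrow> k \<ge> M n \<Longrightarrow> norm (X m - X k) < (1/2)^n" by metis
  \<comment> \<open>The partial sum makes both s n and s (n+1) at least M n, and the summand n makes
    s n >= n.\<close>
  define s where "s n = n + (\<Sum>i\<le>n. M i)" for n
  have sM: "s n \<ge> M n" "s (Suc n) \<ge> M n" for n 
  proof -
    have "M n \<le> (\<Sum>i\<le>n. M i)" by (rule member_le_sum) auto
    then show "s n \<ge> M n" "s (Suc n) \<ge> M n" by (simp_all add: s_def)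
  qed
  have s_ge: "s n \<ge> n" for n by (simp add: s_def)
  have "\<exists>f. sqint f \<and> X (s n) = abs_l2 f" for n by (rule l2_cases)
  then obtain f where f: "\<And>n. sqint (f n)" "\<And>n. X (s n) = abs_l2 (f n)" by metis
  note [measurable] = f(1)[THEN sqint_measurable]
  define d where "d n x = f (Suc n) x - f n x" for n x
  have d: "sqint (d n)" for n unfolding d_def by (intro sqint_diff f)
  note [measurable] = d[THEN sqint_measurable]
  have dn: "norm (abs_l2 (d n)) \<le> (1/2)^n" for n
    using M[OF sM(2,1), of n] unfolding d_def by (simp add: f abs_l2_diff[OF f(1) f(1), symmetric])
  define ad where "ad n x = complex_of_real (cmod (d n x))" for n x
  have ad: "sqint (ad n)" for n
    by (rule sqint_bound[OF d, where c = 1]) (auto simp: ad_def[abs_def])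
  have adn: "norm (abs_l2 (ad n)) \<le> (1/2)^n" for n
  proof -
    have "(norm (abs_l2 (ad n)))\<^sup>2 = (norm (abs_l2 (d n)))\<^sup>2"
      by (simp add: abs_l2_norm[OF ad] abs_l2_norm[OF d]) (simp add: ad_def)
    then show ?thesis using dn[of n] by simp
  qed
  define g where "g N x = (\<Sum>n<N. cmod (d n x))" for N x
  have g: "sqint (\<lambda>x. complex_of_real (g N x)) \<and> norm (abs_l2 (\<lambda>x. complex_of_real (g N x))) \<le> (\<Sum>n<N. (1/2)^n)" for N
  proof (induction N)
    case 0
    have "abs_l2 (\<lambda>x. 0) = 0" by (simp add: zero_l2_def)
    then show ?case by (simp add: g_def sqint_zero)
  next
    case (Suc N)
    have e: "(\<lambda>x. complex_of_real (g (Suc N) x)) = (\<lambda>x. complex_of_real (g N x) + ad N x)"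
      by (simp add: g_def ad_def)
    show ?case unfolding e
      using Suc ad[of N] adn[of N] norm_triangle_ineq[of "abs_l2 (\<lambda>x. complex_of_real (g N x))" "abs_l2 (ad N)"]
      by (auto intro!: sqint_add simp flip: abs_l2_add)
  qed
  have gm[measurable]: "g N \<in> borel_measurable lborel" for N unfolding g_def by measurable
  have g0: "g N x \<ge> 0" for N x by (simp add: g_def sum_nonneg)
  have gmono: "g N x \<le> g (Suc N) x" for N x by (simp add: g_def)
  have gint: "integrable lborel (\<lambda>x. (g N x)\<^sup>2)" and gle: "(LINT x|lborel. (g N x)\<^sup>2) \<le> 4" for N
  proof -
    show "integrable lborel (\<lambda>x. (g N x)\<^sup>2)" using g[of N] by (simp add: sqint_def)
    have "norm (abs_l2 (\<lambda>x. complex_of_real (g N x))) \<le> (\<Sum>n<N. (1/2)^n)" using g by blast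
    also have "\<dots> \<le> 2"
      using sum_le_suminf[of "\<lambda>n. (1/2::real)^n" "{..<N}"] suminf_geometric[of "1/2::real"]
      by (simp add: summable_geometric)
    finally have "(norm (abs_l2 (\<lambda>x. complex_of_real (g N x))))\<^sup>2 \<le> 2\<^sup>2" by (intro power_mono) auto
    then show "(LINT x|lborel. (g N x)\<^sup>2) \<le> 4" using g[of N] by (simp add: abs_l2_norm)
  qed
  have "(\<integral>\<^sup>+x. (SUP N. ennreal ((g N x)\<^sup>2)) \<partial>lborel) = (SUP N. \<integral>\<^sup>+x. ennreal ((g N x)\<^sup>2) \<partial>lborel)"
    by (rule nn_integral_monotone_convergence_SUP)
      (auto intro!: incseq_SucI le_funI ennreal_leI power_mono gmono g0)
  also have "\<dots> \<le> 4"
    using gle gint by (intro SUP_least) (simp add: nn_integral_eq_integral flip: ennreal_numeral)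
  finally have "(\<integral>\<^sup>+x. (SUP N. ennreal ((g N x)\<^sup>2)) \<partial>lborel) \<noteq> \<infinity>" by (auto simp: top_unique)
  then have "AE x in lborel. (SUP N. ennreal ((g N x)\<^sup>2)) \<noteq> \<infinity>"
    by (intro nn_integral_PInf_AE) auto
  then have AEs: "AE x in lborel. summable (\<lambda>n. cmod (d n x))"
  proof eventually_elim
    case (elim x)
    then obtain C where C: "C \<ge> 0" "(SUP N. ennreal ((g N x)\<^sup>2)) = ennreal C"
      by (cases "SUP N. ennreal ((g N x)\<^sup>2)") auto
    have "g N x \<le> C + 1" for N
    proof -
      have "ennreal ((g N x)\<^sup>2) \<le> ennreal C" unfolding C(2)[symmetric] by (rule SUP_upper) simp
      then have "(g N x)\<^sup>2 \<le> C" using C(1) by simp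
      also have "C \<le> (C + 1)\<^sup>2" using C(1) by (simp add: power2_sum)
      finally show ?thesis by (rule power2_le_imp_le) (use C(1) in simp)
    qed
    then have "(\<Sum>n\<le>N. cmod (d n x)) \<le> C + 1" for N
      unfolding g_def lessThan_Suc_atMost[symmetric] by blast
    then show ?case by (intro bounded_imp_summable[of _ "C + 1"]) auto
  qed
  define h where "h x = lim (\<lambda>n. f n x)" for x
  have hm[measurable]: "h \<in> borel_measurable lborel" unfolding h_def by measurable
  \<comment> \<open>The common majorant of all |f n - h|^2; its integrability comes from the squared
    partial sums, whose integrals are at most 4.\<close>
  define w where "w x = (\<Sum>n. cmod (d n x))\<^sup>2" for x
  have wm[measurable]: "w \<in> borel_measurable lborel" unfolding w_def by measurable
  have wint: "integrable lborel w"
  proof -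
    let ?I = "\<lambda>N. LINT x|lborel. (g N x)\<^sup>2"
    have "incseq ?I" by (intro incseq_SucI integral_mono gint power_mono gmono g0)
    then obtain L where L: "?I \<longlonglongrightarrow> L" using incseq_convergent[of ?I 4] gle by metis
    show ?thesis
    proof (rule integrable_monotone_convergence[OF gint _ _ L wm])
      show "AE x in lborel. mono (\<lambda>n. (g n x)\<^sup>2)"
        by (auto intro!: incseq_SucI power_mono gmono g0)
      show "AE x in lborel. (\<lambda>i. (g i x)\<^sup>2) \<longlonglongrightarrow> w x"
        using AEs by eventually_elim
          (auto simp: g_def w_def intro!: tendsto_power summable_LIMSEQ)
    qed
  qed
  have conv: "AE x in lborel. (\<lambda>n. f n x) \<longlonglongrightarrow> h x \<and> (\<forall>n. (cmod (f n x - h x))\<^sup>2 \<le> w x)"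
    using AEs
  proof eventually_elim
    case (elim x)
    have sd: "summable (\<lambda>n. d n x)" using elim by (rule summable_norm_cancel)
    have part: "(\<Sum>k<m. d (k + n) x) = f (m + n) x - f n x" for m n
      by (induction m) (auto simp: d_def)
    have part0: "(\<Sum>k<m. d k x) = f m x - f 0 x" for m by (induction m) (auto simp: d_def)
    have "(\<lambda>m. f m x - f 0 x + f 0 x) \<longlonglongrightarrow> (\<Sum>k. d k x) + f 0 x"
      using summable_LIMSEQ[OF sd] unfolding part0 by (rule tendsto_add) (rule tendsto_const)
    then have "(\<lambda>m. f m x) \<longlonglongrightarrow> (\<Sum>k. d k x) + f 0 x" by simp
    then have lim: "(\<lambda>m. f m x) \<longlonglongrightarrow> h x" unfolding h_def by (simp add: limI)
    moreover have "(cmod (f n x - h x))\<^sup>2 \<le> w x" for n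
    proof -
      have "(\<lambda>m. cmod (f (m + n) x - f n x)) \<longlonglongrightarrow> cmod (h x - f n x)"
        by (intro tendsto_intros LIMSEQ_ignore_initial_segment lim)
      moreover have "cmod (f (m + n) x - f n x) \<le> (\<Sum>k. cmod (d k x))" for m
      proof -
        have "cmod (f (m + n) x - f n x) \<le> (\<Sum>k<m. cmod (d (k + n) x))"
          unfolding part[symmetric] by (rule norm_sum)
        also have "\<dots> = (\<Sum>k\<in>{n..<m+n}. cmod (d k x))"
          by (simp add: sum.shift_bounds_nat_ivl[of _ 0 n m, simplified] lessThan_atLeast0)
        also have "\<dots> \<le> (\<Sum>k. cmod (d k x))" by (rule sum_le_suminf[OF elim]) auto
        finally show ?thesis .
      qed
      ultimately have "cmod (h x - f n x) \<le> (\<Sum>k. cmod (d k x))"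
        by (intro LIMSEQ_le_const2) auto
      then show ?thesis unfolding w_def by (simp add: norm_minus_commute power_mono)
    qed
    ultimately show ?case by blast
  qed
  have fh: "sqint (\<lambda>x. f n x - h x)" for n
    unfolding sqint_def
  proof
    show "integrable lborel (\<lambda>x. (cmod (f n x - h x))\<^sup>2)"
    proof (rule Bochner_Integration.integrable_bound[OF wint])
      show "AE x in lborel. norm ((cmod (f n x - h x))\<^sup>2) \<le> norm (w x)"
        using conv
      proof eventually_elim
        case (elim x)
        then have "(cmod (f n x - h x))\<^sup>2 \<le> w x" by blast
        then show ?case by simp
      qed
    qed measurable
  qed measurable
  have h: "sqint h" using sqint_diff[OF f(1)[of 0] fh[of 0]] by simp
  have "(\<lambda>n. LINT x|lborel. (cmod (f n x - h x))\<^sup>2) \<longlonglongrightarrow> integral\<^sup>L lborel (\<lambda>x::real. 0::real)"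
  proof (rule integral_dominated_convergence[where w = w])
    show "AE x in lborel. (\<lambda>n. (cmod (f n x - h x))\<^sup>2) \<longlonglongrightarrow> 0"
      using conv
    proof eventually_elim
      case (elim x)
      then have "(\<lambda>n. (cmod (f n x - h x))\<^sup>2) \<longlonglongrightarrow> (cmod (h x - h x))\<^sup>2" by (intro tendsto_intros) auto
      then show ?case by simp
    qed
    show "AE x in lborel. norm ((cmod (f n x - h x))\<^sup>2) \<le> w x" for n
      using conv by eventually_elim simp
  qed (auto intro: wint)
  then have "(\<lambda>n. (norm (X (s n) - abs_l2 h))\<^sup>2) \<longlonglongrightarrow> 0"
    by (simp add: f abs_l2_diff[OF f(1) h] abs_l2_norm[OF fh])
  then have "(\<lambda>n. sqrt ((norm (X (s n) - abs_l2 h))\<^sup>2)) \<longlonglongrightarrow> sqrt 0" by (intro tendsto_intros)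
  then have sub: "(\<lambda>n. X (s n)) \<longlonglongrightarrow> abs_l2 h" by (simp add: tendsto_norm_zero_iff LIM_zero_iff)
  have "X \<longlonglongrightarrow> abs_l2 h"
  proof (rule LIMSEQ_I)
    fix e :: real assume e: "e > 0"
    obtain N where N: "\<And>m n. m \<ge> N \<Longrightarrow> n \<ge> N \<Longrightarrow> norm (X m - X n) < e/2"
      using X e unfolding Cauchy_iff by (meson half_gt_zero)
    obtain K where K: "\<And>n. n \<ge> K \<Longrightarrow> norm (X (s n) - abs_l2 h) < e/2"
      using LIMSEQ_D[OF sub, of "e/2"] e by auto
    show "\<exists>no. \<forall>n\<ge>no. norm (X n - abs_l2 h) < e"
    proof (intro exI allI impI)
      fix n assume n: "n \<ge> N"
      let ?k = "max N K"
      have "norm (X n - X (s ?k)) < e/2" using N n s_ge[of ?k] by (meson max.cobounded1 order_trans)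
      moreover have "norm (X (s ?k) - abs_l2 h) < e/2" by (rule K) simp
      ultimately show "norm (X n - abs_l2 h) < e"
        using norm_triangle_ineq[of "X n - X (s ?k)" "X (s ?k) - abs_l2 h"] by simp
    qed
  qed
  then show "convergent X" by (rule convergentI)
qed

section \<open>Square roots and order of nonnegative self-adjoint relations on weighted spaces\<close>

text \<open>An arbitrary m need not preserve square integrability, so a representative is chosen
  instead of lifting to the quotient; for m bounded by 1 the choice does not matter
  (\<open>mulop_abs\<close>).\<close>

definition mulop :: "(real \<Rightarrow> complex) \<Rightarrow> l2 \<Rightarrow> l2" where
  "mulop m x = abs_l2 (\<lambda>t. m t * (SOME f. sqint f \<and> x = abs_l2 f) t)"

lemma sqint_bounded_mult:
  assumes "m \<in> borel_measurable lborel" "\<And>t. cmod (m t) \<le> 1" "sqint f"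
  shows "sqint (\<lambda>t. m t * f t)"
proof -
  note [measurable] = assms(1) sqint_measurable[OF assms(3)]
  have "cmod (m x * f x) \<le> 1 * cmod (f x)" for x
    unfolding norm_mult by (intro mult_right_mono assms) auto
  then show ?thesis by (intro sqint_bound[OF assms(3), where c = 1]) auto
qed

lemma mulop_abs:
  assumes m: "m \<in> borel_measurable lborel" "\<And>t. cmod (m t) \<le> 1" and f: "sqint f"
  shows "mulop m (abs_l2 f) = abs_l2 (\<lambda>t. m t * f t)"
proof -
  define g where "g = (SOME g. sqint g \<and> abs_l2 f = abs_l2 g)"
  have g: "sqint g \<and> abs_l2 f = abs_l2 g"
    unfolding g_def using f by (intro someI_ex[of "\<lambda>g. sqint g \<and> abs_l2 f = abs_l2 g"]) auto
  then have "AE t in lborel. f t = g t" using abs_l2_eq_iff f by blast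
  then have "AE t in lborel. m t * g t = m t * f t" by eventually_elim simp
  then show ?thesis
    unfolding mulop_def g_def[symmetric] using g f by (subst abs_l2_eq_iff) (auto intro!: sqint_bounded_mult m)
qed

lemma bounded_linear_mulop:
  assumes m: "m \<in> borel_measurable lborel" "\<And>t. cmod (m t) \<le> 1"
  shows "bounded_linear (mulop m)"
proof (rule bounded_linear_intro[where K = 1])
  fix x y :: l2 and c :: real
  obtain f g where f: "sqint f" "x = abs_l2 f" and g: "sqint g" "y = abs_l2 g"
    using l2_cases by metis
  note ms = mulop_abs[OF m] sqint_bounded_mult[OF m] sqint_add sqint_scaleR
  show "mulop m (x + y) = mulop m x + mulop m y"
    by (simp add: f g abs_l2_add ms distrib_left)
  show "mulop m (c *\<^sub>R x) = c *\<^sub>R mulop m x"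
    by (simp add: f abs_l2_scaleR ms)
  have "(norm (mulop m x))\<^sup>2 \<le> (norm x)\<^sup>2"
    unfolding f(2) mulop_abs[OF m f(1)] abs_l2_norm[OF f(1)] abs_l2_norm[OF sqint_bounded_mult[OF m f(1)]]
  proof (rule integral_mono)
    show "integrable lborel (\<lambda>x. (cmod (m x * f x))\<^sup>2)" "integrable lborel (\<lambda>x. (cmod (f x))\<^sup>2)"
      using f(1) sqint_bounded_mult[OF m f(1)] by (simp_all add: sqint_def)
    show "(cmod (m x * f x))\<^sup>2 \<le> (cmod (f x))\<^sup>2" for x
      unfolding norm_mult using m(2)[of x] by (intro power_mono mult_left_le_one_le) auto
  qed
  from power2_le_imp_le[OF this] show "norm (mulop m x) \<le> norm x * 1" by simp
qed

section \<open>The weighted space and its isometric embedding into the line\<close>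

locale sturm_liouville =
  fixes S :: slp
  assumes std: "sl_standard S"
begin

lemma sI_measurable[measurable]: "sI S \<in> sets borel"
  by (simp add: sI_def)

text \<open>Multiplication by sqrt(r), continued by 0, is an isometry of the weighted space onto the
  functions vanishing off the interval; it is the map \<open>phi\<close> below, onto by
  \<open>Ei_range\<close>.\<close>

definition wgt :: "real \<Rightarrow> real" where
  "wgt x = sqrt (indicator (sI S) x * sr S x)"

lemma wgt_measurable[measurable]: "wgt \<in> borel_measurable borel"
proof -
  have "(\<lambda>x. indicator (sI S) x * sr S x) \<in> borel_measurable borel"
    using std by (simp add: sl_standard_def set_borel_measurable_def)
  then show ?thesis unfolding wgt_def[abs_def] by measurable
qed

lemma sr_pos: "AE x in lborel. x \<in> sI S \<longrightarrow> sr S x > 0"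
  using std by (simp add: sl_standard_def)

lemma wgt_outside: "x \<notin> sI S \<Longrightarrow> wgt x = 0" by (simp add: wgt_def)

lemma wgt_nonzero: "wgt x \<noteq> 0 \<Longrightarrow> x \<in> sI S" using wgt_outside by blast

lemma wgt_square: "AE x in lborel. wgt x * wgt x = indicator (sI S) x * sr S x"
  using sr_pos by eventually_elim (auto simp: wgt_def indicator_def)

definition wf :: "(real \<Rightarrow> complex) \<Rightarrow> real \<Rightarrow> complex" where
  "wf f x = wgt x *\<^sub>R f x"

definition phi :: "(real \<Rightarrow> complex) \<Rightarrow> l2" where "phi f = abs_l2 (wf f)"

lemma wf_measurable: "set_borel_measurable lborel (sI S) f \<Longrightarrow> wf f \<in> borel_measurable lborel"
proof -
  assume "set_borel_measurable lborel (sI S) f"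
  then have [measurable]: "(\<lambda>x. indicator (sI S) x *\<^sub>R f x) \<in> borel_measurable lborel"
    by (simp add: set_borel_measurable_def)
  have "wf f = (\<lambda>x. wgt x *\<^sub>R (indicator (sI S) x *\<^sub>R f x))"
    by (auto simp: wf_def fun_eq_iff indicator_def dest: wgt_nonzero)
  also have "\<dots> \<in> borel_measurable lborel" by measurable
  finally show ?thesis .
qed

lemma wf_mod: "AE x in lborel. (cmod (wf f x))\<^sup>2 = indicator (sI S) x *\<^sub>R ((cmod (f x))\<^sup>2 * sr S x)"
  using wgt_square
proof eventually_elim
  case (elim x)
  have "(cmod (wf f x))\<^sup>2 = (wgt x * wgt x) * (cmod (f x))\<^sup>2"
    by (simp add: wf_def power_mult_distrib power2_eq_square)
  then show ?case unfolding elim by simp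
qed

lemma L2_measurable: "L2 S f \<Longrightarrow> (\<lambda>x. indicator (sI S) x *\<^sub>R f x) \<in> borel_measurable borel"
  by (simp add: L2_def set_borel_measurable_def)

lemma sr_measurable[measurable]: "(\<lambda>x. indicator (sI S) x *\<^sub>R sr S x) \<in> borel_measurable borel"
  using std by (simp add: sl_standard_def set_borel_measurable_def)

lemma L2_mod_measurable:
  assumes "set_borel_measurable lborel (sI S) f"
  shows "(\<lambda>x. indicator (sI S) x *\<^sub>R ((cmod (f x))\<^sup>2 * sr S x)) \<in> borel_measurable lborel"
proof -
  note [measurable] = assms[unfolded set_borel_measurable_def]
  have "(\<lambda>x. indicator (sI S) x *\<^sub>R ((cmod (f x))\<^sup>2 * sr S x)) =
     (\<lambda>x. (cmod (indicator (sI S) x *\<^sub>R f x))\<^sup>2 * (indicator (sI S) x *\<^sub>R sr S x))"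
    by (auto simp: fun_eq_iff indicator_def)
  also have "\<dots> \<in> borel_measurable lborel" by measurable
  finally show ?thesis .
qed

lemma L2_iff_sqint: "set_borel_measurable lborel (sI S) f \<Longrightarrow> L2 S f \<longleftrightarrow> sqint (wf f)"
proof -
  assume f: "set_borel_measurable lborel (sI S) f"
  note [measurable] = wf_measurable[OF f] L2_mod_measurable[OF f]
  show ?thesis unfolding L2_def sqint_def set_integrable_def
    using f wf_measurable[OF f] L2_mod_measurable[OF f]
      integrable_cong_AE_imp[OF _ L2_mod_measurable[OF f] wf_mod]
      integrable_cong_AE_imp[OF _ _ AE_symmetric[OF wf_mod], of f]
    by fastforce
qed

lemma L2_sqint: "L2 S f \<Longrightarrow> sqint (wf f)"
  using L2_iff_sqint by (auto simp: L2_def)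

lemma phi_norm: "L2 S f \<Longrightarrow> norm (phi f) = nrm S f"
proof -
  assume f: "L2 S f"
  then have fm: "set_borel_measurable lborel (sI S) f" by (simp add: L2_def)
  have "(norm (phi f))\<^sup>2 = (LINT x|lborel. (cmod (wf f x))\<^sup>2)"
    unfolding phi_def by (rule abs_l2_norm[OF L2_sqint[OF f]])
  also have "\<dots> = (LINT x:sI S|lborel. (cmod (f x))\<^sup>2 * sr S x)"
    unfolding set_lebesgue_integral_def
    by (rule integral_cong_AE) (use wf_measurable[OF fm] L2_mod_measurable[OF fm] wf_mod in auto)
  finally show ?thesis unfolding nrm_def by (metis norm_ge_zero real_sqrt_unique)
qed

lemma wf_prod: "AE x in lborel. wf f x * cnj (wf g x) =
   indicator (sI S) x *\<^sub>R (f x * cnj (g x) * complex_of_real (sr S x))"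
  using wgt_square
proof eventually_elim
  case (elim x)
  have "wf f x * cnj (wf g x) = complex_of_real (wgt x * wgt x) * (f x * cnj (g x))"
    by (simp add: wf_def scaleR_conv_of_real)
  then show ?case unfolding elim by (simp add: scaleR_conv_of_real)
qed

lemma L2_prod_measurable:
  assumes "L2 S f" "L2 S g"
  shows "(\<lambda>x. indicator (sI S) x *\<^sub>R (f x * cnj (g x) * complex_of_real (sr S x))) \<in> borel_measurable lborel"
proof -
  note [measurable] = L2_measurable[OF assms(1)] L2_measurable[OF assms(2)]
  have "(\<lambda>x. indicator (sI S) x *\<^sub>R (f x * cnj (g x) * complex_of_real (sr S x))) =
     (\<lambda>x. (indicator (sI S) x *\<^sub>R f x) * cnj (indicator (sI S) x *\<^sub>R g x) * complex_of_real (indicator (sI S) x *\<^sub>R sr S x))"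
    by (auto simp: fun_eq_iff indicator_def)
  also have "\<dots> \<in> borel_measurable lborel" by measurable
  finally show ?thesis .
qed

lemma ip_integrable:
  assumes "L2 S f" "L2 S g"
  shows "set_integrable lborel (sI S) (\<lambda>x. f x * cnj (g x) * complex_of_real (sr S x))"
  unfolding set_integrable_def
  by (rule integrable_cong_AE_imp[OF sqint_integrable_prod[OF L2_sqint[OF assms(1)] L2_sqint[OF assms(2)]]
        L2_prod_measurable[OF assms] wf_prod])

lemma phi_inner:
  assumes "L2 S f" "L2 S g"
  shows "phi f \<bullet> phi g = Re (ip S f g)"
proof -
  have "ip S f g = (LINT x|lborel. wf f x * cnj (wf g x))"
    unfolding ip_def set_lebesgue_integral_def
    by (rule integral_cong_AE[OF L2_prod_measurable[OF assms] _ AE_symmetric[OF wf_prod]])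
      (use sqint_integrable_prod[OF L2_sqint[OF assms(1)] L2_sqint[OF assms(2)]] in simp)
  then show ?thesis
    unfolding phi_def abs_l2_inner[OF assms[THEN L2_sqint]]
    using sqint_integrable_prod[OF L2_sqint[OF assms(1)] L2_sqint[OF assms(2)]]
    by (simp only: integral_Re)
qed

lemma sbm_add: "set_borel_measurable lborel (sI S) f \<Longrightarrow> set_borel_measurable lborel (sI S) g \<Longrightarrow>
   set_borel_measurable lborel (sI S) (\<lambda>x. f x + g x :: complex)"
  unfolding set_borel_measurable_def scaleR_add_right by (rule borel_measurable_add)

lemma sbm_mult: "set_borel_measurable lborel (sI S) f \<Longrightarrow> 
   set_borel_measurable lborel (sI S) (\<lambda>x. c * f x :: complex)"
  unfolding set_borel_measurable_def mult_scaleR_right[symmetric]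
  by (intro borel_measurable_times borel_measurable_const)

lemma wf_add: "wf (\<lambda>x. f x + g x) = (\<lambda>x. wf f x + wf g x)"
  by (simp add: wf_def fun_eq_iff scaleR_add_right)

lemma wf_mult: "wf (\<lambda>x. c * f x) = (\<lambda>x. c * wf f x)"
  by (simp add: wf_def fun_eq_iff)

lemma L2_add: "L2 S f \<Longrightarrow> L2 S g \<Longrightarrow> L2 S (\<lambda>x. f x + g x)"
proof -
  assume f: "L2 S f" and g: "L2 S g"
  have "set_borel_measurable lborel (sI S) (\<lambda>x. f x + g x)"
    using f g by (intro sbm_add) (simp_all add: L2_def)
  from L2_iff_sqint[OF this] show ?thesis
    using sqint_add[OF L2_sqint[OF f] L2_sqint[OF g]] by (simp add: wf_add)
qed

lemma L2_mult: "L2 S f \<Longrightarrow> L2 S (\<lambda>x. c * f x)"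
proof -
  assume f: "L2 S f"
  have "set_borel_measurable lborel (sI S) (\<lambda>x. c * f x)"
    using f by (intro sbm_mult) (simp add: L2_def)
  from L2_iff_sqint[OF this] show ?thesis
    using sqint_mult[OF L2_sqint[OF f]] by (simp add: wf_mult)
qed

lemma L2_zero: "L2 S (\<lambda>_. 0)"
  by (simp add: L2_def set_borel_measurable_def set_integrable_def)

lemma L2_diff: "L2 S f \<Longrightarrow> L2 S g \<Longrightarrow> L2 S (\<lambda>x. f x - g x)"
  using L2_add[of f "\<lambda>x. (-1) * g x"] L2_mult[of g "-1"] by simp

lemma phi_add: "L2 S f \<Longrightarrow> L2 S g \<Longrightarrow> phi (\<lambda>x. f x + g x) = phi f + phi g"
  by (simp add: phi_def wf_add abs_l2_add L2_sqint)

lemma phi_zero: "phi (\<lambda>_. 0) = 0"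
  by (simp add: phi_def wf_def[abs_def] zero_l2_def)

lemma phi_eq_iff:
  assumes "L2 S f" "L2 S g"
  shows "phi f = phi g \<longleftrightarrow> aeq S f g"
proof -
  have "phi f = phi g \<longleftrightarrow> (AE x in lborel. wf f x = wf g x)"
    unfolding phi_def using assms by (intro abs_l2_eq_iff L2_sqint)
  also have "\<dots> \<longleftrightarrow> aeq S f g"
    unfolding aeq_def
  proof
    assume "AE x in lborel. wf f x = wf g x"
    then show "AE x in lborel. x \<in> sI S \<longrightarrow> f x = g x"
      using sr_pos by eventually_elim (auto simp: wf_def wgt_def)
  next
    assume "AE x in lborel. x \<in> sI S \<longrightarrow> f x = g x"
    then show "AE x in lborel. wf f x = wf g x"
      by eventually_elim (auto simp: wf_def wgt_def indicator_def)
  qed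
  finally show ?thesis .
qed

text \<open>\<open>Ei\<close> is the orthogonal projection onto the image of \<open>phi\<close>, and
  \<open>Ji\<close> is the complex structure. A real operator commuting with both comes from a
  complex linear one on the weighted space.\<close>

definition Ei :: "l2 \<Rightarrow> l2" where "Ei = mulop (\<lambda>t. of_real (indicator (sI S) t))"
definition Ji :: "l2 \<Rightarrow> l2" where "Ji = mulop (\<lambda>t. \<i>)"

lemma Ei_meas: "(\<lambda>t. complex_of_real (indicator (sI S) t)) \<in> borel_measurable lborel" 
  "\<And>t. cmod (complex_of_real (indicator (sI S) t)) \<le> 1"
  by (auto simp: indicator_def)

lemmas Ei_bl = bounded_linear_mulop[OF Ei_meas, folded Ei_def]
lemma Ji_bl: "bounded_linear Ji" unfolding Ji_def by (rule bounded_linear_mulop) auto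

lemma Ei_abs: "sqint f \<Longrightarrow> Ei (abs_l2 f) = abs_l2 (\<lambda>t. of_real (indicator (sI S) t) * f t)"
  unfolding Ei_def by (rule mulop_abs[OF Ei_meas])

lemma Ji_abs: "sqint f \<Longrightarrow> Ji (abs_l2 f) = abs_l2 (\<lambda>t. \<i> * f t)"
  unfolding Ji_def by (rule mulop_abs) auto

lemma Ei_phi: "L2 S f \<Longrightarrow> Ei (phi f) = phi f"
proof -
  have "(\<lambda>t. of_real (indicator (sI S) t) * wf f t) = wf f"
    by (auto simp: fun_eq_iff wf_def indicator_def dest: wgt_nonzero)
  then show "L2 S f \<Longrightarrow> Ei (phi f) = phi f" by (simp add: phi_def Ei_abs L2_sqint)
qed

lemma Ji_phi: "L2 S f \<Longrightarrow> Ji (phi f) = phi (\<lambda>x. \<i> * f x)"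
  by (simp add: phi_def Ji_abs L2_sqint wf_mult)

lemma Ei_range: "\<exists>f. L2 S f \<and> Ei x = phi f"
proof -
  obtain F where F: "sqint F" "x = abs_l2 F" using l2_cases by blast
  note [measurable] = sqint_measurable[OF F(1)]
  \<comment> \<open>Where \<open>wgt\<close> vanishes the quotient is 0. Inside the interval this
    affects only a null set, and outside it the projection has removed F.\<close>
  define f where "f t = F t / of_real (wgt t)" for t
  have fm: "set_borel_measurable lborel (sI S) f"
    unfolding set_borel_measurable_def f_def by measurable
  let ?G = "\<lambda>t. of_real (indicator (sI S) t) * F t"
  have G: "sqint ?G" by (rule sqint_bounded_mult[OF Ei_meas F(1)])
  have AE: "AE t in lborel. ?G t = wf f t"
    using sr_pos by eventually_elim (auto simp: wf_def f_def wgt_def scaleR_conv_of_real indicator_def)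
  have "sqint (wf f)"
    unfolding sqint_def
  proof
    show m: "wf f \<in> borel_measurable lborel" by (rule wf_measurable[OF fm])
    have AE2: "AE t in lborel. (cmod (?G t))\<^sup>2 = (cmod (wf f t))\<^sup>2" using AE by eventually_elim simp
    show "integrable lborel (\<lambda>x. (cmod (wf f x))\<^sup>2)"
      using G m by (intro integrable_cong_AE_imp[OF _ _ AE2]) (auto simp: sqint_def)
  qed
  then have f: "L2 S f" using L2_iff_sqint[OF fm] by simp
  have "Ei x = phi f" unfolding F(2) Ei_abs[OF F(1)] phi_def
    by (subst abs_l2_eq_iff) (use G L2_sqint[OF f] AE in auto)
  with f show ?thesis by blast
qed

lemma Ei_inner: assumes g: "L2 S g" shows "Ei x \<bullet> phi g = x \<bullet> phi g"
proof -
  obtain F where F: "sqint F" "x = abs_l2 F" using l2_cases by blast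
  have "(\<lambda>t. Re (of_real (indicator (sI S) t) * F t * cnj (wf g t))) = (\<lambda>t. Re (F t * cnj (wf g t)))"
    by (auto simp: fun_eq_iff wf_def indicator_def dest: wgt_nonzero)
  then show ?thesis
    unfolding F(2) Ei_abs[OF F(1)] phi_def
    by (simp add: abs_l2_inner F sqint_bounded_mult[OF Ei_meas F(1)] L2_sqint g)
qed

lemma Ei_Ei: "Ei (Ei x) = Ei x" using Ei_range[of x] Ei_phi by auto

lemma Ei_Ji: "Ei (Ji x) = Ji (Ei x)"
proof -
  obtain F where F: "sqint F" "x = abs_l2 F" using l2_cases by blast
  show ?thesis unfolding F(2)
    using F(1) sqint_mult[OF F(1), of \<i>] sqint_bounded_mult[OF Ei_meas F(1)]
    by (simp add: Ei_abs Ji_abs mult.left_commute)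
qed

text \<open>The condition on x involves only \<open>Ei x\<close>: the operator is continued by zero
  on the functions supported off the interval. Without this the lifted graph would not be
  self-adjoint in all of \<open>l2\<close>.\<close>

definition lft :: "lrel \<Rightarrow> (l2 \<times> l2) set" where
  "lft A = {(x, y). \<exists>f h. (f, h) \<in> A \<and> Ei x = phi f \<and> y = phi h}"

lemma ip_mult_left: "ip S (\<lambda>x. c * f x) g = c * ip S f g"
  unfolding ip_def by (simp add: mult.assoc)

lemma ip_mult_right: "ip S f (\<lambda>x. c * g x) = cnj c * ip S f g"
proof -
  have "(\<lambda>x. f x * cnj (c * g x) * complex_of_real (sr S x)) = (\<lambda>x. cnj c * (f x * cnj (g x) * complex_of_real (sr S x)))"
    by (simp add: fun_eq_iff)
  then show ?thesis unfolding ip_def by simp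
qed

lemma ip_cong:
  assumes "aeq S f f'" "aeq S g g'" "L2 S f" "L2 S f'" "L2 S g" "L2 S g'"
  shows "ip S f g = ip S f' g'"
  unfolding ip_def set_lebesgue_integral_def
proof (rule integral_cong_AE)
  show "AE x in lborel. indicator (sI S) x *\<^sub>R (f x * cnj (g x) * complex_of_real (sr S x)) =
     indicator (sI S) x *\<^sub>R (f' x * cnj (g' x) * complex_of_real (sr S x))"
    using assms(1,2) unfolding aeq_def by eventually_elim (auto split: split_indicator)
qed (rule L2_prod_measurable; fact)+

lemma aeq_refl[simp]: "aeq S f f" by (simp add: aeq_def)
lemma aeq_sym: "aeq S f g \<Longrightarrow> aeq S g f" unfolding aeq_def by (auto elim: eventually_mono)
lemma aeq_trans: "aeq S f g \<Longrightarrow> aeq S g h \<Longrightarrow> aeq S f h" unfolding aeq_def by (auto elim: eventually_elim2)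

context
  fixes A :: lrel
  assumes A: "nonneg_sa S A"
begin

lemma nonneg_sa_adj: "A = adj S A" using A by (simp add: nonneg_sa_def)

lemma nonneg_sa_L2: "(f, h) \<in> A \<Longrightarrow> L2 S f \<and> L2 S h"
  by (subst (asm) nonneg_sa_adj) (simp add: adj_def)

lemma nonneg_sa_sym: "(f, g) \<in> A \<Longrightarrow> (h, k) \<in> A \<Longrightarrow> ip S g h = ip S f k"
  by (subst (asm) (2) nonneg_sa_adj) (auto simp: adj_def)

lemma nonneg_sa_memI: "L2 S h \<Longrightarrow> L2 S k \<Longrightarrow> (\<And>f g. (f, g) \<in> A \<Longrightarrow> ip S g h = ip S f k) \<Longrightarrow> (h, k) \<in> A"
  by (subst nonneg_sa_adj) (auto simp: adj_def)

text \<open>Inner products do not see null sets, so a relation equal to its adjoint is closed under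
  changes on them.\<close>

lemma nonneg_sa_aeq:
  assumes "(f, g) \<in> A" "L2 S f'" "L2 S g'" "aeq S f f'" "aeq S g g'"
  shows "(f', g') \<in> A"
proof (rule nonneg_sa_memI[OF assms(2,3)])
  fix h k assume hk: "(h, k) \<in> A"
  have "ip S k f = ip S h g" by (rule nonneg_sa_sym[OF hk assms(1)])
  then show "ip S k f' = ip S h g'"
    using assms nonneg_sa_L2[OF hk] nonneg_sa_L2[OF assms(1)]
      ip_cong[of k k f f'] ip_cong[of h h g g'] by simp
qed

lemma nonneg_sa_mult: "(f, g) \<in> A \<Longrightarrow> ((\<lambda>x. c * f x), (\<lambda>x. c * g x)) \<in> A"
  by (rule nonneg_sa_memI) (auto simp: ip_mult_right L2_mult nonneg_sa_sym dest: nonneg_sa_L2)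

lemma nonneg_sa_zero: "((\<lambda>_. 0), (\<lambda>_. 0)) \<in> A"
  by (rule nonneg_sa_memI) (auto simp: L2_zero ip_def)

lemma lft_phi_iff: "L2 S f \<Longrightarrow> L2 S h \<Longrightarrow> (phi f, phi h) \<in> lft A \<longleftrightarrow> (f, h) \<in> A"
proof
  assume f: "L2 S f" and h: "L2 S h" and "(phi f, phi h) \<in> lft A"
  then obtain f' h' where *: "(f', h') \<in> A" "phi f = phi f'" "phi h = phi h'"
    unfolding lft_def by (auto simp: Ei_phi)
  have "L2 S f'" "L2 S h'" using nonneg_sa_L2[OF *(1)] by auto
  then have "aeq S f' f" "aeq S h' h" using * f h phi_eq_iff by metis+
  from nonneg_sa_aeq[OF *(1) f h this] show "(f, h) \<in> A" .
qed (auto simp: lft_def Ei_phi)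

lemma nnsa_lft: "nnsa (lft A)"
  unfolding nnsa_def
proof (intro conjI allI impI)
  have inn: "y \<bullet> x' = Re (ip S h f')" if "(f, h) \<in> A" "(f', h') \<in> A" "y = phi h" "Ei x' = phi f'" for f h f' h' y x'
  proof -
    have "y \<bullet> x' = Ei x' \<bullet> phi h" using that nonneg_sa_L2 Ei_inner[of h x'] by (simp add: inner_commute)
    then show ?thesis using that nonneg_sa_L2 phi_inner[of h f'] by (simp add: inner_commute)
  qed
  show "hadj (lft A) = lft A"
  proof (intro equalityI subsetI)
    fix x assume "x \<in> hadj (lft A)"
    then have adj: "g \<bullet> fst x = f \<bullet> snd x" if "(f, g) \<in> lft A" for f g
      using that unfolding hadj_def by (cases x) auto
    obtain h0 where h0: "L2 S h0" "Ei (fst x) = phi h0" using Ei_range by blast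
    obtain k0 where k0: "L2 S k0" "Ei (snd x) = phi k0" using Ei_range by blast
    \<comment> \<open>The part of the value off the interval. Since (z, 0) belongs to the lifted
      graph, adjointness makes z orthogonal to \<open>snd x\<close>, hence z = 0.\<close>
    define z where "z = snd x - Ei (snd x)"
    have "Ei z = 0" by (simp add: z_def linear_simps[OF Ei_bl] Ei_Ei)
    then have "(z, 0) \<in> lft A" unfolding lft_def using nonneg_sa_zero phi_zero by force
    from adj[OF this] have "z \<bullet> snd x = 0" by simp
    moreover have "z \<bullet> Ei (snd x) = 0"
      using Ei_inner[OF k0(1), of z] k0(2) \<open>Ei z = 0\<close> by simp
    ultimately have "z \<bullet> z = 0" by (simp add: z_def inner_diff_right)
    then have sk: "snd x = phi k0" using k0 by (simp add: z_def)
    have re: "Re (ip S g h0) = Re (ip S f k0)" if fg: "(f, g) \<in> A" for f g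
    proof -
      have L: "L2 S f" "L2 S g" using nonneg_sa_L2[OF fg] by auto
      have "phi g \<bullet> fst x = phi f \<bullet> snd x"
        by (rule adj) (use fg L in \<open>auto simp: lft_phi_iff\<close>)
      moreover have "phi g \<bullet> fst x = phi g \<bullet> phi h0"
        using Ei_inner[OF L(2), of "fst x"] h0(2) by (simp add: inner_commute)
      ultimately show ?thesis using L h0 k0 sk by (simp add: phi_inner)
    qed
    have "(h0, k0) \<in> A"
    proof (rule nonneg_sa_memI[OF h0(1) k0(1)])
      fix f g assume fg: "(f, g) \<in> A"
      \<comment> \<open>The real inner product gives real parts only; the imaginary parts are the
        real parts for i f and i g.\<close>
      have "Im (ip S g h0) = Im (ip S f k0)"
        using re[OF nonneg_sa_mult[OF fg, of \<i>]] by (simp add: ip_mult_left)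
      with re[OF fg] show "ip S g h0 = ip S f k0" by (simp add: complex_eq_iff)
    qed
    then show "x \<in> lft A" unfolding lft_def using h0(2) sk by (cases x) auto
  next
    fix x assume "x \<in> lft A"
    then obtain h k where hk: "(h, k) \<in> A" "Ei (fst x) = phi h" "snd x = phi k" unfolding lft_def by auto
    have "g \<bullet> fst x = f \<bullet> snd x" if "(f, g) \<in> lft A" for f g
    proof -
      from that obtain f' g' where fg: "(f', g') \<in> A" "Ei f = phi f'" "g = phi g'" unfolding lft_def by auto
      have "g \<bullet> fst x = Re (ip S g' h)" by (rule inn[OF fg(1) hk(1) fg(3) hk(2)])
      moreover have "snd x \<bullet> f = Re (ip S k f')" by (rule inn[OF hk(1) fg(1) hk(3) fg(2)])
      ultimately show ?thesis using nonneg_sa_sym[OF fg(1) hk(1)] nonneg_sa_sym[OF hk(1) fg(1)]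
          phi_inner[of f' k] phi_inner[of k f'] nonneg_sa_L2[OF fg(1)] nonneg_sa_L2[OF hk(1)]
        by (simp add: inner_commute)
    qed
    then show "x \<in> hadj (lft A)" unfolding hadj_def by (cases x) auto
  qed
  show "y = 0" if "(0, y) \<in> lft A" for y
  proof -
    from that obtain f h where fh: "(f, h) \<in> A" "phi f = 0" "y = phi h"
      unfolding lft_def by (auto simp: linear_simps[OF Ei_bl])
    have L: "L2 S f" "L2 S h" using nonneg_sa_L2[OF fh(1)] by auto
    have "aeq S (\<lambda>_. 0) f" using fh(2) L L2_zero phi_eq_iff phi_zero by metis
    then have "(f, (\<lambda>_. 0)) \<in> A" by (intro nonneg_sa_aeq[OF nonneg_sa_zero]) (auto intro: L L2_zero)
    with fh(1) have "aeq S h (\<lambda>_. 0)" using A unfolding nonneg_sa_def by blast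
    then show ?thesis using fh(3) L L2_zero phi_eq_iff phi_zero by metis
  qed
  show "\<forall>(f, g)\<in>lft A. 0 \<le> g \<bullet> f"
  proof clarify
    fix x y assume "(x, y) \<in> lft A"
    then obtain f h where fh: "(f, h) \<in> A" "Ei x = phi f" "y = phi h" unfolding lft_def by auto
    have "y \<bullet> x = Re (ip S h f)" by (rule inn[OF fh(1) fh(1) fh(3) fh(2)])
    then show "0 \<le> y \<bullet> x" using A fh(1) unfolding nonneg_sa_def by auto
  qed
qed

lemma lft_Ei: "(x, y) \<in> lft A \<Longrightarrow> (Ei x, Ei y) \<in> lft A"
  unfolding lft_def using Ei_Ei Ei_phi nonneg_sa_L2 by fastforce

lemma lft_Ji: "(x, y) \<in> lft A \<Longrightarrow> (Ji x, Ji y) \<in> lft A"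
proof -
  assume "(x, y) \<in> lft A"
  then obtain f h where fh: "(f, h) \<in> A" "Ei x = phi f" "y = phi h" unfolding lft_def by auto
  have "Ei (Ji x) = phi (\<lambda>x. \<i> * f x)" "Ji y = phi (\<lambda>x. \<i> * h x)"
    using fh nonneg_sa_L2[OF fh(1)] by (simp_all add: Ei_Ji Ji_phi)
  then show ?thesis unfolding lft_def using nonneg_sa_mult[OF fh(1), of \<i>] by blast
qed

end

lemma lft_rcomp:
  assumes R: "nonneg_sa S R" and RR: "rcomp R R = A"
  shows "lft R O lft R = lft A"
proof (intro equalityI subsetI)
  fix v assume "v \<in> lft R O lft R"
  then obtain x y z where v: "v = (x, z)" "(x, y) \<in> lft R" "(y, z) \<in> lft R" by auto
  then obtain f g g' h where *: "(f, g) \<in> R" "Ei x = phi f" "y = phi g" "(g', h) \<in> R" "Ei y = phi g'" "z = phi h"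
    unfolding lft_def by auto
  have L: "L2 S g" "L2 S g'" "L2 S h" using nonneg_sa_L2[OF R] * by auto
  have "aeq S g' g" using * L Ei_phi phi_eq_iff by metis
  then have "(g, h) \<in> R" using nonneg_sa_aeq[OF R *(4)] L by auto
  with *(1) have "(f, h) \<in> A" unfolding RR[symmetric] rcomp_def by blast
  then show "v \<in> lft A" unfolding v lft_def using * by auto
next
  fix v assume "v \<in> lft A"
  then obtain f h where *: "(f, h) \<in> A" "Ei (fst v) = phi f" "snd v = phi h" unfolding lft_def by auto
  then obtain g where g: "(f, g) \<in> R" "(g, h) \<in> R" unfolding RR[symmetric] rcomp_def by blast
  have "(fst v, phi g) \<in> lft R" "(phi g, snd v) \<in> lft R"
    using * g nonneg_sa_L2[OF R] Ei_phi unfolding lft_def by auto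
  then show "v \<in> lft R O lft R" by (cases v) auto
qed

text \<open>The root of the lifted graph is pulled back along \<open>phi\<close>. Commuting with
  \<open>Ei\<close> places its values in the image of \<open>phi\<close>, and commuting with
  \<open>Ji\<close> upgrades the equality of real parts to complex symmetry. Uniqueness follows by
  lifting a competitor.\<close>

lemma nonneg_sa_sqrt:
  assumes A: "nonneg_sa S A"
  shows "nonneg_sa S (opsqrt S A) \<and> rcomp (opsqrt S A) (opsqrt S A) = A"
proof -
  from nnsa_sqrt_ex1[OF nnsa_lft[OF A]] obtain R0 where R0: "nnsa R0" "R0 O R0 = lft A"
    and un: "\<And>R. nnsa R \<Longrightarrow> R O R = lft A \<Longrightarrow> R = R0" by blast
  have cE: "(Ei x, Ei y) \<in> R0" if "(x, y) \<in> R0" for x y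
    by (rule nnsa_sqrt_commute[OF nnsa_lft[OF A] R0 Ei_bl lft_Ei[OF A] that])
  have cJ: "(Ji x, Ji y) \<in> R0" if "(x, y) \<in> R0" for x y
    by (rule nnsa_sqrt_commute[OF nnsa_lft[OF A] R0 Ji_bl lft_Ji[OF A] that])
  \<comment> \<open>Where the lifted graph is zero its root is zero too: the value y there satisfies
    |y|^2 = 0 by symmetry.\<close>
  have ker: "(x - Ei x, 0) \<in> R0" for x
  proof -
    let ?z = "x - Ei x"
    have "Ei ?z = 0" by (simp add: linear_simps[OF Ei_bl] Ei_Ei)
    then have "(?z, 0) \<in> lft A" unfolding lft_def using nonneg_sa_zero[OF A] phi_zero by force
    then obtain y where y: "(?z, y) \<in> R0" "(y, 0) \<in> R0" unfolding R0(2)[symmetric] by blast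
    have "0 \<bullet> ?z = y \<bullet> y" by (rule nnsa_sym[OF R0(1) y(2,1)])
    with y show ?thesis by simp
  qed
  have ran: "Ei y = y" if "(x, y) \<in> R0" for x y
  proof -
    have "(x, Ei y) \<in> R0" using nnsa_add[OF R0(1) cE[OF that] ker[of x]] by simp
    from nnsa_unique[OF R0(1) that this] show ?thesis by simp
  qed
  define R where "R = {(f, h). L2 S f \<and> L2 S h \<and> (phi f, phi h) \<in> R0}"
  have "adj S R = R"
  proof (intro equalityI subsetI)
    fix v assume "v \<in> adj S R"
    then have L: "L2 S (fst v)" "L2 S (snd v)" and ad: "\<And>f g. (f, g) \<in> R \<Longrightarrow> ip S g (fst v) = ip S f (snd v)"
      unfolding adj_def by auto
    have "(phi (fst v), phi (snd v)) \<in> R0"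
    proof (rule nnsa_memI[OF R0(1)])
      fix x y assume xy: "(x, y) \<in> R0"
      obtain f where f: "L2 S f" "Ei x = phi f" using Ei_range by blast
      obtain g where g: "L2 S g" "y = phi g" using Ei_range ran[OF xy] by metis
      have "(f, g) \<in> R" using cE[OF xy] f g ran[OF xy] unfolding R_def by simp
      from ad[OF this] have "phi g \<bullet> phi (fst v) = phi f \<bullet> phi (snd v)" using f g L by (simp add: phi_inner)
      then show "y \<bullet> phi (fst v) = x \<bullet> phi (snd v)" using f g Ei_inner[OF L(2), of x] by simp
    qed
    then show "v \<in> R" using L unfolding R_def by (cases v) auto
  next
    fix v assume "v \<in> R"
    then have L: "L2 S (fst v)" "L2 S (snd v)" and v: "(phi (fst v), phi (snd v)) \<in> R0" unfolding R_def by auto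
    have "ip S g (fst v) = ip S f (snd v)" if "(f, g) \<in> R" for f g
    proof -
      from that have fg: "L2 S f" "L2 S g" "(phi f, phi g) \<in> R0" unfolding R_def by auto
      have "Re (ip S g (fst v)) = Re (ip S f (snd v))"
        using nnsa_sym[OF R0(1) fg(3) v] fg L by (simp add: phi_inner)
      moreover have "Re (ip S (\<lambda>x. \<i> * g x) (fst v)) = Re (ip S (\<lambda>x. \<i> * f x) (snd v))"
        using nnsa_sym[OF R0(1) cJ[OF fg(3)] v] fg L by (simp add: phi_inner Ji_phi L2_mult)
      ultimately show ?thesis by (simp add: ip_mult_left complex_eq_iff)
    qed
    then show "v \<in> adj S R" using L unfolding adj_def by (cases v) auto
  qed
  moreover have "aeq S g g'" if "(f, g) \<in> R" "(f, g') \<in> R" for f g g'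
    using that nnsa_unique[OF R0(1), of "phi f" "phi g" "phi g'"] phi_eq_iff unfolding R_def by auto
  moreover have "0 \<le> Re (ip S g f)" if "(f, g) \<in> R" for f g
    using that nnsa_nonneg[OF R0(1), of "phi f" "phi g"] by (auto simp: R_def phi_inner)
  ultimately have R: "nonneg_sa S R" unfolding nonneg_sa_def by fastforce
  have RR: "rcomp R R = A"
  proof (intro equalityI subsetI)
    fix v assume "v \<in> rcomp R R"
    then obtain g where g: "(fst v, g) \<in> R" "(g, snd v) \<in> R" unfolding rcomp_def by auto
    then have "(phi (fst v), phi (snd v)) \<in> R0 O R0" "L2 S (fst v)" "L2 S (snd v)" unfolding R_def by auto
    then have "(fst v, snd v) \<in> A" using lft_phi_iff[OF A] unfolding R0(2) by blast
    then show "v \<in> A" by simp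
  next
    fix v assume v: "v \<in> A"
    have L: "L2 S (fst v)" "L2 S (snd v)" using nonneg_sa_L2[OF A, of "fst v" "snd v"] v by auto
    have "(phi (fst v), phi (snd v)) \<in> R0 O R0" unfolding R0(2) using v L lft_phi_iff[OF A] by simp
    then obtain y where y: "(phi (fst v), y) \<in> R0" "(y, phi (snd v)) \<in> R0" by blast
    obtain g where g: "L2 S g" "y = phi g" using Ei_range ran[OF y(1)] by metis
    have "(fst v, g) \<in> R" "(g, snd v) \<in> R" using y g L unfolding R_def by auto
    then show "v \<in> rcomp R R" unfolding rcomp_def by (cases v) auto
  qed
  have uniq: "R' = R" if "nonneg_sa S R'" "rcomp R' R' = A" for R'
  proof -
    have "lft R' = R0" by (rule un[OF nnsa_lft[OF that(1)] lft_rcomp[OF that]])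
    then have "(f, h) \<in> R' \<longleftrightarrow> (f, h) \<in> R" for f h
      using lft_phi_iff[OF that(1), of f h] nonneg_sa_L2[OF that(1), of f h] unfolding R_def by auto
    then show ?thesis by auto
  qed
  have "opsqrt S A = R" unfolding opsqrt_def
  proof (rule the_equality)
    show "nonneg_sa S R \<and> rcomp R R = A" using R RR by blast
    show "R' = R" if "nonneg_sa S R' \<and> rcomp R' R' = A" for R' using uniq[of R'] that by blast
  qed
  then show ?thesis using R RR by simp
qed

lemma op_le_iff_form:
  assumes A1: "nonneg_sa S A1" and A2: "nonneg_sa S A2"
  shows "op_le S A1 A2 \<longleftrightarrow>
    (\<forall>(f, k)\<in>A2. \<forall>(g, k')\<in>A1. 2 * Re (ip S f k') - Re (ip S k' g) \<le> Re (ip S k f))"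
proof -
  define R1 where "R1 = opsqrt S A1"
  define R2 where "R2 = opsqrt S A2"
  have R1: "nonneg_sa S R1" "rcomp R1 R1 = A1" and R2: "nonneg_sa S R2" "rcomp R2 R2 = A2"
    using nonneg_sa_sqrt A1 A2 unfolding R1_def R2_def by auto
  note main = nnsa_sqrt_le_iff[OF nnsa_lft[OF A1] nnsa_lft[OF A2] nnsa_lft[OF R1(1)] lft_rcomp[OF R1]
      nnsa_lft[OF R2(1)] lft_rcomp[OF R2]]
  have DomR: "x \<in> Domain (lft R) \<longleftrightarrow> (\<exists>f. f \<in> Dom R \<and> Ei x = phi f)" for x R
    unfolding lft_def Dom_def by auto
  have d: "Domain (lft R2) \<subseteq> Domain (lft R1) \<longleftrightarrow> Dom R2 \<subseteq> Dom R1"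
  proof
    assume sub: "Domain (lft R2) \<subseteq> Domain (lft R1)"
    show "Dom R2 \<subseteq> Dom R1"
    proof
      fix f assume f: "f \<in> Dom R2"
      then have L: "L2 S f" using nonneg_sa_L2[OF R2(1)] unfolding Dom_def by auto
      have "phi f \<in> Domain (lft R2)" unfolding DomR using f Ei_phi[OF L] by auto
      then have "phi f \<in> Domain (lft R1)" using sub by blast
      then obtain f' where f': "f' \<in> Dom R1" "phi f = phi f'" unfolding DomR using Ei_phi[OF L] by auto
      then obtain g where g: "(f', g) \<in> R1" unfolding Dom_def by auto
      have L': "L2 S f'" "L2 S g" using nonneg_sa_L2[OF R1(1) g] by auto
      have "aeq S f' f" using f'(2) phi_eq_iff L L' by metis
      then have "(f, g) \<in> R1" by (intro nonneg_sa_aeq[OF R1(1) g L L'(2)]) auto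
      then show "f \<in> Dom R1" unfolding Dom_def by auto
    qed
  next
    assume "Dom R2 \<subseteq> Dom R1"
    then show "Domain (lft R2) \<subseteq> Domain (lft R1)" using DomR by blast
  qed
  have n: "(\<forall>f g g'. (f, g) \<in> lft R2 \<longrightarrow> (f, g') \<in> lft R1 \<longrightarrow> norm g' \<le> norm g) \<longleftrightarrow>
     (\<forall>f g g'. (f, g) \<in> R2 \<longrightarrow> (f, g') \<in> R1 \<longrightarrow> nrm S g' \<le> nrm S g)" (is "?a \<longleftrightarrow> ?b")
  proof
    assume a: ?a
    show ?b
    proof (intro allI impI)
      fix f g g' assume fg: "(f, g) \<in> R2" "(f, g') \<in> R1"
      then have L: "L2 S f" "L2 S g" "L2 S g'" using nonneg_sa_L2[OF R1(1)] nonneg_sa_L2[OF R2(1)] by auto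
      have "(phi f, phi g) \<in> lft R2" "(phi f, phi g') \<in> lft R1"
        using fg L lft_phi_iff[OF R1(1)] lft_phi_iff[OF R2(1)] by auto
      with a have "norm (phi g') \<le> norm (phi g)" by blast
      then show "nrm S g' \<le> nrm S g" using L by (simp add: phi_norm)
    qed
  next
    assume b: ?b
    show ?a
    proof (intro allI impI)
      fix x y y' assume "(x, y) \<in> lft R2" "(x, y') \<in> lft R1"
      then obtain f g f' g' where *: "(f, g) \<in> R2" "Ei x = phi f" "y = phi g" "(f', g') \<in> R1" "Ei x = phi f'" "y' = phi g'"
        unfolding lft_def by auto
      then have L: "L2 S f" "L2 S f'" "L2 S g" "L2 S g'" using nonneg_sa_L2[OF R1(1)] nonneg_sa_L2[OF R2(1)] by auto
      have "aeq S f' f" using * L phi_eq_iff by metis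
      then have "(f, g') \<in> R1" by (intro nonneg_sa_aeq[OF R1(1) *(4) L(1,4)]) auto
      with b *(1) have "nrm S g' \<le> nrm S g" by blast
      then show "norm y' \<le> norm y" using * L by (simp add: phi_norm)
    qed
  qed
  have r: "(\<forall>(f, k)\<in>lft A2. \<forall>(g, k')\<in>lft A1. 2 * (f \<bullet> k') - k' \<bullet> g \<le> k \<bullet> f) \<longleftrightarrow>
    (\<forall>(f, k)\<in>A2. \<forall>(g, k')\<in>A1. 2 * Re (ip S f k') - Re (ip S k' g) \<le> Re (ip S k f))" (is "?c \<longleftrightarrow> ?d")
  proof
    assume c: ?c
    show ?d
    proof clarify
      fix f k g k' assume fk: "(f, k) \<in> A2" "(g, k') \<in> A1"
      then have L: "L2 S f" "L2 S k" "L2 S g" "L2 S k'" using nonneg_sa_L2[OF A1] nonneg_sa_L2[OF A2] by auto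
      have "(phi f, phi k) \<in> lft A2" "(phi g, phi k') \<in> lft A1"
        using fk L lft_phi_iff[OF A1] lft_phi_iff[OF A2] by auto
      with c have "2 * (phi f \<bullet> phi k') - phi k' \<bullet> phi g \<le> phi k \<bullet> phi f" by blast
      then show "2 * Re (ip S f k') - Re (ip S k' g) \<le> Re (ip S k f)" using L by (simp add: phi_inner)
    qed
  next
    assume dd: ?d
    show ?c
    proof clarify
      fix x y x' y' assume "(x, y) \<in> lft A2" "(x', y') \<in> lft A1"
      then obtain f k g k' where *: "(f, k) \<in> A2" "Ei x = phi f" "y = phi k" "(g, k') \<in> A1" "Ei x' = phi g" "y' = phi k'"
        unfolding lft_def by auto
      then have L: "L2 S f" "L2 S k" "L2 S g" "L2 S k'" using nonneg_sa_L2[OF A1] nonneg_sa_L2[OF A2] by auto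
      have "x \<bullet> y' = phi f \<bullet> phi k'" "y' \<bullet> x' = phi k' \<bullet> phi g" "y \<bullet> x = phi k \<bullet> phi f"
        using Ei_inner[OF L(4), of x] Ei_inner[OF L(4), of x'] Ei_inner[OF L(2), of x] *
        by (simp_all add: inner_commute)
      moreover have "2 * Re (ip S f k') - Re (ip S k' g) \<le> Re (ip S k f)" using dd * by blast
      ultimately show "2 * (x \<bullet> y') - y' \<bullet> x' \<le> y \<bullet> x" using L by (simp add: phi_inner)
    qed
  qed
  show ?thesis unfolding op_le_def R1_def[symmetric] R2_def[symmetric] using main d n r by blast
qed

lemma nonneg_sa_zero_op: "nonneg_sa S (zero_op S)"
proof -
  have z: "ip S h (\<lambda>_. 0) = 0" for h by (simp add: ip_def)
  have "adj S (zero_op S) = zero_op S"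
  proof (intro equalityI subsetI)
    fix v assume v: "v \<in> adj S (zero_op S)"
    then have L: "L2 S (fst v)" "L2 S (snd v)" unfolding adj_def by auto
    have "(snd v, (\<lambda>_. 0)) \<in> zero_op S" using L L2_zero by (simp add: zero_op_def)
    with v have "ip S (\<lambda>_. 0) (fst v) = ip S (snd v) (snd v)" unfolding adj_def by auto
    then have "phi (snd v) \<bullet> phi (snd v) = 0" using L by (simp add: phi_inner) (simp add: ip_def)
    then have "aeq S (snd v) (\<lambda>_. 0)" using L L2_zero phi_eq_iff phi_zero by (metis inner_eq_zero_iff)
    then show "v \<in> zero_op S" using L unfolding zero_op_def by (cases v) auto
  next
    fix v assume "v \<in> zero_op S"
    then have L: "L2 S (fst v)" "L2 S (snd v)" "aeq S (snd v) (\<lambda>_. 0)" unfolding zero_op_def by auto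
    have "ip S g (fst v) = ip S f (snd v)" if "(f, g) \<in> zero_op S" for f g
    proof -
      have fg: "L2 S f" "L2 S g" "aeq S g (\<lambda>_. 0)" using that unfolding zero_op_def by auto
      have "ip S g (fst v) = ip S (\<lambda>_. 0) (fst v)" using fg L by (intro ip_cong) (auto intro: L2_zero)
      moreover have "ip S f (snd v) = ip S f (\<lambda>_. 0)" using fg L by (intro ip_cong) (auto intro: L2_zero)
      ultimately show ?thesis by (simp add: ip_def)
    qed
    then show "v \<in> adj S (zero_op S)" using L unfolding adj_def by (cases v) auto
  qed
  moreover have "aeq S g g'" if "(f, g) \<in> zero_op S" "(f, g') \<in> zero_op S" for f g g'
    using that aeq_trans aeq_sym unfolding zero_op_def by blast
  moreover have "0 \<le> Re (ip S g f)" if "(f, g) \<in> zero_op S" for f g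
  proof -
    have "ip S g f = ip S (\<lambda>_. 0) f" using that by (intro ip_cong) (auto simp: zero_op_def intro: L2_zero)
    then show ?thesis by (simp add: ip_def)
  qed
  ultimately show ?thesis unfolding nonneg_sa_def by fastforce
qed

lemma zero_op_le: "nonneg_sa S A \<Longrightarrow> op_le S (zero_op S) A"
  unfolding op_le_iff_form[OF nonneg_sa_zero_op]
proof clarify
  fix f k g k' assume A: "nonneg_sa S A" and fk: "(f, k) \<in> A" and z: "(g, k') \<in> zero_op S"
  have L: "L2 S f" "L2 S g" "L2 S k'" "aeq S k' (\<lambda>_. 0)"
    using nonneg_sa_L2[OF A fk] z unfolding zero_op_def by auto
  have "ip S f k' = ip S f (\<lambda>_. 0)" "ip S k' g = ip S (\<lambda>_. 0) g"
    using L by (auto intro!: ip_cong L2_zero)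
  moreover have "0 \<le> Re (ip S k f)" using A fk unfolding nonneg_sa_def by auto
  ultimately show "2 * Re (ip S f k') - Re (ip S k' g) \<le> Re (ip S k f)" by (simp add: ip_def)
qed

end

section \<open>Calculus of Lebesgue primitives\<close>

text \<open>Only c <= x is considered, so plain integrals over compact intervals suffice, and J may
  be any set of points. \<open>lprim_iff\<close> identifies it with \<open>lprim\<close> on the
  whole interval.\<close>

definition prim :: "real set \<Rightarrow> (real \<Rightarrow> 'a::{banach,second_countable_topology}) \<Rightarrow> (real \<Rightarrow> 'a) \<Rightarrow> bool" where
  "prim J F k \<longleftrightarrow> (\<forall>c\<in>J. \<forall>x\<in>J. c \<le> x \<longrightarrow>
     set_integrable lborel {c..x} k \<and> F x - F c = (LINT t:{c..x}|lborel. k t))"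

lemma primD: "prim J F k \<Longrightarrow> c \<in> J \<Longrightarrow> x \<in> J \<Longrightarrow> c \<le> x \<Longrightarrow>
  set_integrable lborel {c..x} k \<and> F x - F c = (LINT t:{c..x}|lborel. k t)"
  by (simp add: prim_def)

lemma prim_subset: "prim J F k \<Longrightarrow> K \<subseteq> J \<Longrightarrow> prim K F k"
  unfolding prim_def by blast

lemma set_integral_split:
  fixes k :: "real \<Rightarrow> 'a::{banach,second_countable_topology}"
  assumes "set_integrable lborel {c..x} k" "c \<le> y" "y \<le> x"
  shows "(LINT t:{c..x}|lborel. k t) = (LINT t:{c..y}|lborel. k t) + (LINT t:{y..x}|lborel. k t)"
proof -
  have e: "{c..x} = {c..y} \<union> {y..x}" using assms(2,3) by auto
  have i: "set_integrable lborel {c..y} k" "set_integrable lborel {y..x} k"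
    using assms by (auto intro: set_integrable_subset[OF assms(1)])
  show ?thesis unfolding e
    using AE_lborel_singleton[of y]
    by (intro set_integral_Un_AE[OF _ _ _ i]) (auto elim: eventually_mono)
qed

lemma prim_integral:
  assumes "set_integrable lborel {s..t} k"
  shows "prim {s..t} (\<lambda>x. LINT r:{s..x}|lborel. k r) k"
  unfolding prim_def
proof (intro ballI impI conjI)
  fix c x assume cx: "c \<in> {s..t}" "x \<in> {s..t}" "c \<le> x"
  then show "set_integrable lborel {c..x} k" by (auto intro: set_integrable_subset[OF assms])
  have "set_integrable lborel {s..x} k" using cx by (auto intro: set_integrable_subset[OF assms])
  from set_integral_split[OF this, of c] cx
  show "(LINT r:{s..x}|lborel. k r) - (LINT r:{s..c}|lborel. k r) = (LINT t:{c..x}|lborel. k t)" by simp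
qed

lemma prim_continuous_Icc:
  fixes F :: "real \<Rightarrow> 'a::euclidean_space"
  assumes "prim J F k" "c \<in> J" "d \<in> J" "is_interval J"
  shows "continuous_on {c..d} F"
proof (cases "c \<le> d")
  case True
  have i: "set_integrable lborel {c..d} k" using primD[OF assms(1-3) True] by blast
  have "k integrable_on {c..d}" by (rule set_borel_integral_eq_integral[OF i])
  then have "continuous_on {c..d} (\<lambda>x. F c + integral {c..x} k)"
    by (intro continuous_intros indefinite_integral_continuous_1)
  then show ?thesis
  proof (rule continuous_on_eq)
    fix x assume x: "x \<in> {c..d}"
    then have xJ: "x \<in> J" using assms mem_is_interval_1_I by (metis atLeastAtMost_iff)
    have "set_integrable lborel {c..x} k" "F x - F c = (LINT t:{c..x}|lborel. k t)"
      using primD[OF assms(1) assms(2) xJ] x by auto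
    then show "F c + integral {c..x} k = F x"
      using set_borel_integral_eq_integral(2)[of "{c..x}" k] by (simp add: algebra_simps)
  qed
qed simp

lemma prim_continuous_open:
  fixes F :: "real \<Rightarrow> 'a::euclidean_space"
  assumes F: "prim J F k" "is_interval J" and J: "open J"
  shows "continuous_on J F"
proof (rule continuous_at_imp_continuous_on, rule ballI)
  fix x assume "x \<in> J"
  then obtain e where e: "e > 0" "cball x e \<subseteq> J" using J open_contains_cball by blast
  have sub: "{x - e..x + e} \<subseteq> J" using e(2) by (simp add: cball_eq_atLeastAtMost)
  then have "continuous_on {x - e..x + e} F"
    by (intro prim_continuous_Icc[OF F(1) _ _ F(2)]) (use e(1) in auto)
  then show "isCont F x" by (rule continuous_on_interior) (use e(1) in simp)
qed

lemma prim_cong: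
  assumes "is_interval J" "prim J F k" "\<And>x. x \<in> J \<Longrightarrow> F x = F' x" "\<And>x. x \<in> J \<Longrightarrow> k x = k' x"
  shows "prim J F' k'"
  unfolding prim_def
proof (intro ballI impI)
  fix c x assume cx: "c \<in> J" "x \<in> J" "c \<le> x"
  then have e: "k t = k' t" if "t \<in> {c..x}" for t
    using assms(1,4) that mem_is_interval_1_I by (metis atLeastAtMost_iff)
  have "set_integrable lborel {c..x} k' = set_integrable lborel {c..x} k"
    by (rule set_integrable_cong) (auto simp: e)
  moreover have "(LINT t:{c..x}|lborel. k' t) = (LINT t:{c..x}|lborel. k t)"
    by (rule set_lebesgue_integral_cong) (auto simp: e)
  ultimately show "set_integrable lborel {c..x} k' \<and> F' x - F' c = (LINT t:{c..x}|lborel. k' t)"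
    using primD[OF assms(2) cx] assms(3) cx by simp
qed

lemma prim_add: "prim J F k \<Longrightarrow> prim J G l \<Longrightarrow> prim J (\<lambda>x. F x + G x) (\<lambda>x. k x + l x)"
  unfolding prim_def
proof (intro ballI impI)
  fix c x assume "\<forall>c\<in>J. \<forall>x\<in>J. c \<le> x \<longrightarrow> set_integrable lborel {c..x} k \<and> F x - F c = (LINT t:{c..x}|lborel. k t)"
    "\<forall>c\<in>J. \<forall>x\<in>J. c \<le> x \<longrightarrow> set_integrable lborel {c..x} l \<and> G x - G c = (LINT t:{c..x}|lborel. l t)"
    "c \<in> J" "x \<in> J" "c \<le> x"
  then have "set_integrable lborel {c..x} k" "F x - F c = (LINT t:{c..x}|lborel. k t)"
    "set_integrable lborel {c..x} l" "G x - G c = (LINT t:{c..x}|lborel. l t)" by auto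
  then show "set_integrable lborel {c..x} (\<lambda>x. k x + l x) \<and>
     F x + G x - (F c + G c) = (LINT t:{c..x}|lborel. k t + l t)" by (auto simp: algebra_simps)
qed

lemma prim_cmult:
  fixes c :: "'a::{real_normed_field,banach,second_countable_topology}"
  shows "prim J F k \<Longrightarrow> prim J (\<lambda>x. c * F x) (\<lambda>x. c * k x)"
  unfolding prim_def by (simp flip: right_diff_distrib)

lemma prim_const: "prim J (\<lambda>x. c) (\<lambda>x. 0)"
  unfolding prim_def by (simp add: set_integrable_def)

lemma prim_diff:
  fixes F :: "real \<Rightarrow> 'a::{real_normed_field,banach,second_countable_topology}"
  shows "prim J F k \<Longrightarrow> prim J G l \<Longrightarrow> prim J (\<lambda>x. F x - G x) (\<lambda>x. k x - l x)"
  using prim_add[of J F k "\<lambda>x. (-1) * G x" "\<lambda>x. (-1) * l x"] prim_cmult[of J G l "-1"] by simp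

lemma set_integrable_mult_cont:
  fixes k G :: "real \<Rightarrow> 'a::{euclidean_space,real_normed_field}"
  assumes k: "set_integrable lborel {c..x} k" and G: "continuous_on {c..x} G"
  shows "set_integrable lborel {c..x} (\<lambda>t. k t * G t)"
proof -
  have "bounded (G ` {c..x})" by (intro compact_imp_bounded compact_continuous_image G) simp
  then obtain B where B: "\<And>t. t \<in> {c..x} \<Longrightarrow> norm (G t) \<le> B" unfolding bounded_iff by blast
  have [measurable]: "(\<lambda>t. indicator {c..x} t *\<^sub>R k t) \<in> borel_measurable lborel"
    using k unfolding set_integrable_def by (rule borel_measurable_integrable)
  have [measurable]: "(\<lambda>t. indicator {c..x} t *\<^sub>R G t) \<in> borel_measurable borel"
    by (intro borel_measurable_continuous_on_indicator G) simp
  have "integrable lborel (\<lambda>t. \<bar>B\<bar> * norm (indicator {c..x} t *\<^sub>R k t))"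
    using k unfolding set_integrable_def by (intro integrable_mult_right integrable_norm)
  then have "integrable lborel (\<lambda>t. (indicator {c..x} t *\<^sub>R k t) * (indicator {c..x} t *\<^sub>R G t))"
  proof (rule Bochner_Integration.integrable_bound)
    show "AE t in lborel. norm ((indicator {c..x} t *\<^sub>R k t) * (indicator {c..x} t *\<^sub>R G t))
       \<le> norm (\<bar>B\<bar> * norm (indicator {c..x} t *\<^sub>R k t))"
    proof (rule AE_I2)
      fix t
      show "norm ((indicator {c..x} t *\<^sub>R k t) * (indicator {c..x} t *\<^sub>R G t))
         \<le> norm (\<bar>B\<bar> * norm (indicator {c..x} t *\<^sub>R k t))"
        using B[of t] by (auto simp: indicator_def norm_mult mult.commute intro!: mult_right_mono)
    qed
  qed measurable
  moreover have "(\<lambda>t. (indicator {c..x} t *\<^sub>R k t) * (indicator {c..x} t *\<^sub>R G t)) =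
      (\<lambda>t. indicator {c..x} t *\<^sub>R (k t * G t))"
    by (auto simp: indicator_def fun_eq_iff)
  ultimately show ?thesis by (simp add: set_integrable_def)
qed

text \<open>Fubini for k(t) l(s) on the square [c,x]^2, cut along the diagonal: the two terms on the
  left are the integrals over the two triangles.\<close>

lemma integral_product_rule:
  fixes k l :: "real \<Rightarrow> 'a::{euclidean_space,real_normed_field}"
  assumes k: "set_integrable lborel {c..x} k" and l: "set_integrable lborel {c..x} l"
  shows "(LINT t:{c..x}|lborel. k t * (LINT s:{c..t}|lborel. l s)) +
         (LINT t:{c..x}|lborel. (LINT s:{c..t}|lborel. k s) * l t)
       = (LINT t:{c..x}|lborel. k t) * (LINT t:{c..x}|lborel. l t)"
proof -
  define k' where "k' t = indicator {c..x} t *\<^sub>R k t" for t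
  define l' where "l' t = indicator {c..x} t *\<^sub>R l t" for t
  have ik: "integrable lborel k'" and il: "integrable lborel l'"
    using k l unfolding set_integrable_def k'_def[abs_def] l'_def[abs_def] by auto
  have [measurable]: "k' \<in> borel_measurable borel" "l' \<in> borel_measurable borel"
    using ik il by auto
  define f where "f t s = (if s \<le> t then 0 else k' t * l' s)" for t s
  have iF: "integrable (lborel \<Otimes>\<^sub>M lborel) (\<lambda>(t, s). k' t * l' s)"
  proof (rule lborel_pair.Fubini_integrable)
    show "integrable lborel (\<lambda>t. LINT s|lborel. norm (case (t, s) of (t, s) \<Rightarrow> k' t * l' s))"
      using ik by (simp add: norm_mult)
    show "AE t in lborel. integrable lborel (\<lambda>s. case (t, s) of (t, s) \<Rightarrow> k' t * l' s)"
      using il by simp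
  qed measurable
  have "integrable (lborel \<Otimes>\<^sub>M lborel) (\<lambda>(t, s). f t s)"
    by (rule Bochner_Integration.integrable_bound[OF iF]) (auto simp: f_def split_beta')
  then have ifs: "integrable (lborel \<Otimes>\<^sub>M lborel) (case_prod f)" by simp
  have l_int: "(LINT s:{c..t}|lborel. l s) = (LINT s|lborel. (if s \<le> t then l' s else 0))" if "t \<in> {c..x}" for t
    unfolding set_lebesgue_integral_def
    by (rule Bochner_Integration.integral_cong) (use that in \<open>auto simp: l'_def indicator_def\<close>)
  have k_int: "(LINT s:{c..t}|lborel. k s) = (LINT s|lborel. (if t \<le> s then 0 else k' s))" if "t \<in> {c..x}" for t
    unfolding set_lebesgue_integral_def
  proof (rule integral_cong_AE)
    show "(\<lambda>s. indicator {c..t} s *\<^sub>R k s) \<in> borel_measurable lborel"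
      using set_integrable_subset[OF k, of "{c..t}"] that unfolding set_integrable_def
      by (intro borel_measurable_integrable) auto
    have "AE s in lborel. s \<noteq> t" by (rule AE_lborel_singleton)
    then show "AE s in lborel. indicator {c..t} s *\<^sub>R k s = (if t \<le> s then 0 else k' s)"
      by eventually_elim (use that in \<open>auto simp: k'_def indicator_def\<close>)
  qed measurable
  have f_t: "(LINT s|lborel. f t s) + k' t * (LINT s:{c..t}|lborel. l s) = k' t * (LINT s|lborel. l' s)" for t
  proof (cases "t \<in> {c..x}")
    case True
    have i: "integrable lborel (\<lambda>s. if s \<le> t then l' s else 0)"
      by (rule Bochner_Integration.integrable_bound[OF il]) auto
    have i2: "integrable lborel (f t)"
      by (rule Bochner_Integration.integrable_bound[of _ "\<lambda>s. k' t * l' s"]) (auto simp: f_def[abs_def] il)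
    have "(LINT s|lborel. f t s) + k' t * (LINT s|lborel. (if s \<le> t then l' s else 0))
        = (LINT s|lborel. f t s + k' t * (if s \<le> t then l' s else 0))"
      using i i2 by simp
    also have "\<dots> = (LINT s|lborel. k' t * l' s)"
      by (rule Bochner_Integration.integral_cong) (auto simp: f_def)
    finally show ?thesis using l_int[OF True] by simp
  next
    case False
    then have "k' t = 0" by (simp add: k'_def)
    moreover from this have "f t = (\<lambda>s. 0)" by (auto simp: f_def fun_eq_iff)
    ultimately show ?thesis by simp
  qed
  have f_s: "(LINT t|lborel. f t s) = indicator {c..x} s *\<^sub>R ((LINT t:{c..s}|lborel. k t) * l s)" for s
  proof (cases "s \<in> {c..x}")
    case True
    have "(LINT t|lborel. f t s) = (LINT t|lborel. (if s \<le> t then 0 else k' t) * l' s)"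
      by (rule Bochner_Integration.integral_cong) (auto simp: f_def)
    also have "\<dots> = (LINT t|lborel. (if s \<le> t then 0 else k' t)) * l' s" by simp
    also have "\<dots> = (LINT t:{c..s}|lborel. k t) * l' s" using k_int[OF True] by simp
    finally show ?thesis using True by (simp add: l'_def)
  next
    case False
    then have "l' s = 0" by (simp add: l'_def)
    moreover from this have "(\<lambda>t. f t s) = (\<lambda>t. 0)" by (auto simp: f_def fun_eq_iff)
    ultimately show ?thesis using False by simp
  qed
  let ?L = "LINT s|lborel. l' s"
  have 1: "(LINT t:{c..x}|lborel. (LINT s:{c..t}|lborel. k s) * l t) = (LINT t|lborel. LINT s|lborel. f t s)"
    unfolding lborel_pair.Fubini_integral[OF ifs, symmetric] f_s set_lebesgue_integral_def ..
  have if': "integrable lborel (\<lambda>t. LINT s|lborel. f t s)" by (rule lborel_pair.integrable_fst[OF ifs])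
  have "(LINT t:{c..x}|lborel. k t * (LINT s:{c..t}|lborel. l s)) = (LINT t|lborel. k' t * (LINT s:{c..t}|lborel. l s))"
    unfolding set_lebesgue_integral_def[of lborel "{c..x}"]
    by (rule Bochner_Integration.integral_cong) (auto simp: k'_def)
  also have "\<dots> = (LINT t|lborel. k' t * ?L - (LINT s|lborel. f t s))"
    by (rule Bochner_Integration.integral_cong) (auto simp: f_t[symmetric])
  also have "\<dots> = (LINT t|lborel. k' t) * ?L - (LINT t|lborel. LINT s|lborel. f t s)"
    using ik if' by simp
  finally show ?thesis unfolding 1 by (simp add: set_lebesgue_integral_def k'_def l'_def)
qed

lemma prim_mult:
  fixes F G :: "real \<Rightarrow> 'a::{euclidean_space,real_normed_field}"
  assumes J: "is_interval J" and F: "prim J F k" and G: "prim J G l"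
  shows "prim J (\<lambda>x. F x * G x) (\<lambda>x. k x * G x + F x * l x)"
  unfolding prim_def
proof (intro ballI impI)
  fix c x assume cx: "c \<in> J" "x \<in> J" "c \<le> x"
  have sub: "t \<in> J" if "t \<in> {c..x}" for t using J cx that mem_is_interval_1_I by (metis atLeastAtMost_iff)
  have k: "set_integrable lborel {c..x} k" and l: "set_integrable lborel {c..x} l"
    and Fx: "F x - F c = (LINT t:{c..x}|lborel. k t)" and Gx: "G x - G c = (LINT t:{c..x}|lborel. l t)"
    using primD[OF F cx] primD[OF G cx] by auto
  have cF: "continuous_on {c..x} F" and cG: "continuous_on {c..x} G"
    using prim_continuous_Icc[OF F cx(1,2) J] prim_continuous_Icc[OF G cx(1,2) J] by auto
  have Ft: "(LINT s:{c..t}|lborel. k s) = F t - F c" and Gt: "(LINT s:{c..t}|lborel. l s) = G t - G c"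
    if "t \<in> {c..x}" for t
    using primD[OF F cx(1) sub[OF that]] primD[OF G cx(1) sub[OF that]] that by auto
  have kG: "set_integrable lborel {c..x} (\<lambda>t. k t * G t)" by (rule set_integrable_mult_cont[OF k cG])
  have Fl: "set_integrable lborel {c..x} (\<lambda>t. F t * l t)"
    using set_integrable_mult_cont[OF l cF] by (simp add: mult.commute)
  have "(LINT t:{c..x}|lborel. k t * (LINT s:{c..t}|lborel. l s)) = (LINT t:{c..x}|lborel. k t * G t - k t * G c)"
    by (rule set_lebesgue_integral_cong) (auto simp: Gt algebra_simps)
  also have "\<dots> = (LINT t:{c..x}|lborel. k t * G t) - (F x - F c) * G c"
    using kG k Fx by simp
  finally have 1: "(LINT t:{c..x}|lborel. k t * (LINT s:{c..t}|lborel. l s)) = (LINT t:{c..x}|lborel. k t * G t) - (F x - F c) * G c" .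
  have "(LINT t:{c..x}|lborel. (LINT s:{c..t}|lborel. k s) * l t) = (LINT t:{c..x}|lborel. F t * l t - F c * l t)"
    by (rule set_lebesgue_integral_cong) (auto simp: Ft algebra_simps)
  also have "\<dots> = (LINT t:{c..x}|lborel. F t * l t) - F c * (G x - G c)"
    using Fl l Gx by simp
  finally have 2: "(LINT t:{c..x}|lborel. (LINT s:{c..t}|lborel. k s) * l t) = (LINT t:{c..x}|lborel. F t * l t) - F c * (G x - G c)" .
  have "(LINT t:{c..x}|lborel. k t * G t + F t * l t) = F x * G x - F c * G c"
    using integral_product_rule[OF k l] kG Fl unfolding 1 2 Fx[symmetric] Gx[symmetric]
    by (simp add: algebra_simps)
  then show "set_integrable lborel {c..x} (\<lambda>t. k t * G t + F t * l t) \<and>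
    F x * G x - F c * G c = (LINT t:{c..x}|lborel. k t * G t + F t * l t)"
    using kG Fl by simp
qed

lemma prim_power:
  fixes P :: "real \<Rightarrow> 'a::{euclidean_space,real_normed_field}"
  assumes "is_interval J" "prim J P m"
  shows "prim J (\<lambda>x. P x ^ Suc n) (\<lambda>x. of_nat (Suc n) * (m x * P x ^ n))"
proof (induction n)
  case 0 show ?case using assms(2) by simp
next
  case (Suc n)
  show ?case
    by (rule prim_cong[OF assms(1) prim_mult[OF assms(1) assms(2) Suc]]) (auto simp: algebra_simps)
qed

text \<open>Iterated Gronwall estimate: with P the primitive of |m| from s and M a bound for E,
  induction gives |E| <= M P^n / n! for every n, and the right side tends to 0.\<close>

lemma linear_ode_zero:
  fixes E :: "real \<Rightarrow> 'a::{euclidean_space,real_normed_field}"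
  assumes E: "prim {s..t} E (\<lambda>x. m x * E x)" and E0: "E s = 0"
    and m: "set_integrable lborel {s..t} m" and x: "x \<in> {s..t}"
  shows "E x = 0"
proof -
  define \<mu> where "\<mu> r = norm (m r)" for r
  have \<mu>: "set_integrable lborel {s..t} \<mu>"
  proof -
    have "integrable lborel (\<lambda>x. norm (indicator {s..t} x *\<^sub>R m x))"
      using m unfolding set_integrable_def by (rule integrable_norm)
    then show ?thesis by (simp add: set_integrable_def \<mu>_def)
  qed
  define P where "P y = (LINT r:{s..y}|lborel. \<mu> r)" for y
  have P: "prim {s..t} P \<mu>" unfolding P_def by (rule prim_integral[OF \<mu>])
  have Ps: "P s = 0" using primD[OF P, of s s] x by (simp add: P_def set_lebesgue_integral_def)
  have st: "s \<in> {s..t}" "t \<in> {s..t}" "s \<le> t" using x by auto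
  have cE: "continuous_on {s..t} E" by (rule prim_continuous_Icc[OF E st(1,2)]) simp
  have "bounded (E ` {s..t})" by (intro compact_imp_bounded compact_continuous_image cE) simp
  then obtain M where M: "\<And>y. y \<in> {s..t} \<Longrightarrow> norm (E y) \<le> M" unfolding bounded_iff by blast
  have bound: "norm (E y) \<le> M * (P y ^ n / fact n)" if "y \<in> {s..t}" for n y
    using that
  proof (induction n arbitrary: y)
    case 0 then show ?case using M by simp
  next
    case (Suc n)
    have sy: "s \<in> {s..t}" "y \<in> {s..t}" "s \<le> y" using Suc.prems by auto
    have i1: "set_integrable lborel {s..y} (\<lambda>x. m x * E x)" and e1: "E y = (LINT r:{s..y}|lborel. m r * E r)"
      using primD[OF E sy] E0 by auto
    have i2: "set_integrable lborel {s..y} (\<lambda>x. real (Suc n) * (\<mu> x * P x ^ n))"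
      and e2: "P y ^ Suc n = (LINT r:{s..y}|lborel. real (Suc n) * (\<mu> r * P r ^ n))"
      using primD[OF prim_power[OF _ P, of n] sy] Ps by auto
    have i3: "set_integrable lborel {s..y} (\<lambda>x. \<mu> x * P x ^ n)" using i2 by (simp del: of_nat_Suc)
    have "norm (E y) \<le> (LINT r:{s..y}|lborel. norm (m r * E r))"
      unfolding e1 using i1 by (rule set_integral_norm_bound)
    also have "\<dots> \<le> (LINT r:{s..y}|lborel. (\<mu> r * P r ^ n) * (M / fact n))"
    proof (rule set_integral_mono)
      show "set_integrable lborel {s..y} (\<lambda>r. norm (m r * E r))"
        using i1 unfolding set_integrable_def by (auto dest: integrable_norm)
      show "set_integrable lborel {s..y} (\<lambda>r. (\<mu> r * P r ^ n) * (M / fact n))" using i3 by simp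
      fix r assume "r \<in> {s..y}"
      then have "norm (E r) \<le> M * (P r ^ n / fact n)" using Suc.prems by (intro Suc.IH) auto
      then have "norm (m r) * norm (E r) \<le> norm (m r) * (M * (P r ^ n / fact n))" by (rule mult_left_mono) simp
      then show "norm (m r * E r) \<le> (\<mu> r * P r ^ n) * (M / fact n)"
        by (simp add: norm_mult \<mu>_def mult_ac)
    qed
    also have "\<dots> = (LINT r:{s..y}|lborel. \<mu> r * P r ^ n) * (M / fact n)" by simp
    also have "(LINT r:{s..y}|lborel. \<mu> r * P r ^ n) = P y ^ Suc n / real (Suc n)"
      unfolding e2 by (simp del: of_nat_Suc)
    finally show ?case by (simp add: mult_ac)
  qed
  have "(\<lambda>n. M * (P x ^ n / fact n)) \<longlonglongrightarrow> M * 0"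
    using summable_LIMSEQ_zero[OF summable_exp[of "P x"]]
    by (intro tendsto_mult_left) (simp add: divide_inverse mult.commute)
  then have "norm (E x) \<le> M * 0" by (rule LIMSEQ_le_const) (use bound[OF x] in auto)
  then show ?thesis by simp
qed

text \<open>The indefinite integral of m vanishes on all half lines, which generate the Borel sets
  and are stable under intersection; so it vanishes on every Borel set and m is zero almost
  everywhere.\<close>

lemma AE_zero_if_integrals_zero:
  fixes m :: "real \<Rightarrow> 'a::{banach,second_countable_topology}"
  assumes m: "set_integrable lborel {c..d} m" and z: "\<And>x. x \<in> {c..d} \<Longrightarrow> (LINT t:{c..x}|lborel. m t) = 0"
  shows "AE x in lborel. x \<in> {c..d} \<longrightarrow> m x = 0"
proof (cases "c \<le> d")
  case True
  define m' where "m' x = indicator {c..d} x *\<^sub>R m x" for x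
  have im: "integrable lborel m'" using m unfolding set_integrable_def m'_def[abs_def] .
  have im': "set_integrable lborel A m'" if "A \<in> sets borel" for A
    unfolding set_integrable_def using integrable_mult_indicator[of A lborel m'] im that by simp
  have tot: "(LINT x|lborel. m' x) = 0" using z[of d] True by (simp add: m'_def set_lebesgue_integral_def)
  have "set_lebesgue_integral lborel A m' = 0" if "A \<in> sets lborel" for A
  proof -
    have A: "A \<in> sigma_sets UNIV (range (\<lambda>a::real. {..a}))"
      using that by (simp add: borel_eq_atMost)
    have int: "Int_stable (range (\<lambda>a::real. {..a}))" by (auto simp: Int_stable_def)
    have sub: "range (\<lambda>a::real. {..a}) \<subseteq> Pow UNIV" by simp
    show ?thesis
      using int sub A
    proof (induction rule: sigma_sets_induct_disjoint)
      case (basic A)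
      then obtain a where A: "A = {..a}" by auto
      have e: "(LINT x:A|lborel. m' x) = (LINT x:{c..min a d}|lborel. m x)"
        unfolding set_lebesgue_integral_def A m'_def
        by (rule Bochner_Integration.integral_cong) (auto simp: indicator_def)
      show ?case
      proof (cases "c \<le> a")
        case True then show ?thesis unfolding e using z[of "min a d"] \<open>c \<le> d\<close> by auto
      next
        case False then show ?thesis unfolding e by (simp add: set_lebesgue_integral_def)
      qed
    next
      case empty show ?case by (simp add: set_lebesgue_integral_def)
    next
      case (compl A)
      then have A: "A \<in> sets borel" by (simp add: borel_eq_atMost)
      have "(LINT x:A \<union> (UNIV - A)|lborel. m' x) = (LINT x:A|lborel. m' x) + (LINT x:UNIV - A|lborel. m' x)"
        by (rule set_integral_Un) (use A in \<open>auto intro!: im'\<close>)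
      then show ?case using compl tot by (simp add: set_lebesgue_integral_def)
    next
      case (union A)
      have A: "A i \<in> sets borel" for i using union(2) by (auto simp: borel_eq_atMost)
      have "(LINT x:(\<Union>i. A i)|lborel. m' x) = (\<Sum>i. (LINT x:(A i)|lborel. m' x))"
        by (rule lebesgue_integral_countable_add)
          (use A union(1) in \<open>auto simp: disjoint_family_on_def intro!: im'\<close>)
      then show ?case using union(3) by simp
    qed
  qed
  then have "AE x in lborel. m' x = 0" by (intro sigma_finite_measure.density_zero[OF lborel.sigma_finite_measure_axioms im])
  then show ?thesis by eventually_elim (auto simp: m'_def)
qed simp

lemma continuous_AE_eq:
  fixes f g :: "real \<Rightarrow> 'a::real_normed_vector"
  assumes U: "open U" and f: "continuous_on U f" and g: "continuous_on U g"
    and AE: "AE x in lborel. x \<in> U \<longrightarrow> f x = g x" and x: "x \<in> U"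
  shows "f x = g x"
proof (rule ccontr)
  assume ne: "f x \<noteq> g x"
  let ?V = "U \<inter> (\<lambda>x. f x - g x) -` (- {0})"
  have V: "open ?V" by (intro continuous_open_preimage continuous_on_diff f g U) auto
  have "{x \<in> space lborel. \<not> (x \<in> U \<longrightarrow> f x = g x)} = ?V" by auto
  then have "emeasure lborel ?V = 0" using AE V AE_iff_measurable[of ?V lborel] by simp
  then have "?V \<in> null_sets lborel" using V by (simp add: null_sets_def)
  then have "negligible ?V" by (simp add: negligible_iff_null_sets null_sets_completionI)
  moreover have "?V \<noteq> {}" using x ne by auto
  ultimately show False using open_not_negligible[OF V] by blast
qed

lemma prim_AE_unique:
  fixes k k' :: "real \<Rightarrow> 'a::{banach,second_countable_topology}"
  assumes "prim J F k" "prim J F k'" "c \<in> J" "d \<in> J" "is_interval J"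
  shows "AE x in lborel. x \<in> {c..d} \<longrightarrow> k x = k' x"
proof (cases "c \<le> d")
  case True
  have i: "set_integrable lborel {c..d} k" "set_integrable lborel {c..d} k'"
    using primD[OF assms(1,3,4) True] primD[OF assms(2,3,4) True] by auto
  have "AE x in lborel. x \<in> {c..d} \<longrightarrow> k x - k' x = 0"
  proof (rule AE_zero_if_integrals_zero)
    show "set_integrable lborel {c..d} (\<lambda>x. k x - k' x)" using i by simp
    fix x assume x: "x \<in> {c..d}"
    then have xJ: "x \<in> J" using assms mem_is_interval_1_I by (metis atLeastAtMost_iff)
    show "(LINT t:{c..x}|lborel. k t - k' t) = 0"
      using primD[OF assms(1,3) xJ] primD[OF assms(2,3) xJ] x by simp
  qed
  then show ?thesis by eventually_elim auto
qed simp

section \<open>Solutions of the Sturm--Liouville equation\<close>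

context sturm_liouville
begin

lemma sI_open: "open (sI S)" by (simp add: sI_def)

lemma sI_interval: "is_interval (sI S)"
  unfolding is_interval_1 sI_def
proof (intro ballI allI impI)
  fix a b x assume "a \<in> einterval (sa S) (sb S)" "b \<in> einterval (sa S) (sb S)" "a \<le> x \<and> x \<le> b"
  then have "sa S < ereal a" "ereal a \<le> ereal x" "ereal x \<le> ereal b" "ereal b < sb S"
    by (auto simp: einterval_iff)
  then show "x \<in> einterval (sa S) (sb S)"
    unfolding einterval_iff using less_le_trans le_less_trans by blast
qed

lemma sI_mid: "c \<in> sI S \<Longrightarrow> d \<in> sI S \<Longrightarrow> c \<le> x \<Longrightarrow> x \<le> d \<Longrightarrow> x \<in> sI S"
  using sI_interval mem_is_interval_1_I by metis

lemma sI_ex: "\<exists>c. c \<in> sI S"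
  using einterval_nonempty std unfolding sl_standard_def sI_def by blast

lemma set_integrable_Ioo_Icc:
  "set_integrable lborel {c<..<x} k \<longleftrightarrow> set_integrable lborel {c..x::real} (k :: real \<Rightarrow> complex)"
  by (rule set_integrable_discrete_difference[where X = "{c, x}"]) auto

lemma lprim_iff: "lprim S F k \<longleftrightarrow> prim (sI S) F k"
proof
  assume l: "lprim S F k"
  show "prim (sI S) F k" unfolding prim_def
  proof (intro ballI impI)
    fix c x assume cx: "c \<in> sI S" "x \<in> sI S" "c \<le> x"
    with l have "interval_lebesgue_integrable lborel (ereal c) (ereal x) k"
      "F x - F c = interval_lebesgue_integral lborel (ereal c) (ereal x) k" unfolding lprim_def by auto
    then show "set_integrable lborel {c..x} k \<and> F x - F c = (LINT t:{c..x}|lborel. k t)"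
      using cx(3) by (simp add: interval_lebesgue_integrable_def set_integrable_Ioo_Icc interval_integral_Icc)
  qed
next
  assume p: "prim (sI S) F k"
  have le: "interval_lebesgue_integrable lborel (ereal c) (ereal x) k \<and>
     F x - F c = interval_lebesgue_integral lborel (ereal c) (ereal x) k" if "c \<in> sI S" "x \<in> sI S" "c \<le> x" for c x
    using primD[OF p that] that(3)
    by (simp add: interval_lebesgue_integrable_def set_integrable_Ioo_Icc interval_integral_Icc)
  show "lprim S F k" unfolding lprim_def
  proof (intro ballI)
    fix c x assume cx: "c \<in> sI S" "x \<in> sI S"
    show "interval_lebesgue_integrable lborel (ereal c) (ereal x) k \<and>
       F x - F c = interval_lebesgue_integral lborel (ereal c) (ereal x) k"
    proof (cases "c \<le> x")
      case True then show ?thesis using le cx by blast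
    next
      case False
      then have "x \<le> c" by simp
      from le[OF cx(2,1) this] show ?thesis
        using interval_integrable_endpoints_reverse[of "ereal c" "ereal x" k]
          interval_integral_endpoints_reverse[of "ereal c" "ereal x" k]
        by (simp add: algebra_simps)
    qed
  qed
qed

lemma qrel_iff: "qrel S g g1 h \<longleftrightarrow>
   prim (sI S) g (\<lambda>t. g1 t / complex_of_real (sp S t)) \<and>
   prim (sI S) g1 (\<lambda>t. complex_of_real (sq S t) * g t - complex_of_real (sr S t) * h t)"
  by (simp add: qrel_def lprim_iff)

lemma qrel_continuous:
  assumes "qrel S g g1 h"
  shows "continuous_on (sI S) g" "continuous_on (sI S) g1"
  using assms unfolding qrel_iff by (auto intro: prim_continuous_open sI_interval sI_open)

lemma sp_pos: "AE x in lborel. x \<in> sI S \<longrightarrow> sp S x > 0"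
  using std by (simp add: sl_standard_def)

lemma loc_integrable:
  assumes "c \<in> sI S" "d \<in> sI S"
  shows "set_integrable lborel {c..d} (\<lambda>x. 1 / sp S x)" "set_integrable lborel {c..d} (sq S)"
    "set_integrable lborel {c..d} (sr S)"
  using std assms by (auto simp: sl_standard_def)

lemma sI_sequences:
  obtains l u :: "nat \<Rightarrow> real" where "\<And>n. l n \<in> sI S" "\<And>n. u n \<in> sI S" "decseq l" "incseq u"
    "\<And>x. x \<in> sI S \<Longrightarrow> \<exists>N. \<forall>n\<ge>N. l n < x" "\<And>x. x \<in> sI S \<Longrightarrow> \<exists>N. \<forall>n\<ge>N. x < u n"
proof -
  have lt: "sa S < sb S" using std by (simp add: sl_standard_def)
  obtain u l :: "nat \<Rightarrow> real" where *: "einterval (sa S) (sb S) = (\<Union>i. {l i .. u i})"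
    "incseq u" "decseq l" "\<And>i. l i < u i" "\<And>i. sa S < l i" "\<And>i. u i < sb S"
    "(\<lambda>i. ereal (l i)) \<longlonglongrightarrow> sa S" "(\<lambda>i. ereal (u i)) \<longlonglongrightarrow> sb S"
    by (rule einterval_Icc_approximation[OF lt], rule that; assumption)
  have lu: "l i \<in> sI S \<and> u i \<in> sI S" for i
  proof -
    have "{l i..u i} \<subseteq> sI S" unfolding sI_def *(1) by blast
    then show ?thesis using *(4)[of i] by auto
  qed
  have 1: "\<exists>N. \<forall>n\<ge>N. l n < x" if "x \<in> sI S" for x
  proof -
    have "sa S < ereal x" using that by (simp add: sI_def einterval_iff)
    from order_tendstoD(2)[OF *(7) this] show ?thesis by (simp add: eventually_sequentially)
  qed
  have 2: "\<exists>N. \<forall>n\<ge>N. x < u n" if "x \<in> sI S" for x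
  proof -
    have "ereal x < sb S" using that by (simp add: sI_def einterval_iff)
    from order_tendstoD(1)[OF *(8) this] show ?thesis by (simp add: eventually_sequentially)
  qed
  show thesis by (rule that[of l u]) (use lu *(2,3) 1 2 in auto)
qed

lemma AE_sI_local:
  assumes "\<And>c d. c \<in> sI S \<Longrightarrow> d \<in> sI S \<Longrightarrow> AE x in lborel. x \<in> {c..d} \<longrightarrow> P x"
  shows "AE x in lborel. x \<in> sI S \<longrightarrow> P x"
proof -
  obtain l u :: "nat \<Rightarrow> real" where lu: "\<And>n. l n \<in> sI S" "\<And>n. u n \<in> sI S"
    "\<And>x. x \<in> sI S \<Longrightarrow> \<exists>N. \<forall>n\<ge>N. l n < x" "\<And>x. x \<in> sI S \<Longrightarrow> \<exists>N. \<forall>n\<ge>N. x < u n"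
    by (rule sI_sequences, rule that; assumption)
  have "AE x in lborel. \<forall>i. x \<in> {l i..u i} \<longrightarrow> P x"
    unfolding AE_all_countable using assms lu(1,2) by blast
  then show ?thesis
  proof eventually_elim
    case (elim x)
    show ?case
    proof
      assume x: "x \<in> sI S"
      obtain N M where "\<forall>n\<ge>N. l n < x" "\<forall>n\<ge>M. x < u n" using lu(3,4)[OF x] by blast
      then have "l (max N M) < x" "x < u (max N M)" by auto
      then have "x \<in> {l (max N M)..u (max N M)}" by simp
      then show "P x" using elim by blast
    qed
  qed
qed

lemma prim_sI_AE_unique:
  fixes k k' :: "real \<Rightarrow> complex"
  assumes "prim (sI S) F k" "prim (sI S) F k'"
  shows "AE x in lborel. x \<in> sI S \<longrightarrow> k x = k' x"
  by (rule AE_sI_local) (rule prim_AE_unique[OF assms _ _ sI_interval])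

lemma qrel_unique:
  assumes "qrel S g g1 h" "qrel S g g1' h'" 
  shows "\<And>x. x \<in> sI S \<Longrightarrow> g1 x = g1' x" "aeq S h h'"
proof -
  have "AE x in lborel. x \<in> sI S \<longrightarrow> g1 x / complex_of_real (sp S x) = g1' x / complex_of_real (sp S x)"
    using assms prim_sI_AE_unique unfolding qrel_iff by blast
  then have "AE x in lborel. x \<in> sI S \<longrightarrow> g1 x = g1' x"
    using sp_pos by eventually_elim auto
  then show eq: "g1 x = g1' x" if "x \<in> sI S" for x
    using continuous_AE_eq[OF sI_open qrel_continuous(2)[OF assms(1)] qrel_continuous(2)[OF assms(2)] _ that] by blast
  have "prim (sI S) g1 (\<lambda>t. complex_of_real (sq S t) * g t - complex_of_real (sr S t) * h' t)"
    by (rule prim_cong[OF sI_interval assms(2)[unfolded qrel_iff, THEN conjunct2]]) (auto simp: eq)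
  then have "AE x in lborel. x \<in> sI S \<longrightarrow> complex_of_real (sq S x) * g x - complex_of_real (sr S x) * h x
     = complex_of_real (sq S x) * g x - complex_of_real (sr S x) * h' x"
    using assms(1) prim_sI_AE_unique unfolding qrel_iff by blast
  then show "aeq S h h'" unfolding aeq_def using sr_pos by eventually_elim auto
qed

text \<open>\<open>qd\<close> is a choice among all candidates. On the interval there is only one: p
  > 0 almost everywhere determines the quasi-derivative up to a null set, and continuity does the
  rest.\<close>

lemma qd_eq:
  assumes "qrel S g g1 h" "x \<in> sI S"
  shows "qd S g x = g1 x"
proof -
  let ?P = "\<lambda>g1. \<exists>k. lprim S g (\<lambda>t. g1 t / complex_of_real (sp S t)) \<and> lprim S g1 k"
  have "?P g1" using assms(1) by (auto simp: qrel_def)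
  then have "?P (qd S g)" unfolding qd_def by (rule someI[of ?P])
  then obtain k where k: "prim (sI S) g (\<lambda>t. qd S g t / complex_of_real (sp S t))" "prim (sI S) (qd S g) k"
    unfolding lprim_iff by blast
  have "AE x in lborel. x \<in> sI S \<longrightarrow> g1 x / complex_of_real (sp S x) = qd S g x / complex_of_real (sp S x)"
    using assms k prim_sI_AE_unique unfolding qrel_iff by blast
  then have "AE x in lborel. x \<in> sI S \<longrightarrow> qd S g x = g1 x"
    using sp_pos by eventually_elim auto
  then show ?thesis
    using continuous_AE_eq[OF sI_open prim_continuous_open[OF k(2) sI_interval sI_open]
        qrel_continuous(2)[OF assms(1)] _ assms(2)] by blast
qed

lemma Wr_eq:
  assumes "qrel S f f1 h" "qrel S g g1 k" "x \<in> sI S"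
  shows "Wr S f g x = f x * g1 x - f1 x * g x"
  using qd_eq[OF assms(1,3)] qd_eq[OF assms(2,3)] by (simp add: Wr_def)

text \<open>Lagrange's identity: in the derivative of the Wronskian the terms with p and with q
  cancel.\<close>

lemma wronskian_prim:
  assumes f: "qrel S f f1 h" and g: "qrel S g g1 k"
  shows "prim (sI S) (Wr S f g) (\<lambda>t. complex_of_real (sr S t) * (h t * g t - f t * k t))"
proof -
  have "prim (sI S) (\<lambda>x. f x * g1 x - f1 x * g x) (\<lambda>t.
      (f1 t / complex_of_real (sp S t) * g1 t + f t * (complex_of_real (sq S t) * g t - complex_of_real (sr S t) * k t))
     - ((complex_of_real (sq S t) * f t - complex_of_real (sr S t) * h t) * g t + f1 t * (g1 t / complex_of_real (sp S t))))"
    using f g unfolding qrel_iff by (intro prim_diff prim_mult sI_interval) auto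
  then show ?thesis
    by (rule prim_cong[OF sI_interval]) (auto simp: Wr_eq[OF f g] algebra_simps)
qed

lemma qrel_lin:
  assumes f: "qrel S f f1 h" and g: "qrel S g g1 k"
  shows "qrel S (\<lambda>x. c * f x + d * g x) (\<lambda>x. c * f1 x + d * g1 x) (\<lambda>x. c * h x + d * k x)"
  unfolding qrel_iff
proof
  show "prim (sI S) (\<lambda>x. c * f x + d * g x) (\<lambda>t. (c * f1 t + d * g1 t) / complex_of_real (sp S t))"
    by (rule prim_cong[OF sI_interval prim_add[OF
            prim_cmult[OF f[unfolded qrel_iff, THEN conjunct1], where c = c] prim_cmult[OF g[unfolded qrel_iff, THEN conjunct1], where c = d]]])
      (auto simp: add_divide_distrib)
  show "prim (sI S) (\<lambda>x. c * f1 x + d * g1 x)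
     (\<lambda>t. complex_of_real (sq S t) * (c * f t + d * g t) - complex_of_real (sr S t) * (c * h t + d * k t))"
    by (rule prim_cong[OF sI_interval prim_add[OF
            prim_cmult[OF f[unfolded qrel_iff, THEN conjunct2], where c = c] prim_cmult[OF g[unfolded qrel_iff, THEN conjunct2], where c = d]]])
      (auto simp: algebra_simps)
qed

lemma continuous_sbm:
  assumes "continuous_on (sI S) f" shows "set_borel_measurable lborel (sI S) (f :: real \<Rightarrow> complex)"
  unfolding set_borel_measurable_def using borel_measurable_continuous_on_indicator[OF sI_measurable assms] by simp

text \<open>Boundary values belong to the continuous representative, so elements of
  \<open>Tmax\<close> are handled through it, together with its quasi-derivative.\<close>

definition tm :: "(real \<Rightarrow> complex) \<Rightarrow> (real \<Rightarrow> complex) \<Rightarrow> (real \<Rightarrow> complex) \<Rightarrow> bool" where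
  "tm g g1 h \<longleftrightarrow> L2 S g \<and> L2 S h \<and> qrel S g g1 h"

lemma tm_lin: "tm f f1 h \<Longrightarrow> tm g g1 k \<Longrightarrow>
  tm (\<lambda>x. c * f x + d * g x) (\<lambda>x. c * f1 x + d * g1 x) (\<lambda>x. c * h x + d * k x)"
  unfolding tm_def by (auto intro: qrel_lin L2_add L2_mult)

lemma L2_bound:
  assumes F: "L2 S F" and y: "set_borel_measurable lborel (sI S) y"
    and le: "\<And>x. x \<in> sI S \<Longrightarrow> cmod (y x) \<le> cmod (F x)"
  shows "L2 S y \<and> nrm S y \<le> nrm S F"
proof -
  have AE: "AE x in lborel. indicator (sI S) x *\<^sub>R ((cmod (y x))\<^sup>2 * sr S x)
      \<le> indicator (sI S) x *\<^sub>R ((cmod (F x))\<^sup>2 * sr S x)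
      \<and> 0 \<le> indicator (sI S) x *\<^sub>R ((cmod (y x))\<^sup>2 * sr S x)"
    using sr_pos
  proof eventually_elim
    case (elim x)
    show ?case
    proof (cases "x \<in> sI S")
      case True
      then have "(cmod (y x))\<^sup>2 * sr S x \<le> (cmod (F x))\<^sup>2 * sr S x"
        using elim le by (intro mult_right_mono power_mono) auto
      then show ?thesis using True elim by simp
    qed simp
  qed
  have iF: "integrable lborel (\<lambda>x. indicator (sI S) x *\<^sub>R ((cmod (F x))\<^sup>2 * sr S x))"
    using F by (simp add: L2_def set_integrable_def)
  have iy: "integrable lborel (\<lambda>x. indicator (sI S) x *\<^sub>R ((cmod (y x))\<^sup>2 * sr S x))"
  proof (rule Bochner_Integration.integrable_bound[OF iF L2_mod_measurable[OF y]])
    show "AE x in lborel. norm (indicator (sI S) x *\<^sub>R ((cmod (y x))\<^sup>2 * sr S x))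
       \<le> norm (indicator (sI S) x *\<^sub>R ((cmod (F x))\<^sup>2 * sr S x))"
      using AE by eventually_elim (metis abs_of_nonneg order_trans real_norm_def)
  qed
  have "L2 S y" unfolding L2_def set_integrable_def using y iy by simp
  moreover have "nrm S y \<le> nrm S F" unfolding nrm_def set_lebesgue_integral_def
    by (intro real_sqrt_le_mono integral_mono_AE iF iy) (use AE in \<open>auto elim: eventually_mono\<close>)
  ultimately show ?thesis by blast
qed

lemma L2_abs: assumes "L2 S f" shows "L2 S (\<lambda>x. complex_of_real (cmod (f x)))" "nrm S (\<lambda>x. complex_of_real (cmod (f x))) = nrm S f"
proof -
  have "set_borel_measurable lborel (sI S) (\<lambda>x. complex_of_real (cmod (f x)))"
  proof -
    note [measurable] = L2_measurable[OF assms]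
    have "(\<lambda>x. indicator (sI S) x *\<^sub>R complex_of_real (cmod (f x))) = (\<lambda>x. complex_of_real (cmod (indicator (sI S) x *\<^sub>R f x)))"
      by (auto simp: fun_eq_iff indicator_def)
    also have "\<dots> \<in> borel_measurable lborel" by measurable
    finally show ?thesis by (simp add: set_borel_measurable_def)
  qed
  then show "L2 S (\<lambda>x. complex_of_real (cmod (f x)))" using L2_bound[OF assms] by simp
  show "nrm S (\<lambda>x. complex_of_real (cmod (f x))) = nrm S f" by (simp add: nrm_def)
qed

lemma L2_cnj: assumes "L2 S f" shows "L2 S (\<lambda>x. cnj (f x))"
proof -
  note [measurable] = L2_measurable[OF assms]
  have "(\<lambda>x. indicator (sI S) x *\<^sub>R cnj (f x)) = (\<lambda>x. cnj (indicator (sI S) x *\<^sub>R f x))"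
    by (auto simp: fun_eq_iff indicator_def)
  also have "\<dots> \<in> borel_measurable lborel" by measurable
  finally have "set_borel_measurable lborel (sI S) (\<lambda>x. cnj (f x))" by (simp add: set_borel_measurable_def)
  then show ?thesis using L2_bound[OF assms] by simp
qed

lemma nrm_mult: "nrm S (\<lambda>x. c * f x) = cmod c * nrm S f"
proof -
  have "(\<lambda>x. (cmod (c * f x))\<^sup>2 * sr S x) = (\<lambda>x. (cmod c)\<^sup>2 * ((cmod (f x))\<^sup>2 * sr S x))"
    by (simp add: fun_eq_iff norm_mult power_mult_distrib)
  then show ?thesis by (simp add: nrm_def real_sqrt_mult)
qed

lemma nrm_add: "L2 S f \<Longrightarrow> L2 S g \<Longrightarrow> nrm S (\<lambda>x. f x + g x) \<le> nrm S f + nrm S g"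
  using norm_triangle_ineq[of "phi f" "phi g"] phi_norm[of f] phi_norm[of g]
    phi_norm[OF L2_add[of f g]] phi_add[of f g] by simp

lemma nrm_diff_commute: "nrm S (\<lambda>x. f x - g x) = nrm S (\<lambda>x. g x - f x)"
  by (simp add: nrm_def norm_minus_commute)

lemma nrm_nonneg: "L2 S f \<Longrightarrow> 0 \<le> nrm S f" using phi_norm[of f] norm_ge_zero[of "phi f"] by simp

lemma nrm_zero_iff: "L2 S f \<Longrightarrow> nrm S f = 0 \<longleftrightarrow> aeq S f (\<lambda>_. 0)"
  using phi_eq_iff[of f "\<lambda>_. 0"] L2_zero phi_zero phi_norm[of f] by auto

lemma ip_self: "L2 S f \<Longrightarrow> ip S f f = complex_of_real ((nrm S f)\<^sup>2)"
proof -
  assume f: "L2 S f"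
  have "ip S f f = (LINT x:sI S|lborel. complex_of_real ((cmod (f x))\<^sup>2 * sr S x))"
    unfolding ip_def by (simp add: complex_norm_square[symmetric])
  also have "\<dots> = complex_of_real (LINT x:sI S|lborel. (cmod (f x))\<^sup>2 * sr S x)"
    by (rule set_integral_complex_of_real)
  also have "(LINT x:sI S|lborel. (cmod (f x))\<^sup>2 * sr S x) = (nrm S f)\<^sup>2"
  proof -
    have "Re (ip S f f) = (nrm S f)\<^sup>2"
      using phi_inner[OF f f] phi_norm[OF f] by (simp add: power2_norm_eq_inner[symmetric])
    then show ?thesis using \<open>ip S f f = _\<close> \<open>(LINT x:sI S|lborel. complex_of_real ((cmod (f x))\<^sup>2 * sr S x)) = _\<close> by simp
  qed
  finally show ?thesis .
qed

lemma ip_add_left: "L2 S f \<Longrightarrow> L2 S g \<Longrightarrow> L2 S h \<Longrightarrow> ip S (\<lambda>x. f x + g x) h = ip S f h + ip S g h"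
  unfolding ip_def using ip_integrable by (simp add: distrib_right)

lemma ip_cnj: "cnj (ip S f g) = ip S g f"
proof -
  have "ip S g f = (LINT x:sI S|lborel. cnj (f x * cnj (g x) * complex_of_real (sr S x)))"
    unfolding ip_def by (simp add: mult.commute)
  also have "\<dots> = (LINT x|lborel. cnj (indicator (sI S) x *\<^sub>R (f x * cnj (g x) * complex_of_real (sr S x))))"
    unfolding set_lebesgue_integral_def by (simp add: scaleR_conv_of_real)
  also have "\<dots> = cnj (ip S f g)" unfolding ip_def set_lebesgue_integral_def by (rule Bochner_Integration.integral_cnj)
  finally show ?thesis by simp
qed

lemma ip_add_right: "L2 S f \<Longrightarrow> L2 S g \<Longrightarrow> L2 S h \<Longrightarrow> ip S h (\<lambda>x. f x + g x) = ip S h f + ip S h g"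
  using ip_add_left[of f g h] by (metis ip_cnj complex_cnj_add)

lemma ip_lin_left: "L2 S f \<Longrightarrow> L2 S g \<Longrightarrow> L2 S h \<Longrightarrow>
   ip S (\<lambda>x. c * f x + d * g x) h = c * ip S f h + d * ip S g h"
  by (simp add: ip_add_left ip_mult_left L2_mult)

lemma ip_lin_right: "L2 S f \<Longrightarrow> L2 S g \<Longrightarrow> L2 S h \<Longrightarrow>
   ip S h (\<lambda>x. c * f x + d * g x) = cnj c * ip S h f + cnj d * ip S h g"
  by (simp add: ip_add_right ip_mult_right L2_mult)

lemma ip_diff_left: "L2 S f \<Longrightarrow> L2 S g \<Longrightarrow> L2 S h \<Longrightarrow> ip S (\<lambda>x. f x - g x) h = ip S f h - ip S g h"
  using ip_lin_left[of f g h 1 "-1"] by simp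

lemma ip_diff_right: "L2 S f \<Longrightarrow> L2 S g \<Longrightarrow> L2 S h \<Longrightarrow> ip S h (\<lambda>x. f x - g x) = ip S h f - ip S h g"
  using ip_lin_right[of f g h 1 "-1"] by simp

lemma cauchy_schwarz_abs:
  assumes "L2 S f" "L2 S g"
  shows "set_integrable lborel (sI S) (\<lambda>x. cmod (f x) * cmod (g x) * sr S x)"
    "(LINT x:sI S|lborel. cmod (f x) * cmod (g x) * sr S x) \<le> nrm S f * nrm S g"
proof -
  let ?f = "\<lambda>x. complex_of_real (cmod (f x))" and ?g = "\<lambda>x. complex_of_real (cmod (g x))"
  have L: "L2 S ?f" "L2 S ?g" using L2_abs assms by auto
  have e: "?f x * cnj (?g x) * complex_of_real (sr S x) = complex_of_real (cmod (f x) * cmod (g x) * sr S x)" for x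
    by simp
  have i: "set_integrable lborel (sI S) (\<lambda>x. complex_of_real (cmod (f x) * cmod (g x) * sr S x))"
    using ip_integrable[OF L] by (simp only: e)
  then have "integrable lborel (\<lambda>x. Re (indicator (sI S) x *\<^sub>R complex_of_real (cmod (f x) * cmod (g x) * sr S x)))"
    unfolding set_integrable_def by (rule integrable_Re)
  then show "set_integrable lborel (sI S) (\<lambda>x. cmod (f x) * cmod (g x) * sr S x)"
    by (simp add: set_integrable_def)
  have "ip S ?f ?g = complex_of_real (LINT x:sI S|lborel. cmod (f x) * cmod (g x) * sr S x)"
    unfolding ip_def e by (rule set_integral_complex_of_real)
  then have "(LINT x:sI S|lborel. cmod (f x) * cmod (g x) * sr S x) = phi ?f \<bullet> phi ?g"
    by (simp add: phi_inner[OF L])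
  also have "\<dots> \<le> norm (phi ?f) * norm (phi ?g)" by (rule norm_cauchy_schwarz)
  finally show "(LINT x:sI S|lborel. cmod (f x) * cmod (g x) * sr S x) \<le> nrm S f * nrm S g"
    using L L2_abs assms by (simp add: phi_norm)
qed

lemma ip_bound: "L2 S f \<Longrightarrow> L2 S g \<Longrightarrow> cmod (ip S f g) \<le> nrm S f * nrm S g"
proof -
  assume L: "L2 S f" "L2 S g"
  have "cmod (ip S f g) \<le> (LINT x:sI S|lborel. cmod (f x * cnj (g x) * complex_of_real (sr S x)))"
    unfolding ip_def by (rule set_integral_norm_bound[OF ip_integrable[OF L]])
  also have "\<dots> \<le> (LINT x:sI S|lborel. cmod (f x) * cmod (g x) * sr S x)"
  proof (rule set_integral_mono_AE)
    show "set_integrable lborel (sI S) (\<lambda>x. cmod (f x * cnj (g x) * complex_of_real (sr S x)))"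
      using ip_integrable[OF L] unfolding set_integrable_def by (auto dest: integrable_norm)
    show "AE x in lborel. x \<in> sI S \<longrightarrow> cmod (f x * cnj (g x) * complex_of_real (sr S x)) \<le> cmod (f x) * cmod (g x) * sr S x"
      using sr_pos by eventually_elim (auto simp: norm_mult)
  qed (rule cauchy_schwarz_abs[OF L])
  also have "\<dots> \<le> nrm S f * nrm S g" by (rule cauchy_schwarz_abs[OF L])
  finally show ?thesis .
qed

subsection \<open>Cumulative integrals and boundary limits\<close>

text \<open>A primitive normalised to vanish at the left endpoint, whether that is finite or
  not.\<close>

definition cum :: "(real \<Rightarrow> 'a::{banach,second_countable_topology}) \<Rightarrow> real \<Rightarrow> 'a" where
  "cum k x = (LINT t:{t \<in> sI S. t < x}|lborel. k t)"

lemma below_measurable: "{t \<in> sI S. t < x} \<in> sets lborel" by simp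

lemma above_measurable: "{t \<in> sI S. x \<le> t} \<in> sets lborel" by simp

lemma cum_prim:
  fixes k :: "real \<Rightarrow> 'a::{banach,second_countable_topology}"
  assumes k: "set_integrable lborel (sI S) k"
  shows "prim (sI S) (cum k) k"
  unfolding prim_def
proof (intro ballI impI)
  fix c x assume cx: "c \<in> sI S" "x \<in> sI S" "c \<le> x"
  have sub: "{c..x} \<subseteq> sI S" using sI_mid[OF cx(1,2)] by auto
  have i: "set_integrable lborel {c..x} k" by (rule set_integrable_subset[OF k _ sub]) simp
  have ix: "set_integrable lborel {c..<x} k" by (rule set_integrable_subset[OF i]) auto
  have ic: "set_integrable lborel {t \<in> sI S. t < c} k" by (rule set_integrable_subset[OF k]) auto
  have e: "{t \<in> sI S. t < x} = {t \<in> sI S. t < c} \<union> {c..<x}" using cx sub by auto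
  have "cum k x = cum k c + (LINT t:{c..<x}|lborel. k t)"
    unfolding cum_def e by (rule set_integral_Un[OF _ ic ix]) auto
  also have "(LINT t:{c..<x}|lborel. k t) = (LINT t:{c..x}|lborel. k t)"
    by (rule set_integral_discrete_difference[where X = "{x}"]) auto
  finally show "set_integrable lborel {c..x} k \<and> cum k x - cum k c = (LINT t:{c..x}|lborel. k t)"
    using i by simp
qed

lemma eventually_filt_aI:
  assumes "c \<in> sI S" "\<And>x. x \<in> sI S \<Longrightarrow> x < c \<Longrightarrow> P x"
  shows "eventually P (filt_a S)"
proof (cases "sa S = -\<infinity>")
  case True
  have "P x" if "x < c" for x
  proof (rule assms(2)[OF _ that])
    have "ereal x < ereal c" using that by simp
    also have "ereal c < sb S" using assms(1) by (simp add: sI_def einterval_iff)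
    finally show "x \<in> sI S" using True by (simp add: sI_def einterval_iff)
  qed
  then show ?thesis unfolding filt_a_def using True by (auto simp: eventually_at_bot_dense)
next
  case False
  have "sa S < ereal c" using assms(1) by (simp add: sI_def einterval_iff)
  with False obtain a where a: "sa S = ereal a" by (cases "sa S") auto
  have ac: "a < c" using \<open>sa S < ereal c\<close> a by simp
  have "P x" if "a < x" "x < c" for x
  proof (rule assms(2)[OF _ that(2)])
    have "ereal x < ereal c" using that by simp
    also have "ereal c < sb S" using assms(1) by (simp add: sI_def einterval_iff)
    finally show "x \<in> sI S" using a that by (simp add: sI_def einterval_iff)
  qed
  then show ?thesis unfolding filt_a_def using a ac by (auto simp: eventually_at_right_field)
qed

lemma eventually_filt_bI:
  assumes "c \<in> sI S" "\<And>x. x \<in> sI S \<Longrightarrow> c < x \<Longrightarrow> P x"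
  shows "eventually P (filt_b S)"
proof (cases "sb S = \<infinity>")
  case True
  have "P x" if "c < x" for x
  proof (rule assms(2)[OF _ that])
    have "sa S < ereal c" using assms(1) by (simp add: sI_def einterval_iff)
    also have "ereal c < ereal x" using that by simp
    finally show "x \<in> sI S" using True by (simp add: sI_def einterval_iff)
  qed
  then show ?thesis unfolding filt_b_def using True by (auto simp: eventually_at_top_dense)
next
  case False
  have "ereal c < sb S" using assms(1) by (simp add: sI_def einterval_iff)
  with False obtain b where b: "sb S = ereal b" by (cases "sb S") auto
  have cb: "c < b" using \<open>ereal c < sb S\<close> b by simp
  have "P x" if "c < x" "x < b" for x
  proof (rule assms(2)[OF _ that(1)])
    have "sa S < ereal c" using assms(1) by (simp add: sI_def einterval_iff)
    also have "ereal c < ereal x" using that by simp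
    finally show "x \<in> sI S" using b that by (simp add: sI_def einterval_iff)
  qed
  then show ?thesis unfolding filt_b_def using b cb by (auto simp: eventually_at_left_field)
qed

lemma filt_nontrivial: "\<not> trivial_limit (filt_a S)" "\<not> trivial_limit (filt_b S)"
  by (auto simp: filt_a_def filt_b_def trivial_limit_at_right_real trivial_limit_at_left_real)

lemma eventually_filt_in: "eventually (\<lambda>x. x \<in> sI S) (filt_a S)" "eventually (\<lambda>x. x \<in> sI S) (filt_b S)"
  using sI_ex eventually_filt_aI[of _ "\<lambda>x. x \<in> sI S"] eventually_filt_bI[of _ "\<lambda>x. x \<in> sI S"] by blast+

lemma tail_a_small:
  fixes k :: "real \<Rightarrow> real"
  assumes k: "set_integrable lborel (sI S) k" and e: "e > 0"
  shows "\<exists>c\<in>sI S. \<forall>x. x \<le> c \<longrightarrow> (LINT t:{t \<in> sI S. t < x}|lborel. \<bar>k t\<bar>) < e"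
proof -
  obtain l u :: "nat \<Rightarrow> real" where l: "\<And>n. l n \<in> sI S" "\<And>x. x \<in> sI S \<Longrightarrow> \<exists>N. \<forall>n\<ge>N. l n < x"
    by (rule sI_sequences, rule that; assumption)
  have ik: "set_integrable lborel (sI S) (\<lambda>t. \<bar>k t\<bar>)" using k by (rule set_integrable_abs)
  have "(\<lambda>n. LINT t|lborel. indicator {t \<in> sI S. t < l n} t *\<^sub>R \<bar>k t\<bar>) \<longlonglongrightarrow> (LINT t::real|lborel. (0::real))"
  proof (rule integral_dominated_convergence[where w = "\<lambda>t. indicator (sI S) t *\<^sub>R \<bar>k t\<bar>"])
    show "integrable lborel (\<lambda>t. indicator (sI S) t *\<^sub>R \<bar>k t\<bar>)" using ik by (simp add: set_integrable_def)
    show "(\<lambda>t. indicator {t \<in> sI S. t < l n} t *\<^sub>R \<bar>k t\<bar>) \<in> borel_measurable lborel" for n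
      using set_integrable_subset[OF ik below_measurable[of "l n"]] unfolding set_integrable_def
      by (intro borel_measurable_integrable) auto
    show "AE t in lborel. (\<lambda>n. indicator {t \<in> sI S. t < l n} t *\<^sub>R \<bar>k t\<bar>) \<longlonglongrightarrow> 0"
    proof (rule AE_I2)
      fix t
      have "\<forall>\<^sub>F n in sequentially. indicator {t \<in> sI S. t < l n} t *\<^sub>R \<bar>k t\<bar> = 0"
      proof (cases "t \<in> sI S")
        case True
        then obtain N where N: "\<And>n. n \<ge> N \<Longrightarrow> l n < t" using l(2) by blast
        show ?thesis unfolding eventually_sequentially
          by (rule exI[of _ N]) (auto simp: indicator_def dest: N)
      qed simp
      then show "(\<lambda>n. indicator {t \<in> sI S. t < l n} t *\<^sub>R \<bar>k t\<bar>) \<longlonglongrightarrow> 0" by (rule tendsto_eventually)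
    qed
    show "AE t in lborel. norm (indicator {t \<in> sI S. t < l n} t *\<^sub>R \<bar>k t\<bar>) \<le> indicator (sI S) t *\<^sub>R \<bar>k t\<bar>" for n
      by (rule AE_I2) (auto simp: indicator_def)
  qed simp
  then have "(\<lambda>n. LINT t:{t \<in> sI S. t < l n}|lborel. \<bar>k t\<bar>) \<longlonglongrightarrow> 0" by (simp add: set_lebesgue_integral_def)
  from order_tendstoD(2)[OF this e] obtain n where n: "(LINT t:{t \<in> sI S. t < l n}|lborel. \<bar>k t\<bar>) < e"
    by (auto simp: eventually_sequentially)
  show ?thesis
  proof (intro bexI[of _ "l n"] allI impI)
    fix x assume "x \<le> l n"
    then have "(LINT t:{t \<in> sI S. t < x}|lborel. \<bar>k t\<bar>) \<le> (LINT t:{t \<in> sI S. t < l n}|lborel. \<bar>k t\<bar>)"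
      unfolding set_lebesgue_integral_def
      using set_integrable_subset[OF ik below_measurable[of x]] set_integrable_subset[OF ik below_measurable[of "l n"]]
      by (intro integral_mono) (auto simp: set_integrable_def indicator_def)
    with n show "(LINT t:{t \<in> sI S. t < x}|lborel. \<bar>k t\<bar>) < e" by linarith
  qed (rule l(1))
qed

lemma tail_b_small:
  fixes k :: "real \<Rightarrow> real"
  assumes k: "set_integrable lborel (sI S) k" and e: "e > 0"
  shows "\<exists>c\<in>sI S. \<forall>x. c \<le> x \<longrightarrow> (LINT t:{t \<in> sI S. x \<le> t}|lborel. \<bar>k t\<bar>) < e"
proof -
  obtain l u :: "nat \<Rightarrow> real" where l: "\<And>n. u n \<in> sI S" "\<And>x. x \<in> sI S \<Longrightarrow> \<exists>N. \<forall>n\<ge>N. x < u n"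
    by (rule sI_sequences, rule that; assumption)
  have ik: "set_integrable lborel (sI S) (\<lambda>t. \<bar>k t\<bar>)" using k by (rule set_integrable_abs)
  have "(\<lambda>n. LINT t|lborel. indicator {t \<in> sI S. u n \<le> t} t *\<^sub>R \<bar>k t\<bar>) \<longlonglongrightarrow> (LINT t::real|lborel. (0::real))"
  proof (rule integral_dominated_convergence[where w = "\<lambda>t. indicator (sI S) t *\<^sub>R \<bar>k t\<bar>"])
    show "integrable lborel (\<lambda>t. indicator (sI S) t *\<^sub>R \<bar>k t\<bar>)" using ik by (simp add: set_integrable_def)
    show "(\<lambda>t. indicator {t \<in> sI S. u n \<le> t} t *\<^sub>R \<bar>k t\<bar>) \<in> borel_measurable lborel" for n
      using set_integrable_subset[OF ik above_measurable[of "u n"]] unfolding set_integrable_def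
      by (intro borel_measurable_integrable) auto
    show "AE t in lborel. (\<lambda>n. indicator {t \<in> sI S. u n \<le> t} t *\<^sub>R \<bar>k t\<bar>) \<longlonglongrightarrow> 0"
    proof (rule AE_I2)
      fix t
      have "\<forall>\<^sub>F n in sequentially. indicator {t \<in> sI S. u n \<le> t} t *\<^sub>R \<bar>k t\<bar> = 0"
      proof (cases "t \<in> sI S")
        case True
        then obtain N where N: "\<And>n. n \<ge> N \<Longrightarrow> t < u n" using l(2) by blast
        show ?thesis unfolding eventually_sequentially
          by (rule exI[of _ N]) (auto simp: indicator_def dest: N)
      qed simp
      then show "(\<lambda>n. indicator {t \<in> sI S. u n \<le> t} t *\<^sub>R \<bar>k t\<bar>) \<longlonglongrightarrow> 0" by (rule tendsto_eventually)
    qed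
    show "AE t in lborel. norm (indicator {t \<in> sI S. u n \<le> t} t *\<^sub>R \<bar>k t\<bar>) \<le> indicator (sI S) t *\<^sub>R \<bar>k t\<bar>" for n
      by (rule AE_I2) (auto simp: indicator_def)
  qed simp
  then have "(\<lambda>n. LINT t:{t \<in> sI S. u n \<le> t}|lborel. \<bar>k t\<bar>) \<longlonglongrightarrow> 0" by (simp add: set_lebesgue_integral_def)
  from order_tendstoD(2)[OF this e] obtain n where n: "(LINT t:{t \<in> sI S. u n \<le> t}|lborel. \<bar>k t\<bar>) < e"
    by (auto simp: eventually_sequentially)
  show ?thesis
  proof (intro bexI[of _ "u n"] allI impI)
    fix x assume "u n \<le> x"
    then have "(LINT t:{t \<in> sI S. x \<le> t}|lborel. \<bar>k t\<bar>) \<le> (LINT t:{t \<in> sI S. u n \<le> t}|lborel. \<bar>k t\<bar>)"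
      unfolding set_lebesgue_integral_def
      using set_integrable_subset[OF ik above_measurable[of x]] set_integrable_subset[OF ik above_measurable[of "u n"]]
      by (intro integral_mono) (auto simp: set_integrable_def indicator_def)
    with n show "(LINT t:{t \<in> sI S. x \<le> t}|lborel. \<bar>k t\<bar>) < e" by linarith
  qed (rule l(1))
qed

lemma set_integrable_cmod: "set_integrable lborel A k \<Longrightarrow> set_integrable lborel A (\<lambda>t. cmod (k t))"
  unfolding set_integrable_def by (auto dest: integrable_norm)

lemma cum_a:
  fixes k :: "real \<Rightarrow> complex"
  assumes k: "set_integrable lborel (sI S) k"
  shows "(cum k \<longlongrightarrow> 0) (filt_a S)"
proof (rule tendstoI)
  fix e :: real assume "e > 0"
  from tail_a_small[OF set_integrable_cmod[OF k] this] obtain c where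
    c: "c \<in> sI S" "\<And>x. x \<le> c \<Longrightarrow> (LINT t:{t \<in> sI S. t < x}|lborel. \<bar>cmod (k t)\<bar>) < e" by blast
  show "eventually (\<lambda>x. dist (cum k x) 0 < e) (filt_a S)"
  proof (rule eventually_filt_aI[OF c(1)])
    fix x assume x: "x \<in> sI S" "x < c"
    have "cmod (cum k x) \<le> (LINT t:{t \<in> sI S. t < x}|lborel. cmod (k t))"
      unfolding cum_def by (rule set_integral_norm_bound) (auto intro: set_integrable_subset[OF k])
    with c(2)[of x] x show "dist (cum k x) 0 < e" by simp
  qed
qed

lemma cum_b:
  fixes k :: "real \<Rightarrow> complex"
  assumes k: "set_integrable lborel (sI S) k"
  shows "(cum k \<longlongrightarrow> (LINT t:sI S|lborel. k t)) (filt_b S)"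
proof (rule tendstoI)
  fix e :: real assume "e > 0"
  from tail_b_small[OF set_integrable_cmod[OF k] this] obtain c where
    c: "c \<in> sI S" "\<And>x. c \<le> x \<Longrightarrow> (LINT t:{t \<in> sI S. x \<le> t}|lborel. \<bar>cmod (k t)\<bar>) < e" by blast
  show "eventually (\<lambda>x. dist (cum k x) (LINT t:sI S|lborel. k t) < e) (filt_b S)"
  proof (rule eventually_filt_bI[OF c(1)])
    fix x assume x: "x \<in> sI S" "c < x"
    have i1: "set_integrable lborel {t \<in> sI S. t < x} k" and i2: "set_integrable lborel {t \<in> sI S. x \<le> t} k"
      by (auto intro: set_integrable_subset[OF k])
    have "sI S = {t \<in> sI S. t < x} \<union> {t \<in> sI S. x \<le> t}" by auto
    then have "(LINT t:sI S|lborel. k t) = (LINT t:{t \<in> sI S. t < x} \<union> {t \<in> sI S. x \<le> t}|lborel. k t)" by simp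
    also have "\<dots> = cum k x + (LINT t:{t \<in> sI S. x \<le> t}|lborel. k t)"
      unfolding cum_def by (rule set_integral_Un[OF _ i1 i2]) auto
    finally have "dist (cum k x) (LINT t:sI S|lborel. k t) = cmod (LINT t:{t \<in> sI S. x \<le> t}|lborel. k t)"
      by (simp add: dist_norm)
    also have "\<dots> \<le> (LINT t:{t \<in> sI S. x \<le> t}|lborel. cmod (k t))" by (rule set_integral_norm_bound[OF i2])
    finally show "dist (cum k x) (LINT t:sI S|lborel. k t) < e" using c(2)[of x] x by simp
  qed
qed

text \<open>When the derivative is integrable up to the endpoints, F differs from
  \<open>cum k\<close> by a constant, which is then its limit at a.\<close>

lemma prim_limits:
  fixes k :: "real \<Rightarrow> complex"
  assumes F: "prim (sI S) F k" and k: "set_integrable lborel (sI S) k"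
  shows "\<exists>L. (F \<longlongrightarrow> L) (filt_a S) \<and> (F \<longlongrightarrow> L + (LINT t:sI S|lborel. k t)) (filt_b S)
     \<and> (\<forall>x\<in>sI S. F x = L + cum k x)"
proof -
  obtain c where c: "c \<in> sI S" using sI_ex by blast
  define L where "L = F c - cum k c"
  have e: "F x = L + cum k x" if x: "x \<in> sI S" for x
  proof (cases "c \<le> x")
    case True
    then show ?thesis using primD[OF F c x True] primD[OF cum_prim[OF k] c x True] by (simp add: L_def algebra_simps)
  next
    case False
    then have "x \<le> c" by simp
    then show ?thesis using primD[OF F x c] primD[OF cum_prim[OF k] x c] by (simp add: L_def algebra_simps)
  qed
  have "((\<lambda>x. L + cum k x) \<longlongrightarrow> L + 0) (filt_a S)" by (intro tendsto_intros cum_a k)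
  moreover have "eventually (\<lambda>x. L + cum k x = F x) (filt_a S)"
    using eventually_filt_in(1) by eventually_elim (simp add: e)
  ultimately have a: "(F \<longlongrightarrow> L) (filt_a S)" by (simp add: tendsto_cong)
  have "((\<lambda>x. L + cum k x) \<longlongrightarrow> L + (LINT t:sI S|lborel. k t)) (filt_b S)" by (intro tendsto_intros cum_b k)
  moreover have "eventually (\<lambda>x. L + cum k x = F x) (filt_b S)"
    using eventually_filt_in(2) by eventually_elim (simp add: e)
  ultimately have b: "(F \<longlongrightarrow> L + (LINT t:sI S|lborel. k t)) (filt_b S)" by (simp add: tendsto_cong)
  show ?thesis using a b e by blast
qed

section \<open>Variation of constants and Wronskians at the endpoints\<close>

lemma prod_integrable:
  assumes "L2 S w" "L2 S h"
  shows "set_integrable lborel (sI S) (\<lambda>t. complex_of_real (sr S t) * (w t * h t))"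
  using ip_integrable[OF assms(1) L2_cnj[OF assms(2)]] by (simp add: mult_ac)

lemma ip_real:
  assumes "\<And>x. cnj (s x) = s x"
  shows "(LINT t:sI S|lborel. complex_of_real (sr S t) * (s t * h t)) = ip S h s"
  unfolding ip_def by (simp add: assms mult_ac)

lemma cum_bound:
  assumes "L2 S w" "L2 S h"
  shows "cmod (cum (\<lambda>t. complex_of_real (sr S t) * (w t * h t)) x) \<le> nrm S w * nrm S h"
proof -
  let ?k = "\<lambda>t. complex_of_real (sr S t) * (w t * h t)"
  have i: "set_integrable lborel (sI S) (\<lambda>t. cmod (?k t))"
    by (rule set_integrable_cmod[OF prod_integrable[OF assms]])
  have "cmod (cum ?k x) \<le> (LINT t:{t \<in> sI S. t < x}|lborel. cmod (?k t))"
    unfolding cum_def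
    by (rule set_integral_norm_bound[OF set_integrable_subset[OF prod_integrable[OF assms]]]) auto
  also have "\<dots> \<le> (LINT t:sI S|lborel. cmod (?k t))"
    unfolding set_lebesgue_integral_def
    using set_integrable_subset[OF i below_measurable[of x]] i
    by (intro integral_mono) (auto simp: set_integrable_def indicator_def)
  also have "\<dots> \<le> (LINT t:sI S|lborel. cmod (w t) * cmod (h t) * sr S t)"
  proof (rule set_integral_mono_AE[OF i])
    show "AE t in lborel. t \<in> sI S \<longrightarrow> cmod (?k t) \<le> cmod (w t) * cmod (h t) * sr S t"
      using sr_pos by eventually_elim (auto simp: norm_mult)
  qed (rule cauchy_schwarz_abs[OF assms])
  also have "\<dots> \<le> nrm S w * nrm S h" by (rule cauchy_schwarz_abs[OF assms])
  finally show ?thesis .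
qed

lemma L2_combination_bound:
  assumes z: "L2 S z" and w: "L2 S w" and y: "set_borel_measurable lborel (sI S) y"
    and a: "a \<ge> 0" and b: "b \<ge> 0"
    and le: "\<And>x. x \<in> sI S \<Longrightarrow> cmod (y x) \<le> a * cmod (z x) + b * cmod (w x)"
  shows "L2 S y \<and> nrm S y \<le> a * nrm S z + b * nrm S w"
proof -
  let ?z = "\<lambda>x. complex_of_real (cmod (z x))" and ?w = "\<lambda>x. complex_of_real (cmod (w x))"
  let ?F = "\<lambda>x. complex_of_real a * ?z x + complex_of_real b * ?w x"
  have L: "L2 S ?z" "L2 S ?w" using L2_abs z w by auto
  have F: "L2 S ?F" by (intro L2_add L2_mult L)
  have e: "?F x = complex_of_real (a * cmod (z x) + b * cmod (w x))" for x by simp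
  have "cmod (?F x) = a * cmod (z x) + b * cmod (w x)" for x
    unfolding e norm_of_real using a b by simp
  then have "L2 S y \<and> nrm S y \<le> nrm S ?F" using le by (intro L2_bound[OF F y]) auto
  moreover have "nrm S ?F \<le> a * nrm S z + b * nrm S w"
    using nrm_add[OF L2_mult[OF L(1), of "complex_of_real a"] L2_mult[OF L(2), of "complex_of_real b"]] a b
    by (simp add: nrm_mult L2_abs z w)
  ultimately show ?thesis by linarith
qed

text \<open>The integrals start at the endpoint a itself, so \<alpha> and \<beta> are the
  coefficients at a. They converge there and stay bounded by Cauchy-Schwarz, as both solutions are
  in L2 on the whole interval; for the same reason the result is in L2.\<close>

lemma variation_of_constants:
  assumes w: "qrel S w w1 (\<lambda>_. 0)" "L2 S w" and z: "qrel S z z1 (\<lambda>_. 0)" "L2 S z"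
    and W: "\<And>x. x \<in> sI S \<Longrightarrow> z x * w1 x - z1 x * w x = 1" and h: "L2 S h"
  shows "tm (\<lambda>x. z x * (\<alpha> + cum (\<lambda>t. complex_of_real (sr S t) * (w t * h t)) x)
               + w x * (\<beta> - cum (\<lambda>t. complex_of_real (sr S t) * (z t * h t)) x))
     (\<lambda>x. z1 x * (\<alpha> + cum (\<lambda>t. complex_of_real (sr S t) * (w t * h t)) x)
               + w1 x * (\<beta> - cum (\<lambda>t. complex_of_real (sr S t) * (z t * h t)) x)) h"
    (is "tm ?y ?y1 h")
proof -
  let ?kw = "\<lambda>t. complex_of_real (sr S t) * (w t * h t)"
  let ?kz = "\<lambda>t. complex_of_real (sr S t) * (z t * h t)"
  have A: "prim (sI S) (\<lambda>x. \<alpha> + cum ?kw x) (\<lambda>t. 0 + ?kw t)"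
    by (rule prim_add[OF prim_const cum_prim[OF prod_integrable[OF w(2) h]]])
  have B: "prim (sI S) (\<lambda>x. \<beta> - cum ?kz x) (\<lambda>t. 0 - ?kz t)"
    by (rule prim_diff[OF prim_const cum_prim[OF prod_integrable[OF z(2) h]]])
  note pm = prim_add[OF prim_mult[OF sI_interval _ A] prim_mult[OF sI_interval _ B]]
  have q: "qrel S ?y ?y1 h"
    unfolding qrel_iff
  proof
    show "prim (sI S) ?y (\<lambda>t. ?y1 t / complex_of_real (sp S t))"
      by (rule prim_cong[OF sI_interval pm[OF z(1)[unfolded qrel_iff, THEN conjunct1] w(1)[unfolded qrel_iff, THEN conjunct1]]])
        (simp_all add: add_divide_distrib diff_divide_distrib algebra_simps)
    show "prim (sI S) ?y1 (\<lambda>t. complex_of_real (sq S t) * ?y t - complex_of_real (sr S t) * h t)"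
    proof (rule prim_cong[OF sI_interval pm[OF z(1)[unfolded qrel_iff, THEN conjunct2] w(1)[unfolded qrel_iff, THEN conjunct2]]])
      fix x assume x: "x \<in> sI S"
      have "z1 x * ?kw x - w1 x * ?kz x = - (complex_of_real (sr S x) * h x) * (z x * w1 x - z1 x * w x)"
        by (simp add: algebra_simps)
      then have *: "z1 x * ?kw x - w1 x * ?kz x = - (complex_of_real (sr S x) * h x)" using W[OF x] by simp
      let ?A = "\<alpha> + cum ?kw x" and ?B = "\<beta> - cum ?kz x"
      have "(complex_of_real (sq S x) * z x - complex_of_real (sr S x) * 0) * ?A + z1 x * (0 + ?kw x) +
          ((complex_of_real (sq S x) * w x - complex_of_real (sr S x) * 0) * ?B + w1 x * (0 - ?kz x))
        = complex_of_real (sq S x) * (z x * ?A + w x * ?B) + (z1 x * ?kw x - w1 x * ?kz x)"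
        by (simp add: algebra_simps)
      then show "(complex_of_real (sq S x) * z x - complex_of_real (sr S x) * 0) * ?A + z1 x * (0 + ?kw x) +
          ((complex_of_real (sq S x) * w x - complex_of_real (sr S x) * 0) * ?B + w1 x * (0 - ?kz x))
        = complex_of_real (sq S x) * (z x * ?A + w x * ?B) - complex_of_real (sr S x) * h x"
        unfolding * by simp
    qed simp
  qed
  have sm: "set_borel_measurable lborel (sI S) ?y" by (rule continuous_sbm[OF qrel_continuous(1)[OF q]])
  have "L2 S ?y \<and> nrm S ?y \<le> (cmod \<alpha> + nrm S w * nrm S h) * nrm S z + (cmod \<beta> + nrm S z * nrm S h) * nrm S w"
  proof (rule L2_combination_bound[OF z(2) w(2) sm])
    fix x
    have 1: "cmod (\<alpha> + cum ?kw x) \<le> cmod \<alpha> + nrm S w * nrm S h"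
      using norm_triangle_ineq[of \<alpha> "cum ?kw x"] cum_bound[OF w(2) h, of x] by linarith
    have 2: "cmod (\<beta> - cum ?kz x) \<le> cmod \<beta> + nrm S z * nrm S h"
      using norm_triangle_ineq4[of \<beta> "cum ?kz x"] cum_bound[OF z(2) h, of x] by linarith
    have "cmod (?y x) \<le> cmod (z x) * cmod (\<alpha> + cum ?kw x) + cmod (w x) * cmod (\<beta> - cum ?kz x)"
      using norm_triangle_ineq[of "z x * (\<alpha> + cum ?kw x)" "w x * (\<beta> - cum ?kz x)"] by (simp add: norm_mult)
    also have "\<dots> \<le> cmod (z x) * (cmod \<alpha> + nrm S w * nrm S h) + cmod (w x) * (cmod \<beta> + nrm S z * nrm S h)"
      using 1 2 by (intro add_mono mult_left_mono) auto
    finally show "cmod (?y x) \<le> (cmod \<alpha> + nrm S w * nrm S h) * cmod (z x) + (cmod \<beta> + nrm S z * nrm S h) * cmod (w x)"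
      by (simp add: mult.commute)
  qed (use nrm_nonneg w z h in auto)
  then show ?thesis using q h by (simp add: tm_def)
qed

lemma cum_uminus: "cum (\<lambda>t. - k t) x = - cum k (x :: real)" for k :: "real \<Rightarrow> complex"
  unfolding cum_def set_lebesgue_integral_def by simp

text \<open>For two elements of the maximal domain the density in Lagrange's identity is integrable
  over the interval, so the limits that \<open>WA\<close> and \<open>WB\<close> denote by
  \<open>Lim\<close> exist. The third claim is Green's formula.\<close>

lemma wronskian_limits:
  assumes f: "tm f f1 h" and g: "tm g g1 k"
  shows "(Wr S f g \<longlongrightarrow> WA S f g) (filt_a S)" "(Wr S f g \<longlongrightarrow> WB S f g) (filt_b S)"
    "WB S f g - WA S f g = (LINT t:sI S|lborel. complex_of_real (sr S t) * (h t * g t - f t * k t))"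
    "\<And>x. x \<in> sI S \<Longrightarrow> Wr S f g x = WA S f g + cum (\<lambda>t. complex_of_real (sr S t) * (h t * g t - f t * k t)) x"
proof -
  let ?k = "\<lambda>t. complex_of_real (sr S t) * (h t * g t - f t * k t)"
  have i: "set_integrable lborel (sI S) ?k"
    using set_integral_diff(1)[OF prod_integrable[of h g] prod_integrable[of f k]] f g
    by (simp add: tm_def right_diff_distrib)
  have p: "prim (sI S) (Wr S f g) ?k" using f g by (intro wronskian_prim) (auto simp: tm_def)
  obtain L where L: "(Wr S f g \<longlongrightarrow> L) (filt_a S)" "(Wr S f g \<longlongrightarrow> L + (LINT t:sI S|lborel. ?k t)) (filt_b S)"
    "\<forall>x\<in>sI S. Wr S f g x = L + cum ?k x" using prim_limits[OF p i] by blast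
  have a: "WA S f g = L" unfolding WA_def by (rule tendsto_Lim[OF filt_nontrivial(1) L(1)])
  have b: "WB S f g = L + (LINT t:sI S|lborel. ?k t)" unfolding WB_def by (rule tendsto_Lim[OF filt_nontrivial(2) L(2)])
  show "(Wr S f g \<longlongrightarrow> WA S f g) (filt_a S)" "(Wr S f g \<longlongrightarrow> WB S f g) (filt_b S)"
    "WB S f g - WA S f g = (LINT t:sI S|lborel. ?k t)"
    "\<And>x. x \<in> sI S \<Longrightarrow> Wr S f g x = WA S f g + cum ?k x"
    using L a b by auto
qed

lemma WA_eqI:
  assumes "(F \<longlongrightarrow> L) (filt_a S)" "\<And>x. x \<in> sI S \<Longrightarrow> Wr S f g x = F x" shows "WA S f g = L"
proof -
  have "eventually (\<lambda>x. F x = Wr S f g x) (filt_a S)" using eventually_filt_in(1) by eventually_elim (simp add: assms(2))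
  then have "(Wr S f g \<longlongrightarrow> L) (filt_a S)" using assms(1) by (simp add: tendsto_cong)
  then show ?thesis unfolding WA_def by (intro tendsto_Lim filt_nontrivial)
qed

lemma WB_eqI:
  assumes "(F \<longlongrightarrow> L) (filt_b S)" "\<And>x. x \<in> sI S \<Longrightarrow> Wr S f g x = F x" shows "WB S f g = L"
proof -
  have "eventually (\<lambda>x. F x = Wr S f g x) (filt_b S)" using eventually_filt_in(2) by eventually_elim (simp add: assms(2))
  then have "(Wr S f g \<longlongrightarrow> L) (filt_b S)" using assms(1) by (simp add: tendsto_cong)
  then show ?thesis unfolding WB_def by (intro tendsto_Lim filt_nontrivial)
qed

lemma qrel_qd: "qrel S g g1 h \<Longrightarrow> qrel S g (qd S g) h"
proof -
  assume g: "qrel S g g1 h"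
  show ?thesis unfolding qrel_iff
  proof
    show "prim (sI S) g (\<lambda>t. qd S g t / complex_of_real (sp S t))"
      by (rule prim_cong[OF sI_interval g[unfolded qrel_iff, THEN conjunct1]]) (auto simp: qd_eq[OF g])
    show "prim (sI S) (qd S g) (\<lambda>t. complex_of_real (sq S t) * g t - complex_of_real (sr S t) * h t)"
      by (rule prim_cong[OF sI_interval g[unfolded qrel_iff, THEN conjunct2]]) (auto simp: qd_eq[OF g])
  qed
qed

lemma tm_qd: "tm g g1 h \<Longrightarrow> tm g (qd S g) h" by (auto simp: tm_def qrel_qd)

lemma Wr_lin:
  assumes "tm f f1 h" "tm g g1 k" "tm s s1 l" "x \<in> sI S"
  shows "Wr S s (\<lambda>x. c * f x + d * g x) x = c * Wr S s f x + d * Wr S s g x"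
proof -
  have q: "qrel S f f1 h" "qrel S g g1 k" "qrel S s s1 l" using assms(1-3) by (auto simp: tm_def)
  show ?thesis
    unfolding Wr_eq[OF q(3) qrel_lin[OF q(1,2)] assms(4)] Wr_eq[OF q(3,1) assms(4)] Wr_eq[OF q(3,2) assms(4)]
    by (simp add: algebra_simps)
qed

lemma WA_lin:
  assumes "tm f f1 h" "tm g g1 k" "tm s s1 l"
  shows "WA S s (\<lambda>x. c * f x + d * g x) = c * WA S s f + d * WA S s g"
    "WB S s (\<lambda>x. c * f x + d * g x) = c * WB S s f + d * WB S s g"
proof -
  show "WA S s (\<lambda>x. c * f x + d * g x) = c * WA S s f + d * WA S s g"
    by (rule WA_eqI[where F = "\<lambda>x. c * Wr S s f x + d * Wr S s g x"])
      (auto intro!: tendsto_intros wronskian_limits(1)[OF assms(3,1)] wronskian_limits(1)[OF assms(3,2)] Wr_lin[OF assms])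
  show "WB S s (\<lambda>x. c * f x + d * g x) = c * WB S s f + d * WB S s g"
    by (rule WB_eqI[where F = "\<lambda>x. c * Wr S s f x + d * Wr S s g x"])
      (auto intro!: tendsto_intros wronskian_limits(2)[OF assms(3,1)] wronskian_limits(2)[OF assms(3,2)] Wr_lin[OF assms])
qed

lemma pluecker_identity:
  fixes f f1 g g1 u u1 v v1 :: complex
  assumes "v * u1 - v1 * u = 1"
  shows "f * g1 - f1 * g = (- (u * f1 - u1 * f)) * (v * g1 - v1 * g) - (v * f1 - v1 * f) * (- (u * g1 - u1 * g))"
proof -
  have "(- (u * f1 - u1 * f)) * (v * g1 - v1 * g) - (v * f1 - v1 * f) * (- (u * g1 - u1 * g))
     = (v * u1 - v1 * u) * (f * g1 - f1 * g)" by (simp add: algebra_simps)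
  then show ?thesis using assms by simp
qed

text \<open>With u, v the normalised pair at an endpoint, the Wronskian there is the determinant of
  the generalized boundary values, so that boundary conditions become linear algebra in four
  numbers.\<close>

lemma pluecker:
  assumes f: "tm f f1 h" and g: "tm g g1 k" and u: "tm u u1 z1'" and v: "tm v v1 z2"
    and W: "\<And>x. x \<in> sI S \<Longrightarrow> Wr S v u x = 1"
  shows "WA S f g = (- WA S u f) * WA S v g - WA S v f * (- WA S u g)"
    "WB S f g = (- WB S u f) * WB S v g - WB S v f * (- WB S u g)"
proof -
  have q: "qrel S f f1 h" "qrel S g g1 k" "qrel S u u1 z1'" "qrel S v v1 z2" using assms(1-4) by (auto simp: tm_def)
  have e: "Wr S f g x = (- Wr S u f x) * Wr S v g x - Wr S v f x * (- Wr S u g x)" if x: "x \<in> sI S" for x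
    unfolding Wr_eq[OF q(1,2) x] Wr_eq[OF q(3,1) x] Wr_eq[OF q(4,2) x] Wr_eq[OF q(4,1) x] Wr_eq[OF q(3,2) x]
    by (rule pluecker_identity) (use W[OF x] in \<open>simp add: Wr_eq[OF q(4,3) x]\<close>)
  show "WA S f g = (- WA S u f) * WA S v g - WA S v f * (- WA S u g)"
    by (rule WA_eqI[OF _ e]) (intro tendsto_intros wronskian_limits(1)[OF u f] wronskian_limits(1)[OF v g]
       wronskian_limits(1)[OF v f] wronskian_limits(1)[OF u g])
  show "WB S f g = (- WB S u f) * WB S v g - WB S v f * (- WB S u g)"
    by (rule WB_eqI[OF _ e]) (intro tendsto_intros wronskian_limits(2)[OF u f] wronskian_limits(2)[OF v g]
       wronskian_limits(2)[OF v f] wronskian_limits(2)[OF u g])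
qed

lemma set_integral_cnj:
  fixes k :: "real \<Rightarrow> complex"
  shows "(LINT t:A|lborel. cnj (k t)) = cnj (LINT t:A|lborel. k t)"
proof -
  have "(LINT t:A|lborel. cnj (k t)) = (LINT t|lborel. cnj (indicator A t *\<^sub>R k t))"
    unfolding set_lebesgue_integral_def by (simp add: scaleR_conv_of_real)
  then show ?thesis unfolding set_lebesgue_integral_def by (simp only: Bochner_Integration.integral_cnj)
qed

lemma prim_cnj:
  fixes k :: "real \<Rightarrow> complex"
  assumes "prim J F k" shows "prim J (\<lambda>x. cnj (F x)) (\<lambda>x. cnj (k x))"
  unfolding prim_def
proof (intro ballI impI)
  fix c x assume "c \<in> J" "x \<in> J" "c \<le> x"
  then have *: "set_integrable lborel {c..x} k" "F x - F c = (LINT t:{c..x}|lborel. k t)" using primD[OF assms] by auto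
  have "set_integrable lborel {c..x} (\<lambda>t. cnj (k t))"
    using integrable_cnj[OF *(1)[unfolded set_integrable_def]] by (simp add: set_integrable_def scaleR_conv_of_real)
  then show "set_integrable lborel {c..x} (\<lambda>x. cnj (k x)) \<and> cnj (F x) - cnj (F c) = (LINT t:{c..x}|lborel. cnj (k t))"
    by (simp add: set_integral_cnj *(2)[symmetric])
qed

lemma tm_cnj: "tm g g1 h \<Longrightarrow> tm (\<lambda>x. cnj (g x)) (\<lambda>x. cnj (g1 x)) (\<lambda>x. cnj (h x))"
  unfolding tm_def qrel_iff
  using prim_cnj[of "sI S" g "\<lambda>t. g1 t / complex_of_real (sp S t)"]
    prim_cnj[of "sI S" g1 "\<lambda>t. complex_of_real (sq S t) * g t - complex_of_real (sr S t) * h t"] L2_cnj by auto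

lemma local_zero:
  assumes s: "qrel S s s1 k" and cd: "{c<..<d} \<subseteq> sI S"
    and AE: "AE x in lborel. x \<in> {c<..<d} \<longrightarrow> s x = 0" and x: "x \<in> {c<..<d}"
  shows "s x = 0" "s1 x = 0"
proof -
  have o: "open {c<..<d}" by simp
  have sz: "s y = 0" if "y \<in> {c<..<d}" for y
    by (rule continuous_AE_eq[OF o _ continuous_on_const AE that])
      (rule continuous_on_subset[OF qrel_continuous(1)[OF s] cd])
  show "s x = 0" by (rule sz[OF x])
  have iv: "is_interval {c<..<d}" by simp
  have p1: "prim {c<..<d} s (\<lambda>t. s1 t / complex_of_real (sp S t))"
    using s cd prim_subset unfolding qrel_iff by blast
  have p2: "prim {c<..<d} s (\<lambda>t. 0)"
    by (rule prim_cong[OF iv prim_const[of _ "0::complex"]]) (auto simp: sz)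
  define c' where "c' = (c + x) / 2"
  define d' where "d' = (x + d) / 2"
  have cd': "c' \<in> {c<..<d}" "d' \<in> {c<..<d}" "c' < x" "x < d'" using x by (auto simp: c'_def d'_def)
  have "AE y in lborel. y \<in> {c'..d'} \<longrightarrow> s1 y / complex_of_real (sp S y) = 0"
    by (rule prim_AE_unique[OF p1 p2 cd'(1,2) iv])
  then have "AE y in lborel. y \<in> {c'<..<d'} \<longrightarrow> s1 y = 0"
    using sp_pos
  proof eventually_elim
    case (elim y)
    show ?case
    proof
      assume y: "y \<in> {c'<..<d'}"
      then have "y \<in> {c'..d'}" "y \<in> sI S" using cd cd' by auto
      with elim show "s1 y = 0" by auto
    qed
  qed
  moreover have "continuous_on {c'<..<d'} s1"
    by (rule continuous_on_subset[OF qrel_continuous(2)[OF s]]) (use cd cd' in auto)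
  ultimately show "s1 x = 0"
    using continuous_AE_eq[of "{c'<..<d'}" s1 "\<lambda>_. 0" x] cd' by auto
qed

text \<open>If s vanished almost everywhere on a subinterval, then so would its quasi-derivative
  there, and with it the Wronskian.\<close>

lemma local_nontrivial:
  assumes s: "qrel S s s1 k" and t: "qrel S t t1 l" and W: "\<And>x. x \<in> sI S \<Longrightarrow> Wr S t s x \<noteq> 0"
    and cd: "c \<in> sI S" "d \<in> sI S" "c < d" and L: "L2 S s"
  shows "0 < (LINT x:{c..d}|lborel. (cmod (s x))\<^sup>2 * sr S x)"
proof -
  have sub: "{c..d} \<subseteq> sI S" using sI_mid[OF cd(1,2)] by auto
  have iI: "set_integrable lborel (sI S) (\<lambda>x. (cmod (s x))\<^sup>2 * sr S x)" using L by (simp add: L2_def)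
  have i: "integrable lborel (\<lambda>x. indicator {c..d} x *\<^sub>R ((cmod (s x))\<^sup>2 * sr S x))"
    using set_integrable_subset[OF iI _ sub] by (simp add: set_integrable_def)
  have nn: "AE x in lborel. 0 \<le> indicator {c..d} x *\<^sub>R ((cmod (s x))\<^sup>2 * sr S x)"
    using sr_pos by eventually_elim (use sub in \<open>auto simp: indicator_def\<close>)
  have "(LINT x:{c..d}|lborel. (cmod (s x))\<^sup>2 * sr S x) \<noteq> 0"
  proof
    assume "(LINT x:{c..d}|lborel. (cmod (s x))\<^sup>2 * sr S x) = 0"
    then have "AE x in lborel. indicator {c..d} x *\<^sub>R ((cmod (s x))\<^sup>2 * sr S x) = 0"
      unfolding set_lebesgue_integral_def using integral_nonneg_eq_0_iff_AE[OF i nn] by simp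
    then have AE: "AE x in lborel. x \<in> {c<..<d} \<longrightarrow> s x = 0"
      using sr_pos
    proof eventually_elim
      case (elim x)
      show ?case
      proof
        assume "x \<in> {c<..<d}"
        then have "x \<in> {c..d}" "x \<in> sI S" using sub by auto
        with elim show "s x = 0" by auto
      qed
    qed
    let ?x = "(c + d) / 2"
    have x: "?x \<in> {c<..<d}" "?x \<in> sI S" using cd(3) sub by auto
    have "{c<..<d} \<subseteq> {c..d}" by auto
    with sub have "{c<..<d} \<subseteq> sI S" by blast
    from local_zero[OF s this AE x(1)] have "Wr S t s ?x = 0" unfolding Wr_eq[OF t s x(2)] by simp
    with W[OF x(2)] show False by simp
  qed
  moreover have "0 \<le> (LINT x:{c..d}|lborel. (cmod (s x))\<^sup>2 * sr S x)"
    unfolding set_lebesgue_integral_def by (rule integral_nonneg_AE[OF nn])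
  ultimately show ?thesis by simp
qed

lemma L2_aeq: "L2 S f \<Longrightarrow> aeq S f g \<Longrightarrow> set_borel_measurable lborel (sI S) g \<Longrightarrow> L2 S g"
proof -
  assume f: "L2 S f" and a: "aeq S f g" and g: "set_borel_measurable lborel (sI S) g"
  have "set_integrable lborel (sI S) (\<lambda>x. (cmod (g x))\<^sup>2 * sr S x)"
    unfolding set_integrable_def
  proof (rule integrable_cong_AE_imp)
    show "integrable lborel (\<lambda>x. indicator (sI S) x *\<^sub>R ((cmod (f x))\<^sup>2 * sr S x))"
      using f by (simp add: L2_def set_integrable_def)
    show "AE x in lborel. indicator (sI S) x *\<^sub>R ((cmod (f x))\<^sup>2 * sr S x) = indicator (sI S) x *\<^sub>R ((cmod (g x))\<^sup>2 * sr S x)"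
      using a unfolding aeq_def by eventually_elim (auto simp: indicator_def)
  qed (rule L2_mod_measurable[OF g])
  then show ?thesis using g by (simp add: L2_def)
qed

lemma nrm_aeq: "L2 S f \<Longrightarrow> L2 S g \<Longrightarrow> aeq S f g \<Longrightarrow> nrm S f = nrm S g"
  using phi_eq_iff phi_norm by metis

lemma qrel_aeq:
  assumes g: "qrel S g g1 h" and a: "aeq S h h'" and L: "L2 S h'"
  shows "qrel S g g1 h'"
  unfolding qrel_iff
proof
  show "prim (sI S) g (\<lambda>t. g1 t / complex_of_real (sp S t))" using g by (simp add: qrel_iff)
  show "prim (sI S) g1 (\<lambda>t. complex_of_real (sq S t) * g t - complex_of_real (sr S t) * h' t)"
    unfolding prim_def
  proof (intro ballI impI)
    fix c x assume cx: "c \<in> sI S" "x \<in> sI S" "c \<le> x"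
    let ?k = "\<lambda>t. complex_of_real (sq S t) * g t - complex_of_real (sr S t) * h t"
    let ?k' = "\<lambda>t. complex_of_real (sq S t) * g t - complex_of_real (sr S t) * h' t"
    have sub: "{c..x} \<subseteq> sI S" using sI_mid[OF cx(1,2)] by auto
    have *: "set_integrable lborel {c..x} ?k" "g1 x - g1 c = (LINT t:{c..x}|lborel. ?k t)"
      using primD[OF g[unfolded qrel_iff, THEN conjunct2] cx] by auto
    have m: "(\<lambda>t. indicator {c..x} t *\<^sub>R ?k' t) \<in> borel_measurable lborel"
    proof -
      have q: "(\<lambda>t. indicator {c..x} t *\<^sub>R sq S t) \<in> borel_measurable borel"
        "(\<lambda>t. indicator {c..x} t *\<^sub>R sr S t) \<in> borel_measurable borel"
        using loc_integrable(2,3)[OF cx(1,2)] unfolding set_integrable_def by auto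
      have gm: "(\<lambda>t. indicator {c..x} t *\<^sub>R g t) \<in> borel_measurable borel"
        by (rule borel_measurable_continuous_on_indicator)
          (use continuous_on_subset[OF qrel_continuous(1)[OF g] sub] in auto)
      note [measurable] = q gm L2_measurable[OF L]
      have "(\<lambda>t. indicator {c..x} t *\<^sub>R ?k' t) = (\<lambda>t. complex_of_real (indicator {c..x} t *\<^sub>R sq S t) * (indicator {c..x} t *\<^sub>R g t)
          - complex_of_real (indicator {c..x} t *\<^sub>R sr S t) * (indicator (sI S) t *\<^sub>R h' t))"
        using sub by (auto simp: fun_eq_iff indicator_def)
      also have "\<dots> \<in> borel_measurable lborel" by measurable
      finally show ?thesis .
    qed
    have AE: "AE t in lborel. indicator {c..x} t *\<^sub>R ?k t = indicator {c..x} t *\<^sub>R ?k' t"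
      using a unfolding aeq_def by eventually_elim (use sub in \<open>auto simp: indicator_def\<close>)
    have "set_integrable lborel {c..x} ?k'"
      unfolding set_integrable_def by (rule integrable_cong_AE_imp[OF *(1)[unfolded set_integrable_def] m AE])
    moreover have "(LINT t:{c..x}|lborel. ?k t) = (LINT t:{c..x}|lborel. ?k' t)"
      unfolding set_lebesgue_integral_def
      using *(1) m AE by (intro integral_cong_AE) (auto simp: set_integrable_def)
    ultimately show "set_integrable lborel {c..x} ?k' \<and> g1 x - g1 c = (LINT t:{c..x}|lborel. ?k' t)" using * by simp
  qed
qed

lemma tm_aeq: "tm g g1 h \<Longrightarrow> aeq S h h' \<Longrightarrow> L2 S h' \<Longrightarrow> tm g g1 h'"
  unfolding tm_def using qrel_aeq by blast

lemma Tmax_iff: "(f, h) \<in> Tmax S \<longleftrightarrow> L2 S f \<and> L2 S h \<and> (\<exists>g g1. aeq S f g \<and> tm g g1 h)"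
  unfolding Tmax_def Trestr_def
  using L2_aeq continuous_sbm qrel_continuous(1) by (auto simp: tm_def)

lemma TrestrD: "(f, h) \<in> Trestr S P \<Longrightarrow> L2 S f \<and> L2 S h \<and> (\<exists>g g1. aeq S f g \<and> tm g g1 h \<and> P g)"
  unfolding Trestr_def
  using L2_aeq continuous_sbm qrel_continuous(1) by (auto simp: tm_def)

lemma TrestrI: "L2 S f \<Longrightarrow> aeq S f g \<Longrightarrow> tm g g1 h \<Longrightarrow> P g \<Longrightarrow> (f, h) \<in> Trestr S P"
  unfolding Trestr_def tm_def by auto

lemma aeq_continuous:
  assumes "aeq S f g" "tm f f1 h" "tm g g1 k" "x \<in> sI S" shows "f x = g x"
  using continuous_AE_eq[OF sI_open qrel_continuous(1)[of f f1 h] qrel_continuous(1)[of g g1 k] _ assms(4)] assms(1-3)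
  by (auto simp: aeq_def tm_def)

lemma sol_L2:
  assumes LC: "limit_circle_a S" "limit_circle_b S" and w: "is_sol S 0 w"
  shows "L2 S w"
proof -
  obtain w1 where q: "qrel S w w1 (\<lambda>t. 0 * w t)" using w unfolding is_sol_def by blast
  have cont: "continuous_on (sI S) w" by (rule qrel_continuous(1)[OF q])
  let ?f = "\<lambda>x. (cmod (w x))\<^sup>2 * sr S x"
  obtain c where c: "c \<in> sI S" "set_integrable lborel {x \<in> sI S. x \<le> c} ?f"
    using LC(1) w unfolding limit_circle_a_def by blast
  obtain d where d: "d \<in> sI S" "set_integrable lborel {x \<in> sI S. d \<le> x} ?f"
    using LC(2) w unfolding limit_circle_b_def by blast
  have "set_integrable lborel {c..d} (\<lambda>x. sr S x * (cmod (w x))\<^sup>2)"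
  proof (rule set_integrable_mult_cont[OF loc_integrable(3)[OF c(1) d(1)]])
    have "{c..d} \<subseteq> sI S" using sI_mid[OF c(1) d(1)] by auto
    then show "continuous_on {c..d} (\<lambda>x. (cmod (w x))\<^sup>2)"
      by (intro continuous_intros continuous_on_subset[OF cont])
  qed
  then have m: "set_integrable lborel {c..d} ?f" by (simp add: mult.commute)
  have e: "sI S = ({x \<in> sI S. x \<le> c} \<union> {x \<in> sI S. d \<le> x}) \<union> {c..d}"
    using sI_mid[OF c(1) d(1)] by auto
  have "set_integrable lborel (({x \<in> sI S. x \<le> c} \<union> {x \<in> sI S. d \<le> x}) \<union> {c..d}) ?f"
    by (intro set_integrable_Un c d m) auto
  then have "set_integrable lborel (sI S) ?f" using e by simp
  then show ?thesis unfolding L2_def using continuous_sbm[OF cont] by simp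
qed

end

section \<open>Boundary values and the minimal operator\<close>

locale limit_circle_problem = sturm_liouville S for S :: slp +
  fixes \<epsilon> :: real and ua uha ub uhb :: "real \<Rightarrow> real"
  assumes LCa: "limit_circle_a S" and LCb: "limit_circle_b S" and eps: "\<epsilon> > 0"
    and Tmin_lb: "\<forall>(f, h)\<in>Tmin S. \<epsilon> * (nrm S f)\<^sup>2 \<le> Re (ip S h f)"
    and pair_a: "normalized_pair_a S ua uha" and pair_b: "normalized_pair_b S ub uhb"
begin

abbreviation "u \<equiv> cu ua"
abbreviation "uh \<equiv> cu uha"
abbreviation "w \<equiv> cu ub"
abbreviation "wh \<equiv> cu uhb"
text \<open>The generalized boundary values of g: value and derivative at a, then at b.\<close>

abbreviation "a0 g \<equiv> - WA S u g"
abbreviation "a1 g \<equiv> WA S uh g"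
abbreviation "b0 g \<equiv> - WB S w g"
abbreviation "b1 g \<equiv> WB S wh g"

lemma sol_tm: "is_sol S 0 s \<Longrightarrow> tm s (qd S s) (\<lambda>_. 0)"
proof -
  assume s: "is_sol S 0 s"
  then obtain s1 where "qrel S s s1 (\<lambda>t. 0 * s t)" unfolding is_sol_def by blast
  then have "qrel S s (qd S s) (\<lambda>_. 0)" using qrel_qd by simp
  then show ?thesis using sol_L2[OF LCa LCb s] L2_zero by (simp add: tm_def)
qed

lemma tm_u: "tm u (qd S u) (\<lambda>_. 0)" and tm_uh: "tm uh (qd S uh) (\<lambda>_. 0)"
  and tm_w: "tm w (qd S w) (\<lambda>_. 0)" and tm_wh: "tm wh (qd S wh) (\<lambda>_. 0)"
  using pair_a pair_b by (auto simp: normalized_pair_a_def normalized_pair_b_def principal_a_def principal_b_def intro: sol_tm)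

lemma L2_sol: "L2 S u" "L2 S uh" "L2 S w" "L2 S wh"
  using tm_u tm_uh tm_w tm_wh by (auto simp: tm_def)

lemma W_a: "x \<in> sI S \<Longrightarrow> Wr S uh u x = 1" and W_b: "x \<in> sI S \<Longrightarrow> Wr S wh w x = 1"
  using pair_a pair_b by (auto simp: normalized_pair_a_def normalized_pair_b_def)

lemma real_sol: "cnj (u x) = u x" "cnj (uh x) = uh x" "cnj (w x) = w x" "cnj (wh x) = wh x"
  by (simp_all add: cu_def)

lemma pluecker_a: "tm f f1 h \<Longrightarrow> tm g g1 k \<Longrightarrow> WA S f g = a0 f * a1 g - a1 f * a0 g"
  using pluecker(1)[OF _ _ tm_u tm_uh W_a] by blast

lemma pluecker_b: "tm f f1 h \<Longrightarrow> tm g g1 k \<Longrightarrow> WB S f g = b0 f * b1 g - b1 f * b0 g"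
  using pluecker(2)[OF _ _ tm_w tm_wh W_b] by blast

lemma Wr_swap: "Wr S f g x = - Wr S g f x" by (simp add: Wr_def algebra_simps)

lemma Wr_same: "Wr S f f x = 0" by (simp add: Wr_def)

lemma bv_sol: "a0 u = 0" "a1 u = 1" "a0 uh = 1" "a1 uh = 0" "b0 w = 0" "b1 w = 1" "b0 wh = 1" "b1 wh = 0"
proof -
  have "WA S u u = 0" by (rule WA_eqI[OF tendsto_const]) (simp add: Wr_same)
  moreover show "a1 u = 1" by (rule WA_eqI[OF tendsto_const]) (simp add: W_a)
  moreover have "WA S u uh = -1" by (rule WA_eqI[OF tendsto_const]) (simp add: W_a Wr_swap[of u uh])
  moreover show "a1 uh = 0" by (rule WA_eqI[OF tendsto_const]) (simp add: Wr_same)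
  moreover have "WB S w w = 0" by (rule WB_eqI[OF tendsto_const]) (simp add: Wr_same)
  moreover show "b1 w = 1" by (rule WB_eqI[OF tendsto_const]) (simp add: W_b)
  moreover have "WB S w wh = -1" by (rule WB_eqI[OF tendsto_const]) (simp add: W_b Wr_swap[of w wh])
  moreover show "b1 wh = 0" by (rule WB_eqI[OF tendsto_const]) (simp add: Wr_same)
  ultimately show "a0 u = 0" "a0 uh = 1" "b0 w = 0" "b0 wh = 1" by simp_all
qed

lemma WB_u_uh: "WB S u uh = -1"
  by (rule WB_eqI[OF tendsto_const]) (simp add: W_a Wr_swap[of u uh])

lemma bv_lin:
  assumes "tm f f1 h" "tm g g1 k"
  shows "a0 (\<lambda>x. c * f x + d * g x) = c * a0 f + d * a0 g"
    "a1 (\<lambda>x. c * f x + d * g x) = c * a1 f + d * a1 g"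
    "b0 (\<lambda>x. c * f x + d * g x) = c * b0 f + d * b0 g"
    "b1 (\<lambda>x. c * f x + d * g x) = c * b1 f + d * b1 g"
  using WA_lin[OF assms tm_u, of c d] WA_lin[OF assms tm_uh, of c d] WA_lin[OF assms tm_w, of c d]
    WA_lin[OF assms tm_wh, of c d] by simp_all

lemma representation:
  assumes y: "tm y y1 h" and x: "x \<in> sI S"
  shows "y x = uh x * (a0 y + cum (\<lambda>t. complex_of_real (sr S t) * (u t * h t)) x)
    + u x * (a1 y - cum (\<lambda>t. complex_of_real (sr S t) * (uh t * h t)) x)"
proof -
  have q: "qrel S y y1 h" "qrel S u (qd S u) (\<lambda>_. 0)" "qrel S uh (qd S uh) (\<lambda>_. 0)"
    using y tm_u tm_uh by (auto simp: tm_def)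
  have "y x = y x * (uh x * qd S u x - qd S uh x * u x)"
    using W_a[OF x] by (simp add: Wr_eq[OF q(3,2) x])
  also have "\<dots> = uh x * (- Wr S u y x) + u x * Wr S uh y x"
    unfolding Wr_eq[OF q(2,1) x] Wr_eq[OF q(3,1) x] by (simp add: algebra_simps)
  finally show ?thesis
    unfolding wronskian_limits(4)[OF tm_u y x] wronskian_limits(4)[OF tm_uh y x]
    by (simp add: cum_uminus)
qed

lemma vc_ex:
  assumes h: "L2 S h"
  shows "\<exists>y y1. tm y y1 h \<and> a0 y = \<alpha> \<and> a1 y = \<beta>"
proof -
  let ?A = "\<lambda>x. \<alpha> + cum (\<lambda>t. complex_of_real (sr S t) * (u t * h t)) x"
  let ?B = "\<lambda>x. \<beta> - cum (\<lambda>t. complex_of_real (sr S t) * (uh t * h t)) x"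
  let ?y = "\<lambda>x. uh x * ?A x + u x * ?B x" and ?y1 = "\<lambda>x. qd S uh x * ?A x + qd S u x * ?B x"
  have q: "qrel S u (qd S u) (\<lambda>_. 0)" "qrel S uh (qd S uh) (\<lambda>_. 0)" using tm_u tm_uh by (auto simp: tm_def)
  have W: "uh x * qd S u x - qd S uh x * u x = 1" if "x \<in> sI S" for x
    using W_a[OF that] by (simp add: Wr_eq[OF q(2,1) that])
  have y: "tm ?y ?y1 h"
    by (rule variation_of_constants[OF q(1) L2_sol(1) q(2) L2_sol(2) W h])
  have q3: "qrel S ?y ?y1 h" using y by (simp add: tm_def)
  have "WA S u ?y = - (\<alpha> + 0)"
  proof (rule WA_eqI)
    show "((\<lambda>x. - ?A x) \<longlongrightarrow> - (\<alpha> + 0)) (filt_a S)"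
      by (intro tendsto_intros cum_a prod_integrable L2_sol h)
    fix x assume x: "x \<in> sI S"
    have "u x * ?y1 x - qd S u x * ?y x = - (uh x * qd S u x - qd S uh x * u x) * ?A x" by (simp add: algebra_simps)
    then show "Wr S u ?y x = - ?A x" unfolding Wr_eq[OF q(1) q3 x] W[OF x] by simp
  qed
  moreover have "WA S uh ?y = \<beta> - 0"
  proof (rule WA_eqI)
    show "(?B \<longlongrightarrow> \<beta> - 0) (filt_a S)"
      by (intro tendsto_intros cum_a prod_integrable L2_sol h)
    fix x assume x: "x \<in> sI S"
    have "uh x * ?y1 x - qd S uh x * ?y x = (uh x * qd S u x - qd S uh x * u x) * ?B x" by (simp add: algebra_simps)
    then show "Wr S uh ?y x = ?B x" unfolding Wr_eq[OF q(2) q3 x] W[OF x] by simp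
  qed
  ultimately have "a0 ?y = \<alpha> \<and> a1 ?y = \<beta>" by simp
  then show ?thesis using y by blast
qed

text \<open>The solution with zero data at a depends continuously in L2 on the right-hand side. This
  turns convergence of the images in the definition of \<open>Tmin\<close> into convergence of the
  elements.\<close>

lemma tm_bound:
  assumes y: "tm y y1 h" and z: "a0 y = 0" "a1 y = 0"
  shows "nrm S y \<le> 2 * nrm S u * nrm S uh * nrm S h"
proof -
  have h: "L2 S h" using y by (simp add: tm_def)
  have "L2 S y \<and> nrm S y \<le> (nrm S u * nrm S h) * nrm S uh + (nrm S uh * nrm S h) * nrm S u"
  proof (rule L2_combination_bound[OF L2_sol(2,1)])
    show "set_borel_measurable lborel (sI S) y" using y by (auto simp: tm_def L2_def)
    fix x assume x: "x \<in> sI S"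
    let ?A = "cum (\<lambda>t. complex_of_real (sr S t) * (u t * h t)) x"
    let ?B = "cum (\<lambda>t. complex_of_real (sr S t) * (uh t * h t)) x"
    have "y x = uh x * ?A - u x * ?B" using representation[OF y x] z by simp
    then have "cmod (y x) \<le> cmod (uh x) * cmod ?A + cmod (u x) * cmod ?B"
      using norm_triangle_ineq4[of "uh x * ?A" "u x * ?B"] by (simp add: norm_mult)
    also have "\<dots> \<le> cmod (uh x) * (nrm S u * nrm S h) + cmod (u x) * (nrm S uh * nrm S h)"
      by (intro add_mono mult_left_mono cum_bound L2_sol h) auto
    finally show "cmod (y x) \<le> nrm S u * nrm S h * cmod (uh x) + nrm S uh * nrm S h * cmod (u x)"
      by (simp add: mult.commute)
  qed (auto intro!: mult_nonneg_nonneg nrm_nonneg L2_sol h)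
  then show ?thesis by (simp add: algebra_simps)
qed

lemma green:
  assumes g: "tm g g1 h" and s: "tm s s1 (\<lambda>_. 0)" and r: "\<And>x. cnj (s x) = s x"
  shows "WA S s g - WB S s g = ip S h s"
proof -
  have "WB S s g - WA S s g = (LINT t:sI S|lborel. - (complex_of_real (sr S t) * (s t * h t)))"
    using wronskian_limits(3)[OF s g] by simp
  also have "\<dots> = - (LINT t:sI S|lborel. complex_of_real (sr S t) * (s t * h t))"
    by (rule set_integral_uminus) (use prod_integrable[of s h] s g in \<open>simp add: tm_def\<close>)
  also have "\<dots> = - ip S h s" by (simp add: ip_real[OF r])
  finally show ?thesis by (simp add: algebra_simps)
qed

text \<open>The boundary values at b of \<open>u\<close> and \<open>uh\<close> have determinant -1,
  the constant Wronskian; so the two Wronskians against them determine both boundary values of g at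
  b.\<close>

lemma bv_b_zeroI:
  assumes g: "tm g g1 h" and z: "WB S u g = 0" "WB S uh g = 0"
  shows "b0 g = 0 \<and> b1 g = 0"
proof -
  have 1: "b0 u * b1 g - b1 u * b0 g = 0" "b0 uh * b1 g - b1 uh * b0 g = 0"
    using pluecker_b[OF tm_u g] pluecker_b[OF tm_uh g] z by simp_all
  have d: "b0 u * b1 uh - b1 u * b0 uh = -1" using pluecker_b[OF tm_u tm_uh] WB_u_uh by simp
  have "(b0 u * b1 uh - b1 u * b0 uh) * b1 g = b1 uh * (b0 u * b1 g - b1 u * b0 g) - b1 u * (b0 uh * b1 g - b1 uh * b0 g)"
    by (simp add: algebra_simps)
  then have "b1 g = 0" unfolding 1 d by simp
  moreover have "(b0 u * b1 uh - b1 u * b0 uh) * b0 g = b0 uh * (b0 u * b1 g - b1 u * b0 g) - b0 u * (b0 uh * b1 g - b1 uh * b0 g)"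
    by (simp add: algebra_simps)
  then have "b0 g = 0" unfolding 1 d by simp
  ultimately show ?thesis by simp
qed

lemma WB_zero: "tm g g1 h \<Longrightarrow> tm s s1 k \<Longrightarrow> b0 g = 0 \<Longrightarrow> b1 g = 0 \<Longrightarrow> WB S s g = 0"
  using pluecker_b[of s s1 k g g1 h] by simp

lemma WA_zero: "tm g g1 h \<Longrightarrow> tm s s1 k \<Longrightarrow> a0 g = 0 \<Longrightarrow> a1 g = 0 \<Longrightarrow> WA S s g = 0"
  using pluecker_a[of s s1 k g g1 h] by simp

section \<open>Compactly supported elements and the minimal operator\<close>

definition rst :: "real \<Rightarrow> real \<Rightarrow> (real \<Rightarrow> complex) \<Rightarrow> real \<Rightarrow> complex" where
  "rst c d f x = complex_of_real (indicator {c..d} x) * f x"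

lemma rst_L2: assumes f: "L2 S f" shows "L2 S (rst c d f)"
proof -
  note [measurable] = L2_measurable[OF f]
  have "(\<lambda>x. indicator (sI S) x *\<^sub>R rst c d f x) = (\<lambda>x. complex_of_real (indicator {c..d} x) * (indicator (sI S) x *\<^sub>R f x))"
    by (auto simp: fun_eq_iff rst_def)
  also have "\<dots> \<in> borel_measurable lborel" by measurable
  finally have "set_borel_measurable lborel (sI S) (rst c d f)" by (simp add: set_borel_measurable_def)
  then show ?thesis using L2_bound[OF f] by (auto simp: rst_def indicator_def)
qed

lemma rst_ip: "ip S (rst c d f) g = ip S (rst c d f) (rst c d g)"
proof -
  have "(\<lambda>x. rst c d f x * cnj (g x) * complex_of_real (sr S x)) = (\<lambda>x. rst c d f x * cnj (rst c d g x) * complex_of_real (sr S x))"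
    by (auto simp: rst_def fun_eq_iff indicator_def)
  then show ?thesis unfolding ip_def by simp
qed

lemma rst_pos:
  assumes s: "tm s s1 k" and t: "tm t t1 l" and W: "\<And>x. x \<in> sI S \<Longrightarrow> Wr S t s x \<noteq> 0"
    and cd: "c \<in> sI S" "d \<in> sI S" "c < d"
  shows "nrm S (rst c d s) > 0"
proof -
  have sub: "{c..d} \<subseteq> sI S" using sI_mid[OF cd(1,2)] by auto
  have "(LINT x:sI S|lborel. (cmod (rst c d s x))\<^sup>2 * sr S x) = (LINT x:{c..d}|lborel. (cmod (s x))\<^sup>2 * sr S x)"
    unfolding set_lebesgue_integral_def
    by (rule Bochner_Integration.integral_cong) (use sub in \<open>auto simp: rst_def indicator_def\<close>)
  also have "\<dots> > 0" by (rule local_nontrivial[OF _ _ W cd]) (use s t in \<open>auto simp: tm_def\<close>)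
  finally show ?thesis by (simp add: nrm_def)
qed

lemma nrm_sol_pos:
  assumes s: "tm s s1 k" and t: "tm t t1 l" and W: "\<And>x. x \<in> sI S \<Longrightarrow> Wr S t s x \<noteq> 0"
  shows "nrm S s > 0"
proof -
  obtain c where c: "c \<in> sI S" using sI_ex by blast
  obtain e where e: "e > 0" "cball c e \<subseteq> sI S" using sI_open c open_contains_cball by blast
  have d: "c + e \<in> sI S" using e by (auto simp: dist_norm subset_iff)
  have "0 < nrm S (rst c (c + e) s)" by (rule rst_pos[OF s t W c d]) (use e in auto)
  also have "\<dots> \<le> nrm S s"
    using L2_bound[of s "rst c (c + e) s"] s rst_L2[of s c "c + e"]
    by (auto simp: tm_def L2_def rst_def indicator_def)
  finally show ?thesis .
qed

lemma sI_pair: "\<exists>c d. c \<in> sI S \<and> d \<in> sI S \<and> c < d"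
proof -
  obtain c where c: "c \<in> sI S" using sI_ex by blast
  obtain e where e: "e > 0" "cball c e \<subseteq> sI S" using sI_open c open_contains_cball by blast
  have "c + e \<in> sI S" using e by (auto simp: dist_norm subset_iff)
  then show ?thesis using c e(1) by (intro exI[of _ c] exI[of _ "c + e"]) auto
qed

text \<open>Gram-Schmidt for the restrictions of the two solutions to a compact interval, where they
  stay independent by \<open>local_nontrivial\<close>. The dual pair serves to correct moments
  without leaving compact support.\<close>

lemma dual_basis:
  "\<exists>e1 e2 c d. L2 S e1 \<and> L2 S e2 \<and> c \<in> sI S \<and> d \<in> sI S \<and> c < d \<and>
    (\<forall>x. x \<notin> {c..d} \<longrightarrow> e1 x = 0 \<and> e2 x = 0) \<and>
    ip S e1 u = 1 \<and> ip S e1 uh = 0 \<and> ip S e2 u = 0 \<and> ip S e2 uh = 1"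
proof -
  obtain c d where cd: "c \<in> sI S" "d \<in> sI S" "c < d" using sI_pair by blast
  define f where "f = rst c d u"
  have f: "L2 S f" unfolding f_def by (rule rst_L2[OF L2_sol(1)])
  have fu: "ip S f u = complex_of_real ((nrm S f)\<^sup>2)"
    unfolding f_def rst_ip[of c d u u] by (rule ip_self[OF f[unfolded f_def]])
  have fpos: "nrm S f > 0" unfolding f_def
    by (rule rst_pos[OF tm_u tm_uh _ cd]) (simp add: W_a)
  define \<kappa> where "\<kappa> = ip S (rst c d uh) u / ip S f u"
  define s where "s = (\<lambda>x. 1 * uh x + (- \<kappa>) * u x)"
  have s: "tm s (\<lambda>x. 1 * qd S uh x + (- \<kappa>) * qd S u x) (\<lambda>x. 1 * 0 + (- \<kappa>) * 0)"
    unfolding s_def by (rule tm_lin[OF tm_uh tm_u])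
  have Ls: "L2 S s" using s by (simp add: tm_def)
  define g where "g = rst c d s"
  have g: "L2 S g" unfolding g_def by (rule rst_L2[OF Ls])
  have gpos: "nrm S g > 0" unfolding g_def
  proof (rule rst_pos[OF s tm_u _ cd])
    fix x assume x: "x \<in> sI S"
    have "Wr S u s x = 1 * Wr S u uh x + (- \<kappa>) * Wr S u u x"
      unfolding s_def by (rule Wr_lin[OF tm_uh tm_u tm_u x])
    then show "Wr S u s x \<noteq> 0" using W_a[OF x] by (simp add: Wr_same Wr_swap[of u uh])
  qed
  have g_eq: "g = (\<lambda>x. 1 * rst c d uh x + (- \<kappa>) * f x)"
    by (simp add: g_def s_def f_def rst_def fun_eq_iff algebra_simps)
  have gu: "ip S g u = 0"
    unfolding g_eq ip_lin_left[OF rst_L2[OF L2_sol(2)] f L2_sol(1)]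
    using fpos by (simp add: \<kappa>_def fu)
  have "ip S g s = complex_of_real ((nrm S g)\<^sup>2)"
    unfolding g_def rst_ip[of c d s s] by (rule ip_self[OF g[unfolded g_def]])
  moreover have "ip S g s = ip S g uh"
    unfolding s_def ip_lin_right[OF L2_sol(2,1) g] gu by simp
  ultimately have guh: "ip S g uh = complex_of_real ((nrm S g)\<^sup>2)" by simp
  define e2 where "e2 = (\<lambda>x. (1 / ip S g uh) * g x)"
  have e2: "L2 S e2" unfolding e2_def by (rule L2_mult[OF g])
  have e2u: "ip S e2 u = 0" "ip S e2 uh = 1"
    unfolding e2_def ip_mult_left using gpos by (simp_all add: gu guh)
  define e1 where "e1 = (\<lambda>x. (1 / ip S f u) * f x + (- ip S f uh / ip S f u) * e2 x)"
  have e1: "L2 S e1" unfolding e1_def by (intro L2_add L2_mult f e2)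
  have e1u: "ip S e1 u = 1" "ip S e1 uh = 0"
    unfolding e1_def ip_lin_left[OF f e2 L2_sol(1)] ip_lin_left[OF f e2 L2_sol(2)]
    using e2u fpos by (simp_all add: fu)
  have "e1 x = 0 \<and> e2 x = 0" if "x \<notin> {c..d}" for x
    using that by (simp add: e1_def e2_def g_def f_def rst_def)
  with e1 e2 e1u e2u cd show ?thesis by blast
qed

lemma rst_tendsto:
  assumes h: "L2 S h" and lu: "\<And>x. x \<in> sI S \<Longrightarrow> \<exists>N. \<forall>n\<ge>N. l n < x" "\<And>x. x \<in> sI S \<Longrightarrow> \<exists>N. \<forall>n\<ge>N. x < v n"
  shows "(\<lambda>n. nrm S (\<lambda>x. rst (l n) (v n) h x - h x)) \<longlonglongrightarrow> 0"
proof -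
  let ?g = "\<lambda>n x. indicator (sI S) x *\<^sub>R ((cmod (rst (l n) (v n) h x - h x))\<^sup>2 * sr S x)"
  have "(\<lambda>n. LINT x|lborel. ?g n x) \<longlonglongrightarrow> (LINT x::real|lborel. (0::real))"
  proof (rule integral_dominated_convergence[where w = "\<lambda>x. indicator (sI S) x *\<^sub>R ((cmod (h x))\<^sup>2 * sr S x)"])
    show "integrable lborel (\<lambda>x. indicator (sI S) x *\<^sub>R ((cmod (h x))\<^sup>2 * sr S x))"
      using h by (simp add: L2_def set_integrable_def)
    show "?g n \<in> borel_measurable lborel" for n
      by (rule L2_mod_measurable) (use L2_diff[OF rst_L2[OF h] h] in \<open>simp add: L2_def\<close>)
    show "AE x in lborel. (\<lambda>n. ?g n x) \<longlonglongrightarrow> 0"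
    proof (rule AE_I2)
      fix x
      have "\<forall>\<^sub>F n in sequentially. ?g n x = 0"
      proof (cases "x \<in> sI S")
        case True
        obtain N M where N: "\<And>n. n \<ge> N \<Longrightarrow> l n < x" and M: "\<And>n. n \<ge> M \<Longrightarrow> x < v n"
          using lu[OF True] by blast
        show ?thesis unfolding eventually_sequentially
          by (rule exI[of _ "max N M"]) (use N M in \<open>auto simp: rst_def less_imp_le\<close>)
      qed simp
      then show "(\<lambda>n. ?g n x) \<longlonglongrightarrow> 0" by (rule tendsto_eventually)
    qed
    show "AE x in lborel. norm (?g n x) \<le> indicator (sI S) x *\<^sub>R ((cmod (h x))\<^sup>2 * sr S x)" for n
      using sr_pos by eventually_elim (auto simp: rst_def indicator_def)
  qed simp
  then have "(\<lambda>n. sqrt (LINT x|lborel. ?g n x)) \<longlonglongrightarrow> sqrt 0" by (intro tendsto_intros) simp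
  then show ?thesis by (simp add: nrm_def set_lebesgue_integral_def)
qed

text \<open>Truncations of h converge to h but lose the orthogonality to the solutions. Their
  moments tend to 0, so subtracting the matching combination of the dual basis repairs this without
  disturbing the limit.\<close>

lemma compact_approximation:
  assumes h: "L2 S h" and hu: "ip S h u = 0" "ip S h uh = 0"
  shows "\<exists>hn. (\<forall>n. L2 S (hn n) \<and> ip S (hn n) u = 0 \<and> ip S (hn n) uh = 0 \<and>
      (\<exists>c\<in>sI S. \<exists>d\<in>sI S. \<forall>x. x \<notin> {c..d} \<longrightarrow> hn n x = 0)) \<and>
      (\<lambda>n. nrm S (\<lambda>x. hn n x - h x)) \<longlonglongrightarrow> 0"
proof -
  obtain e1 e2 c d where e: "L2 S e1" "L2 S e2" "c \<in> sI S" "d \<in> sI S"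
    "\<And>x. x \<notin> {c..d} \<Longrightarrow> e1 x = 0 \<and> e2 x = 0"
    "ip S e1 u = 1" "ip S e1 uh = 0" "ip S e2 u = 0" "ip S e2 uh = 1"
    using dual_basis by blast
  obtain l v :: "nat \<Rightarrow> real" where lv: "\<And>n. l n \<in> sI S" "\<And>n. v n \<in> sI S"
    "\<And>x. x \<in> sI S \<Longrightarrow> \<exists>N. \<forall>n\<ge>N. l n < x" "\<And>x. x \<in> sI S \<Longrightarrow> \<exists>N. \<forall>n\<ge>N. x < v n"
    by (rule sI_sequences, rule that; assumption)
  define k where "k n = rst (l n) (v n) h" for n
  have k: "L2 S (k n)" for n unfolding k_def by (rule rst_L2[OF h])
  have kh: "(\<lambda>n. nrm S (\<lambda>x. k n x - h x)) \<longlonglongrightarrow> 0" unfolding k_def by (rule rst_tendsto[OF h lv(3,4)])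
  have Ld: "L2 S (\<lambda>x. k n x - h x)" for n by (rule L2_diff[OF k h])
  have ku: "(\<lambda>n. cmod (ip S (k n) s)) \<longlonglongrightarrow> 0" if s: "L2 S s" "ip S h s = 0" for s
  proof (rule tendsto_sandwich[OF _ _ tendsto_const])
    show "(\<lambda>n. nrm S (\<lambda>x. k n x - h x) * nrm S s) \<longlonglongrightarrow> 0" using tendsto_mult_left_zero[OF kh] by simp
    have "cmod (ip S (k n) s) \<le> nrm S (\<lambda>x. k n x - h x) * nrm S s" for n
      using ip_bound[OF Ld[of n] s(1)] s(2) by (simp add: ip_diff_left[OF k h s(1)])
    then show "\<forall>\<^sub>F n in sequentially. cmod (ip S (k n) s) \<le> nrm S (\<lambda>x. k n x - h x) * nrm S s" by simp
  qed simp
  define m where "m n = (\<lambda>x. ip S (k n) u * e1 x + ip S (k n) uh * e2 x)" for n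
  have m: "L2 S (m n)" for n unfolding m_def by (intro L2_add L2_mult e)
  define hn where "hn n = (\<lambda>x. k n x - m n x)" for n
  have hn: "L2 S (hn n)" for n unfolding hn_def by (rule L2_diff[OF k m])
  have "ip S (hn n) u = 0" "ip S (hn n) uh = 0" for n
    unfolding hn_def ip_diff_left[OF k m L2_sol(1)] ip_diff_left[OF k m L2_sol(2)]
    unfolding m_def ip_lin_left[OF e(1,2) L2_sol(1)] ip_lin_left[OF e(1,2) L2_sol(2)]
    using e by simp_all
  moreover have "\<exists>c\<in>sI S. \<exists>d\<in>sI S. \<forall>x. x \<notin> {c..d} \<longrightarrow> hn n x = 0" for n
  proof -
    have "min c (l n) \<in> sI S" "max d (v n) \<in> sI S" using e lv by (auto simp: min_def max_def)
    moreover have "hn n x = 0" if "x \<notin> {min c (l n)..max d (v n)}" for x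
    proof -
      have "x \<notin> {c..d}" "x \<notin> {l n..v n}" using that by auto
      then show ?thesis using e(5) by (simp add: hn_def m_def k_def rst_def)
    qed
    ultimately show ?thesis by blast
  qed
  moreover have "(\<lambda>n. nrm S (\<lambda>x. hn n x - h x)) \<longlonglongrightarrow> 0"
  proof (rule tendsto_sandwich[OF _ _ tendsto_const])
    let ?B = "\<lambda>n. nrm S (\<lambda>x. k n x - h x) + (cmod (ip S (k n) u) * nrm S e1 + cmod (ip S (k n) uh) * nrm S e2)"
    have "?B \<longlonglongrightarrow> 0 + (0 * nrm S e1 + 0 * nrm S e2)"
      by (intro tendsto_intros kh ku L2_sol hu)
    then show "?B \<longlonglongrightarrow> 0" by simp
    have "nrm S (\<lambda>x. hn n x - h x) \<le> ?B n" for n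
    proof -
      have e: "(\<lambda>x. hn n x - h x) = (\<lambda>x. (k n x - h x) + (-1) * m n x)" by (simp add: hn_def fun_eq_iff)
      have "nrm S (\<lambda>x. hn n x - h x) \<le> nrm S (\<lambda>x. k n x - h x) + nrm S (m n)"
        unfolding e using nrm_add[OF Ld[of n] L2_mult[OF m[of n], of "-1"]] nrm_mult[of "-1" "m n"] by simp
      also have "nrm S (m n) \<le> cmod (ip S (k n) u) * nrm S e1 + cmod (ip S (k n) uh) * nrm S e2"
        unfolding m_def using nrm_add[OF L2_mult[OF \<open>L2 S e1\<close>] L2_mult[OF \<open>L2 S e2\<close>]] by (simp add: nrm_mult)
      finally show ?thesis by simp
    qed
    then show "\<forall>\<^sub>F n in sequentially. nrm S (\<lambda>x. hn n x - h x) \<le> ?B n" by simp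
    show "\<forall>\<^sub>F n in sequentially. 0 \<le> nrm S (\<lambda>x. hn n x - h x)"
      using nrm_nonneg[OF L2_diff[OF hn h]] by simp
  qed
  ultimately show ?thesis using hn by blast
qed

lemma cum_zero_left: "(\<And>t. t \<in> sI S \<Longrightarrow> t < x \<Longrightarrow> k t = 0) \<Longrightarrow> cum k x = 0"
  unfolding cum_def by (subst set_lebesgue_integral_cong[of _ _ k "\<lambda>_. 0"]) auto

lemma cum_zero_right:
  assumes "\<And>t. t \<in> sI S \<Longrightarrow> x \<le> t \<Longrightarrow> k t = 0"
  shows "cum k x = (LINT t:sI S|lborel. k t)"
  unfolding cum_def set_lebesgue_integral_def
proof (rule Bochner_Integration.integral_cong)
  fix t
  show "indicator {t \<in> sI S. t < x} t *\<^sub>R k t = indicator (sI S) t *\<^sub>R k t"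
    using assms[of t] by (cases "t < x") (auto simp: indicator_def)
qed simp

text \<open>Approximate the right-hand side by compactly supported ones without moments. The
  solution started with zero data at a vanishes before the support, and beyond it as well, since its
  coefficients there are the two vanishing moments.\<close>

lemma Tmin_if_zero_bv:
  assumes g: "tm g g1 h" and z: "a0 g = 0" "a1 g = 0" "b0 g = 0" "b1 g = 0"
  shows "(g, h) \<in> Tmin S"
proof -
  have L: "L2 S g" "L2 S h" using g by (auto simp: tm_def)
  have hu: "ip S h u = 0" "ip S h uh = 0"
    using green[OF g tm_u real_sol(1)] green[OF g tm_uh real_sol(2)]
      WA_zero[OF g tm_u z(1,2)] WA_zero[OF g tm_uh z(1,2)] WB_zero[OF g tm_u z(3,4)] WB_zero[OF g tm_uh z(3,4)]
    by simp_all
  obtain hn where hn: "\<And>n. L2 S (hn n)" "\<And>n. ip S (hn n) u = 0" "\<And>n. ip S (hn n) uh = 0"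
    "\<And>n. \<exists>c\<in>sI S. \<exists>d\<in>sI S. \<forall>x. x \<notin> {c..d} \<longrightarrow> hn n x = 0"
    "(\<lambda>n. nrm S (\<lambda>x. hn n x - h x)) \<longlonglongrightarrow> 0"
    using compact_approximation[OF L(2) hu] by blast
  have "\<exists>y y1. tm y y1 (hn n) \<and> a0 y = 0 \<and> a1 y = 0" for n using vc_ex[OF hn(1)] by blast
  then obtain y y1 where y: "\<And>n. tm (y n) (y1 n) (hn n)" "\<And>n. a0 (y n) = 0" "\<And>n. a1 (y n) = 0" by metis
  have Ly: "L2 S (y n)" for n using y(1)[of n] by (simp add: tm_def)
  have supp: "\<exists>c\<in>sI S. \<exists>d\<in>sI S. AE x in lborel. x \<in> sI S \<and> (x < c \<or> d < x) \<longrightarrow> y n x = 0" for n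
  proof -
    obtain c d where cd: "c \<in> sI S" "d \<in> sI S" "\<And>x. x \<notin> {c..d} \<Longrightarrow> hn n x = 0" using hn(4) by blast
    have "y n x = 0" if x: "x \<in> sI S" "x < c \<or> d < x" for x
    proof (cases "x < c")
      case True
      then have "cum (\<lambda>t. complex_of_real (sr S t) * (s t * hn n t)) x = 0" for s
        using cd(3) by (intro cum_zero_left) auto
      then show ?thesis using representation[OF y(1)[of n] x(1)] y(2)[of n] y(3)[of n] by simp
    next
      case False
      then have "d < x" using x by simp
      then have *: "cum (\<lambda>t. complex_of_real (sr S t) * (s t * hn n t)) x =
          (LINT t:sI S|lborel. complex_of_real (sr S t) * (s t * hn n t))" for s
        using cd(3) by (intro cum_zero_right) auto
      show ?thesis using representation[OF y(1)[of n] x(1)] y(2)[of n] y(3)[of n] hn(2)[of n] hn(3)[of n]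
        unfolding * by (simp add: ip_real real_sol)
    qed
    then show ?thesis using cd(1,2) by (intro bexI[of _ c] bexI[of _ d] AE_I2) auto
  qed
  have yg: "(\<lambda>n. nrm S (\<lambda>x. y n x - g x)) \<longlonglongrightarrow> 0"
  proof (rule tendsto_sandwich[OF _ _ tendsto_const])
    let ?C = "2 * nrm S u * nrm S uh"
    show "(\<lambda>n. ?C * nrm S (\<lambda>x. hn n x - h x)) \<longlonglongrightarrow> 0" using tendsto_mult_right_zero[OF hn(5)] .
    have "nrm S (\<lambda>x. y n x - g x) \<le> ?C * nrm S (\<lambda>x. hn n x - h x)" for n
    proof -
      have "tm (\<lambda>x. 1 * y n x + (-1) * g x) (\<lambda>x. 1 * y1 n x + (-1) * g1 x) (\<lambda>x. 1 * hn n x + (-1) * h x)"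
        by (rule tm_lin[OF y(1) g])
      from tm_bound[OF this] show ?thesis
        unfolding bv_lin[OF y(1) g] using y(2,3)[of n] z by simp
    qed
    then show "\<forall>\<^sub>F n in sequentially. nrm S (\<lambda>x. y n x - g x) \<le> ?C * nrm S (\<lambda>x. hn n x - h x)" by simp
    show "\<forall>\<^sub>F n in sequentially. 0 \<le> nrm S (\<lambda>x. y n x - g x)" using nrm_nonneg[OF L2_diff[OF Ly L(1)]] by simp
  qed
  have "(y n, hn n) \<in> Tmax S" for n unfolding Tmax_iff using Ly hn(1) y(1) aeq_refl by blast
  then show ?thesis unfolding Tmin_def using L supp yg hn(5) by blast
qed

lemma zero_near_end:
  assumes g: "tm g g1 h" and c: "c \<in> sI S"
  shows "(AE x in lborel. x \<in> sI S \<and> x < c \<longrightarrow> g x = 0) \<Longrightarrow> a0 g = 0 \<and> a1 g = 0"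
    "(AE x in lborel. x \<in> sI S \<and> c < x \<longrightarrow> g x = 0) \<Longrightarrow> b0 g = 0 \<and> b1 g = 0"
proof -
  have q: "qrel S g g1 h" using g by (simp add: tm_def)
  {
    assume AE: "AE x in lborel. x \<in> sI S \<and> x < c \<longrightarrow> g x = 0"
    have W: "Wr S s g x = 0" if s: "tm s s1 k" and x: "x \<in> sI S" "x < c" for s s1 k x
    proof -
      obtain e where e: "e > 0" "ball x e \<subseteq> sI S" using sI_open x(1) open_contains_ball by blast
      let ?d = "min c (x + e)"
      have sub: "{x - e<..<?d} \<subseteq> sI S" using e(2) by (auto simp: subset_iff dist_real_def)
      have "AE y in lborel. y \<in> {x - e<..<?d} \<longrightarrow> g y = 0"
        using AE by eventually_elim (use sub in auto)
      from local_zero[OF q sub this, of x] have "g x = 0" "g1 x = 0" using x e by auto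
      then show ?thesis using Wr_eq[of s s1 k g g1 h x] s q x by (simp add: tm_def)
    qed
    have z: "WA S s g = 0" if "tm s s1 k" for s s1 k
    proof -
      have "eventually (\<lambda>x. Wr S s g x = 0) (filt_a S)" by (rule eventually_filt_aI[OF c]) (rule W[OF that])
      then have "(Wr S s g \<longlongrightarrow> 0) (filt_a S)" by (rule tendsto_eventually)
      then show ?thesis using wronskian_limits(1)[OF that g] filt_nontrivial(1) tendsto_unique by blast
    qed
    show "a0 g = 0 \<and> a1 g = 0" using z[OF tm_u] z[OF tm_uh] by simp
  }
  {
    assume AE: "AE x in lborel. x \<in> sI S \<and> c < x \<longrightarrow> g x = 0"
    have W: "Wr S s g x = 0" if s: "tm s s1 k" and x: "x \<in> sI S" "c < x" for s s1 k x
    proof -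
      obtain e where e: "e > 0" "ball x e \<subseteq> sI S" using sI_open x(1) open_contains_ball by blast
      let ?d = "max c (x - e)"
      have sub: "{?d<..<x + e} \<subseteq> sI S" using e(2) by (auto simp: subset_iff dist_real_def)
      have "AE y in lborel. y \<in> {?d<..<x + e} \<longrightarrow> g y = 0"
        using AE by eventually_elim (use sub in auto)
      from local_zero[OF q sub this, of x] have "g x = 0" "g1 x = 0" using x e by auto
      then show ?thesis using Wr_eq[of s s1 k g g1 h x] s q x by (simp add: tm_def)
    qed
    have z: "WB S s g = 0" if "tm s s1 k" for s s1 k
    proof -
      have "eventually (\<lambda>x. Wr S s g x = 0) (filt_b S)" by (rule eventually_filt_bI[OF c]) (rule W[OF that])
      then have "(Wr S s g \<longlongrightarrow> 0) (filt_b S)" by (rule tendsto_eventually)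
      then show ?thesis using wronskian_limits(2)[OF that g] filt_nontrivial(2) tendsto_unique by blast
    qed
    show "b0 g = 0 \<and> b1 g = 0" using z[OF tm_w] z[OF tm_wh] by simp
  }
qed

text \<open>What passes to the limit is not the boundary values but the moments of the right-hand
  sides, which are continuous in L2. Green's formula then returns the boundary values at b, while
  those at a are zero by the choice of y.\<close>

lemma Tmin_zero_bv:
  assumes fh: "(f, h) \<in> Tmin S"
  shows "\<exists>g g1. aeq S f g \<and> tm g g1 h \<and> a0 g = 0 \<and> a1 g = 0 \<and> b0 g = 0 \<and> b1 g = 0"
proof -
  obtain F H where L: "L2 S f" "L2 S h" and FH: "\<And>n. (F n, H n) \<in> Tmax S"
    and supp: "\<And>n. \<exists>c\<in>sI S. \<exists>d\<in>sI S. AE x in lborel. x \<in> sI S \<and> (x < c \<or> d < x) \<longrightarrow> F n x = 0"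
    and limF: "(\<lambda>n. nrm S (\<lambda>x. F n x - f x)) \<longlonglongrightarrow> 0" and limH: "(\<lambda>n. nrm S (\<lambda>x. H n x - h x)) \<longlonglongrightarrow> 0"
    using fh unfolding Tmin_def by blast
  have "\<exists>g g1. aeq S (F n) g \<and> tm g g1 (H n)" for n using FH[of n] unfolding Tmax_iff by blast
  then obtain G G1 where G: "\<And>n. aeq S (F n) (G n)" "\<And>n. tm (G n) (G1 n) (H n)" by metis
  have LF: "L2 S (F n)" "L2 S (H n)" "L2 S (G n)" for n using FH[of n] G(2)[of n] by (auto simp: Tmax_iff tm_def)
  have z: "a0 (G n) = 0 \<and> a1 (G n) = 0 \<and> b0 (G n) = 0 \<and> b1 (G n) = 0" for n
  proof -
    obtain c d where cd: "c \<in> sI S" "d \<in> sI S" "AE x in lborel. x \<in> sI S \<and> (x < c \<or> d < x) \<longrightarrow> F n x = 0"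
      using supp by blast
    have "AE x in lborel. x \<in> sI S \<and> x < c \<longrightarrow> G n x = 0" "AE x in lborel. x \<in> sI S \<and> d < x \<longrightarrow> G n x = 0"
      using cd(3) G(1)[of n, unfolded aeq_def] by (eventually_elim, auto)+
    then show ?thesis using zero_near_end[OF G(2) cd(1)] zero_near_end[OF G(2) cd(2)] by blast
  qed
  obtain y y1 where y: "tm y y1 h" "a0 y = 0" "a1 y = 0" using vc_ex[OF L(2), of 0 0] by blast
  have Ly: "L2 S y" using y by (simp add: tm_def)
  let ?C = "2 * nrm S u * nrm S uh"
  have Gy: "nrm S (\<lambda>x. G n x - y x) \<le> ?C * nrm S (\<lambda>x. H n x - h x)" for n
  proof -
    have "tm (\<lambda>x. 1 * G n x + (-1) * y x) (\<lambda>x. 1 * G1 n x + (-1) * y1 x) (\<lambda>x. 1 * H n x + (-1) * h x)"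
      by (rule tm_lin[OF G(2) y(1)])
    from tm_bound[OF this] show ?thesis
      unfolding bv_lin[OF G(2) y(1)] using y(2,3) z[of n] by simp
  qed
  have fy: "nrm S (\<lambda>x. f x - y x) \<le> nrm S (\<lambda>x. F n x - f x) + ?C * nrm S (\<lambda>x. H n x - h x)" for n
  proof -
    have "aeq S (\<lambda>x. f x - y x) (\<lambda>x. (f x - F n x) + (G n x - y x))"
      using G(1)[of n] unfolding aeq_def by eventually_elim simp
    then have "nrm S (\<lambda>x. f x - y x) = nrm S (\<lambda>x. (f x - F n x) + (G n x - y x))"
      by (intro nrm_aeq L2_add L2_diff L Ly LF)
    also have "\<dots> \<le> nrm S (\<lambda>x. f x - F n x) + nrm S (\<lambda>x. G n x - y x)"
      by (intro nrm_add L2_diff L Ly LF)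
    also have "nrm S (\<lambda>x. f x - F n x) = nrm S (\<lambda>x. F n x - f x)" by (rule nrm_diff_commute)
    finally show ?thesis using Gy[of n] by linarith
  qed
  have lim: "(\<lambda>n. nrm S (\<lambda>x. F n x - f x) + ?C * nrm S (\<lambda>x. H n x - h x)) \<longlonglongrightarrow> 0 + ?C * 0"
    by (intro tendsto_intros limF limH)
  have "nrm S (\<lambda>x. f x - y x) \<le> 0 + ?C * 0" by (rule LIMSEQ_le_const[OF lim]) (use fy in blast)
  then have "nrm S (\<lambda>x. f x - y x) = 0" using nrm_nonneg[OF L2_diff[OF L(1) Ly]] by simp
  then have "aeq S (\<lambda>x. f x - y x) (\<lambda>_. 0)" using nrm_zero_iff[OF L2_diff[OF L(1) Ly]] by simp
  then have fy': "aeq S f y" unfolding aeq_def by eventually_elim simp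
  have orth: "ip S h s = 0" if s: "tm s s1 (\<lambda>_. 0)" "\<And>x. cnj (s x) = s x" for s s1
  proof -
    have Ls: "L2 S s" using s by (simp add: tm_def)
    have Hs: "ip S (H n) s = 0" for n
      using green[OF G(2)[of n] s] WA_zero[OF G(2)[of n] s(1)] WB_zero[OF G(2)[of n] s(1)] z[of n] by simp
    have le: "cmod (ip S h s) \<le> nrm S (\<lambda>x. H n x - h x) * nrm S s" for n
      using ip_bound[OF L2_diff[OF LF(2) L(2)] Ls, of n] by (simp add: ip_diff_left[OF LF(2) L(2) Ls] Hs)
    have "(\<lambda>n. nrm S (\<lambda>x. H n x - h x) * nrm S s) \<longlonglongrightarrow> 0 * nrm S s" by (intro tendsto_intros limH)
    then have "cmod (ip S h s) \<le> 0 * nrm S s" by (rule LIMSEQ_le_const) (use le in blast)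
    then show ?thesis by simp
  qed
  have "WB S u y = 0" "WB S uh y = 0"
    using green[OF y(1) tm_u real_sol(1)] green[OF y(1) tm_uh real_sol(2)] orth[OF tm_u real_sol(1)] orth[OF tm_uh real_sol(2)]
      WA_zero[OF y(1) tm_u y(2,3)] WA_zero[OF y(1) tm_uh y(2,3)] by simp_all
  from bv_b_zeroI[OF y(1) this] show ?thesis using fy' y by blast
qed

end

section \<open>Cutoffs of small energy and the Friedrichs extension\<close>

lemma prim_of_real: "prim J F k \<Longrightarrow> prim J (\<lambda>x. complex_of_real (F x)) (\<lambda>x. complex_of_real (k x))"
  unfolding prim_def
proof (intro ballI impI)
  fix c x assume "\<forall>c\<in>J. \<forall>x\<in>J. c \<le> x \<longrightarrow> set_integrable lborel {c..x} k \<and> F x - F c = (LINT t:{c..x}|lborel. k t)"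
    "c \<in> J" "x \<in> J" "c \<le> x"
  then have *: "set_integrable lborel {c..x} k" "F x - F c = (LINT t:{c..x}|lborel. k t)" by auto
  have "set_integrable lborel {c..x} (\<lambda>t. complex_of_real (k t))"
    using integrable_of_real[OF *(1)[unfolded set_integrable_def], where ?'a = complex]
    by (simp add: set_integrable_def scaleR_conv_of_real)
  then show "set_integrable lborel {c..x} (\<lambda>x. complex_of_real (k x)) \<and>
      complex_of_real (F x) - complex_of_real (F c) = (LINT t:{c..x}|lborel. complex_of_real (k t))"
    by (simp add: set_integral_complex_of_real *(2)[symmetric])
qed

lemma set_integral_indicator_mult:
  fixes f :: "real \<Rightarrow> real"
  assumes "B \<subseteq> A" "B \<in> sets borel" "set_integrable lborel B f"
  shows "set_integrable lborel A (\<lambda>x. indicator B x * f x)"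
    "(LINT x:A|lborel. indicator B x * f x) = (LINT x:B|lborel. f x)"
proof -
  have e: "(\<lambda>x. indicator A x *\<^sub>R (indicator B x * f x)) = (\<lambda>x. indicator B x *\<^sub>R f x)"
    using assms(1) by (auto simp: fun_eq_iff indicator_def)
  show "set_integrable lborel A (\<lambda>x. indicator B x * f x)"
    "(LINT x:A|lborel. indicator B x * f x) = (LINT x:B|lborel. f x)"
    using assms(3) unfolding set_integrable_def set_lebesgue_integral_def e by auto
qed

context limit_circle_problem
begin

lemma cum_of_real: "cum (\<lambda>t. complex_of_real (k t)) x = complex_of_real (cum k x)"
  unfolding cum_def by (rule set_integral_complex_of_real)

text \<open>Two blocks of unit mass and opposite sign: the primitive climbs from 0 to 1 on [s, s'],
  stays at 1, and descends to 0 on [t', t]. The density \<rho> will be r U^2, so that k is r U times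
  an L2 function.\<close>

lemma cutoff_weight:
  fixes \<rho> :: "real \<Rightarrow> real"
  assumes \<rho>: "set_integrable lborel (sI S) \<rho>" and \<rho>0: "AE x in lborel. x \<in> sI S \<longrightarrow> 0 \<le> \<rho> x"
    and pts: "s \<in> sI S" "t \<in> sI S" "s < s'" "s' < t'" "t' < t"
    and pos: "0 < (LINT x:{s..s'}|lborel. \<rho> x)" "0 < (LINT x:{t'..t}|lborel. \<rho> x)"
    and k_def: "k = (\<lambda>x. (indicator {s..s'} x / (LINT x:{s..s'}|lborel. \<rho> x) - indicator {t'..t} x / (LINT x:{t'..t}|lborel. \<rho> x)) * \<rho> x)"
  shows "set_integrable lborel (sI S) k" "prim (sI S) (cum k) k"
    "\<And>x. x \<in> {s..t} \<Longrightarrow> 0 \<le> cum k x \<and> cum k x \<le> 1"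
    "\<And>x. x \<in> {s'..t'} \<Longrightarrow> cum k x = 1"
    "\<And>x. x \<in> sI S \<Longrightarrow> x \<le> s \<or> t \<le> x \<Longrightarrow> cum k x = 0"
    "(LINT x:sI S|lborel. k x) = 0"
proof -
  let ?m1 = "LINT x:{s..s'}|lborel. \<rho> x" and ?m2 = "LINT x:{t'..t}|lborel. \<rho> x"
  have sub: "{s..t} \<subseteq> sI S" using sI_mid[OF pts(1,2)] by auto
  have sub1: "{s..s'} \<subseteq> sI S" "{t'..t} \<subseteq> sI S" using sub pts by auto
  have i1: "set_integrable lborel {s..s'} \<rho>" and i2: "set_integrable lborel {t'..t} \<rho>"
    using sub1 by (auto intro: set_integrable_subset[OF \<rho>])
  have k_eq: "k = (\<lambda>x. (1 / ?m1) * (indicator {s..s'} x * \<rho> x) - (1 / ?m2) * (indicator {t'..t} x * \<rho> x))"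
    unfolding k_def by (auto simp: fun_eq_iff field_simps)
  have ki: "set_integrable lborel A k \<and> (LINT x:A|lborel. k x) = 0" if "{s..t} \<subseteq> A" for A
  proof -
    have "{s..s'} \<subseteq> A" "{t'..t} \<subseteq> A" using that pts by auto
    note j1 = set_integral_indicator_mult[OF this(1) _ i1] and j2 = set_integral_indicator_mult[OF this(2) _ i2]
    show ?thesis unfolding k_eq using j1 j2 pos by simp
  qed
  show kI: "set_integrable lborel (sI S) k" using ki[OF sub] by blast
  show "(LINT x:sI S|lborel. k x) = 0" using ki[OF sub] by blast
  show p: "prim (sI S) (cum k) k" by (rule cum_prim[OF kI])
  have tt: "(LINT x:{s..t}|lborel. k x) = 0" using ki[of "{s..t}"] by simp
  have cs: "cum k x = 0" if "x \<le> s" for x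
    by (rule cum_zero_left) (use that pts in \<open>auto simp: k_def\<close>)
  have ct: "cum k t = 0" using primD[OF p pts(1,2)] tt cs[of s] pts by simp
  have ct': "cum k x = 0" if x: "x \<in> sI S" "t \<le> x" for x
  proof -
    have "(LINT y:{t..x}|lborel. k y) = 0"
      unfolding set_lebesgue_integral_def
    proof (rule integral_eq_zero_AE)
      have "AE y in lborel. y \<noteq> t" by (rule AE_lborel_singleton)
      then show "AE y in lborel. indicator {t..x} y *\<^sub>R k y = 0"
        by eventually_elim (use pts in \<open>auto simp: k_def indicator_def\<close>)
    qed
    then show ?thesis using primD[OF p pts(2) x(1) x(2)] ct by simp
  qed
  show "cum k x = 0" if "x \<in> sI S" "x \<le> s \<or> t \<le> x" for x using cs ct' that by blast
  have incr: "cum k c \<le> cum k x" if "s \<le> c" "c \<le> x" "x \<le> t'" for c x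
  proof -
    have cx: "c \<in> sI S" "x \<in> sI S" using sub that pts by auto
    have "0 \<le> (LINT y:{c..x}|lborel. k y)"
      unfolding set_lebesgue_integral_def
    proof (rule integral_nonneg_AE)
      have "AE y in lborel. y \<noteq> t'" by (rule AE_lborel_singleton)
      then show "AE y in lborel. 0 \<le> indicator {c..x} y *\<^sub>R k y"
        using \<rho>0
      proof eventually_elim
        case (elim y)
        show ?case
        proof (cases "y \<in> {c..x}")
          case True
          then have "y \<in> sI S" "y \<notin> {t'..t}" using sub that pts elim(1) by auto
          then show ?thesis using True elim(2) pos by (simp add: k_def)
        qed simp
      qed
    qed
    then show ?thesis using primD[OF p cx that(2)] by simp
  qed
  have decr: "cum k x \<le> cum k c" if "s' \<le> c" "c \<le> x" "x \<le> t" for c x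
  proof -
    have cx: "c \<in> sI S" "x \<in> sI S" using sub that pts by auto
    have "0 \<le> (LINT y|lborel. - (indicator {c..x} y *\<^sub>R k y))"
    proof (rule integral_nonneg_AE)
      have "AE y in lborel. y \<noteq> s'" by (rule AE_lborel_singleton)
      then show "AE y in lborel. 0 \<le> - (indicator {c..x} y *\<^sub>R k y)"
        using \<rho>0
      proof eventually_elim
        case (elim y)
        show ?case
        proof (cases "y \<in> {c..x}")
          case True
          then have "y \<in> sI S" "y \<notin> {s..s'}" using sub that pts elim(1) by auto
          then show ?thesis using True elim(2) pos by (simp add: k_def)
        qed simp
      qed
    qed
    then have "(LINT y:{c..x}|lborel. k y) \<le> 0" by (simp add: set_lebesgue_integral_def)
    then show ?thesis using primD[OF p cx that(2)] by simp
  qed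
  have s'1: "cum k s' = 1"
  proof -
    have "s' \<in> sI S" using sub pts by auto
    then have "cum k s' = (LINT y:{s..s'}|lborel. k y)" using primD[OF p pts(1)] pts(3) cs[of s] by simp
    also have "\<dots> = (LINT y:{s..s'}|lborel. (1 / ?m1) * \<rho> y)"
      by (rule set_lebesgue_integral_cong) (use pts in \<open>auto simp: k_def\<close>)
    also have "\<dots> = 1" using pos by simp
    finally show ?thesis .
  qed
  show "0 \<le> cum k x \<and> cum k x \<le> 1" if x: "x \<in> {s..t}" for x
  proof (cases "x \<le> s'")
    case True
    then show ?thesis using incr[of s x] incr[of x s'] cs[of s] s'1 x pts by simp
  next
    case False
    then show ?thesis using decr[of s' x] decr[of x t] ct s'1 x pts by simp
  qed
  show "cum k x = 1" if x: "x \<in> {s'..t'}" for x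
    using incr[of s' x] decr[of s' x] s'1 x pts by simp
qed

text \<open>Near an endpoint a second solution V is U times the primitive of -1/(p U^2). The cutoff is
  U times a primitive of this weight, truncated so that the quasi-derivative vanishes at both ends;
  its energy is the reciprocal of the integral of 1/(p U^2), hence small if U is principal.\<close>

lemma cutoff:
  fixes U V :: "real \<Rightarrow> real"
  assumes U: "tm (cu U) U1 (\<lambda>_. 0)" and V: "tm (cu V) V1 (\<lambda>_. 0)"
    and W: "\<And>x. x \<in> sI S \<Longrightarrow> Wr S (cu V) (cu U) x = 1"
    and pts: "s \<in> sI S" "t \<in> sI S" "s < s'" "s' < t'" "t' < t"
    and nz: "\<And>x. x \<in> {s..t} \<Longrightarrow> U x \<noteq> 0"
    and X: "X > 0" "X \<le> (LINT x:{s'..t'}|lborel. 1 / (sp S x * (U x)\<^sup>2))"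
  shows "\<exists>\<theta> \<theta>1 h \<eta>. tm \<theta> \<theta>1 h \<and> (\<forall>x\<in>sI S. \<theta> x = complex_of_real (\<eta> x) * cu U x \<and> 0 \<le> \<eta> x \<and> \<eta> x \<le> 1) \<and>
    (\<forall>x\<in>sI S. x \<le> s \<longrightarrow> \<eta> x = 1) \<and> (\<forall>x\<in>sI S. t < x \<longrightarrow> \<eta> x = 0) \<and> (\<forall>x. x \<notin> {s..t} \<longrightarrow> h x = 0) \<and>
    Re (ip S h \<theta>) \<le> 1 / X \<and> ip S h (cu U) = 0"
proof -
  have qU: "qrel S (cu U) U1 (\<lambda>_. 0)" and qV: "qrel S (cu V) V1 (\<lambda>_. 0)"
    and LU: "L2 S (cu U)" and LV: "L2 S (cu V)" using U V by (auto simp: tm_def)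
  have W': "cu V x * U1 x - V1 x * cu U x = 1" if "x \<in> sI S" for x
    using W[OF that] unfolding Wr_eq[OF qV qU that] .
  have sub: "{s..t} \<subseteq> sI S" using sI_mid[OF pts(1,2)] by auto
  have iv: "is_interval {s..t}" by simp
  have st: "s \<in> {s..t}" "t \<in> {s..t}" "s \<le> t" using pts by auto
  define \<rho> where "\<rho> x = (cmod (cu U x))\<^sup>2 * sr S x" for x
  have \<rho>U: "\<rho> x = U x * U x * sr S x" for x by (simp add: \<rho>_def cu_def power2_eq_square)
  have \<rho>i: "set_integrable lborel (sI S) \<rho>" using LU unfolding L2_def \<rho>_def by simp
  have \<rho>0: "AE x in lborel. x \<in> sI S \<longrightarrow> 0 \<le> \<rho> x"
    using sr_pos by eventually_elim (auto simp: \<rho>_def)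
  have nzW: "Wr S (cu V) (cu U) x \<noteq> 0" if "x \<in> sI S" for x using W[OF that] by simp
  have mid: "s' \<in> sI S" "t' \<in> sI S" using sub pts by auto
  have m1: "0 < (LINT x:{s..s'}|lborel. \<rho> x)" unfolding \<rho>_def
    by (rule local_nontrivial[OF qU qV nzW pts(1) mid(1) pts(3) LU])
  have m2: "0 < (LINT x:{t'..t}|lborel. \<rho> x)" unfolding \<rho>_def
    by (rule local_nontrivial[OF qU qV nzW mid(2) pts(2) pts(5) LU])
  define c1 where "c1 = 1 / (LINT x:{s..s'}|lborel. \<rho> x)"
  define c2 where "c2 = 1 / (LINT x:{t'..t}|lborel. \<rho> x)"
  have c12: "c1 > 0" "c2 > 0" using m1 m2 by (auto simp: c1_def c2_def)
  define k where "k = (\<lambda>x. (indicator {s..s'} x / (LINT x:{s..s'}|lborel. \<rho> x) - indicator {t'..t} x / (LINT x:{t'..t}|lborel. \<rho> x)) * \<rho> x)"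
  have k_c: "k x = (c1 * indicator {s..s'} x - c2 * indicator {t'..t} x) * \<rho> x" for x
    by (simp add: k_def c1_def c2_def)
  note kp = cutoff_weight[OF \<rho>i \<rho>0 pts m1 m2 k_def]
  define \<omega> where "\<omega> = cum k"
  \<comment> \<open>A step multiple of U, hence in L2, with r U h0 = k.\<close>
  define h0 where "h0 = (\<lambda>x. complex_of_real c1 * rst s s' (cu U) x + complex_of_real (- c2) * rst t' t (cu U) x)"
  have h0L: "L2 S h0" unfolding h0_def by (intro L2_add L2_mult rst_L2 LU)
  have h0e: "h0 x = complex_of_real ((c1 * indicator {s..s'} x - c2 * indicator {t'..t} x) * U x)" for x
    by (simp add: h0_def rst_def cu_def algebra_simps)
  have h0U: "complex_of_real (sr S x) * (cu U x * h0 x) = complex_of_real (k x)" for x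
    unfolding h0e k_c \<rho>U cu_def by (simp add: algebra_simps)
  have h0z: "h0 x = 0" if "x \<notin> {s..t}" for x
  proof -
    have "x \<notin> {s..s'}" "x \<notin> {t'..t}" using that pts by auto
    then show ?thesis by (simp add: h0_def rst_def)
  qed
  define g where "g x = 1 / (sp S x * (U x)\<^sup>2)" for x
  have cU: "continuous_on {s..t} (cu U)" by (rule continuous_on_subset[OF qrel_continuous(1)[OF qU] sub])
  then have cUr: "continuous_on {s..t} U"
    using continuous_on_Re[OF cU] by (simp add: cu_def)
  have gi: "set_integrable lborel {s..t} g"
  proof -
    have "set_integrable lborel {s..t} (\<lambda>x. 1 / sp S x * (1 / (U x)\<^sup>2))"
      by (rule set_integrable_mult_cont[OF loc_integrable(1)[OF pts(1,2)]])
        (intro continuous_intros cUr, use nz in auto)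
    then show ?thesis by (simp add: g_def[abs_def])
  qed
  have g0: "AE x in lborel. x \<in> {s..t} \<longrightarrow> 0 \<le> g x"
    using sp_pos by eventually_elim (use sub in \<open>auto simp: g_def\<close>)
  \<comment> \<open>Reduction of order: \<Psi> is the quotient V/U, whose derivative is -1/(p
    U^2).\<close>
  define \<Psi> where "\<Psi> x = V s / U s - (LINT r:{s..x}|lborel. g r)" for x
  have P\<Psi>: "prim {s..t} \<Psi> (\<lambda>x. 0 - g x)"
    unfolding \<Psi>_def[abs_def] by (rule prim_diff[OF prim_const prim_integral[OF gi]])
  have \<Psi>s: "\<Psi> s = V s / U s" using primD[OF prim_integral[OF gi] st(1) st(1)] 
    by (simp add: \<Psi>_def set_lebesgue_integral_def)
  have VU: "V x = U x * \<Psi> x" if x: "x \<in> {s..t}" for x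
  proof -
    \<comment> \<open>By the Wronskian relation the difference V - U \<Psi> solves the first order
      equation E' = (U1 / (p U)) E with E(s) = 0, so it vanishes.\<close>
    define E where "E x = cu V x - cu U x * complex_of_real (\<Psi> x)" for x
    define m where "m x = complex_of_real (1 / sp S x) * (U1 x / cu U x)" for x
    have im: "set_integrable lborel {s..t} m"
      unfolding m_def[abs_def]
    proof (rule set_integrable_mult_cont)
      show "set_integrable lborel {s..t} (\<lambda>x. complex_of_real (1 / sp S x))"
        using integrable_of_real[OF loc_integrable(1)[OF pts(1,2), unfolded set_integrable_def], where ?'a = complex]
        by (simp add: set_integrable_def scaleR_conv_of_real)
      show "continuous_on {s..t} (\<lambda>x. U1 x / cu U x)"
        by (intro continuous_intros cU continuous_on_subset[OF qrel_continuous(2)[OF qU] sub])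
          (use nz in \<open>auto simp: cu_def\<close>)
    qed
    have "prim {s..t} E (\<lambda>x. V1 x / complex_of_real (sp S x)
        - (U1 x / complex_of_real (sp S x) * complex_of_real (\<Psi> x) + cu U x * complex_of_real (0 - g x)))"
      unfolding E_def[abs_def]
      by (intro prim_diff prim_mult iv prim_of_real P\<Psi> prim_subset[OF _ sub])
        (use qU qV in \<open>auto simp: qrel_iff\<close>)
    then have "prim {s..t} E (\<lambda>x. m x * E x)"
    proof (rule prim_cong[OF iv])
      fix x assume x: "x \<in> {s..t}"
      then have xI: "x \<in> sI S" and Ux: "cu U x \<noteq> 0" using sub nz by (auto simp: cu_def)
      have gx: "complex_of_real (0 - g x) = - (complex_of_real (1 / sp S x) / (cu U x)\<^sup>2)"
        by (simp add: g_def cu_def)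
      have "V1 x / complex_of_real (sp S x)
        - (U1 x / complex_of_real (sp S x) * complex_of_real (\<Psi> x) + cu U x * complex_of_real (0 - g x))
        = complex_of_real (1 / sp S x) * (V1 x - U1 x * complex_of_real (\<Psi> x) + 1 / cu U x)"
      proof -
        have "cu U x * complex_of_real (0 - g x) = - (complex_of_real (1 / sp S x) * (1 / cu U x))"
          unfolding gx using Ux by (simp add: power2_eq_square)
        then show ?thesis by (simp add: divide_inverse algebra_simps)
      qed
      also have "V1 x - U1 x * complex_of_real (\<Psi> x) + 1 / cu U x = (U1 x / cu U x) * E x"
      proof -
        have "V1 x * cu U x + 1 = cu V x * U1 x" using W'[OF xI] by (simp add: algebra_simps)
        then have "V1 x + 1 / cu U x = cu V x * U1 x / cu U x" using Ux by (simp add: field_simps)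
        then show ?thesis using Ux by (simp add: E_def field_simps)
      qed
      finally show "V1 x / complex_of_real (sp S x)
        - (U1 x / complex_of_real (sp S x) * complex_of_real (\<Psi> x) + cu U x * complex_of_real (0 - g x)) = m x * E x"
        by (simp add: m_def)
    qed simp
    moreover have "E s = 0" using nz[of s] pts by (simp add: E_def \<Psi>s cu_def)
    ultimately have "E x = 0" by (rule linear_ode_zero[OF _ _ im x])
    then have "complex_of_real (V x) = complex_of_real (U x * \<Psi> x)" by (simp add: E_def cu_def)
    then show ?thesis using of_real_eq_iff by blast
  qed
  have p\<omega>: "prim {s..t} \<omega> k" unfolding \<omega>_def by (rule prim_subset[OF kp(2) sub])
  have c\<omega>: "continuous_on {s..t} \<omega>" by (rule prim_continuous_Icc[OF p\<omega> st(1,2) iv])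
  have c\<Psi>: "continuous_on {s..t} \<Psi>" by (rule prim_continuous_Icc[OF P\<Psi> st(1,2) iv])
  have \<omega>s: "\<omega> s = 0" "\<omega> t = 0" using kp(5)[of s] kp(5)[of t] pts by (auto simp: \<omega>_def)
  have gwi: "set_integrable lborel {s..t} (\<lambda>x. g x * \<omega> x)" by (rule set_integrable_mult_cont[OF gi c\<omega>])
  \<comment> \<open>With \<omega> the plateau function, Z grows from 0 to at least X, as \<omega> =
    1 on [s', t']. The profile of the cutoff will be 1 - \<kappa> Z. Integration by parts gives
    \<Psi> \<omega> + Z as the primitive of \<Psi> k.\<close>
  define Z where "Z x = (LINT r:{s..x}|lborel. g r * \<omega> r)" for x
  have PZ: "prim {s..t} Z (\<lambda>x. g x * \<omega> x)" unfolding Z_def[abs_def] by (rule prim_integral[OF gwi])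
  have Zs: "Z s = 0" using primD[OF PZ st(1) st(1)] by (simp add: Z_def)
  have Y: "(LINT r:{s..x}|lborel. \<Psi> r * k r) = \<Psi> x * \<omega> x + Z x" if x: "x \<in> {s..t}" for x
  proof -
    have sx: "s \<le> x" using x by simp
    have "prim {s..t} (\<lambda>x. \<Psi> x * \<omega> x + Z x) (\<lambda>x. ((0 - g x) * \<omega> x + \<Psi> x * k x) + g x * \<omega> x)"
      by (rule prim_add[OF prim_mult[OF iv P\<Psi> p\<omega>] PZ])
    then have "prim {s..t} (\<lambda>x. \<Psi> x * \<omega> x + Z x) (\<lambda>x. \<Psi> x * k x)"
      by (rule prim_cong[OF iv]) (auto simp: algebra_simps)
    from primD[OF this st(1) x sx] have "\<Psi> x * \<omega> x + Z x - (\<Psi> s * \<omega> s + Z s) = (LINT r:{s..x}|lborel. \<Psi> r * k r)" by blast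
    then show ?thesis by (simp add: \<omega>s Zs)
  qed
  have Zmono: "Z c \<le> Z x" if "c \<in> {s..t}" "x \<in> {s..t}" "c \<le> x" for c x
  proof -
    have "0 \<le> (LINT r:{c..x}|lborel. g r * \<omega> r)"
      unfolding set_lebesgue_integral_def
    proof (rule integral_nonneg_AE)
      show "AE r in lborel. 0 \<le> indicator {c..x} r *\<^sub>R (g r * \<omega> r)"
        using g0
      proof eventually_elim
        case (elim r)
        show ?case using elim kp(3)[of r] that by (auto simp: indicator_def \<omega>_def)
      qed
    qed
    then show ?thesis using primD[OF PZ that] by simp
  qed
  have ZX: "X \<le> Z t"
  proof -
    have "X \<le> (LINT x:{s'..t'}|lborel. g x)" using X(2) by (simp add: g_def)
    also have "\<dots> = (LINT x:{s'..t'}|lborel. g x * \<omega> x)"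
      by (rule set_lebesgue_integral_cong) (auto simp: \<omega>_def kp(4))
    also have "\<dots> = Z t' - Z s'" using primD[OF PZ, of s' t'] pts by simp
    also have "\<dots> \<le> Z t" using Zmono[of t' t] Zmono[of s s'] Zs pts by simp
    finally show ?thesis .
  qed
  \<comment> \<open>The normalisation that brings the profile 1 - \<kappa> Z to 0 at t; it is at the
    same time the bound for the energy.\<close>
  define \<kappa> where "\<kappa> = 1 / Z t"
  have \<kappa>: "\<kappa> > 0" "\<kappa> \<le> 1 / X" "\<kappa> * Z t = 1" using ZX X(1) by (auto simp: \<kappa>_def frac_le)
  define h where "h = (\<lambda>x. complex_of_real \<kappa> * h0 x)"
  have hL: "L2 S h" unfolding h_def by (rule L2_mult[OF h0L])
  let ?cU = "cum (\<lambda>t. complex_of_real (sr S t) * (cu U t * h t))"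
  let ?cV = "cum (\<lambda>t. complex_of_real (sr S t) * (cu V t * h t))"
  \<comment> \<open>Coefficients 0 of V and 1 of U at a: to the left of the support of h the
    function is U. Inside, substituting V = U \<Psi> cancels the terms with \<Psi> and leaves U (1 -
    \<kappa> Z).\<close>
  define \<theta> where "\<theta> = (\<lambda>x. cu V x * (0 + ?cU x) + cu U x * (1 - ?cV x))"
  define \<theta>1 where "\<theta>1 = (\<lambda>x. V1 x * (0 + ?cU x) + U1 x * (1 - ?cV x))"
  have \<theta>: "tm \<theta> \<theta>1 h" unfolding \<theta>_def \<theta>1_def
    by (rule variation_of_constants[OF qU LU qV LV W' hL])
  have hU: "complex_of_real (sr S x) * (cu U x * h x) = complex_of_real (\<kappa> * k x)" for x
    using h0U[of x] by (simp add: h_def mult_ac)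
  have cU_eq: "?cU x = complex_of_real (\<kappa> * \<omega> x)" for x
    unfolding hU cum_of_real by (simp add: cum_def \<omega>_def)
  have PV: "prim (sI S) ?cV (\<lambda>t. complex_of_real (sr S t) * (cu V t * h t))"
    by (rule cum_prim[OF prod_integrable[OF LV hL]])
  have cV_s: "?cV x = 0" if "x \<le> s" for x
    by (rule cum_zero_left) (use that h0z in \<open>auto simp: h_def\<close>)
  have cV_eq: "?cV x = complex_of_real (\<kappa> * (\<Psi> x * \<omega> x + Z x))" if x: "x \<in> {s..t}" for x
  proof -
    have xI: "x \<in> sI S" "s \<le> x" using x sub by auto
    have "?cV x = (LINT r:{s..x}|lborel. complex_of_real (sr S r) * (cu V r * h r))"
      using primD[OF PV pts(1) xI] cV_s[of s] by simp
    also have "\<dots> = (LINT r:{s..x}|lborel. complex_of_real (\<kappa> * (\<Psi> r * k r)))"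
    proof (rule set_lebesgue_integral_cong)
      show "\<forall>r. r \<in> {s..x} \<longrightarrow> complex_of_real (sr S r) * (cu V r * h r) = complex_of_real (\<kappa> * (\<Psi> r * k r))"
      proof (intro allI impI)
        fix r assume "r \<in> {s..x}"
        then have r: "r \<in> {s..t}" using x by auto
        have "complex_of_real (sr S r) * (cu V r * h r) = complex_of_real (\<Psi> r) * (complex_of_real (sr S r) * (cu U r * h r))"
          by (simp add: cu_def VU[OF r] mult_ac)
        then show "complex_of_real (sr S r) * (cu V r * h r) = complex_of_real (\<kappa> * (\<Psi> r * k r))"
          unfolding hU by (simp add: mult_ac)
      qed
    qed simp
    also have "\<dots> = complex_of_real (LINT r:{s..x}|lborel. \<kappa> * (\<Psi> r * k r))" by (rule set_integral_complex_of_real)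
    also have "\<dots> = complex_of_real (\<kappa> * (\<Psi> x * \<omega> x + Z x))" by (simp add: Y[OF x])
    finally show ?thesis .
  qed
  have cV_t: "?cV x = 1" if x: "x \<in> sI S" "t < x" for x
  proof -
    have "(LINT r:{t..x}|lborel. complex_of_real (sr S r) * (cu V r * h r)) = 0"
      unfolding set_lebesgue_integral_def
    proof (rule integral_eq_zero_AE)
      have "AE y in lborel. y \<noteq> t" by (rule AE_lborel_singleton)
      then show "AE y in lborel. indicator {t..x} y *\<^sub>R (complex_of_real (sr S y) * (cu V y * h y)) = 0"
        by eventually_elim (auto simp: h_def h0z indicator_def)
    qed
    then have "?cV x = ?cV t" using primD[OF PV pts(2) x(1)] x(2) by simp
    also have "\<dots> = 1" unfolding cV_eq[OF st(2)] using \<kappa>(3) \<omega>s by simp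
    finally show ?thesis .
  qed
  define \<eta> where "\<eta> x = (if x \<le> s then 1 else if x \<le> t then 1 - \<kappa> * Z x else 0)" for x
  have \<eta>01: "0 \<le> \<eta> x \<and> \<eta> x \<le> 1" for x
  proof -
    have "0 \<le> Z x \<and> Z x \<le> Z t" if "x \<in> {s..t}" using Zmono[of s x] Zmono[of x t] Zs st that by auto
    then have "0 \<le> \<kappa> * Z x \<and> \<kappa> * Z x \<le> 1" if "x \<in> {s..t}"
      using that \<kappa> mult_left_mono[of "Z x" "Z t" \<kappa>] by auto
    then show ?thesis by (auto simp: \<eta>_def)
  qed
  have \<theta>\<eta>: "\<theta> x = complex_of_real (\<eta> x) * cu U x" if x: "x \<in> sI S" for x
  proof -
    consider "x \<le> s" | "s < x" "x \<le> t" | "t < x" by linarith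
    then show ?thesis
    proof cases
      case 1
      then have "\<omega> x = 0" using kp(5)[OF x] by (simp add: \<omega>_def)
      then show ?thesis using 1 unfolding \<theta>_def cU_eq cV_s[OF 1] by (simp add: \<eta>_def)
    next
      case 2
      then have xJ: "x \<in> {s..t}" by simp
      have "\<theta> x = complex_of_real (U x * \<Psi> x * (\<kappa> * \<omega> x) + U x * (1 - \<kappa> * (\<Psi> x * \<omega> x + Z x)))"
        unfolding \<theta>_def cU_eq cV_eq[OF xJ] unfolding cu_def VU[OF xJ] by simp
      also have "U x * \<Psi> x * (\<kappa> * \<omega> x) + U x * (1 - \<kappa> * (\<Psi> x * \<omega> x + Z x)) = \<eta> x * U x"
        using 2 by (simp add: \<eta>_def algebra_simps)
      finally show ?thesis by (simp add: cu_def)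
    next
      case 3
      then have "\<omega> x = 0" using kp(5)[OF x] by (simp add: \<omega>_def)
      then show ?thesis unfolding \<theta>_def cU_eq cV_t[OF x 3] using 3 pts by (simp add: \<eta>_def)
    qed
  qed
  have energy: "Re (ip S h \<theta>) \<le> 1 / X"
  proof -
    have L\<theta>: "L2 S \<theta>" using \<theta> by (simp add: tm_def)
    have i: "integrable lborel (\<lambda>x. indicator (sI S) x *\<^sub>R (h x * cnj (\<theta> x) * complex_of_real (sr S x)))"
      using ip_integrable[OF hL L\<theta>] by (simp add: set_integrable_def)
    have i2: "integrable lborel (\<lambda>x. \<kappa> * (c1 * (indicator {s..s'} x *\<^sub>R \<rho> x)))"
    proof -
      have "{s..s'} \<subseteq> sI S" using sub pts by auto
      then have "set_integrable lborel {s..s'} \<rho>" by (intro set_integrable_subset[OF \<rho>i]) auto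
      then show ?thesis unfolding set_integrable_def by (intro integrable_mult_right) 
    qed
    have "Re (ip S h \<theta>) = (LINT x|lborel. Re (indicator (sI S) x *\<^sub>R (h x * cnj (\<theta> x) * complex_of_real (sr S x))))"
      unfolding ip_def set_lebesgue_integral_def using i by (simp only: integral_Re)
    \<comment> \<open>The energy density is \<kappa> \<eta> k with \<eta> between 0 and 1, so
      dropping the negative block of k and replacing \<eta> by 1 on the positive one, whose mass is
      1, only increases it.\<close>
    also have "\<dots> \<le> (LINT x|lborel. \<kappa> * (c1 * (indicator {s..s'} x *\<^sub>R \<rho> x)))"
    proof (rule integral_mono_AE[OF integrable_Re[OF i] i2])
      show "AE x in lborel. Re (indicator (sI S) x *\<^sub>R (h x * cnj (\<theta> x) * complex_of_real (sr S x))) \<le> \<kappa> * (c1 * (indicator {s..s'} x *\<^sub>R \<rho> x))"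
        using \<rho>0
      proof eventually_elim
        case (elim x)
        show ?case
        proof (cases "x \<in> sI S")
          case True
          have "h x * cnj (\<theta> x) * complex_of_real (sr S x) = complex_of_real (\<eta> x) * (complex_of_real (sr S x) * (cu U x * h x))"
            unfolding \<theta>\<eta>[OF True] by (simp add: cu_def mult_ac)
          also have "\<dots> = complex_of_real (\<kappa> * (\<eta> x * k x))" unfolding hU by (simp add: mult_ac)
          finally have e: "Re (h x * cnj (\<theta> x) * complex_of_real (sr S x)) = \<kappa> * (\<eta> x * k x)" by simp
          have \<rho>x: "0 \<le> \<rho> x" using elim True by simp
          have "k x \<le> c1 * indicator {s..s'} x * \<rho> x"
            unfolding k_c using c12 \<rho>x by (intro mult_right_mono) (auto simp: indicator_def)
          then have "\<eta> x * k x \<le> \<eta> x * (c1 * indicator {s..s'} x * \<rho> x)" using \<eta>01 by (intro mult_left_mono) auto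
          also have "\<dots> \<le> 1 * (c1 * indicator {s..s'} x * \<rho> x)"
            using \<eta>01 c12 \<rho>x by (intro mult_right_mono) (auto simp: indicator_def)
          finally have "\<kappa> * (\<eta> x * k x) \<le> \<kappa> * (c1 * indicator {s..s'} x * \<rho> x)"
            using \<kappa>(1) by (intro mult_left_mono) auto
          then show ?thesis using True e by (simp add: mult_ac)
        next
          case False
          moreover have "{s..s'} \<subseteq> {s..t}" using pts by auto
          ultimately have "x \<notin> {s..s'}" using sub by blast
          with False show ?thesis by simp
        qed
      qed
    qed
    also have "\<dots> = \<kappa> * (c1 * (LINT x:{s..s'}|lborel. \<rho> x))" by (simp add: set_lebesgue_integral_def)
    also have "\<dots> = \<kappa>" using m1 by (simp add: c1_def)
    finally show ?thesis using \<kappa>(2) by linarith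
  qed
  have orth: "ip S h (cu U) = 0"
  proof -
    have "ip S h (cu U) = (LINT x:sI S|lborel. complex_of_real (\<kappa> * k x))"
      unfolding hU[symmetric] by (rule ip_real[symmetric]) (simp add: cu_def)
    also have "\<dots> = complex_of_real (LINT x:sI S|lborel. \<kappa> * k x)" by (rule set_integral_complex_of_real)
    also have "\<dots> = 0" using kp(6) by simp
    finally show ?thesis .
  qed
  have "\<forall>x. x \<notin> {s..t} \<longrightarrow> h x = 0" using h0z by (simp add: h_def)
  moreover have "\<forall>x\<in>sI S. x \<le> s \<longrightarrow> \<eta> x = 1" "\<forall>x\<in>sI S. t < x \<longrightarrow> \<eta> x = 0" using pts by (auto simp: \<eta>_def)
  ultimately show ?thesis using \<theta> \<theta>\<eta> \<eta>01 energy orth by blast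
qed

text \<open>Monotone convergence along an exhausting sequence of compact intervals, on each of which
  1/(p U^2) is integrable because U is continuous without zeros there.\<close>

lemma energy_large:
  assumes A: "\<And>n. l n \<in> sI S" "\<And>n. v n \<in> sI S" "incseq (\<lambda>n. {l n..v n})"
    and nz: "\<And>n x. x \<in> {l n..v n} \<Longrightarrow> U x \<noteq> 0" and U: "tm (cu U) U1 (\<lambda>_. 0)"
    and inf: "(\<integral>\<^sup>+ x. indicator (\<Union>n. {l n..v n}) x * ennreal (1 / (sp S x * (U x)\<^sup>2)) \<partial>lborel) = \<infinity>"
    and X: "X > 0"
  shows "\<exists>n. l n < v n \<and> X \<le> (LINT x:{l n..v n}|lborel. 1 / (sp S x * (U x)\<^sup>2))"
proof -
  let ?g = "\<lambda>x. 1 / (sp S x * (U x)\<^sup>2)"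
  have qU: "qrel S (cu U) U1 (\<lambda>_. 0)" using U by (simp add: tm_def)
  have sub: "{l n..v n} \<subseteq> sI S" for n using sI_mid[OF A(1,2)] by auto
  have gi: "set_integrable lborel {l n..v n} ?g" for n
  proof -
    have "continuous_on {l n..v n} (cu U)" by (rule continuous_on_subset[OF qrel_continuous(1)[OF qU] sub])
    then have c: "continuous_on {l n..v n} U" using continuous_on_Re by (fastforce simp: cu_def)
    have "set_integrable lborel {l n..v n} (\<lambda>x. 1 / sp S x * (1 / (U x)\<^sup>2))"
      by (rule set_integrable_mult_cont[OF loc_integrable(1)[OF A(1,2)]])
        (intro continuous_intros c, use nz in auto)
    then show ?thesis by simp
  qed
  have nn: "AE x in lborel. 0 \<le> indicator {l n..v n} x *\<^sub>R ?g x" for n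
    using sp_pos by eventually_elim (use sub[of n] in \<open>auto simp: indicator_def\<close>)
  have e: "indicator B x * ennreal (?g x) = ennreal (indicator B x *\<^sub>R ?g x)" for B x
    by (simp add: indicator_def)
  have m: "(\<lambda>x. indicator {l n..v n} x * ennreal (?g x)) \<in> borel_measurable lborel" for n
    unfolding e using gi[of n] unfolding set_integrable_def by measurable
  have I: "(\<integral>\<^sup>+ x. indicator {l n..v n} x * ennreal (?g x) \<partial>lborel) = ennreal (LINT x:{l n..v n}|lborel. ?g x)" for n
    unfolding e set_lebesgue_integral_def
    by (rule nn_integral_eq_integral[OF _ nn]) (use gi[of n] in \<open>simp add: set_integrable_def\<close>)
  have "(\<integral>\<^sup>+ x. indicator (\<Union>n. {l n..v n}) x * ennreal (?g x) \<partial>lborel)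
      = (\<integral>\<^sup>+ x. (SUP n. indicator {l n..v n} x * ennreal (?g x)) \<partial>lborel)"
  proof (rule nn_integral_cong)
    fix x
    show "indicator (\<Union>n. {l n..v n}) x * ennreal (?g x) = (SUP n. indicator {l n..v n} x * ennreal (?g x))"
    proof (cases "\<exists>n. x \<in> {l n..v n}")
      case True
      then obtain n where n: "x \<in> {l n..v n}" by blast
      have "(SUP n. indicator {l n..v n} x * ennreal (?g x)) = ennreal (?g x)"
      proof (rule antisym)
        show "(SUP n. indicator {l n..v n} x * ennreal (?g x)) \<le> ennreal (?g x)"
          by (rule SUP_least) (simp add: indicator_def)
        show "ennreal (?g x) \<le> (SUP n. indicator {l n..v n} x * ennreal (?g x))"
          by (rule SUP_upper2[of n]) (use n in auto)
      qed
      then show ?thesis using True by simp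
    next
      case False
      have "indicator {l n..v n} x * ennreal (?g x) = 0" for n using False by auto
      then show ?thesis using False by simp
    qed
  qed
  also have "\<dots> = (SUP n. \<integral>\<^sup>+ x. indicator {l n..v n} x * ennreal (?g x) \<partial>lborel)"
  proof (rule nn_integral_monotone_convergence_SUP[OF _ m])
    show "incseq (\<lambda>n x. indicator {l n..v n} x * ennreal (?g x))"
    proof (intro incseq_SucI le_funI mult_right_mono)
      fix n x
      have "{l n..v n} \<subseteq> {l (Suc n)..v (Suc n)}" using incseq_SucD[OF A(3)] .
      then show "indicator {l n..v n} x \<le> (indicator {l (Suc n)..v (Suc n)} x :: ennreal)"
        by (cases "x \<in> {l n..v n}") (auto simp del: atLeastAtMost_iff simp: subset_iff)
    qed simp
  qed
  finally have "(SUP n. ennreal (LINT x:{l n..v n}|lborel. ?g x)) = \<infinity>" unfolding inf I by simp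
  then have "ennreal X < (SUP n. ennreal (LINT x:{l n..v n}|lborel. ?g x))"
    by (simp only: infinity_ennreal_def ennreal_less_top)
  then obtain n where n: "ennreal X < ennreal (LINT x:{l n..v n}|lborel. ?g x)" by (auto simp: less_SUP_iff)
  then have XI: "X < (LINT x:{l n..v n}|lborel. ?g x)" using X by (simp add: ennreal_less_iff)
  have "l n < v n"
  proof (rule ccontr)
    assume "\<not> l n < v n"
    then have "(LINT x:{l n..v n}|lborel. ?g x) = 0"
      unfolding set_lebesgue_integral_def
      by (intro integral_eq_zero_AE)
        (use AE_lborel_singleton[of "l n"] in \<open>auto elim!: eventually_mono simp: indicator_def\<close>)
    with XI X show False by simp
  qed
  then show ?thesis using XI less_imp_le by blast
qed

text \<open>The integral of 1/(p u^2) still diverges after a compact piece is cut off, so the points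
  can be found arbitrarily close to a. The middle interval [s', t'] carries the integral; the outer
  two leave room for the ascent and descent in \<open>cutoff_weight\<close>.\<close>

lemma principal_points_a:
  assumes c: "c \<in> sI S" and X: "X > 0"
  shows "\<exists>s s' t' t. s \<in> sI S \<and> t \<in> sI S \<and> s < s' \<and> s' < t' \<and> t' < t \<and> t < c \<and> (\<forall>x\<in>{s..t}. ua x \<noteq> 0) \<and>
    X \<le> (LINT x:{s'..t'}|lborel. 1 / (sp S x * (ua x)\<^sup>2))"
proof -
  let ?g = "\<lambda>x. ennreal (1 / (sp S x * (ua x)\<^sup>2))"
  obtain c0 where c0: "c0 \<in> sI S" "\<And>x. x \<in> sI S \<Longrightarrow> x \<le> c0 \<Longrightarrow> ua x \<noteq> 0"
    "(\<integral>\<^sup>+ x. indicator {x\<in>sI S. x \<le> c0} x * ?g x \<partial>lborel) = \<infinity>"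
    using pair_a unfolding normalized_pair_a_def principal_a_def by blast
  obtain l v :: "nat \<Rightarrow> real" where l: "\<And>n. l n \<in> sI S" "decseq l" "\<And>x. x \<in> sI S \<Longrightarrow> \<exists>N. \<forall>n\<ge>N. l n < x"
    by (rule sI_sequences, rule that; assumption)
  have mc: "min c c0 \<in> sI S" using c c0 by (simp add: min_def)
  obtain t where t: "t \<in> sI S" "t < min c c0" using l(1) l(3)[OF mc] by blast
  obtain t' where t': "t' \<in> sI S" "t' < t" using l(1) l(3)[OF t(1)] by blast
  have U: "(\<Union>n. {l n..t'}) = {x\<in>sI S. x \<le> t'}"
  proof (intro equalityI subsetI)
    fix x assume "x \<in> (\<Union>n. {l n..t'})"
    then obtain n where "x \<in> {l n..t'}" by blast
    then show "x \<in> {x\<in>sI S. x \<le> t'}" using sI_mid[OF l(1) t'(1)] by auto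
  next
    fix x assume "x \<in> {x\<in>sI S. x \<le> t'}"
    then show "x \<in> (\<Union>n. {l n..t'})" using l(3)[of x] by (auto intro: less_imp_le)
  qed
  have nz: "ua x \<noteq> 0" if "x \<in> {l n..t'}" for n x
  proof -
    have "x \<in> sI S" using that sI_mid[OF l(1) t'(1)] by auto
    then show ?thesis using c0(2) that t t' by auto
  qed
  have inc: "incseq (\<lambda>n. {l n..t'})" using l(2) by (auto simp: incseq_def decseq_def intro: order_trans)
  have gi: "(\<integral>\<^sup>+ x. indicator {t'..c0} x * ?g x \<partial>lborel) < \<infinity>"
  proof -
    have sub: "{t'..c0} \<subseteq> sI S" using sI_mid[OF t'(1) c0(1)] by auto
    have qU: "qrel S u (qd S u) (\<lambda>_. 0)" using tm_u by (simp add: tm_def)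
    have "continuous_on {t'..c0} u" by (rule continuous_on_subset[OF qrel_continuous(1)[OF qU] sub])
    then have cc: "continuous_on {t'..c0} ua" using continuous_on_Re by (fastforce simp: cu_def)
    have "set_integrable lborel {t'..c0} (\<lambda>x. 1 / sp S x * (1 / (ua x)\<^sup>2))"
      by (rule set_integrable_mult_cont[OF loc_integrable(1)[OF t'(1) c0(1)]])
        (intro continuous_intros cc, use c0(2) sub in auto)
    then have i: "integrable lborel (\<lambda>x. indicator {t'..c0} x *\<^sub>R (1 / (sp S x * (ua x)\<^sup>2)))" by (simp add: set_integrable_def)
    have e: "indicator {t'..c0} x * ?g x = ennreal (indicator {t'..c0} x *\<^sub>R (1 / (sp S x * (ua x)\<^sup>2)))" for x
      by (simp add: indicator_def)
    have nn: "AE x in lborel. 0 \<le> indicator {t'..c0} x *\<^sub>R (1 / (sp S x * (ua x)\<^sup>2))"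
      using sp_pos by eventually_elim (use sub in \<open>auto simp: indicator_def\<close>)
    show ?thesis unfolding e nn_integral_eq_integral[OF i nn] by simp
  qed
  have inf: "(\<integral>\<^sup>+ x. indicator {x\<in>sI S. x \<le> t'} x * ?g x \<partial>lborel) = \<infinity>"
  proof (rule ccontr)
    assume f: "(\<integral>\<^sup>+ x. indicator {x\<in>sI S. x \<le> t'} x * ?g x \<partial>lborel) \<noteq> \<infinity>"
    have "(\<integral>\<^sup>+ x. indicator {x\<in>sI S. x \<le> c0} x * ?g x \<partial>lborel)
       \<le> (\<integral>\<^sup>+ x. indicator {x\<in>sI S. x \<le> t'} x * ?g x + indicator {t'..c0} x * ?g x \<partial>lborel)"
      by (rule nn_integral_mono) (auto simp: indicator_def)
    also have "\<dots> = (\<integral>\<^sup>+ x. indicator {x\<in>sI S. x \<le> t'} x * ?g x \<partial>lborel) + (\<integral>\<^sup>+ x. indicator {t'..c0} x * ?g x \<partial>lborel)"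
    proof (rule nn_integral_add)
      have "(\<lambda>x. indicator (sI S) x *\<^sub>R sp S x) \<in> borel_measurable lborel"
        using std by (simp add: sl_standard_def set_borel_measurable_def)
      moreover have "(\<lambda>x. Re (indicator (sI S) x *\<^sub>R u x)) \<in> borel_measurable lborel"
        using L2_measurable[OF L2_sol(1)] by measurable
      ultimately have m: "(\<lambda>x. indicator B x * ennreal (1 / ((indicator (sI S) x *\<^sub>R sp S x) * (Re (indicator (sI S) x *\<^sub>R u x))\<^sup>2))) \<in> borel_measurable lborel"
        if "B \<in> sets borel" for B using that by measurable
      have e: "(\<lambda>x. indicator B x * ?g x) = (\<lambda>x. indicator B x * ennreal (1 / ((indicator (sI S) x *\<^sub>R sp S x) * (Re (indicator (sI S) x *\<^sub>R u x))\<^sup>2)))"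
        if "B \<subseteq> sI S" for B using that by (auto simp: fun_eq_iff indicator_def cu_def)
      show "(\<lambda>x. indicator {x\<in>sI S. x \<le> t'} x * ?g x) \<in> borel_measurable lborel"
        by (subst e, blast, rule m, simp)
      show "(\<lambda>x. indicator {t'..c0} x * ?g x) \<in> borel_measurable lborel"
      proof (subst e)
        show "{t'..c0} \<subseteq> sI S" using sI_mid[OF t'(1) c0(1)] by auto
      qed (rule m, simp)
    qed
    also have "\<dots> < \<infinity>" using f gi by (simp add: less_top)
    finally show False using c0(3) by simp
  qed
  have "\<exists>n. l n < t' \<and> X \<le> (LINT x:{l n..t'}|lborel. 1 / (sp S x * (ua x)\<^sup>2))"
  proof (rule energy_large[of l "\<lambda>_. t'" ua "qd S u" X])
    show "(\<integral>\<^sup>+ x. indicator (\<Union>n. {l n..t'}) x * ?g x \<partial>lborel) = \<infinity>" unfolding U by (rule inf)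
  qed (use l(1) t'(1) inc nz tm_u X in blast)+
  then obtain n where n: "l n < t'" "X \<le> (LINT x:{l n..t'}|lborel. 1 / (sp S x * (ua x)\<^sup>2))" by blast
  obtain s where s: "s \<in> sI S" "s < l n" using l(1) l(3)[OF l(1)[of n]] by blast
  have "\<forall>x\<in>{s..t}. ua x \<noteq> 0" using c0(2) t sI_mid[OF s(1) t(1)] by auto
  then show ?thesis using s t t' n by (intro exI[of _ s] exI[of _ "l n"] exI[of _ t'] exI[of _ t]) auto
qed

lemma principal_points_b:
  assumes c: "c \<in> sI S" and X: "X > 0"
  shows "\<exists>s s' t' t. s \<in> sI S \<and> t \<in> sI S \<and> s < s' \<and> s' < t' \<and> t' < t \<and> c < s \<and> (\<forall>x\<in>{s..t}. ub x \<noteq> 0) \<and>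
    X \<le> (LINT x:{s'..t'}|lborel. 1 / (sp S x * (ub x)\<^sup>2))"
proof -
  let ?g = "\<lambda>x. ennreal (1 / (sp S x * (ub x)\<^sup>2))"
  obtain c0 where c0: "c0 \<in> sI S" "\<And>x. x \<in> sI S \<Longrightarrow> c0 \<le> x \<Longrightarrow> ub x \<noteq> 0"
    "(\<integral>\<^sup>+ x. indicator {x\<in>sI S. c0 \<le> x} x * ?g x \<partial>lborel) = \<infinity>"
    using pair_b unfolding normalized_pair_b_def principal_b_def by blast
  obtain l v :: "nat \<Rightarrow> real" where l: "\<And>n. v n \<in> sI S" "incseq v" "\<And>x. x \<in> sI S \<Longrightarrow> \<exists>N. \<forall>n\<ge>N. x < v n"
    by (rule sI_sequences, rule that; assumption)
  have mc: "max c c0 \<in> sI S" using c c0 by (simp add: max_def)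
  obtain s where s: "s \<in> sI S" "max c c0 < s" using l(1) l(3)[OF mc] by blast
  obtain s' where s': "s' \<in> sI S" "s < s'" using l(1) l(3)[OF s(1)] by blast
  have U: "(\<Union>n. {s'..v n}) = {x\<in>sI S. s' \<le> x}"
  proof (intro equalityI subsetI)
    fix x assume "x \<in> (\<Union>n. {s'..v n})"
    then obtain n where "x \<in> {s'..v n}" by blast
    then show "x \<in> {x\<in>sI S. s' \<le> x}" using sI_mid[OF s'(1) l(1)] by auto
  next
    fix x assume "x \<in> {x\<in>sI S. s' \<le> x}"
    then show "x \<in> (\<Union>n. {s'..v n})" using l(3)[of x] by (auto intro: less_imp_le)
  qed
  have nz: "ub x \<noteq> 0" if "x \<in> {s'..v n}" for n x
  proof -
    have "x \<in> sI S" using that sI_mid[OF s'(1) l(1)] by auto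
    then show ?thesis using c0(2) that s s' by auto
  qed
  have inc: "incseq (\<lambda>n. {s'..v n})" using l(2) by (auto simp: incseq_def intro: order_trans)
  have gi: "(\<integral>\<^sup>+ x. indicator {c0..s'} x * ?g x \<partial>lborel) < \<infinity>"
  proof -
    have sub: "{c0..s'} \<subseteq> sI S" using sI_mid[OF c0(1) s'(1)] by auto
    have qU: "qrel S w (qd S w) (\<lambda>_. 0)" using tm_w by (simp add: tm_def)
    have "continuous_on {c0..s'} w" by (rule continuous_on_subset[OF qrel_continuous(1)[OF qU] sub])
    then have cc: "continuous_on {c0..s'} ub" using continuous_on_Re by (fastforce simp: cu_def)
    have "set_integrable lborel {c0..s'} (\<lambda>x. 1 / sp S x * (1 / (ub x)\<^sup>2))"
      by (rule set_integrable_mult_cont[OF loc_integrable(1)[OF c0(1) s'(1)]])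
        (intro continuous_intros cc, use c0(2) sub in auto)
    then have i: "integrable lborel (\<lambda>x. indicator {c0..s'} x *\<^sub>R (1 / (sp S x * (ub x)\<^sup>2)))" by (simp add: set_integrable_def)
    have e: "indicator {c0..s'} x * ?g x = ennreal (indicator {c0..s'} x *\<^sub>R (1 / (sp S x * (ub x)\<^sup>2)))" for x
      by (simp add: indicator_def)
    have nn: "AE x in lborel. 0 \<le> indicator {c0..s'} x *\<^sub>R (1 / (sp S x * (ub x)\<^sup>2))"
      using sp_pos by eventually_elim (use sub in \<open>auto simp: indicator_def\<close>)
    show ?thesis unfolding e nn_integral_eq_integral[OF i nn] by simp
  qed
  have inf: "(\<integral>\<^sup>+ x. indicator {x\<in>sI S. s' \<le> x} x * ?g x \<partial>lborel) = \<infinity>"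
  proof (rule ccontr)
    assume f: "(\<integral>\<^sup>+ x. indicator {x\<in>sI S. s' \<le> x} x * ?g x \<partial>lborel) \<noteq> \<infinity>"
    have "(\<integral>\<^sup>+ x. indicator {x\<in>sI S. c0 \<le> x} x * ?g x \<partial>lborel)
       \<le> (\<integral>\<^sup>+ x. indicator {x\<in>sI S. s' \<le> x} x * ?g x + indicator {c0..s'} x * ?g x \<partial>lborel)"
      by (rule nn_integral_mono) (auto simp: indicator_def)
    also have "\<dots> = (\<integral>\<^sup>+ x. indicator {x\<in>sI S. s' \<le> x} x * ?g x \<partial>lborel) + (\<integral>\<^sup>+ x. indicator {c0..s'} x * ?g x \<partial>lborel)"
    proof (rule nn_integral_add)
      have "(\<lambda>x. indicator (sI S) x *\<^sub>R sp S x) \<in> borel_measurable lborel"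
        using std by (simp add: sl_standard_def set_borel_measurable_def)
      moreover have "(\<lambda>x. Re (indicator (sI S) x *\<^sub>R w x)) \<in> borel_measurable lborel"
        using L2_measurable[OF L2_sol(3)] by measurable
      ultimately have m: "(\<lambda>x. indicator B x * ennreal (1 / ((indicator (sI S) x *\<^sub>R sp S x) * (Re (indicator (sI S) x *\<^sub>R w x))\<^sup>2))) \<in> borel_measurable lborel"
        if "B \<in> sets borel" for B using that by measurable
      have e: "(\<lambda>x. indicator B x * ?g x) = (\<lambda>x. indicator B x * ennreal (1 / ((indicator (sI S) x *\<^sub>R sp S x) * (Re (indicator (sI S) x *\<^sub>R w x))\<^sup>2)))"
        if "B \<subseteq> sI S" for B using that by (auto simp: fun_eq_iff indicator_def cu_def)
      show "(\<lambda>x. indicator {x\<in>sI S. s' \<le> x} x * ?g x) \<in> borel_measurable lborel"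
        by (subst e, blast, rule m, simp)
      show "(\<lambda>x. indicator {c0..s'} x * ?g x) \<in> borel_measurable lborel"
      proof (subst e)
        show "{c0..s'} \<subseteq> sI S" using sI_mid[OF c0(1) s'(1)] by auto
      qed (rule m, simp)
    qed
    also have "\<dots> < \<infinity>" using f gi by (simp add: less_top)
    finally show False using c0(3) by simp
  qed
  have "\<exists>n. s' < v n \<and> X \<le> (LINT x:{s'..v n}|lborel. 1 / (sp S x * (ub x)\<^sup>2))"
  proof (rule energy_large[of "\<lambda>_. s'" v ub "qd S w" X])
    show "(\<integral>\<^sup>+ x. indicator (\<Union>n. {s'..v n}) x * ?g x \<partial>lborel) = \<infinity>" unfolding U by (rule inf)
  qed (use l(1) s'(1) inc nz tm_w X in blast)+
  then obtain n where n: "s' < v n" "X \<le> (LINT x:{s'..v n}|lborel. 1 / (sp S x * (ub x)\<^sup>2))" by blast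
  obtain t where t: "t \<in> sI S" "v n < t" using l(1) l(3)[OF l(1)[of n]] by blast
  have "\<forall>x\<in>{s..t}. ub x \<noteq> 0" using c0(2) s sI_mid[OF s(1) t(1)] by auto
  then show ?thesis using s t s' n by (intro exI[of _ s] exI[of _ s'] exI[of _ "v n"] exI[of _ t]) auto
qed

section \<open>Cutoffs of small energy at each endpoint\<close>

lemma nrm_le_tail:
  assumes \<theta>: "L2 S \<theta>" and f: "L2 S f" and A: "A \<subseteq> sI S" "A \<in> sets borel"
    and le: "\<And>x. x \<in> sI S \<Longrightarrow> cmod (\<theta> x) \<le> cmod (f x)" and z: "\<And>x. x \<in> sI S \<Longrightarrow> x \<notin> A \<Longrightarrow> \<theta> x = 0"
    and d: "(LINT x:A|lborel. \<bar>(cmod (f x))\<^sup>2 * sr S x\<bar>) < \<delta>\<^sup>2" "\<delta> > 0"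
  shows "nrm S \<theta> \<le> \<delta>"
proof -
  have i: "set_integrable lborel (sI S) (\<lambda>x. (cmod (\<theta> x))\<^sup>2 * sr S x)" using \<theta> by (simp add: L2_def)
  have "set_integrable lborel (sI S) (\<lambda>x. (cmod (f x))\<^sup>2 * sr S x)" using f by (simp add: L2_def)
  then have "set_integrable lborel A (\<lambda>x. (cmod (f x))\<^sup>2 * sr S x)" by (rule set_integrable_subset) (use A in auto)
  then have j: "set_integrable lborel A (\<lambda>x. \<bar>(cmod (f x))\<^sup>2 * sr S x\<bar>)" by (rule set_integrable_abs)
  have "(LINT x:sI S|lborel. (cmod (\<theta> x))\<^sup>2 * sr S x) \<le> (LINT x:A|lborel. \<bar>(cmod (f x))\<^sup>2 * sr S x\<bar>)"
    unfolding set_lebesgue_integral_def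
  proof (rule integral_mono_AE)
    show "AE x in lborel. indicator (sI S) x *\<^sub>R ((cmod (\<theta> x))\<^sup>2 * sr S x) \<le> indicator A x *\<^sub>R \<bar>(cmod (f x))\<^sup>2 * sr S x\<bar>"
      using sr_pos
    proof eventually_elim
      case (elim x)
      show ?case
      proof (cases "x \<in> sI S")
        case True
        have "(cmod (\<theta> x))\<^sup>2 * sr S x \<le> (cmod (f x))\<^sup>2 * sr S x"
          using elim True le by (intro mult_right_mono power_mono) auto
        then show ?thesis using True z[OF True] by (cases "x \<in> A") auto
      qed simp
    qed
  qed (use i j in \<open>auto simp: set_integrable_def\<close>)
  with d have "(LINT x:sI S|lborel. (cmod (\<theta> x))\<^sup>2 * sr S x) \<le> \<delta>\<^sup>2" by linarith
  then have "nrm S \<theta> \<le> sqrt (\<delta>\<^sup>2)" unfolding nrm_def by (rule real_sqrt_le_mono)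
  then show ?thesis using d(2) by simp
qed

lemma bv_eq_near_a:
  assumes f: "tm f f1 h" and g: "tm g g1 k" and c: "c \<in> sI S" and e: "\<And>x. x \<in> sI S \<Longrightarrow> x < c \<Longrightarrow> f x = g x"
  shows "a0 f = a0 g \<and> a1 f = a1 g"
proof -
  have t: "tm (\<lambda>x. 1 * f x + (-1) * g x) (\<lambda>x. 1 * f1 x + (-1) * g1 x) (\<lambda>x. 1 * h x + (-1) * k x)" by (rule tm_lin[OF f g])
  have "AE x in lborel. x \<in> sI S \<and> x < c \<longrightarrow> 1 * f x + (-1) * g x = 0" by (rule AE_I2) (use e in auto)
  from zero_near_end(1)[OF t c this] show ?thesis unfolding bv_lin[OF f g] by simp
qed

lemma bv_eq_near_b:
  assumes f: "tm f f1 h" and g: "tm g g1 k" and c: "c \<in> sI S" and e: "\<And>x. x \<in> sI S \<Longrightarrow> c < x \<Longrightarrow> f x = g x"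
  shows "b0 f = b0 g \<and> b1 f = b1 g"
proof -
  have t: "tm (\<lambda>x. 1 * f x + (-1) * g x) (\<lambda>x. 1 * f1 x + (-1) * g1 x) (\<lambda>x. 1 * h x + (-1) * k x)" by (rule tm_lin[OF f g])
  have "AE x in lborel. x \<in> sI S \<and> c < x \<longrightarrow> 1 * f x + (-1) * g x = 0" by (rule AE_I2) (use e in auto)
  from zero_near_end(2)[OF t c this] show ?thesis unfolding bv_lin[OF f g] by simp
qed

lemma tm_zero: "tm (\<lambda>_. 0) (\<lambda>_. 0) (\<lambda>_. 0)"
  unfolding tm_def qrel_iff using L2_zero prim_const[of "sI S" "0::complex"] by simp

lemma bv_zero: "a0 (\<lambda>_. 0) = 0" "a1 (\<lambda>_. 0) = 0" "b0 (\<lambda>_. 0) = 0" "b1 (\<lambda>_. 0) = 0"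
  using bv_lin[OF tm_zero tm_zero, of 0 0] by simp_all

text \<open>Taking X = 1/\<delta> in \<open>cutoff\<close> bounds the energy by \<delta>. The norm
  is small because the function is dominated by \<open>u\<close> and lives where \<open>u\<close>
  has a small tail.\<close>

lemma cutoff_a:
  assumes \<delta>: "\<delta> > 0" and c: "c \<in> sI S"
  shows "\<exists>\<theta> \<theta>1 h. tm \<theta> \<theta>1 h \<and> (\<forall>x\<in>sI S. c \<le> x \<longrightarrow> \<theta> x = 0) \<and> (\<forall>x. h x \<noteq> 0 \<longrightarrow> x < c) \<and>
    a0 \<theta> = 0 \<and> a1 \<theta> = 1 \<and> b0 \<theta> = 0 \<and> b1 \<theta> = 0 \<and> Re (ip S h \<theta>) \<le> \<delta> \<and> nrm S \<theta> \<le> \<delta>"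
proof -
  have Li: "set_integrable lborel (sI S) (\<lambda>x. (cmod (u x))\<^sup>2 * sr S x)" using L2_sol(1) by (simp add: L2_def)
  have "\<delta>\<^sup>2 > 0" using \<delta> by simp
  from tail_a_small[OF Li this] obtain c' where c': "c' \<in> sI S"
    "\<And>x. x \<le> c' \<Longrightarrow> (LINT t:{t \<in> sI S. t < x}|lborel. \<bar>(cmod (u t))\<^sup>2 * sr S t\<bar>) < \<delta>\<^sup>2" by blast
  have m: "min c c' \<in> sI S" using c c' by (simp add: min_def)
  obtain s s' t' t where p: "s \<in> sI S" "t \<in> sI S" "s < s'" "s' < t'" "t' < t" "t < min c c'"
    "\<And>x. x \<in> {s..t} \<Longrightarrow> ua x \<noteq> 0" "1 / \<delta> \<le> (LINT x:{s'..t'}|lborel. 1 / (sp S x * (ua x)\<^sup>2))"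
    using principal_points_a[OF m, of "1 / \<delta>"] \<delta> by auto
  have d1: "1 / \<delta> > 0" using \<delta> by simp
  obtain \<theta> \<theta>1 h \<eta> where \<theta>: "tm \<theta> \<theta>1 h"
    "\<And>x. x \<in> sI S \<Longrightarrow> \<theta> x = complex_of_real (\<eta> x) * u x \<and> 0 \<le> \<eta> x \<and> \<eta> x \<le> 1"
    "\<And>x. x \<in> sI S \<Longrightarrow> x \<le> s \<Longrightarrow> \<eta> x = 1" "\<And>x. x \<in> sI S \<Longrightarrow> t < x \<Longrightarrow> \<eta> x = 0"
    "\<And>x. x \<notin> {s..t} \<Longrightarrow> h x = 0" "Re (ip S h \<theta>) \<le> 1 / (1 / \<delta>)"
    using cutoff[OF tm_u tm_uh W_a p(1-5,7) d1 p(8)] by blast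
  have z: "\<theta> x = 0" if "x \<in> sI S" "t < x" for x using \<theta>(2)[OF that(1)] \<theta>(4)[OF that] by simp
  have near: "\<theta> x = u x" if "x \<in> sI S" "x < s" for x using \<theta>(2)[OF that(1)] \<theta>(3)[OF that(1)] that by simp
  have "a0 \<theta> = 0 \<and> a1 \<theta> = 1" using bv_eq_near_a[OF \<theta>(1) tm_u p(1) near] bv_sol by simp
  moreover have "b0 \<theta> = 0 \<and> b1 \<theta> = 0" using bv_eq_near_b[OF \<theta>(1) tm_zero p(2) z] bv_zero by simp
  moreover have "nrm S \<theta> \<le> \<delta>"
  proof (rule nrm_le_tail[OF _ L2_sol(1), where A = "{t \<in> sI S. t < c'}"])
    show "L2 S \<theta>" using \<theta>(1) by (simp add: tm_def)
    show "cmod (\<theta> x) \<le> cmod (u x)" if "x \<in> sI S" for x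
      using \<theta>(2)[OF that] by (simp add: norm_mult mult_left_le_one_le)
    show "\<theta> x = 0" if "x \<in> sI S" "x \<notin> {t \<in> sI S. t < c'}" for x using z that p(6) by auto
  qed (use c'(2)[of c'] \<delta> in auto)
  moreover have "\<forall>x\<in>sI S. c \<le> x \<longrightarrow> \<theta> x = 0" using z p(6) by auto
  moreover have "\<forall>x. h x \<noteq> 0 \<longrightarrow> x < c" using \<theta>(5) p(6) by force
  moreover have "Re (ip S h \<theta>) \<le> \<delta>" using \<theta>(6) by simp
  ultimately show ?thesis using \<theta>(1) by blast
qed

text \<open>The construction in \<open>cutoff\<close> keeps the solution on the left and kills it on
  the right. At b the opposite is wanted, so its difference from \<open>w\<close> is taken;
  orthogonality of h0 to \<open>w\<close> keeps the energy unchanged.\<close>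

lemma cutoff_b:
  assumes \<delta>: "\<delta> > 0" and c: "c \<in> sI S"
  shows "\<exists>\<theta> \<theta>1 h. tm \<theta> \<theta>1 h \<and> (\<forall>x\<in>sI S. x \<le> c \<longrightarrow> \<theta> x = 0) \<and> (\<forall>x. h x \<noteq> 0 \<longrightarrow> c < x) \<and>
    a0 \<theta> = 0 \<and> a1 \<theta> = 0 \<and> b0 \<theta> = 0 \<and> b1 \<theta> = 1 \<and> Re (ip S h \<theta>) \<le> \<delta> \<and> nrm S \<theta> \<le> \<delta>"
proof -
  have Li: "set_integrable lborel (sI S) (\<lambda>x. (cmod (w x))\<^sup>2 * sr S x)" using L2_sol(3) by (simp add: L2_def)
  have "\<delta>\<^sup>2 > 0" using \<delta> by simp
  from tail_b_small[OF Li this] obtain c' where c': "c' \<in> sI S"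
    "\<And>x. c' \<le> x \<Longrightarrow> (LINT t:{t \<in> sI S. x \<le> t}|lborel. \<bar>(cmod (w t))\<^sup>2 * sr S t\<bar>) < \<delta>\<^sup>2" by blast
  have m: "max c c' \<in> sI S" using c c' by (simp add: max_def)
  obtain s s' t' t where p: "s \<in> sI S" "t \<in> sI S" "s < s'" "s' < t'" "t' < t" "max c c' < s"
    "\<And>x. x \<in> {s..t} \<Longrightarrow> ub x \<noteq> 0" "1 / \<delta> \<le> (LINT x:{s'..t'}|lborel. 1 / (sp S x * (ub x)\<^sup>2))"
    using principal_points_b[OF m, of "1 / \<delta>"] \<delta> by auto
  have d1: "1 / \<delta> > 0" using \<delta> by simp
  obtain \<theta>0 \<theta>1 h0 \<eta> where \<theta>0: "tm \<theta>0 \<theta>1 h0"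
    "\<And>x. x \<in> sI S \<Longrightarrow> \<theta>0 x = complex_of_real (\<eta> x) * w x \<and> 0 \<le> \<eta> x \<and> \<eta> x \<le> 1"
    "\<And>x. x \<in> sI S \<Longrightarrow> x \<le> s \<Longrightarrow> \<eta> x = 1" "\<And>x. x \<in> sI S \<Longrightarrow> t < x \<Longrightarrow> \<eta> x = 0"
    "\<And>x. x \<notin> {s..t} \<Longrightarrow> h0 x = 0" "Re (ip S h0 \<theta>0) \<le> 1 / (1 / \<delta>)" "ip S h0 w = 0"
    using cutoff[OF tm_w tm_wh W_b p(1-5,7) d1 p(8)] by blast
  define \<theta> where "\<theta> = (\<lambda>x. 1 * w x + (-1) * \<theta>0 x)"
  define h where "h = (\<lambda>x. 1 * 0 + (-1) * h0 x)"
  have \<theta>: "tm \<theta> (\<lambda>x. 1 * qd S w x + (-1) * \<theta>1 x) h" unfolding \<theta>_def h_def by (rule tm_lin[OF tm_w \<theta>0(1)])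
  have L: "L2 S \<theta>0" "L2 S h0" using \<theta>0(1) by (auto simp: tm_def)
  have \<theta>e: "\<theta> x = complex_of_real (1 - \<eta> x) * w x" if "x \<in> sI S" for x
    using \<theta>0(2)[OF that] by (simp add: \<theta>_def algebra_simps)
  have z: "\<theta> x = 0" if "x \<in> sI S" "x < s" for x using \<theta>e[OF that(1)] \<theta>0(3)[OF that(1)] that by simp
  have near: "\<theta> x = w x" if "x \<in> sI S" "t < x" for x using \<theta>e[OF that(1)] \<theta>0(4)[OF that] by simp
  have "b0 \<theta> = 0 \<and> b1 \<theta> = 1" using bv_eq_near_b[OF \<theta> tm_w p(2) near] bv_sol by simp
  moreover have "a0 \<theta> = 0 \<and> a1 \<theta> = 0" using bv_eq_near_a[OF \<theta> tm_zero p(1) z] bv_zero by simp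
  moreover have "nrm S \<theta> \<le> \<delta>"
  proof (rule nrm_le_tail[OF _ L2_sol(3), where A = "{t \<in> sI S. c' \<le> t}"])
    show "L2 S \<theta>" using \<theta> by (simp add: tm_def)
    show "cmod (\<theta> x) \<le> cmod (w x)" if "x \<in> sI S" for x
    proof -
      have "cmod (\<theta> x) = (1 - \<eta> x) * cmod (w x)"
        unfolding \<theta>e[OF that] norm_mult norm_of_real using \<theta>0(2)[OF that] by simp
      also have "\<dots> \<le> 1 * cmod (w x)" using \<theta>0(2)[OF that] by (intro mult_right_mono) auto
      finally show ?thesis by simp
    qed
    show "\<theta> x = 0" if "x \<in> sI S" "x \<notin> {t \<in> sI S. c' \<le> t}" for x using z that p(6) by auto
  qed (use c'(2)[of c'] \<delta> in auto)
  moreover have "\<forall>x\<in>sI S. x \<le> c \<longrightarrow> \<theta> x = 0" using z p(6) by auto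
  moreover have "\<forall>x. h x \<noteq> 0 \<longrightarrow> c < x" using \<theta>0(5) p(6) by (force simp: h_def)
  moreover have "Re (ip S h \<theta>) \<le> \<delta>"
  proof -
    have "ip S h \<theta> = - ip S h0 \<theta>" unfolding h_def using ip_mult_left[of "-1" h0 \<theta>] by simp
    also have "ip S h0 \<theta> = ip S h0 w - ip S h0 \<theta>0"
      unfolding \<theta>_def using ip_lin_right[OF L2_sol(3) L(1,2), of 1 "-1"] by simp
    finally show ?thesis using \<theta>0(6,7) by simp
  qed
  ultimately show ?thesis using \<theta> by blast
qed

text \<open>The two cutoffs live on different sides of a point c, so the energy of their combination
  has no mixed terms.\<close>

lemma Friedrichs_cutoff:
  assumes \<delta>: "\<delta> > 0"
  shows "\<exists>\<theta> \<theta>1 h. tm \<theta> \<theta>1 h \<and> a0 \<theta> = 0 \<and> a1 \<theta> = A \<and> b0 \<theta> = 0 \<and> b1 \<theta> = B \<and> Re (ip S h \<theta>) \<le> \<delta> \<and> nrm S \<theta> \<le> \<delta>"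
proof -
  \<comment> \<open>K dominates |A|^2 + |B|^2, which scales the energy, and |A| + |B|, which scales
    the norm; the 1 keeps it positive.\<close>
  define K where "K = (cmod A)\<^sup>2 + (cmod B)\<^sup>2 + cmod A + cmod B + 1"
  have K: "K \<ge> 1" "(cmod A)\<^sup>2 + (cmod B)\<^sup>2 \<le> K" "cmod A + cmod B \<le> K"
    using norm_ge_zero[of A] norm_ge_zero[of B] zero_le_power2[of "cmod A"] zero_le_power2[of "cmod B"]
    unfolding K_def by linarith+
  have dK: "\<delta> / K > 0" using \<delta> K by simp
  obtain c where c: "c \<in> sI S" using sI_ex by blast
  obtain f f1 h where f: "tm f f1 h" "\<And>x. x \<in> sI S \<Longrightarrow> c \<le> x \<Longrightarrow> f x = 0" "\<And>x. h x \<noteq> 0 \<Longrightarrow> x < c"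
    "a0 f = 0" "a1 f = 1" "b0 f = 0" "b1 f = 0" "Re (ip S h f) \<le> \<delta> / K" "nrm S f \<le> \<delta> / K"
    using cutoff_a[OF dK c] by blast
  obtain g g1 k where g: "tm g g1 k" "\<And>x. x \<in> sI S \<Longrightarrow> x \<le> c \<Longrightarrow> g x = 0" "\<And>x. k x \<noteq> 0 \<Longrightarrow> c < x"
    "a0 g = 0" "a1 g = 0" "b0 g = 0" "b1 g = 1" "Re (ip S k g) \<le> \<delta> / K" "nrm S g \<le> \<delta> / K"
    using cutoff_b[OF dK c] by blast
  have L: "L2 S f" "L2 S h" "L2 S g" "L2 S k" using f(1) g(1) by (auto simp: tm_def)
  define \<theta> where "\<theta> = (\<lambda>x. A * f x + B * g x)"
  define d where "d = (\<lambda>x. A * h x + B * k x)"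
  have \<theta>: "tm \<theta> (\<lambda>x. A * f1 x + B * g1 x) d" unfolding \<theta>_def d_def by (rule tm_lin[OF f(1) g(1)])
  have bv: "a0 \<theta> = 0" "a1 \<theta> = A" "b0 \<theta> = 0" "b1 \<theta> = B"
    unfolding \<theta>_def bv_lin[OF f(1) g(1)] using f g by simp_all
  have cross: "ip S h g = 0" "ip S k f = 0"
  proof -
    have "(LINT x:sI S|lborel. h x * cnj (g x) * complex_of_real (sr S x)) = (LINT x:sI S|lborel. 0)"
      by (rule set_lebesgue_integral_cong) (use f(3) g(2) in \<open>force+\<close>)
    then show "ip S h g = 0" by (simp add: ip_def)
    have "(LINT x:sI S|lborel. k x * cnj (f x) * complex_of_real (sr S x)) = (LINT x:sI S|lborel. 0)"
      by (rule set_lebesgue_integral_cong) (use g(3) f(2) in \<open>force+\<close>)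
    then show "ip S k f = 0" by (simp add: ip_def)
  qed
  have "ip S d \<theta> = A * cnj A * ip S h f + B * cnj B * ip S k g"
    unfolding d_def \<theta>_def ip_lin_left[OF L(2,4) L2_add[OF L2_mult[OF L(1)] L2_mult[OF L(3)]]]
      ip_lin_right[OF L(1,3,2)] ip_lin_right[OF L(1,3,4)] cross by simp
  also have "\<dots> = complex_of_real ((cmod A)\<^sup>2) * ip S h f + complex_of_real ((cmod B)\<^sup>2) * ip S k g"
    by (simp only: complex_norm_square)
  finally have "Re (ip S d \<theta>) = (cmod A)\<^sup>2 * Re (ip S h f) + (cmod B)\<^sup>2 * Re (ip S k g)" by simp
  also have "\<dots> \<le> (cmod A)\<^sup>2 * (\<delta> / K) + (cmod B)\<^sup>2 * (\<delta> / K)"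
    using f(8) g(8) by (intro add_mono mult_left_mono) auto
  also have "\<dots> = ((cmod A)\<^sup>2 + (cmod B)\<^sup>2) * (\<delta> / K)" by (rule distrib_right[symmetric])
  also have "\<dots> \<le> K * (\<delta> / K)" using K dK by (intro mult_right_mono) auto
  also have "\<dots> = \<delta>" using K by simp
  finally have e: "Re (ip S d \<theta>) \<le> \<delta>" .
  have "nrm S \<theta> \<le> cmod A * nrm S f + cmod B * nrm S g"
    unfolding \<theta>_def using nrm_add[OF L2_mult[OF L(1)] L2_mult[OF L(3)]] by (simp add: nrm_mult)
  also have "\<dots> \<le> cmod A * (\<delta> / K) + cmod B * (\<delta> / K)" using f(9) g(9) by (intro add_mono mult_left_mono) auto
  also have "\<dots> = (cmod A + cmod B) * (\<delta> / K)" by (rule distrib_right[symmetric])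
  also have "\<dots> \<le> K * (\<delta> / K)" using K dK by (intro mult_right_mono) auto
  also have "\<dots> = \<delta>" using K by simp
  finally show ?thesis using \<theta> bv e by blast
qed

section \<open>Symmetry, lower bound and surjectivity of the Friedrichs extension\<close>

lemma WA_cnj: "tm g g1 h \<Longrightarrow> tm s s1 k \<Longrightarrow> (\<And>x. cnj (s x) = s x) \<Longrightarrow> WA S s (\<lambda>x. cnj (g x)) = cnj (WA S s g)"
  and WB_cnj: "tm g g1 h \<Longrightarrow> tm s s1 k \<Longrightarrow> (\<And>x. cnj (s x) = s x) \<Longrightarrow> WB S s (\<lambda>x. cnj (g x)) = cnj (WB S s g)"
proof -
  assume g: "tm g g1 h" and s: "tm s s1 k" and r: "\<And>x. cnj (s x) = s x"
  have q: "qrel S g g1 h" "qrel S s s1 k" "qrel S (\<lambda>x. cnj (g x)) (\<lambda>x. cnj (g1 x)) (\<lambda>x. cnj (h x))"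
    "qrel S (\<lambda>x. cnj (s x)) (\<lambda>x. cnj (s1 x)) (\<lambda>x. cnj (k x))"
    using g s tm_cnj[OF g] tm_cnj[OF s] by (auto simp: tm_def)
  have s1r: "cnj (s1 x) = s1 x" if x: "x \<in> sI S" for x
  proof -
    have "qrel S s (\<lambda>x. cnj (s1 x)) (\<lambda>x. cnj (k x))" using q(4) by (simp add: r)
    from qrel_unique(1)[OF q(2) this x] show ?thesis by simp
  qed
  have e: "Wr S s (\<lambda>x. cnj (g x)) x = cnj (Wr S s g x)" if x: "x \<in> sI S" for x
    unfolding Wr_eq[OF q(2,3) x] Wr_eq[OF q(2,1) x] using r s1r[OF x] by simp
  show "WA S s (\<lambda>x. cnj (g x)) = cnj (WA S s g)"
    by (rule WA_eqI[OF _ e]) (intro tendsto_intros tendsto_cnj wronskian_limits(1)[OF s g])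
  show "WB S s (\<lambda>x. cnj (g x)) = cnj (WB S s g)"
    by (rule WB_eqI[OF _ e]) (intro tendsto_intros tendsto_cnj wronskian_limits(2)[OF s g])
qed

text \<open>The Wronskian is bilinear, so Green's formula is used for f and the conjugate of g; the
  boundary determinants vanish because the first entries of both vectors do.\<close>

lemma TF_sym:
  assumes f: "tm f f1 h" "a0 f = 0" "b0 f = 0" and g: "tm g g1 k" "a0 g = 0" "b0 g = 0"
  shows "ip S h g = ip S f k"
proof -
  let ?g = "\<lambda>x. cnj (g x)"
  have cg: "tm ?g (\<lambda>x. cnj (g1 x)) (\<lambda>x. cnj (k x))" by (rule tm_cnj[OF g(1)])
  have z: "a0 ?g = 0" "b0 ?g = 0"
    using WA_cnj[OF g(1) tm_u real_sol(1)] WB_cnj[OF g(1) tm_w real_sol(3)] g(2,3) by simp_all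
  have L: "L2 S f" "L2 S h" "L2 S g" "L2 S k" using f(1) g(1) by (auto simp: tm_def)
  have "WB S f ?g - WA S f ?g = (LINT t:sI S|lborel. complex_of_real (sr S t) * (h t * cnj (g t) - f t * cnj (k t)))"
    by (rule wronskian_limits(3)[OF f(1) cg])
  also have "\<dots> = (LINT t:sI S|lborel. h t * cnj (g t) * complex_of_real (sr S t) - f t * cnj (k t) * complex_of_real (sr S t))"
    by (simp add: algebra_simps)
  also have "\<dots> = ip S h g - ip S f k"
    unfolding ip_def using ip_integrable[OF L(2,3)] ip_integrable[OF L(1,4)] by simp
  finally show ?thesis using pluecker_a[OF f(1) cg] pluecker_b[OF f(1) cg] z f(2,3) by simp
qed

text \<open>Subtracting a cutoff with the same derivative boundary values moves g into dom(T_min),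
  where the bound is assumed. By symmetry of T_F the mixed terms contain only the norm of the
  cutoff, so all errors are of order \<delta>.\<close>

lemma TF_lower_bound:
  assumes g: "tm g g1 k" "a0 g = 0" "b0 g = 0"
  shows "\<epsilon> * (nrm S g)\<^sup>2 \<le> Re (ip S k g)"
proof (rule field_le_epsilon)
  fix e :: real assume e: "e > 0"
  have L: "L2 S g" "L2 S k" using g(1) by (auto simp: tm_def)
  \<comment> \<open>M collects the errors: 2 \<epsilon> |g| from the norm on the left, 2 |k| from
    the two mixed terms, 1 from the energy of the cutoff.\<close>
  define M where "M = 2 * \<epsilon> * nrm S g + 2 * nrm S k + 1"
  have n0: "0 \<le> nrm S g" "0 \<le> nrm S k" using nrm_nonneg L by auto
  then have M: "M > 0" using eps by (simp add: M_def add_nonneg_pos)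
  define \<delta> where "\<delta> = e / M"
  have \<delta>: "\<delta> > 0" using e M by (simp add: \<delta>_def)
  obtain \<theta> \<theta>1 d where \<theta>: "tm \<theta> \<theta>1 d" "a0 \<theta> = 0" "a1 \<theta> = a1 g" "b0 \<theta> = 0" "b1 \<theta> = b1 g"
    "Re (ip S d \<theta>) \<le> \<delta>" "nrm S \<theta> \<le> \<delta>" using Friedrichs_cutoff[OF \<delta>] by blast
  have L\<theta>: "L2 S \<theta>" "L2 S d" using \<theta>(1) by (auto simp: tm_def)
  let ?f = "\<lambda>x. 1 * g x + (-1) * \<theta> x" and ?h = "\<lambda>x. 1 * k x + (-1) * d x"
  have f: "tm ?f (\<lambda>x. 1 * g1 x + (-1) * \<theta>1 x) ?h" by (rule tm_lin[OF g(1) \<theta>(1)])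
  have "(?f, ?h) \<in> Tmin S"
    by (rule Tmin_if_zero_bv[OF f]) (unfold bv_lin[OF g(1) \<theta>(1)], use g \<theta> in simp_all)
  then have lb: "\<epsilon> * (nrm S ?f)\<^sup>2 \<le> Re (ip S ?h ?f)" using Tmin_lb by blast
  have "ip S ?h ?f = ip S k g - ip S k \<theta> - ip S d g + ip S d \<theta>"
    unfolding ip_lin_left[OF L(2) L\<theta>(2) L2_add[OF L2_mult[OF L(1)] L2_mult[OF L\<theta>(1)]]]
      ip_lin_right[OF L(1) L\<theta>(1) L(2)] ip_lin_right[OF L(1) L\<theta>(1) L\<theta>(2)] by simp
  moreover have "ip S d g = ip S \<theta> k" by (rule TF_sym[OF \<theta>(1,2,4) g])
  ultimately have re: "Re (ip S ?h ?f) = Re (ip S k g) - Re (ip S k \<theta>) - Re (ip S \<theta> k) + Re (ip S d \<theta>)" by simp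
  have "cmod (ip S k \<theta>) \<le> nrm S k * \<delta>" "cmod (ip S \<theta> k) \<le> nrm S k * \<delta>"
    using ip_bound[OF L(2) L\<theta>(1)] ip_bound[OF L\<theta>(1) L(2)] mult_left_mono[OF \<theta>(7) n0(2)]
    by (auto simp: mult.commute)
  moreover have "- Re z \<le> cmod z" for z using abs_Re_le_cmod[of z] by linarith
  from this[of "ip S k \<theta>"] this[of "ip S \<theta> k"]
  have "- Re (ip S k \<theta>) \<le> cmod (ip S k \<theta>)" "- Re (ip S \<theta> k) \<le> cmod (ip S \<theta> k)" .
  ultimately have up: "Re (ip S ?h ?f) \<le> Re (ip S k g) + 2 * nrm S k * \<delta> + \<delta>"
    unfolding re using \<theta>(6) by linarith
  have "nrm S g \<le> nrm S ?f + \<delta>"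
  proof -
    have "nrm S (\<lambda>x. ?f x + \<theta> x) \<le> nrm S ?f + nrm S \<theta>" using f L\<theta> by (intro nrm_add) (auto simp: tm_def)
    then show ?thesis using \<theta>(7) by simp
  qed
  moreover have "0 \<le> nrm S ?f" using nrm_nonneg f by (simp add: tm_def)
  ultimately have "(nrm S g)\<^sup>2 - 2 * nrm S g * \<delta> \<le> (nrm S ?f)\<^sup>2"
  proof (cases "nrm S g \<le> \<delta>")
    case True
    then have "nrm S g * nrm S g \<le> nrm S g * \<delta>" using n0 by (intro mult_left_mono) auto
    moreover have "0 \<le> nrm S g * \<delta>" using n0 \<delta> by simp
    moreover have "0 \<le> (nrm S ?f)\<^sup>2" by simp
    ultimately show ?thesis unfolding power2_eq_square[of "nrm S g"] by linarith
  next
    case False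
    assume "nrm S g \<le> nrm S ?f + \<delta>"
    then have "(nrm S g - \<delta>)\<^sup>2 \<le> (nrm S ?f)\<^sup>2" using False by (intro power_mono) auto
    moreover have "(nrm S g - \<delta>)\<^sup>2 = (nrm S g)\<^sup>2 - 2 * nrm S g * \<delta> + \<delta>\<^sup>2" by (simp add: power2_diff)
    ultimately show ?thesis using zero_le_power2[of \<delta>] by linarith
  qed
  then have "\<epsilon> * ((nrm S g)\<^sup>2 - 2 * nrm S g * \<delta>) \<le> \<epsilon> * (nrm S ?f)\<^sup>2" using eps by (intro mult_left_mono) auto
  then have "\<epsilon> * (nrm S g)\<^sup>2 - 2 * \<epsilon> * nrm S g * \<delta> \<le> Re (ip S k g) + 2 * nrm S k * \<delta> + \<delta>"
    using lb up by (simp add: algebra_simps)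
  then have "\<epsilon> * (nrm S g)\<^sup>2 \<le> Re (ip S k g) + M * \<delta>" by (simp add: M_def algebra_simps)
  also have "M * \<delta> = e" using M by (simp add: \<delta>_def)
  finally show "\<epsilon> * (nrm S g)\<^sup>2 \<le> Re (ip S k g) + e" .
qed

lemma nrm_u_pos: "nrm S u > 0"
  by (rule nrm_sol_pos[OF tm_u tm_uh]) (simp add: W_a)

text \<open>Otherwise \<open>u\<close> would satisfy both Friedrichs conditions and lie in the
  kernel of T_F, against the positive lower bound.\<close>

lemma b0_u_nonzero: "b0 u \<noteq> 0"
proof
  assume "b0 u = 0"
  then have "\<epsilon> * (nrm S u)\<^sup>2 \<le> Re (ip S (\<lambda>_. 0) u)" by (intro TF_lower_bound[OF tm_u]) (auto simp: bv_sol)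
  also have "\<dots> = 0" by (simp add: ip_def)
  finally show False using eps nrm_u_pos by (simp add: mult_le_0_iff)
qed

lemma TF_solve:
  assumes "L2 S k"
  shows "\<exists>x x1. tm x x1 k \<and> a0 x = 0 \<and> b0 x = 0"
proof -
  obtain y y1 where y: "tm y y1 k" "a0 y = 0" using vc_ex[OF assms, of 0 0] by blast
  \<comment> \<open>Adding a multiple of \<open>u\<close> keeps the condition at a, where
    \<open>a0 u\<close> = 0, and adjusts the one at b.\<close>
  let ?c = "- b0 y / b0 u"
  have "tm (\<lambda>x. 1 * y x + ?c * u x) (\<lambda>x. 1 * y1 x + ?c * qd S u x) (\<lambda>x. 1 * k x + ?c * 0)" by (rule tm_lin[OF y(1) tm_u])
  moreover have "a0 (\<lambda>x. 1 * y x + ?c * u x) = 0" "b0 (\<lambda>x. 1 * y x + ?c * u x) = 0"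
    unfolding bv_lin[OF y(1) tm_u] using y(2) bv_sol b0_u_nonzero by simp_all
  ultimately show ?thesis by force
qed

end

section \<open>The nonnegative extensions\<close>

lemma hermitian_form_nonneg:
  assumes "p \<ge> 0" "s \<ge> 0" "(cmod z)\<^sup>2 \<le> p * s"
  shows "0 \<le> p * (cmod c)\<^sup>2 + s * (cmod d)\<^sup>2 + 2 * Re (c * cnj d * z)"
proof -
  have "cmod z \<le> sqrt (p * s)" using assms(3) by (rule real_le_rsqrt)
  then have z: "cmod z \<le> sqrt p * sqrt s" by (simp add: real_sqrt_mult)
  have "- Re (c * cnj d * z) \<le> cmod (c * cnj d * z)" using abs_Re_le_cmod[of "c * cnj d * z"] by linarith
  also have "\<dots> = cmod c * cmod d * cmod z" by (simp add: norm_mult)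
  also have "\<dots> \<le> cmod c * cmod d * (sqrt p * sqrt s)" using z by (intro mult_left_mono) auto
  finally have 1: "- Re (c * cnj d * z) \<le> (sqrt p * cmod c) * (sqrt s * cmod d)" by (simp add: mult_ac)
  have "0 \<le> (sqrt p * cmod c - sqrt s * cmod d)\<^sup>2" by simp
  then have "2 * ((sqrt p * cmod c) * (sqrt s * cmod d)) \<le> p * (cmod c)\<^sup>2 + s * (cmod d)\<^sup>2"
    using assms(1,2) by (simp add: power2_diff power_mult_distrib)
  with 1 show ?thesis by linarith
qed

lemma hermitian_form_nonneg_iff:
  "(\<forall>c d. 0 \<le> p * (cmod c)\<^sup>2 + s * (cmod d)\<^sup>2 + 2 * Re (c * cnj d * z)) \<longleftrightarrow>
   p \<ge> 0 \<and> s \<ge> 0 \<and> (cmod z)\<^sup>2 \<le> p * s" (is "?L \<longleftrightarrow> ?R")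
proof
  assume L: ?L
  have p: "p \<ge> 0" using L[rule_format, of 1 0] by simp
  have s: "s \<ge> 0" using L[rule_format, of 0 1] by simp
  \<comment> \<open>With c = x real and d = z the mixed term becomes 2 x |z|^2, so that the form is
    a real quadratic polynomial in x; its minimum, or for p = 0 its slope, gives the determinant
    condition.\<close>
  have form: "0 \<le> p * x\<^sup>2 + s * (cmod z)\<^sup>2 + 2 * (x * (cmod z)\<^sup>2)" for x :: real
  proof -
    have "complex_of_real x * cnj z * z = complex_of_real (x * (cmod z)\<^sup>2)"
      unfolding of_real_mult complex_norm_square by (simp only: mult_ac)
    then have "Re (complex_of_real x * cnj z * z) = x * (cmod z)\<^sup>2" by (simp only: Re_complex_of_real)
    moreover have "p * (cmod (complex_of_real x))\<^sup>2 = p * x\<^sup>2" by simp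
    ultimately show ?thesis using L[rule_format, of "complex_of_real x" z] by (simp only:)
  qed
  have "(cmod z)\<^sup>2 \<le> p * s"
  proof (cases "p = 0")
    case True
    have "0 \<le> - ((s + 2) * (cmod z)\<^sup>2)" using form[of "- (s + 1)"] True by (simp add: algebra_simps)
    then have "(s + 2) * (cmod z)\<^sup>2 \<le> 0" by simp
    then have "(cmod z)\<^sup>2 \<le> 0" using s by (simp add: mult_le_0_iff)
    then show ?thesis using True by simp
  next
    case False
    then have p0: "p > 0" using p by simp
    have "0 \<le> p * (- ((cmod z)\<^sup>2 / p))\<^sup>2 + s * (cmod z)\<^sup>2 + 2 * (- ((cmod z)\<^sup>2 / p) * (cmod z)\<^sup>2)" by (rule form)
    also have "\<dots> = (cmod z)\<^sup>2 * ((p * s - (cmod z)\<^sup>2) / p)"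
      using p0 by (simp add: field_simps power2_eq_square)
    finally have "0 \<le> (cmod z)\<^sup>2 * ((p * s - (cmod z)\<^sup>2) / p)" .
    then show ?thesis using p0 s by (cases "z = 0") (auto simp: zero_le_mult_iff zero_le_divide_iff)
  qed
  with p s show ?R by blast
next
  assume ?R then show ?L using hermitian_form_nonneg by blast
qed

context limit_circle_problem
begin

definition hv :: "real \<Rightarrow> complex" where
  "hv = (\<lambda>x. uh x - ip S uh u / complex_of_real ((nrm S u)\<^sup>2) * u x)"

definition \<kappa> :: complex where "\<kappa> = ip S uh u / complex_of_real ((nrm S u)\<^sup>2)"

abbreviation "nu \<equiv> (nrm S u)\<^sup>2"
abbreviation "nv \<equiv> (nrm S hv)\<^sup>2"
abbreviation "UB \<equiv> b0 u"
abbreviation "UB' \<equiv> b1 u"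
abbreviation "VB \<equiv> b0 hv"
abbreviation "VB' \<equiv> b1 hv"
abbreviation "VA' \<equiv> a1 hv"

lemma hv_lin: "hv = (\<lambda>x. 1 * uh x + (- \<kappa>) * u x)"
  by (simp add: hv_def \<kappa>_def fun_eq_iff)

lemma tm_hv: "tm hv (qd S hv) (\<lambda>_. 0)"
proof -
  have "tm hv (\<lambda>x. 1 * qd S uh x + (- \<kappa>) * qd S u x) (\<lambda>x. 1 * 0 + (- \<kappa>) * 0)"
    unfolding hv_lin by (rule tm_lin[OF tm_uh tm_u])
  from tm_qd[OF this] show ?thesis by simp
qed

lemma L2_hv: "L2 S hv" using tm_hv by (simp add: tm_def)

lemma real_hv: "cnj (hv x) = hv x"
proof -
  have "ip S uh u = ip S u uh"
    using ip_real[of u uh, OF real_sol(1)] ip_real[of uh u, OF real_sol(2)] by (simp add: mult_ac)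
  then have "cnj (ip S uh u) = ip S uh u" using ip_cnj by metis
  then have "cnj \<kappa> = \<kappa>" by (simp add: \<kappa>_def)
  then show ?thesis by (simp add: hv_lin real_sol)
qed

lemma nu_pos: "nu > 0" using nrm_u_pos by simp

lemma nv_pos: "nv > 0"
proof -
  have "nrm S hv > 0"
  proof (rule nrm_sol_pos[OF tm_hv tm_u])
    fix x assume x: "x \<in> sI S"
    have "Wr S u hv x = 1 * Wr S u uh x + (- \<kappa>) * Wr S u u x"
      unfolding hv_lin by (rule Wr_lin[OF tm_uh tm_u tm_u x])
    then show "Wr S u hv x \<noteq> 0" using W_a[OF x] by (simp add: Wr_same Wr_swap[of u uh])
  qed
  then show ?thesis by simp
qed

lemma orth: "ip S hv u = 0" "ip S u hv = 0"
proof -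
  show "ip S hv u = 0"
    unfolding hv_lin ip_lin_left[OF L2_sol(2,1,1)] ip_self[OF L2_sol(1)] using nu_pos by (simp add: \<kappa>_def)
  then show "ip S u hv = 0" using ip_cnj[of hv u] by simp
qed

lemma a0_hv: "a0 hv = 1"
  unfolding hv_lin bv_lin[OF tm_uh tm_u] using bv_sol by simp

text \<open>The Wronskian of \<open>u\<close> and \<open>hv\<close> is that of \<open>u\<close> and
  \<open>uh\<close>, the constant -1, written here as a determinant at b.\<close>

lemma bv_det: "UB * VB' - UB' * VB = -1"
proof -
  have "WB S u hv = 1 * WB S u uh + (- \<kappa>) * WB S u u"
    unfolding hv_lin by (rule WA_lin(2)[OF tm_uh tm_u tm_u])
  moreover have "WB S u u = 0" by (rule WB_eqI[OF tendsto_const]) (simp add: Wr_same)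
  ultimately show ?thesis using pluecker_b[OF tm_u tm_hv] WB_u_uh by simp
qed

lemma bv_real: "cnj UB = UB" "cnj UB' = UB'" "cnj VB = VB" "cnj VA' = VA'"
proof -
  have e: "(\<lambda>x. cnj (u x)) = u" "(\<lambda>x. cnj (hv x)) = hv" by (simp_all add: real_sol real_hv)
  show "cnj UB = UB" "cnj UB' = UB'" "cnj VB = VB" "cnj VA' = VA'"
    using WB_cnj[OF tm_u tm_w real_sol(3), symmetric] WB_cnj[OF tm_u tm_wh real_sol(4), symmetric]
      WB_cnj[OF tm_hv tm_w real_sol(3), symmetric] WA_cnj[OF tm_hv tm_uh real_sol(2), symmetric]
    unfolding e by simp_all
qed

text \<open>On dom(T_F) two boundary values vanish, and the remaining two, \<open>a1\<close> and
  \<open>b1\<close>, correspond linearly and, as \<open>UB\<close> is nonzero, bijectively to the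
  moments of T_F x. Prescribing moments and prescribing derivative boundary values are therefore the
  same.\<close>

lemma ip_TF:
  assumes x: "tm x x1 h" "a0 x = 0" "b0 x = 0"
  shows "ip S h u = - UB * b1 x" "ip S h hv = a1 x - VB * b1 x"
proof -
  show "ip S h u = - UB * b1 x"
    using green[OF x(1) tm_u real_sol(1)] pluecker_a[OF tm_u x(1)] pluecker_b[OF tm_u x(1)] x(2,3) bv_sol by simp
  have "WA S hv x = a1 x" "WB S hv x = VB * b1 x"
    using pluecker_a[OF tm_hv x(1)] pluecker_b[OF tm_hv x(1)] x(2,3) a0_hv by simp_all
  then show "ip S h hv = a1 x - VB * b1 x" using green[OF x(1) tm_hv real_hv] by simp
qed

definition eta :: "complex \<Rightarrow> complex \<Rightarrow> real \<Rightarrow> complex" where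
  "eta c1 c2 = (\<lambda>t. c1 * u t + c2 * hv t)"

lemma tm_eta: "tm (eta c1 c2) (\<lambda>x. c1 * qd S u x + c2 * qd S hv x) (\<lambda>_. 0)"
  using tm_lin[OF tm_u tm_hv, of c1 c2] by (simp add: eta_def)

lemma L2_eta: "L2 S (eta c1 c2)" using tm_eta by (simp add: tm_def)

lemma bv_eta: "a0 (eta c1 c2) = c2" "a1 (eta c1 c2) = c1 + c2 * VA'"
    "b0 (eta c1 c2) = c1 * UB + c2 * VB" "b1 (eta c1 c2) = c1 * UB' + c2 * VB'"
  unfolding eta_def bv_lin[OF tm_u tm_hv] using bv_sol a0_hv by simp_all

lemma ip_eta: "ip S (eta c1 c2) u = c1 * complex_of_real nu" "ip S (eta c1 c2) hv = c2 * complex_of_real nv"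
  unfolding eta_def ip_lin_left[OF L2_sol(1) L2_hv L2_sol(1)] ip_lin_left[OF L2_sol(1) L2_hv L2_hv]
  by (simp_all add: ip_self[OF L2_sol(1)] ip_self[OF L2_hv] orth)

lemma ip_eta_right: "L2 S h \<Longrightarrow> ip S h (eta d1 d2) = cnj d1 * ip S h u + cnj d2 * ip S h hv"
  unfolding eta_def by (rule ip_lin_right[OF L2_sol(1) L2_hv])

lemma N0_iff: "f \<in> N0 S \<longleftrightarrow> L2 S f \<and> (\<exists>c1 c2. aeq S f (eta c1 c2))"
proof
  assume "f \<in> N0 S"
  then obtain g g1 where g: "L2 S f" "aeq S f g" "tm g g1 (\<lambda>_. 0)" unfolding N0_def Tmax_iff by auto
  have c0: "cum (\<lambda>t. 0 :: complex) x = 0" for x by (rule cum_zero_left) simp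
  have "g x = eta (a1 g + \<kappa> * a0 g) (a0 g) x" if "x \<in> sI S" for x
    using representation[OF g(3) that] by (simp add: c0 eta_def hv_lin algebra_simps)
  then have "aeq S g (eta (a1 g + \<kappa> * a0 g) (a0 g))" unfolding aeq_def by (intro AE_I2) auto
  then show "L2 S f \<and> (\<exists>c1 c2. aeq S f (eta c1 c2))" using g aeq_trans by blast
next
  assume "L2 S f \<and> (\<exists>c1 c2. aeq S f (eta c1 c2))"
  then show "f \<in> N0 S" unfolding N0_def Tmax_iff using tm_eta L2_zero by blast
qed

lemma TF_iff: "(x, k) \<in> T_F S ua uha ub uhb \<longleftrightarrow>
   L2 S x \<and> L2 S k \<and> (\<exists>g g1. aeq S x g \<and> tm g g1 k \<and> a0 g = 0 \<and> b0 g = 0)"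
proof
  assume "(x, k) \<in> T_F S ua uha ub uhb"
  then show "L2 S x \<and> L2 S k \<and> (\<exists>g g1. aeq S x g \<and> tm g g1 k \<and> a0 g = 0 \<and> b0 g = 0)"
    unfolding T_F_def T_sep_def by (auto dest!: TrestrD simp: bv_a_def bv_b_def)
next
  assume "L2 S x \<and> L2 S k \<and> (\<exists>g g1. aeq S x g \<and> tm g g1 k \<and> a0 g = 0 \<and> b0 g = 0)"
  then show "(x, k) \<in> T_F S ua uha ub uhb"
    unfolding T_F_def T_sep_def by (auto intro!: TrestrI simp: bv_a_def bv_b_def)
qed

definition TN :: "real \<Rightarrow> complex \<Rightarrow> real \<Rightarrow> lrel" where
  "TN b11 b12 b22 = T_BW S ua uha ub uhb (Bmat S u hv (complex_of_real b11) b12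
     (cnj b12 * complex_of_real nv / complex_of_real nu) (complex_of_real b22)) (N0 S)"

lemma qrel_cong: "qrel S g g1 h \<Longrightarrow> (\<And>x. x \<in> sI S \<Longrightarrow> g x = g' x) \<Longrightarrow> qrel S g' g1 h"
  unfolding qrel_iff using prim_cong[OF sI_interval, of g _ g'] prim_cong[OF sI_interval, of g1 _ g1] by auto

lemma Tmax_rep_unique:
  assumes "tm g g1 h" "tm g' g1' h'" "aeq S g g'"
  shows "aeq S h h'"
proof -
  have "g x = g' x" if "x \<in> sI S" for x by (rule aeq_continuous[OF assms(3,1,2) that])
  then have "qrel S g' g1 h" using assms(1) qrel_cong by (auto simp: tm_def)
  then show ?thesis using qrel_unique(2) assms(2) by (auto simp: tm_def)
qed

lemma TF_kernel:
  assumes x: "tm x x1 k" "a0 x = 0" "b0 x = 0" and k: "aeq S k (\<lambda>_. 0)"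
  shows "aeq S x (\<lambda>_. 0)"
proof -
  have L: "L2 S x" "L2 S k" using x by (auto simp: tm_def)
  have "ip S k x = ip S (\<lambda>_. 0) x" using k L L2_zero by (intro ip_cong) auto
  then have "\<epsilon> * (nrm S x)\<^sup>2 \<le> 0" using TF_lower_bound[OF x] by (simp add: ip_def)
  then have "nrm S x = 0" using eps by (simp add: mult_le_0_iff)
  then show ?thesis using nrm_zero_iff[OF L(1)] by simp
qed

text \<open>The range of T_min consists of the functions without moments. Hence the summand from
  dom(T_min) amounts to the freedom of changing B \<eta> to any h with the same moments, and x
  absorbs it. The third summand is trivial, since the kernel meets its orthogonal complement only in
  0.\<close>

lemma TN_iff:
  "(f, h) \<in> TN b11 b12 b22 \<longleftrightarrow> L2 S f \<and> L2 S h \<and> (\<exists>c1 c2 x x1. tm x x1 h \<and> a0 x = 0 \<and> b0 x = 0 \<and>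
     aeq S f (\<lambda>t. x t + eta c1 c2 t) \<and>
     ip S h u = c1 * complex_of_real b11 * complex_of_real nu + c2 * cnj b12 * complex_of_real nv \<and>
     ip S h hv = (c1 * b12 + c2 * complex_of_real b22) * complex_of_real nv)" (is "?L \<longleftrightarrow> ?R")
proof
  let ?b21 = "cnj b12 * complex_of_real nv / complex_of_real nu"
  let ?\<beta> = "\<lambda>c1 c2. eta (c1 * complex_of_real b11 + c2 * ?b21) (c1 * b12 + c2 * complex_of_real b22)"
  have nu0: "complex_of_real nu \<noteq> 0" using nu_pos by simp
  {
    assume ?L
    then obtain f0 \<eta> \<beta> x v y where max: "(f, h) \<in> Tmax S" and f0: "f0 \<in> Dom (Tmin S)"
      and B: "(\<eta>, \<beta>) \<in> Bmat S u hv (complex_of_real b11) b12 ?b21 (complex_of_real b22)"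
      and x: "(x, \<beta>) \<in> T_F S ua uha ub uhb" and v: "v \<in> N0 S" "v \<in> perp S (N0 S)"
      and y: "(y, v) \<in> T_F S ua uha ub uhb" and f: "aeq S f (\<lambda>t. f0 t + (x t + \<eta> t) + y t)"
      unfolding TN_def T_BW_def by blast
    obtain g g1 where g: "aeq S f g" "tm g g1 h" "L2 S f" "L2 S h" using max unfolding Tmax_iff by blast
    obtain h0 g0 g01 where g0: "aeq S f0 g0" "tm g0 g01 h0" "a0 g0 = 0" "a1 g0 = 0" "b0 g0 = 0" "b1 g0 = 0"
      using f0 Tmin_zero_bv unfolding Dom_def by blast
    obtain c1 c2 where c: "L2 S \<eta>" "L2 S \<beta>" "aeq S \<eta> (eta c1 c2)" "aeq S \<beta> (?\<beta> c1 c2)"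
      using B unfolding Bmat_def eta_def by blast
    obtain gx gx1 where gx: "aeq S x gx" "tm gx gx1 \<beta>" "a0 gx = 0" "b0 gx = 0" using x unfolding TF_iff by blast
    obtain gy gy1 where gy: "aeq S y gy" "tm gy gy1 v" "a0 gy = 0" "b0 gy = 0" using y unfolding TF_iff by blast
    have Lv: "L2 S v" using v(1) by (simp add: N0_iff)
    \<comment> \<open>v lies in the kernel and is orthogonal to it.\<close>
    have "ip S v v = 0" using v unfolding perp_def by blast
    then have "nrm S v = 0" using ip_self[OF Lv] by simp
    then have "aeq S v (\<lambda>_. 0)" using nrm_zero_iff[OF Lv] by simp
    then have y0: "aeq S gy (\<lambda>_. 0)" by (rule TF_kernel[OF gy(2-4)])
    let ?X = "\<lambda>t. 1 * g0 t + 1 * gx t"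
    have X: "tm ?X (\<lambda>t. 1 * g01 t + 1 * gx1 t) (\<lambda>t. 1 * h0 t + 1 * \<beta> t)" by (rule tm_lin[OF g0(2) gx(2)])
    have XG: "tm (\<lambda>t. 1 * ?X t + 1 * eta c1 c2 t) (\<lambda>t. 1 * (1 * g01 t + 1 * gx1 t) + 1 * (c1 * qd S u t + c2 * qd S hv t))
        (\<lambda>t. 1 * (1 * h0 t + 1 * \<beta> t) + 1 * 0)" by (rule tm_lin[OF X tm_eta])
    have fX: "aeq S f (\<lambda>t. ?X t + eta c1 c2 t)"
      using f g0(1) gx(1) c(3) gy(1) y0 unfolding aeq_def by eventually_elim auto
    have "aeq S g (\<lambda>t. 1 * ?X t + 1 * eta c1 c2 t)" using aeq_trans[OF aeq_sym[OF g(1)] fX] by simp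
    from Tmax_rep_unique[OF g(2) XG this] have hh: "aeq S h (\<lambda>t. h0 t + \<beta> t)" by simp
    have Lh0: "L2 S h0" using g0(2) by (simp add: tm_def)
    have X': "tm ?X (\<lambda>t. 1 * g01 t + 1 * gx1 t) h"
      by (rule tm_aeq[OF X _ g(4)]) (use aeq_sym[OF hh] in simp)
    have bvX: "a0 ?X = 0" "b0 ?X = 0" unfolding bv_lin[OF g0(2) gx(2)] using g0 gx by simp_all
    have ip: "ip S h s = ip S (?\<beta> c1 c2) s" if s: "L2 S s" "ip S h0 s = 0" for s
    proof -
      have "ip S h s = ip S (\<lambda>t. h0 t + \<beta> t) s" using hh g(4) Lh0 c(2) s by (intro ip_cong) (auto intro: L2_add)
      also have "\<dots> = ip S \<beta> s" using s by (simp add: ip_add_left Lh0 c(2))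
      also have "\<dots> = ip S (?\<beta> c1 c2) s" using c s L2_eta by (intro ip_cong) auto
      finally show ?thesis .
    qed
    have "ip S h0 u = 0" "ip S h0 hv = 0" using ip_TF[OF g0(2,3,5)] g0(4,6) by simp_all
    then have "ip S h u = (c1 * complex_of_real b11 + c2 * ?b21) * complex_of_real nu"
      "ip S h hv = (c1 * b12 + c2 * complex_of_real b22) * complex_of_real nv"
      using ip[OF L2_sol(1)] ip[OF L2_hv] by (simp_all add: ip_eta)
    moreover from this(1) have "ip S h u = c1 * complex_of_real b11 * complex_of_real nu + c2 * cnj b12 * complex_of_real nv"
      using nu0 by (simp add: distrib_right)
    ultimately show ?R using X' bvX fX g(3,4) by blast
  }
  {
    assume ?R
    then obtain c1 c2 x x1 where L: "L2 S f" "L2 S h" and x: "tm x x1 h" "a0 x = 0" "b0 x = 0"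
      and f: "aeq S f (\<lambda>t. x t + eta c1 c2 t)"
      and ip: "ip S h u = c1 * complex_of_real b11 * complex_of_real nu + c2 * cnj b12 * complex_of_real nv"
        "ip S h hv = (c1 * b12 + c2 * complex_of_real b22) * complex_of_real nv" by blast
    let ?b = "?\<beta> c1 c2"
    \<comment> \<open>z is the T_F preimage of B \<eta>. The difference x - z has right-hand side
      without moments, so by \<open>ip_TF\<close> all its boundary values vanish and it lies in
      dom(T_min).\<close>
    obtain z z1 where z: "tm z z1 ?b" "a0 z = 0" "b0 z = 0" using TF_solve[OF L2_eta] by blast
    let ?f0 = "\<lambda>t. 1 * x t + (-1) * z t"
    have f0: "tm ?f0 (\<lambda>t. 1 * x1 t + (-1) * z1 t) (\<lambda>t. 1 * h t + (-1) * ?b t)" by (rule tm_lin[OF x(1) z(1)])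
    have bv: "a0 ?f0 = 0" "b0 ?f0 = 0" unfolding bv_lin[OF x(1) z(1)] using x z by simp_all
    have "ip S (\<lambda>t. 1 * h t + (-1) * ?b t) u = 0" "ip S (\<lambda>t. 1 * h t + (-1) * ?b t) hv = 0"
      unfolding ip_lin_left[OF L(2) L2_eta L2_sol(1)] ip_lin_left[OF L(2) L2_eta L2_hv] ip ip_eta
      using nu0 by (simp_all add: distrib_right)
    then have "b1 ?f0 = 0" "a1 ?f0 = 0" using ip_TF[OF f0 bv] b0_u_nonzero by simp_all
    then have "(?f0, (\<lambda>t. 1 * h t + (-1) * ?b t)) \<in> Tmin S" using Tmin_if_zero_bv[OF f0] bv by simp
    then have 1: "?f0 \<in> Dom (Tmin S)" unfolding Dom_def by blast
    have 2: "(eta c1 c2, ?b) \<in> Bmat S u hv (complex_of_real b11) b12 ?b21 (complex_of_real b22)"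
      unfolding Bmat_def eta_def[symmetric] using L2_eta aeq_refl by blast
    have Lz: "L2 S z" using z(1) by (simp add: tm_def)
    have 3: "(z, ?b) \<in> T_F S ua uha ub uhb" unfolding TF_iff using z Lz L2_eta aeq_refl by blast
    have 4: "(\<lambda>_. 0) \<in> N0 S \<inter> perp S (N0 S)"
    proof -
      have "aeq S (\<lambda>_. 0) (eta 0 0)" by (simp add: eta_def)
      then have "(\<lambda>_. 0) \<in> N0 S" unfolding N0_iff using L2_zero by blast
      then show ?thesis using L2_zero by (auto simp: perp_def ip_def)
    qed
    have 5: "((\<lambda>_. 0), (\<lambda>_. 0)) \<in> T_F S ua uha ub uhb"
      unfolding TF_iff using tm_zero bv_zero L2_zero aeq_refl by blast
    have 6: "aeq S f (\<lambda>t. ?f0 t + (z t + eta c1 c2 t) + 0)" using f by simp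
    have 7: "(f, h) \<in> Tmax S"
    proof -
      have "tm (\<lambda>t. 1 * x t + 1 * eta c1 c2 t) (\<lambda>t. 1 * x1 t + 1 * (c1 * qd S u t + c2 * qd S hv t)) (\<lambda>t. 1 * h t + 1 * 0)"
        by (rule tm_lin[OF x(1) tm_eta])
      then show ?thesis unfolding Tmax_iff using L f by auto
    qed
    show ?L unfolding TN_def T_BW_def using 1 2 3 4 5 6 7 by blast
  }
qed

text \<open>The kernel part can be read off from g: both \<open>u\<close> and the T_F part vanish at
  a, so \<open>a0 g\<close> is c2, and then \<open>b0 g\<close> fixes c1. The last two equations are
  \<open>ip_TF\<close> for the remainder g - \<eta>.\<close>

lemma TN_bv:
  "TN b11 b12 b22 = Trestr S (\<lambda>g. \<exists>c1 c2. a0 g = c2 \<and> b0 g = c1 * UB + c2 * VB \<and>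
     - UB * (b1 g - (c1 * UB' + c2 * VB')) = c1 * complex_of_real b11 * complex_of_real nu + c2 * cnj b12 * complex_of_real nv \<and>
     a1 g - (c1 + c2 * VA') - VB * (b1 g - (c1 * UB' + c2 * VB')) = (c1 * b12 + c2 * complex_of_real b22) * complex_of_real nv)"
  (is "_ = Trestr S ?P")
proof (intro equalityI subsetI)
  fix fh assume fh: "fh \<in> TN b11 b12 b22"
  obtain f h where e: "fh = (f, h)" by (cases fh)
  obtain c1 c2 x x1 where L: "L2 S f" "L2 S h" and x: "tm x x1 h" "a0 x = 0" "b0 x = 0"
      and f: "aeq S f (\<lambda>t. x t + eta c1 c2 t)"
      and ip: "ip S h u = c1 * complex_of_real b11 * complex_of_real nu + c2 * cnj b12 * complex_of_real nv"
        "ip S h hv = (c1 * b12 + c2 * complex_of_real b22) * complex_of_real nv"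
    using fh unfolding e TN_iff by blast
  let ?g = "\<lambda>t. 1 * x t + 1 * eta c1 c2 t"
  have g: "tm ?g (\<lambda>t. 1 * x1 t + 1 * (c1 * qd S u t + c2 * qd S hv t)) h"
    using tm_lin[OF x(1) tm_eta, of 1 1] by simp
  have bv: "a0 ?g = c2" "a1 ?g = a1 x + (c1 + c2 * VA')" "b0 ?g = c1 * UB + c2 * VB" "b1 ?g = b1 x + (c1 * UB' + c2 * VB')"
    unfolding bv_lin[OF x(1) tm_eta] bv_eta using x by simp_all
  have "?P ?g"
  proof (intro exI conjI)
    show "a0 ?g = c2" "b0 ?g = c1 * UB + c2 * VB" by (rule bv)+
    show "- UB * (b1 ?g - (c1 * UB' + c2 * VB')) = c1 * complex_of_real b11 * complex_of_real nu + c2 * cnj b12 * complex_of_real nv"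
      unfolding bv using ip_TF(1)[OF x] ip(1) by simp
    show "a1 ?g - (c1 + c2 * VA') - VB * (b1 ?g - (c1 * UB' + c2 * VB')) = (c1 * b12 + c2 * complex_of_real b22) * complex_of_real nv"
      unfolding bv using ip_TF(2)[OF x] ip(2) by simp
  qed
  moreover have "aeq S f ?g" using f by simp
  ultimately show "fh \<in> Trestr S ?P" unfolding e by (intro TrestrI[OF L(1) _ g, of ?P])
next
  fix fh assume fh: "fh \<in> Trestr S ?P"
  obtain f h where e: "fh = (f, h)" by (cases fh)
  obtain g g1 where L: "L2 S f" "L2 S h" and g: "aeq S f g" "tm g g1 h" "?P g"
    using TrestrD[of f h ?P] fh unfolding e by blast
  obtain c1 c2 where c: "a0 g = c2" "b0 g = c1 * UB + c2 * VB"
     "- UB * (b1 g - (c1 * UB' + c2 * VB')) = c1 * complex_of_real b11 * complex_of_real nu + c2 * cnj b12 * complex_of_real nv"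
     "a1 g - (c1 + c2 * VA') - VB * (b1 g - (c1 * UB' + c2 * VB')) = (c1 * b12 + c2 * complex_of_real b22) * complex_of_real nv"
    using g(3) by blast
  let ?x = "\<lambda>t. 1 * g t + (-1) * eta c1 c2 t"
  have x: "tm ?x (\<lambda>t. 1 * g1 t + (-1) * (c1 * qd S u t + c2 * qd S hv t)) h"
    using tm_lin[OF g(2) tm_eta, of 1 "-1"] by simp
  have bv: "a0 ?x = 0" "a1 ?x = a1 g - (c1 + c2 * VA')" "b0 ?x = 0" "b1 ?x = b1 g - (c1 * UB' + c2 * VB')"
    unfolding bv_lin[OF g(2) tm_eta] bv_eta using c by simp_all
  have "ip S h u = c1 * complex_of_real b11 * complex_of_real nu + c2 * cnj b12 * complex_of_real nv"
    "ip S h hv = (c1 * b12 + c2 * complex_of_real b22) * complex_of_real nv"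
    using ip_TF[OF x bv(1,3)] c(3,4) unfolding bv by simp_all
  moreover have "aeq S f (\<lambda>t. ?x t + eta c1 c2 t)" using g(1) by simp
  ultimately show "fh \<in> TN b11 b12 b22" unfolding e TN_iff
    by (intro conjI L exI[of _ c1] exI[of _ c2] exI[of _ ?x] exI) (assumption | rule x bv)+
qed

text \<open>\<open>mu\<close> and \<open>mv\<close> are the moments of B \<eta> against
  \<open>u\<close> and \<open>hv\<close>, with b21 N_u already rewritten as the conjugate of b12
  times N_v. \<open>Qf\<close> is the sesquilinear form of B on the kernel in the coordinates c and
  d.\<close>

definition mu :: "real \<Rightarrow> complex \<Rightarrow> complex \<Rightarrow> complex \<Rightarrow> complex" where
  "mu b11 b12 c1 c2 = c1 * complex_of_real b11 * complex_of_real nu + c2 * cnj b12 * complex_of_real nv"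

definition mv :: "complex \<Rightarrow> real \<Rightarrow> complex \<Rightarrow> complex \<Rightarrow> complex" where
  "mv b12 b22 c1 c2 = (c1 * b12 + c2 * complex_of_real b22) * complex_of_real nv"

definition Qf :: "real \<Rightarrow> complex \<Rightarrow> real \<Rightarrow> complex \<Rightarrow> complex \<Rightarrow> complex \<Rightarrow> complex \<Rightarrow> complex" where
  "Qf b11 b12 b22 c1 c2 d1 d2 = mu b11 b12 c1 c2 * cnj d1 + mv b12 b22 c1 c2 * cnj d2"

lemma Qf_hermitian: "cnj (Qf b11 b12 b22 d1 d2 c1 c2) = Qf b11 b12 b22 c1 c2 d1 d2"
  by (simp add: Qf_def mu_def mv_def algebra_simps)

lemma Re_Qf_sym: "Re (Qf b11 b12 b22 d1 d2 c1 c2) = Re (Qf b11 b12 b22 c1 c2 d1 d2)"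
  using Qf_hermitian[of b11 b12 b22 d1 d2 c1 c2] by (metis complex_cnj(1) complex.sel(1) complex_surj)

lemma Re_Qf_diag:
  "Re (Qf b11 b12 b22 c1 c2 c1 c2) =
     (b11 * nu) * (cmod c1)\<^sup>2 + (b22 * nv) * (cmod c2)\<^sup>2 + 2 * Re (c1 * cnj c2 * (b12 * complex_of_real nv))"
  by (simp only: cmod_power2) (simp add: Qf_def mu_def mv_def algebra_simps power2_eq_square)

definition form_nonneg :: "real \<Rightarrow> complex \<Rightarrow> real \<Rightarrow> bool" where
  "form_nonneg b11 b12 b22 \<longleftrightarrow> b11 \<ge> 0 \<and> b22 \<ge> 0 \<and> b11 * b22 * nu - (cmod b12)\<^sup>2 * nv \<ge> 0"

lemma form_nonneg_iff: "form_nonneg b11 b12 b22 \<longleftrightarrow> (\<forall>c d. 0 \<le> Re (Qf b11 b12 b22 c d c d))"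
proof -
  have "(cmod (b12 * complex_of_real nv))\<^sup>2 \<le> (b11 * nu) * (b22 * nv) \<longleftrightarrow>
      nv * ((cmod b12)\<^sup>2 * nv) \<le> nv * (b11 * b22 * nu)"
    by (simp add: norm_mult power_mult_distrib norm_power power2_eq_square mult_ac)
  also have "\<dots> \<longleftrightarrow> (cmod b12)\<^sup>2 * nv \<le> b11 * b22 * nu" using nv_pos by (rule mult_le_cancel_left_pos)
  moreover have "0 \<le> b11 * nu \<longleftrightarrow> 0 \<le> b11" "0 \<le> b22 * nv \<longleftrightarrow> 0 \<le> b22"
    using nu_pos nv_pos by (metis mult_le_cancel_right_pos mult_zero_left)+
  ultimately show ?thesis unfolding Re_Qf_diag hermitian_form_nonneg_iff form_nonneg_def by auto
qed

lemma Qf_diff: "Qf (hb11 - b11) (hb12 - b12) (hb22 - b22) c1 c2 d1 d2 = Qf hb11 hb12 hb22 c1 c2 d1 d2 - Qf b11 b12 b22 c1 c2 d1 d2"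
  by (simp add: Qf_def mu_def mv_def algebra_simps)

lemma Qf_arg_diff: "Qf b11 b12 b22 (c1 - d1) (c2 - d2) (c1 - d1) (c2 - d2) =
   Qf b11 b12 b22 c1 c2 c1 c2 - Qf b11 b12 b22 c1 c2 d1 d2 - Qf b11 b12 b22 d1 d2 c1 c2 + Qf b11 b12 b22 d1 d2 d1 d2"
  by (simp add: Qf_def mu_def mv_def algebra_simps)

section \<open>Self-adjointness and order of the extensions\<close>

lemma TN_E:
  assumes "(f, h) \<in> TN b11 b12 b22"
  obtains c1 c2 x x1 where "L2 S f" "L2 S h" "tm x x1 h" "a0 x = 0" "b0 x = 0"
    "aeq S f (\<lambda>t. x t + eta c1 c2 t)" "ip S h u = mu b11 b12 c1 c2" "ip S h hv = mv b12 b22 c1 c2"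
  using assms unfolding TN_iff mu_def mv_def by blast

lemma TN_I:
  assumes "tm x x1 h" "a0 x = 0" "b0 x = 0" "L2 S f"
    "aeq S f (\<lambda>t. x t + eta c1 c2 t)" "ip S h u = mu b11 b12 c1 c2" "ip S h hv = mv b12 b22 c1 c2"
  shows "(f, h) \<in> TN b11 b12 b22"
  using assms unfolding TN_iff mu_def mv_def tm_def by blast

lemma TN_I':
  assumes "tm x x1 h" "a0 x = 0" "b0 x = 0" "ip S h u = mu b11 b12 c1 c2" "ip S h hv = mv b12 b22 c1 c2"
  shows "((\<lambda>t. x t + eta c1 c2 t), h) \<in> TN b11 b12 b22"
  using assms(1) by (intro TN_I[OF assms(1-3) _ aeq_refl assms(4,5)] L2_add L2_eta) (simp add: tm_def)

text \<open>h meets the kernel part of y only through its moments, which are those of B \<eta>. So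
  the Friedrichs part and the form of B separate.\<close>

lemma ip_split:
  assumes h: "L2 S h" "ip S h u = mu b11 b12 c1 c2" "ip S h hv = mv b12 b22 c1 c2"
    and y: "L2 S y" "L2 S x" "aeq S y (\<lambda>t. x t + eta d1 d2 t)"
  shows "ip S h y = ip S h x + Qf b11 b12 b22 c1 c2 d1 d2"
proof -
  have "ip S h y = ip S h (\<lambda>t. 1 * x t + 1 * eta d1 d2 t)"
    using y h(1) L2_eta by (intro ip_cong) (auto intro: L2_add)
  also have "\<dots> = 1 * ip S h x + 1 * ip S h (eta d1 d2)"
    unfolding ip_lin_right[OF y(2) L2_eta h(1)] by simp
  finally show ?thesis unfolding ip_eta_right[OF h(1)] h by (simp add: Qf_def)
qed

lemma moments_ex:
  obtains c1 c2 where "ip S (eta c1 c2) u = p" "ip S (eta c1 c2) hv = q"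
proof
  show "ip S (eta (p / complex_of_real nu) (q / complex_of_real nv)) u = p"
    "ip S (eta (p / complex_of_real nu) (q / complex_of_real nv)) hv = q"
    unfolding ip_eta using nu_pos nv_pos by simp_all
qed

lemma TN_sym:
  assumes "(f, h) \<in> TN b11 b12 b22" "(f', h') \<in> TN b11 b12 b22"
  shows "ip S h f' = ip S f h'"
proof -
  obtain c1 c2 x x1 where 1: "L2 S f" "L2 S h" "tm x x1 h" "a0 x = 0" "b0 x = 0"
    "aeq S f (\<lambda>t. x t + eta c1 c2 t)" "ip S h u = mu b11 b12 c1 c2" "ip S h hv = mv b12 b22 c1 c2"
    using assms(1) by (rule TN_E)
  obtain d1 d2 y y1 where 2: "L2 S f'" "L2 S h'" "tm y y1 h'" "a0 y = 0" "b0 y = 0"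
    "aeq S f' (\<lambda>t. y t + eta d1 d2 t)" "ip S h' u = mu b11 b12 d1 d2" "ip S h' hv = mv b12 b22 d1 d2"
    using assms(2) by (rule TN_E)
  have L: "L2 S x" "L2 S y" using 1(3) 2(3) by (auto simp: tm_def)
  have "ip S h f' = ip S h y + Qf b11 b12 b22 c1 c2 d1 d2" by (rule ip_split[OF 1(2,7,8) 2(1) L(2) 2(6)])
  also have "ip S h y = cnj (ip S h' x)" using TF_sym[OF 1(3-5) 2(3-5)] ip_cnj by simp
  also have "\<dots> + Qf b11 b12 b22 c1 c2 d1 d2 = cnj (ip S h' x + Qf b11 b12 b22 d1 d2 c1 c2)"
    by (simp add: Qf_hermitian)
  also have "\<dots> = cnj (ip S h' f)" unfolding ip_split[OF 2(2,7,8) 1(1) L(1) 1(6)] ..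
  finally show ?thesis by (simp add: ip_cnj)
qed

text \<open>Two families of test elements suffice. Those with c = 0 and a right-hand side without
  moments show that y - X lies in the kernel, where X is the T_F preimage of m; those with arbitrary
  kernel part then give the moments of m.\<close>

lemma TN_adj:
  assumes "(y, m) \<in> adj S (TN b11 b12 b22)"
  shows "(y, m) \<in> TN b11 b12 b22"
proof -
  have L: "L2 S y" "L2 S m" and A: "\<And>f g. (f, g) \<in> TN b11 b12 b22 \<Longrightarrow> ip S g y = ip S f m"
    using assms unfolding adj_def by auto
  obtain X X1 where X: "tm X X1 m" "a0 X = 0" "b0 X = 0" using TF_solve[OF L(2)] by blast
  have LX: "L2 S X" using X(1) by (simp add: tm_def)
  let ?d = "\<lambda>t. y t - X t"
  have Ld: "L2 S ?d" by (rule L2_diff[OF L(1) LX])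
  obtain c1 c2 where c: "ip S (eta c1 c2) u = ip S ?d u" "ip S (eta c1 c2) hv = ip S ?d hv" by (rule moments_ex)
  \<comment> \<open>The component of y - X orthogonal to the kernel. It is itself an admissible
    right-hand side without moments, and testing with its T_F preimage shows that it is orthogonal
    to itself.\<close>
  let ?e = "\<lambda>t. ?d t - eta c1 c2 t"
  have Le: "L2 S ?e" by (rule L2_diff[OF Ld L2_eta])
  have e: "ip S ?e u = 0" "ip S ?e hv = 0"
    unfolding ip_diff_left[OF Ld L2_eta L2_sol(1)] ip_diff_left[OF Ld L2_eta L2_hv] using c by simp_all
  obtain G G1 where G: "tm G G1 ?e" "a0 G = 0" "b0 G = 0" using TF_solve[OF Le] by blast
  have LG: "L2 S G" using G(1) by (simp add: tm_def)
  have "(G, ?e) \<in> TN b11 b12 b22"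
    using e by (intro TN_I[OF G LG, of 0 0]) (simp_all add: mu_def mv_def, simp add: eta_def)
  then have "ip S ?e y = ip S ?e X" using A TF_sym[OF G X] by simp
  then have "ip S ?e ?d = 0" unfolding ip_diff_right[OF L(1) LX Le] by simp
  moreover have "ip S ?e (eta c1 c2) = 0" unfolding ip_eta_right[OF Le] e by simp
  ultimately have "ip S ?e ?e = 0" using ip_diff_right[OF Ld L2_eta Le, of c1 c2] by simp
  then have "aeq S ?e (\<lambda>_. 0)" using ip_self[OF Le] nrm_zero_iff[OF Le] by simp
  then have y: "aeq S y (\<lambda>t. X t + eta c1 c2 t)"
    unfolding aeq_def by eventually_elim (auto simp: algebra_simps)
  \<comment> \<open>The right-hand side is taken from the kernel, with the moments belonging to d1,
    d2; the Friedrichs terms on both sides agree by \<open>TF_sym\<close> and cancel.\<close>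
  have test: "d1 * cnj (ip S m u) + d2 * cnj (ip S m hv) = Qf b11 b12 b22 d1 d2 c1 c2" for d1 d2
  proof -
    obtain e1 e2 where k: "ip S (eta e1 e2) u = mu b11 b12 d1 d2" "ip S (eta e1 e2) hv = mv b12 b22 d1 d2"
      by (rule moments_ex)
    let ?k = "eta e1 e2"
    obtain G G1 where G: "tm G G1 ?k" "a0 G = 0" "b0 G = 0" using TF_solve[OF L2_eta] by blast
    have LG: "L2 S G" using G(1) by (simp add: tm_def)
    have "ip S ?k X + Qf b11 b12 b22 d1 d2 c1 c2 = ip S ?k y" by (rule ip_split[OF L2_eta k L(1) LX y, symmetric])
    also have "\<dots> = ip S (\<lambda>t. G t + eta d1 d2 t) m" by (rule A[OF TN_I'[OF G k]])
    also have "\<dots> = ip S G m + cnj (ip S m (eta d1 d2))"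
      unfolding ip_add_left[OF LG L2_eta L(2)] ip_cnj ..
    also have "\<dots> = ip S ?k X + (d1 * cnj (ip S m u) + d2 * cnj (ip S m hv))"
      unfolding ip_eta_right[OF L(2)] TF_sym[OF G X] by simp
    finally show ?thesis by simp
  qed
  have "ip S m u = cnj (Qf b11 b12 b22 1 0 c1 c2)" "ip S m hv = cnj (Qf b11 b12 b22 0 1 c1 c2)"
    using test[of 1 0, symmetric] test[of 0 1, symmetric] by simp_all
  then have "ip S m u = mu b11 b12 c1 c2" "ip S m hv = mv b12 b22 c1 c2"
    unfolding Qf_hermitian by (simp_all add: Qf_def)
  then show ?thesis by (rule TN_I[OF X L(1) y])
qed

lemma nonneg_sa_TN:
  assumes "form_nonneg b11 b12 b22"
  shows "nonneg_sa S (TN b11 b12 b22)"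
  unfolding nonneg_sa_def
proof (intro conjI allI impI)
  have "fh \<in> adj S (TN b11 b12 b22)" if "fh \<in> TN b11 b12 b22" for fh
  proof -
    obtain f h where e: "fh = (f, h)" by (cases fh)
    have "L2 S f" "L2 S h" using that unfolding e TN_iff by blast+
    then show ?thesis unfolding e adj_def using TN_sym that[unfolded e] by auto
  qed
  then show "TN b11 b12 b22 = adj S (TN b11 b12 b22)" using TN_adj by auto
next
  fix f g g' assume g: "(f, g) \<in> TN b11 b12 b22" "(f, g') \<in> TN b11 b12 b22"
  have *: "\<exists>z z1. aeq S f z \<and> tm z z1 h" if "(f, h) \<in> TN b11 b12 b22" for h
    using that unfolding TN_bv by (auto dest!: TrestrD)
  obtain z z1 where z: "aeq S f z" "tm z z1 g" using *[OF g(1)] by blast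
  obtain z' z1' where z': "aeq S f z'" "tm z' z1' g'" using *[OF g(2)] by blast
  show "aeq S g g'" by (rule Tmax_rep_unique[OF z(2) z'(2) aeq_trans[OF aeq_sym[OF z(1)] z'(1)]])
next
  show "\<forall>(f, g)\<in>TN b11 b12 b22. 0 \<le> Re (ip S g f)"
  proof clarify
    fix f h assume "(f, h) \<in> TN b11 b12 b22"
    then obtain c1 c2 x x1 where 1: "L2 S f" "L2 S h" "tm x x1 h" "a0 x = 0" "b0 x = 0"
      "aeq S f (\<lambda>t. x t + eta c1 c2 t)" "ip S h u = mu b11 b12 c1 c2" "ip S h hv = mv b12 b22 c1 c2"
      by (rule TN_E)
    have L: "L2 S x" using 1(3) by (auto simp: tm_def)
    have "0 \<le> Re (ip S h x)" using TF_lower_bound[OF 1(3-5)] eps by (smt (verit) mult_nonneg_nonneg zero_le_power2)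
    moreover have "0 \<le> Re (Qf b11 b12 b22 c1 c2 c1 c2)" using assms unfolding form_nonneg_iff by blast
    ultimately show "0 \<le> Re (ip S h f)" unfolding ip_split[OF 1(2,7,8) 1(1) L 1(6)] by simp
  qed
qed

text \<open>\<open>Friedrichs_cutoff\<close> with the derivative boundary values that
  \<open>ip_TF\<close> assigns to the moments p and q.\<close>

lemma cutoff_moments:
  assumes \<delta>: "\<delta> > 0"
  shows "\<exists>\<theta> \<theta>1 d. tm \<theta> \<theta>1 d \<and> a0 \<theta> = 0 \<and> b0 \<theta> = 0 \<and> ip S d u = p \<and> ip S d hv = q \<and> Re (ip S d \<theta>) \<le> \<delta>"
proof -
  obtain \<theta> \<theta>1 d where \<theta>: "tm \<theta> \<theta>1 d" "a0 \<theta> = 0" "a1 \<theta> = q - VB * p / UB" "b0 \<theta> = 0" "b1 \<theta> = - p / UB"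
    "Re (ip S d \<theta>) \<le> \<delta>" using Friedrichs_cutoff[OF \<delta>] by blast
  have "ip S d u = p" "ip S d hv = q" using ip_TF[OF \<theta>(1,2,4)] \<theta>(3,5) b0_u_nonzero by simp_all
  with \<theta> show ?thesis by blast
qed

theorem TN_le_iff:
  assumes B: "form_nonneg b11 b12 b22" and B': "form_nonneg hb11 hb12 hb22"
  shows "op_le S (TN b11 b12 b22) (TN hb11 hb12 hb22) \<longleftrightarrow> form_nonneg (hb11 - b11) (hb12 - b12) (hb22 - b22)"
  (is "?L \<longleftrightarrow> ?R")
proof
  let ?Q = "Qf b11 b12 b22" and ?Q' = "Qf hb11 hb12 hb22"
  assume ?R
  then have le: "Re (?Q c d c d) \<le> Re (?Q' c d c d)" for c d
    unfolding form_nonneg_iff Qf_diff by simp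
  show ?L unfolding op_le_iff_form[OF nonneg_sa_TN[OF B] nonneg_sa_TN[OF B']]
  proof clarify
    fix f k g k' assume "(f, k) \<in> TN hb11 hb12 hb22" "(g, k') \<in> TN b11 b12 b22"
    obtain c1 c2 x x1 where 1: "L2 S f" "L2 S k" "tm x x1 k" "a0 x = 0" "b0 x = 0"
      "aeq S f (\<lambda>t. x t + eta c1 c2 t)" "ip S k u = mu hb11 hb12 c1 c2" "ip S k hv = mv hb12 hb22 c1 c2"
      using \<open>(f, k) \<in> TN hb11 hb12 hb22\<close> by (rule TN_E)
    obtain d1 d2 y y1 where 2: "L2 S g" "L2 S k'" "tm y y1 k'" "a0 y = 0" "b0 y = 0"
      "aeq S g (\<lambda>t. y t + eta d1 d2 t)" "ip S k' u = mu b11 b12 d1 d2" "ip S k' hv = mv b12 b22 d1 d2"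
      using \<open>(g, k') \<in> TN b11 b12 b22\<close> by (rule TN_E)
    have L: "L2 S x" "L2 S y" using 1(3) 2(3) by (auto simp: tm_def)
    \<comment> \<open>The inequality splits into two completed squares: the Friedrichs form at x -
      y, and the form of B at the difference of the kernel parts, the latter followed by the
      comparison of the two forms.\<close>
    let ?z = "\<lambda>t. 1 * x t + (-1) * y t" and ?k = "\<lambda>t. 1 * k t + (-1) * k' t"
    have z: "tm ?z (\<lambda>t. 1 * x1 t + (-1) * y1 t) ?k" by (rule tm_lin[OF 1(3) 2(3)])
    have Lz: "L2 S ?z" using z by (simp only: tm_def)
    have "a0 ?z = 0" "b0 ?z = 0" unfolding bv_lin[OF 1(3) 2(3)] using 1 2 by simp_all
    from TF_lower_bound[OF z this] have "0 \<le> Re (ip S ?k ?z)"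
      using eps by (smt (verit) mult_nonneg_nonneg zero_le_power2)
    also have "ip S ?k ?z = ip S k x - ip S k y - ip S k' x + ip S k' y"
      unfolding ip_lin_left[OF 1(2) 2(2) Lz] ip_lin_right[OF L 1(2)] ip_lin_right[OF L 2(2)] by simp
    finally have "0 \<le> Re (ip S k x) - Re (ip S k y) - Re (ip S k' x) + Re (ip S k' y)" by simp
    moreover have "ip S k y = cnj (ip S k' x)" using TF_sym[OF 1(3-5) 2(3-5)] ip_cnj by simp
    ultimately have x: "2 * Re (ip S k' x) - Re (ip S k' y) \<le> Re (ip S k x)" by simp
    have "0 \<le> Re (?Q (c1 - d1) (c2 - d2) (c1 - d1) (c2 - d2))" using B unfolding form_nonneg_iff by blast
    then have q: "2 * Re (?Q d1 d2 c1 c2) - Re (?Q d1 d2 d1 d2) \<le> Re (?Q' c1 c2 c1 c2)"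
      unfolding Qf_arg_diff using le[of c1 c2] Re_Qf_sym[of b11 b12 b22 c1 c2 d1 d2] by simp
    have "ip S f k' = cnj (ip S k' x + ?Q d1 d2 c1 c2)"
      unfolding ip_split[OF 2(2,7,8) 1(1) L(1) 1(6), symmetric] by (simp add: ip_cnj)
    moreover have "ip S k' g = ip S k' y + ?Q d1 d2 d1 d2" by (rule ip_split[OF 2(2,7,8) 2(1) L(2) 2(6)])
    moreover have "ip S k f = ip S k x + ?Q' c1 c2 c1 c2" by (rule ip_split[OF 1(2,7,8) 1(1) L(1) 1(6)])
    ultimately show "2 * Re (ip S f k') - Re (ip S k' g) \<le> Re (ip S k f)" using x q by simp
  qed
next
  let ?Q = "Qf b11 b12 b22" and ?Q' = "Qf hb11 hb12 hb22"
  assume ?L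
  then have op: "2 * Re (ip S f k') - Re (ip S k' g) \<le> Re (ip S k f)"
    if "(f, k) \<in> TN hb11 hb12 hb22" "(g, k') \<in> TN b11 b12 b22" for f k g k'
    using that unfolding op_le_iff_form[OF nonneg_sa_TN[OF B] nonneg_sa_TN[OF B']] by fast
  have "Re (?Q c1 c2 c1 c2) \<le> Re (?Q' c1 c2 c1 c2) + \<delta>" if \<delta>: "\<delta> > 0" for c1 c2 \<delta>
  proof -
    \<comment> \<open>Both test elements get the same kernel part. Their right-hand sides must then
      differ in moments, and a cutoff carries the difference: with y = x - \<theta> all Friedrichs
      terms cancel except the energy of \<theta>, at most \<delta>.\<close>
    obtain e1 e2 where k: "ip S (eta e1 e2) u = mu hb11 hb12 c1 c2" "ip S (eta e1 e2) hv = mv hb12 hb22 c1 c2"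
      by (rule moments_ex)
    let ?k = "eta e1 e2"
    obtain x x1 where x: "tm x x1 ?k" "a0 x = 0" "b0 x = 0" using TF_solve[OF L2_eta] by blast
    obtain \<theta> \<theta>1 d where \<theta>: "tm \<theta> \<theta>1 d" "a0 \<theta> = 0" "b0 \<theta> = 0"
      "ip S d u = mu hb11 hb12 c1 c2 - mu b11 b12 c1 c2" "ip S d hv = mv hb12 hb22 c1 c2 - mv b12 b22 c1 c2"
      "Re (ip S d \<theta>) \<le> \<delta>" using cutoff_moments[OF \<delta>] by blast
    let ?y = "\<lambda>t. 1 * x t + (-1) * \<theta> t" and ?k' = "\<lambda>t. 1 * ?k t + (-1) * d t"
    have y: "tm ?y (\<lambda>t. 1 * x1 t + (-1) * \<theta>1 t) ?k'" by (rule tm_lin[OF x(1) \<theta>(1)])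
    have y0: "a0 ?y = 0" "b0 ?y = 0" unfolding bv_lin[OF x(1) \<theta>(1)] using x \<theta> by simp_all
    have L: "L2 S x" "L2 S \<theta>" "L2 S d" "L2 S ?y" "L2 S ?k'" using x(1) \<theta>(1) y by (simp_all only: tm_def)
    have k': "ip S ?k' u = mu b11 b12 c1 c2" "ip S ?k' hv = mv b12 b22 c1 c2"
      unfolding ip_lin_left[OF L2_eta L(3) L2_sol(1)] ip_lin_left[OF L2_eta L(3) L2_hv] k \<theta>(4,5) by simp_all
    let ?f = "\<lambda>t. x t + eta c1 c2 t" and ?g = "\<lambda>t. ?y t + eta c1 c2 t"
    have Lfg: "L2 S ?f" "L2 S ?g" using L L2_eta L2_add by blast+
    have "2 * Re (ip S ?f ?k') - Re (ip S ?k' ?g) \<le> Re (ip S ?k ?f)"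
      by (rule op[OF TN_I'[OF x k] TN_I'[OF y y0 k']])
    moreover have "ip S ?f ?k' = cnj (ip S ?k' x + ?Q c1 c2 c1 c2)"
      unfolding ip_split[OF L(5) k' Lfg(1) L(1) aeq_refl, symmetric] by (rule ip_cnj[symmetric])
    moreover have "ip S ?k' ?g = ip S ?k' ?y + ?Q c1 c2 c1 c2" by (rule ip_split[OF L(5) k' Lfg(2) L(4) aeq_refl])
    moreover have "ip S ?k ?f = ip S ?k x + ?Q' c1 c2 c1 c2" by (rule ip_split[OF L2_eta k Lfg(1) L(1) aeq_refl])
    moreover have "ip S ?k' x = ip S ?k x - ip S d x" unfolding ip_lin_left[OF L2_eta L(3) L(1)] by simp
    moreover have "ip S ?k' ?y = ip S ?k x - ip S ?k \<theta> - ip S d x + ip S d \<theta>"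
      unfolding ip_lin_left[OF L2_eta L(3) L(4)] ip_lin_right[OF L(1,2) L2_eta] ip_lin_right[OF L(1,2) L(3)] by simp
    moreover have "ip S ?k \<theta> = cnj (ip S d x)" using TF_sym[OF x \<theta>(1-3)] ip_cnj by simp
    ultimately show ?thesis using \<theta>(6) by simp
  qed
  then have "Re (?Q c1 c2 c1 c2) \<le> Re (?Q' c1 c2 c1 c2)" for c1 c2 by (rule field_le_epsilon)
  then show ?R unfolding form_nonneg_iff Qf_diff by simp
qed

end

section \<open>Elimination of the kernel coordinates from the boundary conditions\<close>

lemma cot_surj: "\<exists>\<alpha>\<in>{0<..<pi}. cot \<alpha> = t"
proof
  show "pi / 2 - arctan t \<in> {0<..<pi}" using arctan_bounded[of t] by auto
  show "cot (pi / 2 - arctan t) = t"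
    using tan_arctan[of t] by (simp add: cot_def tan_def sin_diff cos_diff)
qed

text \<open>The coordinate c2 is replaced by a0 at once, and the equations are solved for b1 and
  then for a1. In the last one the coefficients of c and of a0 become D and E/U. Here \<beta>21
  plays the part of the conjugate of b12, and \<nu>, \<mu> those of N_u, N_v.\<close>

lemma boundary_condition_parametrized:
  fixes U U' V V' VA a0 a1 b0 b1 \<nu> \<mu> \<beta>11 \<beta>12 \<beta>21 \<beta>22 :: complex
  assumes U: "U \<noteq> 0"
  shows "(\<exists>c1 c2. a0 = c2 \<and> b0 = c1 * U + c2 * V \<and>
      - U * (b1 - (c1 * U' + c2 * V')) = c1 * \<beta>11 * \<nu> + c2 * \<beta>21 * \<mu> \<and>
      a1 - (c1 + c2 * VA) - V * (b1 - (c1 * U' + c2 * V')) = (c1 * \<beta>12 + c2 * \<beta>22) * \<mu>) \<longleftrightarrow>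
    (\<exists>c. b0 = c * U + a0 * V \<and> b1 = c * (U' - \<beta>11 * \<nu> / U) + a0 * (V' - \<beta>21 * \<mu> / U) \<and>
      a1 = c * (1 - \<beta>11 * (V / U) * \<nu> + \<beta>12 * \<mu>) + a0 * ((\<mu> * \<beta>22 * U - \<mu> * \<beta>21 * V + U * VA) / U))"
proof -
  have 1: "- U * (b1 - (c * U' + a0 * V')) = c * \<beta>11 * \<nu> + a0 * \<beta>21 * \<mu> \<longleftrightarrow>
      b1 = c * (U' - \<beta>11 * \<nu> / U) + a0 * (V' - \<beta>21 * \<mu> / U)" for c
  proof -
    have "U * (c * (U' - \<beta>11 * \<nu> / U) + a0 * (V' - \<beta>21 * \<mu> / U)) = U * (c * U' + a0 * V') - (c * \<beta>11 * \<nu> + a0 * \<beta>21 * \<mu>)"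
      using U by (simp add: field_simps)
    moreover have "b1 = X \<longleftrightarrow> U * b1 = U * X" for X using U by simp
    moreover have "- U * (b1 - P) = M \<longleftrightarrow> U * b1 = U * P - M" for P M
      by (simp add: right_diff_distrib eq_diff_eq diff_eq_eq) (metis add.commute)
    ultimately show ?thesis by (simp only:)
  qed
  have 2: "a1 - (c + a0 * VA) - V * (b1 - (c * U' + a0 * V')) = (c * \<beta>12 + a0 * \<beta>22) * \<mu> \<longleftrightarrow>
      a1 = c * (1 - \<beta>11 * (V / U) * \<nu> + \<beta>12 * \<mu>) + a0 * ((\<mu> * \<beta>22 * U - \<mu> * \<beta>21 * V + U * VA) / U)"
    if b1: "b1 = c * (U' - \<beta>11 * \<nu> / U) + a0 * (V' - \<beta>21 * \<mu> / U)" for c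
  proof -
    have "c * (1 - \<beta>11 * (V / U) * \<nu> + \<beta>12 * \<mu>) + a0 * ((\<mu> * \<beta>22 * U - \<mu> * \<beta>21 * V + U * VA) / U)
      = (c * \<beta>12 + a0 * \<beta>22) * \<mu> + (c + a0 * VA) + V * (b1 - (c * U' + a0 * V'))"
      unfolding b1 using U by (simp add: field_simps)
    moreover have "a1 - P - Q = M \<longleftrightarrow> a1 = M + P + Q" for P Q M by (simp add: diff_eq_eq add_ac)
    ultimately show ?thesis by (simp only:)
  qed
  show ?thesis using 1 2 by blast
qed

text \<open>For D nonzero the third equation determines c, which is inserted into the other
  two.\<close>

lemma coupled_condition:
  fixes U V F H D E a0 a1 b0 b1 :: complex
  assumes U: "U \<noteq> 0" and D: "D \<noteq> 0"
  shows "(\<exists>c. b0 = c * U + a0 * V \<and> b1 = c * F + a0 * H \<and> a1 = c * D + a0 * (E / U)) \<longleftrightarrow>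
    b0 = a1 * (U / D) + a0 * (V - E / D) \<and> b1 = a1 * (F / D) + a0 * (H - (1 / U) * F * (E / D))"
proof -
  have "a1 = c * D + a0 * (E / U) \<longleftrightarrow> c = (a1 - a0 * (E / U)) / D" for c using D by (auto simp: field_simps)
  then have "(\<exists>c. b0 = c * U + a0 * V \<and> b1 = c * F + a0 * H \<and> a1 = c * D + a0 * (E / U)) \<longleftrightarrow>
      b0 = (a1 - a0 * (E / U)) / D * U + a0 * V \<and> b1 = (a1 - a0 * (E / U)) / D * F + a0 * H" by auto
  moreover have "(a1 - a0 * (E / U)) / D * U + a0 * V = a1 * (U / D) + a0 * (V - E / D)"
    "(a1 - a0 * (E / U)) / D * F + a0 * H = a1 * (F / D) + a0 * (H - (1 / U) * F * (E / D))"
    using U D by (simp_all add: field_simps)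
  ultimately show ?thesis by simp
qed

text \<open>For D = 0 the third equation is free of c and is the condition at a. Now c comes from
  the first equation, and H = V F / U makes a0 drop out of the second, which leaves the condition at
  b.\<close>

lemma separated_condition:
  fixes U V F H E a0 a1 b0 b1 :: complex and \<alpha> \<beta> :: real
  assumes U: "U \<noteq> 0" and H: "H = V * F / U"
    and \<alpha>: "\<alpha> \<in> {0<..<pi}" "complex_of_real (cot \<alpha>) = - (E / U)"
    and \<beta>: "\<beta> \<in> {0<..<pi}" "complex_of_real (cot \<beta>) = F / U"
  shows "(\<exists>c. b0 = c * U + a0 * V \<and> b1 = c * F + a0 * H \<and> a1 = c * 0 + a0 * (E / U)) \<longleftrightarrow>
    a0 * complex_of_real (cos \<alpha>) + a1 * complex_of_real (sin \<alpha>) = 0 \<and>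
    b0 * complex_of_real (cos \<beta>) - b1 * complex_of_real (sin \<beta>) = 0"
proof -
  have cs: "complex_of_real (cos x) = complex_of_real (cot x) * complex_of_real (sin x)" "complex_of_real (sin x) \<noteq> 0"
    if "x \<in> {0<..<pi}" for x
  proof -
    have "sin x \<noteq> 0" using sin_gt_zero[of x] that by auto
    then show "complex_of_real (sin x) \<noteq> 0" by simp
    have "cos x = cot x * sin x" using \<open>sin x \<noteq> 0\<close> by (simp add: cot_def)
    then show "complex_of_real (cos x) = complex_of_real (cot x) * complex_of_real (sin x)" by (metis of_real_mult)
  qed
  have "a0 * complex_of_real (cos \<alpha>) + a1 * complex_of_real (sin \<alpha>) = (a1 - a0 * (E / U)) * complex_of_real (sin \<alpha>)"
    unfolding cs(1)[OF \<alpha>(1)] \<alpha>(2) by (simp add: algebra_simps)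
  then have A: "a0 * complex_of_real (cos \<alpha>) + a1 * complex_of_real (sin \<alpha>) = 0 \<longleftrightarrow> a1 = a0 * (E / U)"
    using cs(2)[OF \<alpha>(1)] by simp
  have "b0 * complex_of_real (cos \<beta>) - b1 * complex_of_real (sin \<beta>) = (b0 * (F / U) - b1) * complex_of_real (sin \<beta>)"
    unfolding cs(1)[OF \<beta>(1)] \<beta>(2) by (simp add: algebra_simps)
  then have B: "b0 * complex_of_real (cos \<beta>) - b1 * complex_of_real (sin \<beta>) = 0 \<longleftrightarrow> b1 = b0 * (F / U)"
    using cs(2)[OF \<beta>(1)] by auto
  have "b0 = c * U + a0 * V \<longleftrightarrow> c = (b0 - a0 * V) / U" for c using U by (auto simp: field_simps)
  then have "(\<exists>c. b0 = c * U + a0 * V \<and> b1 = c * F + a0 * H \<and> a1 = c * 0 + a0 * (E / U)) \<longleftrightarrow>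
      b1 = (b0 - a0 * V) / U * F + a0 * H \<and> a1 = a0 * (E / U)" by auto
  also have "(b0 - a0 * V) / U * F + a0 * H = b0 * (F / U)" unfolding H using U by (simp add: field_simps)
  finally show ?thesis unfolding A B by blast
qed

context limit_circle_problem
begin

definition DD :: "real \<Rightarrow> complex \<Rightarrow> complex" where
  "DD b11 b12 = 1 - complex_of_real b11 * (VB / UB) * complex_of_real nu + b12 * complex_of_real nv"

definition EE :: "complex \<Rightarrow> real \<Rightarrow> complex" where
  "EE b12 b22 = complex_of_real nv * complex_of_real b22 * UB - complex_of_real nv * cnj b12 * VB + UB * VA'"

lemma TN_param:
  "TN b11 b12 b22 = Trestr S (\<lambda>g. \<exists>c. b0 g = c * UB + a0 g * VB \<and>
     b1 g = c * (UB' - complex_of_real b11 * complex_of_real nu / UB) + a0 g * (VB' - cnj b12 * complex_of_real nv / UB) \<and>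
     a1 g = c * DD b11 b12 + a0 g * (EE b12 b22 / UB))"
  unfolding TN_bv DD_def EE_def by (rule arg_cong[of _ _ "Trestr S"], rule ext, rule boundary_condition_parametrized[OF b0_u_nonzero])

lemma DD_zero_iff: "DD b11 b12 = 0 \<longleftrightarrow> b12 = (complex_of_real b11 * (VB / UB) * complex_of_real nu - 1) / complex_of_real nv"
proof -
  have "complex_of_real nv \<noteq> 0" using nv_pos by simp
  then have "b12 = (complex_of_real b11 * (VB / UB) * complex_of_real nu - 1) / complex_of_real nv \<longleftrightarrow>
      b12 * complex_of_real nv = complex_of_real b11 * (VB / UB) * complex_of_real nu - 1"
    by (rule nonzero_eq_divide_eq)
  also have "\<dots> \<longleftrightarrow> DD b11 b12 = 0" unfolding DD_def by (auto simp: algebra_simps)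
  finally show ?thesis by simp
qed

theorem TN_coupled:
  assumes "DD b11 b12 \<noteq> 0"
  shows "TN b11 b12 b22 = Trestr S (\<lambda>g.
     b0 g = a1 g * (UB / DD b11 b12) + a0 g * (VB - EE b12 b22 / DD b11 b12) \<and>
     b1 g = a1 g * ((UB' - complex_of_real b11 * complex_of_real nu / UB) / DD b11 b12)
       + a0 g * (VB' - cnj b12 * complex_of_real nv / UB
          - (1 / UB) * (UB' - complex_of_real b11 * complex_of_real nu / UB) * (EE b12 b22 / DD b11 b12)))"
  unfolding TN_param by (rule arg_cong[of _ _ "Trestr S"], rule ext, rule coupled_condition[OF b0_u_nonzero assms])

theorem TN_separated:
  assumes D: "DD b11 b12 = 0"
  shows "\<exists>\<alpha>\<in>{0<..<pi}. \<exists>\<beta>\<in>{0<..<pi}.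
      complex_of_real (cot \<alpha>) = complex_of_real b11 * (VB / UB)\<^sup>2 * complex_of_real nu
         - complex_of_real b22 * complex_of_real nv - VA' - VB / UB \<and>
      complex_of_real (cot \<beta>) = (1 / UB) * (UB' - complex_of_real b11 * complex_of_real nu / UB) \<and>
      TN b11 b12 b22 = T_sep S ua uha ub uhb \<alpha> \<beta>"
proof -
  let ?A = "complex_of_real b11 * (VB / UB)\<^sup>2 * complex_of_real nu - complex_of_real b22 * complex_of_real nv - VA' - VB / UB"
  let ?F = "UB' - complex_of_real b11 * complex_of_real nu / UB"
  have real: "\<exists>t. z = complex_of_real t" if "cnj z = z" for z using that by (metis Reals_cases Reals_cnj_iff)
  obtain s where s: "?A = complex_of_real s" using real[of ?A] by (auto simp: bv_real[simplified])
  obtain t where t: "(1 / UB) * ?F = complex_of_real t" using real[of "(1 / UB) * ?F"] by (auto simp: bv_real[simplified])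
  obtain \<alpha> where \<alpha>: "\<alpha> \<in> {0<..<pi}" "complex_of_real (cot \<alpha>) = ?A" using cot_surj[of s] s by auto
  obtain \<beta> where \<beta>: "\<beta> \<in> {0<..<pi}" "complex_of_real (cot \<beta>) = (1 / UB) * ?F" using cot_surj[of t] t by auto
  have b12: "b12 = (complex_of_real b11 * (VB / UB) * complex_of_real nu - 1) / complex_of_real nv"
    using D DD_zero_iff by blast
  then have "cnj b12 = b12" by (simp add: bv_real[simplified])
  moreover have nv0: "complex_of_real nv \<noteq> 0" using nv_pos by simp
  ultimately have cb: "cnj b12 * complex_of_real nv = complex_of_real b11 * (VB / UB) * complex_of_real nu - 1"
    using b12 by simp
  have U: "UB \<noteq> 0" by (rule b0_u_nonzero)
  have "EE b12 b22 / UB = complex_of_real nv * complex_of_real b22 - (cnj b12 * complex_of_real nv) * (VB / UB) + VA'"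
    unfolding EE_def using U by (simp add: field_simps)
  also have "\<dots> = - ?A" unfolding cb by (simp add: algebra_simps power2_eq_square)
  finally have E: "complex_of_real (cot \<alpha>) = - (EE b12 b22 / UB)" using \<alpha>(2) by simp
  \<comment> \<open>This is the relation by which the conditions decouple. Inserting b12 from D = 0
    produces a term 1/\<open>UB\<close>, and the determinant \<open>bv_det\<close> absorbs exactly
    this term.\<close>
  have "VB' - cnj b12 * complex_of_real nv / UB = VB * ?F / UB"
  proof -
    have "UB * VB' + 1 = UB' * VB" using bv_det by (simp add: algebra_simps)
    then have "(UB * VB' + 1 - complex_of_real b11 * (VB / UB) * complex_of_real nu) / UB
        = (UB' * VB - complex_of_real b11 * (VB / UB) * complex_of_real nu) / UB" by simp
    moreover have "VB' - cnj b12 * complex_of_real nv / UB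
        = (UB * VB' + 1 - complex_of_real b11 * (VB / UB) * complex_of_real nu) / UB"
      unfolding cb using U by (simp add: field_simps)
    ultimately show ?thesis by (simp add: algebra_simps)
  qed
  moreover have "complex_of_real (cot \<beta>) = ?F / UB" using \<beta>(2) by simp
  ultimately have "TN b11 b12 b22 = T_sep S ua uha ub uhb \<alpha> \<beta>"
    unfolding TN_param T_sep_def D bv_a_def bv_b_def fst_conv snd_conv
    by (intro arg_cong[of _ _ "Trestr S"] ext separated_condition[OF U _ \<alpha>(1) E \<beta>(1)])
  with \<alpha> \<beta> show ?thesis by blast
qed

end

theorem theorem3p5:
  fixes S :: slp and \<epsilon> :: real and ua uha ub uhb :: "real \<Rightarrow> real"
    and b11 b22 :: real and b12 :: complex
    and vh :: "real \<Rightarrow> complex" and Nu Nv :: real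
    and Ub Ub' Vb Vb' Va' D E :: complex
    and TB :: "real \<Rightarrow> complex \<Rightarrow> real \<Rightarrow> lrel"
  assumes std: "sl_standard S"
    and LCa: "limit_circle_a S" and LCb: "limit_circle_b S"
    and eps: "\<epsilon> > 0"
    and Tmin_lb: "\<forall>(f, h)\<in>Tmin S. \<epsilon> * (nrm S f)\<^sup>2 \<le> Re (ip S h f)"
    and pair_a: "normalized_pair_a S ua uha"
    and pair_b: "normalized_pair_b S ub uhb"
  defines "vh \<equiv> (\<lambda>x. cu uha x - ip S (cu uha) (cu ua) / complex_of_real ((nrm S (cu ua))\<^sup>2) * cu ua x)"
    and "Nu \<equiv> (nrm S (cu ua))\<^sup>2"
    and "Nv \<equiv> (nrm S vh)\<^sup>2"
    and "Ub \<equiv> fst (bv_b S ub uhb (cu ua))"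
    and "Ub' \<equiv> snd (bv_b S ub uhb (cu ua))"
    and "Vb \<equiv> fst (bv_b S ub uhb vh)"
    and "Vb' \<equiv> snd (bv_b S ub uhb vh)"
    and "Va' \<equiv> snd (bv_a S ua uha vh)"
    and "TB \<equiv> (\<lambda>c11 c12 c22. T_BW S ua uha ub uhb
           (Bmat S (cu ua) vh (complex_of_real c11) c12
              (cnj c12 * complex_of_real Nv / complex_of_real Nu) (complex_of_real c22)) (N0 S))"
    and "D \<equiv> 1 - complex_of_real b11 * (Vb / Ub) * complex_of_real Nu + b12 * complex_of_real Nv"
    and "E \<equiv> complex_of_real Nv * complex_of_real b22 * Ub - complex_of_real Nv * cnj b12 * Vb + Ub * Va'"
  assumes b11: "b11 \<ge> 0" and b22: "b22 \<ge> 0"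
    and Bpos: "b11 * b22 * Nu - (cmod b12)\<^sup>2 * Nv \<ge> 0"
  shows
    "(b12 = (complex_of_real b11 * (Vb / Ub) * complex_of_real Nu - 1) / complex_of_real Nv \<longrightarrow>
       (\<exists>\<alpha>\<in>{0<..<pi}. \<exists>\<beta>\<in>{0<..<pi}.
          complex_of_real (cot \<alpha>) = complex_of_real b11 * (Vb / Ub)\<^sup>2 * complex_of_real Nu
             - complex_of_real b22 * complex_of_real Nv - Va' - Vb / Ub \<and>
          complex_of_real (cot \<beta>) = (1 / Ub) * (Ub' - complex_of_real b11 * complex_of_real Nu / Ub) \<and>
          TB b11 b12 b22 = T_sep S ua uha ub uhb \<alpha> \<beta>))
     \<and>
     (b12 \<noteq> (complex_of_real b11 * (Vb / Ub) * complex_of_real Nu - 1) / complex_of_real Nv \<longrightarrow>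
       TB b11 b12 b22 = Trestr S (\<lambda>g.
          fst (bv_b S ub uhb g) =
             snd (bv_a S ua uha g) * (Ub / D) + fst (bv_a S ua uha g) * (Vb - E / D) \<and>
          snd (bv_b S ub uhb g) =
             snd (bv_a S ua uha g) * ((Ub' - complex_of_real b11 * complex_of_real Nu / Ub) / D)
             + fst (bv_a S ua uha g) * (Vb' - cnj b12 * complex_of_real Nv / Ub
                 - (1 / Ub) * (Ub' - complex_of_real b11 * complex_of_real Nu / Ub) * (E / D))))
     \<and>
     (\<forall>hb11 hb22 :: real. \<forall>hb12 :: complex.
        hb11 \<ge> 0 \<longrightarrow> hb22 \<ge> 0 \<longrightarrow> hb11 * hb22 * Nu - (cmod hb12)\<^sup>2 * Nv \<ge> 0 \<longrightarrow>
        ((op_le S (zero_op S) (TB b11 b12 b22) \<and> op_le S (TB b11 b12 b22) (TB hb11 hb12 hb22)) \<longleftrightarrow>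
         (hb11 \<ge> b11 \<and> hb22 \<ge> b22 \<and> (hb11 - b11) * (hb22 - b22) * Nu - (cmod (hb12 - b12))\<^sup>2 * Nv \<ge> 0)))"

proof -
  interpret limit_circle_problem S \<epsilon> ua uha ub uhb
    by unfold_locales fact+
  have vh: "vh = hv" unfolding vh_def hv_def ..
  have Nu: "Nu = nu" and Nv: "Nv = nv" unfolding Nu_def Nv_def vh by auto
  have bv: "Ub = UB" "Ub' = UB'" "Vb = VB" "Vb' = VB'" "Va' = VA'"
    unfolding Ub_def Ub'_def Vb_def Vb'_def Va'_def vh bv_a_def bv_b_def by simp_all
  have T: "TB = TN"
    unfolding TB_def vh Nu Nv by (intro ext) (rule TN_def[symmetric])
  have D: "D = DD b11 b12" and E: "E = EE b12 b22"
    unfolding D_def E_def DD_def EE_def bv Nu Nv by (rule refl)+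
  have B: "form_nonneg b11 b12 b22" using b11 b22 Bpos unfolding form_nonneg_def Nu Nv by blast
  show ?thesis
    unfolding bv Nu Nv T D E DD_zero_iff[symmetric] bv_a_def bv_b_def fst_conv snd_conv
  proof (intro conjI impI allI)
    assume "DD b11 b12 = 0"
    then show "\<exists>\<alpha>\<in>{0<..<pi}. \<exists>\<beta>\<in>{0<..<pi}.
      complex_of_real (cot \<alpha>) = complex_of_real b11 * (VB / UB)\<^sup>2 * complex_of_real nu
         - complex_of_real b22 * complex_of_real nv - VA' - VB / UB \<and>
      complex_of_real (cot \<beta>) = (1 / UB) * (UB' - complex_of_real b11 * complex_of_real nu / UB) \<and>
      TN b11 b12 b22 = T_sep S ua uha ub uhb \<alpha> \<beta>" by (rule TN_separated)
  next
    assume "DD b11 b12 \<noteq> 0"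
    then show "TN b11 b12 b22 = Trestr S (\<lambda>g.
     b0 g = a1 g * (UB / DD b11 b12) + a0 g * (VB - EE b12 b22 / DD b11 b12) \<and>
     b1 g = a1 g * ((UB' - complex_of_real b11 * complex_of_real nu / UB) / DD b11 b12)
       + a0 g * (VB' - cnj b12 * complex_of_real nv / UB
          - (1 / UB) * (UB' - complex_of_real b11 * complex_of_real nu / UB) * (EE b12 b22 / DD b11 b12)))"
      by (rule TN_coupled)
  next
    fix hb11 hb22 :: real and hb12 :: complex
    assume "hb11 \<ge> 0" "hb22 \<ge> 0" "0 \<le> hb11 * hb22 * nu - (cmod hb12)\<^sup>2 * nv"
    then have "form_nonneg hb11 hb12 hb22" by (simp only: form_nonneg_def)
    from TN_le_iff[OF B this] zero_op_le[OF nonneg_sa_TN[OF B]]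
    show "(op_le S (zero_op S) (TN b11 b12 b22) \<and> op_le S (TN b11 b12 b22) (TN hb11 hb12 hb22)) \<longleftrightarrow>
         (hb11 \<ge> b11 \<and> hb22 \<ge> b22 \<and> (hb11 - b11) * (hb22 - b22) * nu - (cmod (hb12 - b12))\<^sup>2 * nv \<ge> 0)"
      unfolding form_nonneg_def by simp
  qed
qed

end
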